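(* There is a list of $91$ patterns in $S_6 \cup S_7 \cup S_8$ such that a permutation $w$ is $3$-vexillary if and only if it avoids all the patterns in this list.
   Context: Permutations are elements of $S_\infty=\bigcup_{n\ge 0} S_n$, in one-line notation. For a sequence $x=x(1)\cdots x(m)$ of distinct integers, $\mathrm{fl}(x)$ is the unique $v\in S_m$ with $v(i)<v(j)$ iff $x(i)<x(j)$. A permutation $w$ contains $v\in S_m$ as a pattern if there are $i_1<\cdots<i_m$ with $\mathrm{fl}(w(i_1)\cdots w(i_m))=v$; otherwise $w$ avoids $v$. Let $s_i=(i\ i{+}1)$. A reduced word of $w$ is a minimal-length sequence $(a_1,\dots,a_{\ell})$ with $s_{a_1}\cdots s_{a_{\ell}}=w$ (right multiplication by $s_i$ swaps the entries in positions $i$ and $i+1$). $\mathcal{EG}(w)$ is the set of semistandard Young tableaux (English notation) whose column word, obtained by reading each column from bottom to top, starting with the leftmost column and moving right, is a reduced word of $w$. Put $EG(w)=|\mathcal{EG}(w)|$. A permutation $w$ is $3$-vexillary if $EG(w)\le 3$. *)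

theory Defs
  imports "HOL-Combinatorics.Combinatorics"
begin

(* S_m as the set of one-line words of length m.  A pattern is such a word, so
   that it carries its size m: as a pattern, 213 in S_3 differs from 21 in S_2. *)
definition Sym :: "nat \<Rightarrow> nat list set" where
  "Sym m = permutations_of_set {1..m}"

definition S_infinity :: "(nat \<Rightarrow> nat) set" where
  "S_infinity = {w. \<exists>n. w permutes {1..n}}"

definition same_relative_order :: "'a::linorder list \<Rightarrow> 'b::linorder list \<Rightarrow> bool" where
  "same_relative_order x y \<longleftrightarrow> length x = length y \<and>
     (\<forall>i<length x. \<forall>j<length x. x ! i < x ! j \<longleftrightarrow> y ! i < y ! j)"

definition fl :: "'a::linorder list \<Rightarrow> nat list" where
  "fl x = (THE v. v \<in> Sym (length x) \<and> same_relative_order v x)"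

lemma ex1_fl:
  fixes x :: "'a::linorder list"
  assumes "distinct x"
  shows "\<exists>!v. v \<in> Sym (length x) \<and> same_relative_order v x"
proof -
  define m where "m = length x"
  define r where "r = (\<lambda>y. card {z \<in> set x. z \<le> y})"
  have r_mono: "r y < r y'" if "y < y'" "y' \<in> set x" for y y'
  proof -
    have "{z \<in> set x. z \<le> y} \<subset> {z \<in> set x. z \<le> y'}"
    proof (rule psubsetI)
      show "{z \<in> set x. z \<le> y} \<subseteq> {z \<in> set x. z \<le> y'}" using that by auto
      have "y' \<in> {z \<in> set x. z \<le> y'}" "y' \<notin> {z \<in> set x. z \<le> y}" using that by auto
      then show "{z \<in> set x. z \<le> y} \<noteq> {z \<in> set x. z \<le> y'}" by metis
    qed
    then show ?thesis unfolding r_def by (intro psubset_card_mono) auto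
  qed
  have r_iff: "r y < r y' \<longleftrightarrow> y < y'" if "y \<in> set x" "y' \<in> set x" for y y'
    using r_mono[of y y'] r_mono[of y' y] that by (metis less_asym linorder_neqE)
  have r_inj: "inj_on r (set x)"
    by (intro inj_onI) (metis r_iff less_irrefl linorder_neqE)
  have r_range: "r ` set x \<subseteq> {1..m}"
  proof
    fix k assume "k \<in> r ` set x"
    then obtain y where y: "y \<in> set x" "k = r y" by auto
    have "{z \<in> set x. z \<le> y} \<noteq> {}" using y by auto
    then have "r y > 0" unfolding r_def by (simp add: card_gt_0_iff)
    moreover have "r y \<le> card (set x)" unfolding r_def by (intro card_mono) auto
    ultimately show "k \<in> {1..m}"
      using y card_length[of x] unfolding m_def by auto
  qed
  have "card (r ` set x) = m"
    using card_image[OF r_inj] distinct_card[OF assms] by (simp add: m_def)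
  then have r_eq: "r ` set x = {1..m}"
    using r_range by (intro card_subset_eq) auto
  have ex: "map r x \<in> Sym (length x) \<and> same_relative_order (map r x) x"
    using r_eq r_inj assms r_iff
    by (auto simp: Sym_def permutations_of_set_def same_relative_order_def distinct_map m_def)
  moreover have "v = map r x"
    if v: "v \<in> Sym (length x)" "same_relative_order v x" for v
  proof (rule nth_equalityI)
    have lv: "length v = m" using v(2) by (simp add: same_relative_order_def m_def)
    have sv: "set v = {1..m}" "distinct v"
      using v(1) by (auto simp: Sym_def permutations_of_set_def m_def)
    show "length v = length (map r x)" using lv by (simp add: m_def)
    fix i assume "i < length v"
    then have i: "i < m" using lv by simp
    have vi: "v ! i \<in> {1..m}" using i lv sv(1) nth_mem[of i v] by auto
    have le_iff: "v ! j \<le> v ! i \<longleftrightarrow> x ! j \<le> x ! i" if "j < m" for j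
      using v(2) i lv that unfolding same_relative_order_def by (metis linorder_not_le)
    have "{z \<in> set x. z \<le> x ! i} = (!) x ` {j. j < m \<and> x ! j \<le> x ! i}"
      by (auto simp: in_set_conv_nth m_def)
    then have "r (x ! i) = card {j. j < m \<and> x ! j \<le> x ! i}"
      unfolding r_def using assms
      by (simp add: card_image inj_on_def nth_eq_iff_index_eq m_def)
    also have "{j. j < m \<and> x ! j \<le> x ! i} = {j. j < m \<and> v ! j \<le> v ! i}"
      using le_iff by auto
    also have "card \<dots> = card ((!) v ` {j. j < m \<and> v ! j \<le> v ! i})"
      using sv(2) lv by (simp add: card_image inj_on_def nth_eq_iff_index_eq)
    also have "(!) v ` {j. j < m \<and> v ! j \<le> v ! i} = {z \<in> set v. z \<le> v ! i}"
      using lv by (auto simp: in_set_conv_nth)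
    also have "\<dots> = {1..v ! i}" using sv(1) vi by auto
    finally show "v ! i = map r x ! i" using i by (simp add: m_def)
  qed
  ultimately show ?thesis by (intro ex1I[of _ "map r x"]) auto
qed

(* Positions range over all positive integers, as w lives in S_infinity. *)
definition contains_pattern :: "(nat \<Rightarrow> nat) \<Rightarrow> nat list \<Rightarrow> bool" where
  "contains_pattern w v \<longleftrightarrow>
     (\<exists>is. sorted_wrt (<) is \<and> (\<forall>i\<in>set is. 1 \<le> i) \<and> fl (map w is) = v)"

definition avoids :: "(nat \<Rightarrow> nat) \<Rightarrow> nat list \<Rightarrow> bool" where
  "avoids w v \<longleftrightarrow> \<not> contains_pattern w v"

(* s_(a_1) o ... o s_(a_l); since (w o s_i)(j) = w (s_i j), right multiplication by
   s_i swaps the entries of w in positions i and i + 1. *)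
definition word_product :: "nat list \<Rightarrow> nat \<Rightarrow> nat" where
  "word_product as = foldr (\<lambda>a f. transpose a (Suc a) \<circ> f) as id"

definition word_for :: "(nat \<Rightarrow> nat) \<Rightarrow> nat list \<Rightarrow> bool" where
  "word_for w as \<longleftrightarrow> (\<forall>a\<in>set as. 1 \<le> a) \<and> word_product as = w"

definition reduced_word :: "(nat \<Rightarrow> nat) \<Rightarrow> nat list \<Rightarrow> bool" where
  "reduced_word w as \<longleftrightarrow>
     word_for w as \<and> (\<forall>bs. word_for w bs \<longrightarrow> length as \<le> length bs)"

(* A tableau is its list of rows, top row first. *)
definition semistandard :: "nat list list \<Rightarrow> bool" where
  "semistandard T \<longleftrightarrow>
     (\<forall>r\<in>set T. r \<noteq> [] \<and> sorted r \<and> (\<forall>a\<in>set r. 1 \<le> a)) \<and>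
     sorted_wrt (\<ge>) (map length T) \<and>
     (\<forall>i j. Suc i < length T \<longrightarrow> j < length (T ! Suc i) \<longrightarrow> T ! i ! j < T ! Suc i ! j)"

definition num_columns :: "nat list list \<Rightarrow> nat" where
  "num_columns T = (case T of [] \<Rightarrow> 0 | r # _ \<Rightarrow> length r)"

(* The entries of column j, from top to bottom. *)
definition column :: "nat list list \<Rightarrow> nat \<Rightarrow> nat list" where
  "column T j = map (\<lambda>r. r ! j) (filter (\<lambda>r. j < length r) T)"

definition column_word :: "nat list list \<Rightarrow> nat list" where
  "column_word T = concat (map (\<lambda>j. rev (column T j)) [0..<num_columns T])"

definition EG_tableaux :: "(nat \<Rightarrow> nat) \<Rightarrow> nat list list set" where
  "EG_tableaux w = {T. semistandard T \<and> reduced_word w (column_word T)}"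

definition EG :: "(nat \<Rightarrow> nat) \<Rightarrow> nat" where
  "EG w = card (EG_tableaux w)"

definition vexillary :: "nat \<Rightarrow> (nat \<Rightarrow> nat) \<Rightarrow> bool" where
  "vexillary k w \<longleftrightarrow> EG w \<le> k"

end

(*
The alternating sum, over permutations of the column heights, of the products of the operators that sum
over decreasing words of given lengths vanishes or counts tableaux: a sign-reversing involution cancels
everything except the Edelman-Greene tableaux.  Since these sums commute with the operators involved in
Monk's rule, EG satisfies the transition recurrence of Lascoux and Schuetzenberger: EG w is the sum of
EG over the children of w at a corner, that is, at the lexicographically last "43" of a pattern 2143;
permutations without 2143 have EG = 1.  Along this recurrence EG >= 3 and EG >= 4 are inherited from
patterns, and a permutation that is minimal with EG >= 4 is the union of few small windows (a corner
together with patterns of two of its children), so that it has at most 8 entries.  The finitely many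
possible positions of the windows relative to the corner are run through by rewriting.
*)
theory Submission
  imports Defs Complex_Main
begin

section \<open>Operators on functions of permutations\<close>

text \<open>The operators \<open>dop\<close> obey the nilCoxeter relations, and the product of the
  factors 1 + t \<open>dop\<close> a over decreasing a commutes with the same product at another
  parameter by the Yang-Baxter equation; comparing coefficients makes the sums \<open>hop\<close>
  commute. A reduced word of w is a descending path from the inverse of w, which is why inverses
  enter the count of tableaux. Monotonicity under patterns is established only for the truncation of
  EG at 4, in one induction with the description of the minimal words: each of the two statements
  uses the other for shorter words and for children. The threshold 3 cannot be avoided on the way to
  4: at a corner with two children, one of value 1, the other must contribute 3. In the finite
  checks EG itself is never computed exactly; a recursion certifies lower bounds, and only this
  direction has to be sound. What is not forced by the lower bounds is excluded by minimality, since
  a minimal word coincides with each of its windows that reaches the threshold.\<close>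

definition dop :: "nat \<Rightarrow> ((nat \<Rightarrow> nat) \<Rightarrow> real) \<Rightarrow> (nat \<Rightarrow> nat) \<Rightarrow> real" where
  "dop a f q = (if q (Suc a) < q a then f (q \<circ> transpose a (Suc a)) else 0)"

text \<open>For a decreasing list this is the elementary symmetric polynomial of degree k in the
  noncommuting operators \<open>dop\<close> a, the larger letters acting outermost.\<close>

fun hop :: "nat list \<Rightarrow> nat \<Rightarrow> ((nat \<Rightarrow> nat) \<Rightarrow> real) \<Rightarrow> (nat \<Rightarrow> nat) \<Rightarrow> real" where
  "hop [] k f q = (if k = 0 then f q else 0)"
| "hop (a # L) k f q = hop L k f q + (if k = 0 then 0 else dop a (hop L (k - 1) f) q)"

definition aop :: "nat \<Rightarrow> real \<Rightarrow> ((nat \<Rightarrow> nat) \<Rightarrow> real) \<Rightarrow> (nat \<Rightarrow> nat) \<Rightarrow> real" where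
  "aop a t f = (\<lambda>q. f q + t * dop a f q)"

fun gop :: "nat list \<Rightarrow> real \<Rightarrow> ((nat \<Rightarrow> nat) \<Rightarrow> real) \<Rightarrow> (nat \<Rightarrow> nat) \<Rightarrow> real" where
  "gop [] t f = f"
| "gop (a # L) t f = aop a t (gop L t f)"

lemma dop_lin: "dop a (\<lambda>q. f q + c * g q) q = dop a f q + c * dop a g q"
  by (simp add: dop_def)

lemma dop_add: "dop a (\<lambda>q. f q + g q) q = dop a f q + dop a g q"
  by (simp add: dop_def)

lemma dop_cmult: "dop a (\<lambda>q. c * g q) q = c * dop a g q"
  by (simp add: dop_def)

lemma dop_dop: "dop a (dop a f) q = 0"
  by (simp add: dop_def)

lemma dop_comm:
  assumes "Suc a < b"
  shows "dop a (dop b f) q = dop b (dop a f) q"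
proof -
  have "transpose a (Suc a) \<circ> transpose b (Suc b) = transpose b (Suc b) \<circ> transpose a (Suc a)"
    using assms by (auto simp: fun_eq_iff transpose_def)
  then have "q \<circ> transpose a (Suc a) \<circ> transpose b (Suc b) = q \<circ> transpose b (Suc b) \<circ> transpose a (Suc a)"
    by (simp add: comp_assoc)
  then show ?thesis using assms by (simp add: dop_def)
qed

lemma dop_braid: "dop a (dop (Suc a) (dop a f)) q = dop (Suc a) (dop a (dop (Suc a) f)) q"
proof -
  have "transpose a (Suc a) \<circ> transpose (Suc a) (Suc (Suc a)) \<circ> transpose a (Suc a) =
    transpose (Suc a) (Suc (Suc a)) \<circ> transpose a (Suc a) \<circ> transpose (Suc a) (Suc (Suc a))"
    by (auto simp: fun_eq_iff transpose_def)
  then have "q \<circ> transpose a (Suc a) \<circ> transpose (Suc a) (Suc (Suc a)) \<circ> transpose a (Suc a) =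
    q \<circ> transpose (Suc a) (Suc (Suc a)) \<circ> transpose a (Suc a) \<circ> transpose (Suc a) (Suc (Suc a))"
    by (simp add: comp_assoc)
  then show ?thesis by (auto simp: dop_def)
qed

lemma aop_aop: "aop a t (aop a u f) = aop a (t + u) f"
  by (rule ext) (simp add: aop_def dop_lin dop_dop algebra_simps)

lemma aop_zero [simp]: "aop a 0 f = f"
  by (simp add: aop_def)

lemma aop_comm:
  assumes "Suc a < b"
  shows "aop a t (aop b u f) = aop b u (aop a t f)"
  by (rule ext) (simp add: aop_def dop_lin dop_comm[OF assms] algebra_simps)

text \<open>Expanding both sides leaves words without repeated neighbours; the two words of length
  three agree by the braid relation, and taking the middle parameter as the sum of the outer ones
  makes the coefficients of the shorter words agree.\<close>

lemma yang_baxter: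
  "aop a t (aop (Suc a) (t + u) (aop a u f)) = aop (Suc a) u (aop a (t + u) (aop (Suc a) t f))"
proof (rule ext)
  fix q
  show "aop a t (aop (Suc a) (t + u) (aop a u f)) q = aop (Suc a) u (aop a (t + u) (aop (Suc a) t f)) q"
    unfolding aop_def by (simp only: dop_add dop_cmult dop_dop dop_braid[of a]) (simp add: algebra_simps)
qed

lemma gop_append: "gop (L @ L') t f = gop L t (gop L' t f)"
  by (induction L) auto

lemma gop_aop_comm:
  assumes "\<forall>b\<in>set L. Suc a < b"
  shows "gop L u (aop a t f) = aop a t (gop L u f)"
  using assms by (induction L) (auto simp: aop_comm)

lemma rev_upt_Suc: "a < n \<Longrightarrow> rev [a..<n] = rev [Suc a..<n] @ [a]"
  by (simp add: upt_conv_Cons)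

text \<open>This is the commutation behind the symmetry of Stanley symmetric functions. Induction
  removes the smallest letter a from both factors; the letters above a commute by hypothesis, and
  the remainder is shown to be symmetric in t and u. The lower end of the interval stays arbitrary
  because the later cancellation needs the letters above a given bound.\<close>

lemma gop_gop_comm: "gop (rev [a..<n]) t (gop (rev [a..<n]) u f) = gop (rev [a..<n]) u (gop (rev [a..<n]) t f)"
proof (induction "n - a" arbitrary: a f t u)
  case 0
  then show ?case by simp
next
  case (Suc k)
  then have an: "a < n" by simp
  define H where "H = rev [Suc a..<n]"
  have IH: "gop H t (gop H u f) = gop H u (gop H t f)" for t u f
    unfolding H_def using Suc(1)[of "Suc a"] Suc(2) by simp
  have split: "gop (rev [a..<n]) t f = gop H t (aop a t f)" for t f
    using an by (simp add: rev_upt_Suc gop_append H_def)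
  show ?case
  proof (cases "Suc a < n")
    case False
    then have "H = []" using an by (simp add: H_def)
    then show ?thesis by (simp add: split aop_aop add.commute)
  next
    case True
    define H2 where "H2 = rev [Suc (Suc a)..<n]"
    have H2: "gop H t f = gop H2 t (aop (Suc a) t f)" for t f
      using True by (simp add: rev_upt_Suc gop_append H_def H2_def)
    have "\<forall>b\<in>set H2. Suc a < b" by (auto simp: H2_def)
    then have c: "aop a t (gop H2 u f) = gop H2 u (aop a t f)" for t u f
      by (simp add: gop_aop_comm)
    have H2': "gop H2 u f = gop H u (aop (Suc a) (- u) f)" for u f
      by (simp add: H2 aop_aop)
    \<comment> \<open>\<open>X\<close> gathers what is left of the letters a and a+1 once both
      copies of \<open>H\<close> have been completed; the factor with parameter -u compensates the
      letter a+1 that is borrowed to turn \<open>H2\<close> into \<open>H\<close>.\<close>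
    define X where "X = (\<lambda>t u f. aop (Suc a) (- u) (aop a t (aop (Suc a) u (aop a u f))))"
    have e: "gop (rev [a..<n]) t (gop (rev [a..<n]) u f) = gop H t (gop H u (X t u f))" for t u
    proof -
      have "gop (rev [a..<n]) t (gop (rev [a..<n]) u f) =
          gop H t (aop a t (gop H2 u (aop (Suc a) u (aop a u f))))"
        by (simp add: split H2)
      also have "\<dots> = gop H t (gop H2 u (aop a t (aop (Suc a) u (aop a u f))))"
        by (simp add: c)
      also have "\<dots> = gop H t (gop H u (X t u f))"
        by (simp add: H2' X_def)
      finally show ?thesis .
    qed
    have X: "X t u f = X u t f" for t u
    proof -
      \<comment> \<open>Splitting the last parameter u as (u - t) + t brings the three leading
        factors into the shape required by \<open>yang_baxter\<close>.\<close>
      have "aop a t (aop (Suc a) u (aop a u f)) = aop a t (aop (Suc a) (t + (u - t)) (aop a (u - t) (aop a t f)))"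
        by (simp add: aop_aop)
      also have "\<dots> = aop (Suc a) (u - t) (aop a u (aop (Suc a) t (aop a t f)))"
        by (subst yang_baxter) simp
      finally show ?thesis by (simp add: X_def aop_aop)
    qed
    show ?thesis by (simp add: e IH[of t u] X[of t u])
  qed
qed

lemma hop_gt: "length L < k \<Longrightarrow> hop L k f q = 0"
  by (induction L arbitrary: k q) (auto simp: dop_def)

lemma dop_sum: "dop a (\<lambda>q. \<Sum>k\<in>A. g k q) q = (\<Sum>k\<in>A. dop a (g k) q)"
  by (simp add: dop_def)

lemma hop_sum: "hop L k (\<lambda>q. \<Sum>i\<in>A. g i q) q = (\<Sum>i\<in>A. hop L k (g i) q)"
proof (induction L arbitrary: k q)
  case (Cons a L)
  show ?case unfolding hop.simps Cons by (cases k) (simp_all add: dop_sum sum.distrib)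
qed simp

lemma hop_cmult: "hop L k (\<lambda>q. c * g q) q = c * hop L k g q"
proof (induction L arbitrary: k q)
  case (Cons a L)
  show ?case unfolding hop.simps Cons by (cases k) (simp_all add: dop_cmult algebra_simps)
qed simp

lemma gop_hop: "gop L t f q = (\<Sum>k\<le>length L. hop L k f q * t ^ k)"
proof (induction L arbitrary: q)
  case (Cons a L)
  have "gop (a # L) t f q = gop L t f q + t * dop a (gop L t f) q" by (simp add: aop_def)
  also have "dop a (gop L t f) q = (\<Sum>k\<le>length L. dop a (hop L k f) q * t ^ k)"
  proof -
    have "gop L t f = (\<lambda>q. \<Sum>k\<le>length L. t ^ k * hop L k f q)"
      using Cons by (simp add: fun_eq_iff mult.commute)
    then show ?thesis by (simp only: dop_sum dop_cmult) (simp add: mult.commute)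
  qed
  also have "gop L t f q = (\<Sum>k\<le>Suc (length L). hop L k f q * t ^ k)"
    by (simp add: Cons hop_gt)
  also have "t * (\<Sum>k\<le>length L. dop a (hop L k f) q * t ^ k) =
      (\<Sum>k\<le>length L. (if Suc k = 0 then 0 else dop a (hop L (Suc k - 1) f) q) * t ^ Suc k)"
    by (simp add: sum_distrib_left algebra_simps)
  also have "\<dots> = (\<Sum>k\<le>Suc (length L). (if k = 0 then 0 else dop a (hop L (k - 1) f) q) * t ^ k)"
    by (subst sum.atMost_Suc_shift) simp
  finally show ?case by (simp add: sum.distrib algebra_simps del: sum.atMost_Suc)
qed simp

lemma gop_gop_hop: "gop L t (gop L u f) q =
  (\<Sum>i\<le>length L. (\<Sum>j\<le>length L. hop L i (hop L j f) q * u ^ j) * t ^ i)"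
proof -
  have "hop L i (gop L u f) q = (\<Sum>j\<le>length L. hop L i (hop L j f) q * u ^ j)" for i
  proof -
    have "gop L u f = (\<lambda>q. \<Sum>j\<le>length L. u ^ j * hop L j f q)"
      by (simp add: fun_eq_iff gop_hop mult.commute)
    then show ?thesis by (simp add: hop_sum hop_cmult mult.commute)
  qed
  then show ?thesis by (simp add: gop_hop[of L t])
qed

text \<open>Both sides are the coefficient of the same monomial in t and u in two products that
  agree for all real t and u. Real values are used so that the coefficients of these polynomial
  functions can be compared, one variable at a time.\<close>

lemma hop_comm: "hop (rev [a..<n]) i (hop (rev [a..<n]) j f) q = hop (rev [a..<n]) j (hop (rev [a..<n]) i f) q"
proof -
  define L where "L = rev [a..<n]"
  define c where "c = (\<lambda>i j. hop L i (hop L j f) q)"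
  let ?N = "length L"
  have "(\<Sum>i\<le>?N. (\<Sum>j\<le>?N. c i j * u ^ j) * t ^ i) = (\<Sum>i\<le>?N. (\<Sum>j\<le>?N. c j i * u ^ j) * t ^ i)" for t u
  proof -
    have "(\<Sum>i\<le>?N. (\<Sum>j\<le>?N. c i j * u ^ j) * t ^ i) = gop L t (gop L u f) q"
      by (simp add: gop_gop_hop c_def)
    also have "\<dots> = gop L u (gop L t f) q" by (simp add: L_def gop_gop_comm)
    also have "\<dots> = (\<Sum>j\<le>?N. (\<Sum>i\<le>?N. c j i * t ^ i) * u ^ j)" by (simp add: gop_gop_hop c_def)
    also have "\<dots> = (\<Sum>i\<le>?N. (\<Sum>j\<le>?N. c j i * u ^ j) * t ^ i)"
      unfolding sum_distrib_right by (subst sum.swap) (simp add: algebra_simps)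
    finally show ?thesis .
  qed
  then have "\<forall>i\<le>?N. (\<Sum>j\<le>?N. c i j * u ^ j) = (\<Sum>j\<le>?N. c j i * u ^ j)" for u
    using polyfun_eq_coeffs[of "\<lambda>i. \<Sum>j\<le>?N. c i j * u ^ j" ?N "\<lambda>i. \<Sum>j\<le>?N. c j i * u ^ j"] by simp
  then have "\<forall>j\<le>?N. c i j = c j i" if "i \<le> ?N" for i
    using polyfun_eq_coeffs[of "\<lambda>j. c i j" ?N "\<lambda>j. c j i"] that by simp
  then show ?thesis
  proof (cases "i \<le> ?N \<and> j \<le> ?N")
    case False
    have z: "hop L k (\<lambda>q. 0) q = 0" for k q using hop_sum[of L k "\<lambda>_ _. 0" "{}" q] by simp
    have "hop L k f = (\<lambda>q. 0)" if "k > ?N" for k using that by (simp add: fun_eq_iff hop_gt)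
    then have "hop L i (hop L j f) q = 0" "hop L j (hop L i f) q = 0"
      using False z by (auto simp: hop_gt not_le)
    then show ?thesis by (simp add: L_def)
  qed (auto simp: c_def L_def)
qed

section \<open>Monk operators: signed sums over covers in Bruhat order\<close>

definition cv :: "nat \<Rightarrow> nat \<Rightarrow> (nat \<Rightarrow> nat) \<Rightarrow> bool" where
  "cv x y q \<longleftrightarrow> x < y \<and> q x < q y \<and> (\<forall>z. x < z \<and> z < y \<longrightarrow> \<not> (q x < q z \<and> q z < q y))"

definition sgc :: "nat \<Rightarrow> nat \<Rightarrow> (nat \<Rightarrow> nat) \<Rightarrow> real" where
  "sgc x y q = (if cv x y q then 1 else if cv y x q then -1 else 0)"

text \<open>The summands run over the covers of q in Bruhat order that exchange position x with
  another position y, with sign plus for y to the right of x and minus for y to the left;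
  \<open>cv\<close> is the covering relation. The bound B keeps the sum finite.\<close>

definition mnk :: "nat \<Rightarrow> nat \<Rightarrow> ((nat \<Rightarrow> nat) \<Rightarrow> real) \<Rightarrow> (nat \<Rightarrow> nat) \<Rightarrow> real" where
  "mnk B x f q = (\<Sum>y<B. sgc x y q * f (q \<circ> transpose x y))"

text \<open>Conjugation by the simple transposition carries covers to covers unless it exchanges x
  and y themselves. When one of x, y is a or a+1, the other of these two positions may enter or
  leave the interval between x and y, and the descent conditions on the two sides compensate for
  exactly this.\<close>

lemma sgc_swap:
  assumes inj: "inj q" and ne: "\<not> (x = a \<and> y = Suc a)" "\<not> (x = Suc a \<and> y = a)"
  defines "\<tau> \<equiv> transpose a (Suc a)"
  shows "(if (q \<circ> transpose x y) (Suc a) < (q \<circ> transpose x y) a then sgc x y q else 0) =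
    (if q (Suc a) < q a then sgc (\<tau> x) (\<tau> y) (q \<circ> \<tau>) else 0)"
proof -
  have neq: "q i \<noteq> q j" if "i \<noteq> j" for i j using inj_eq[OF inj] that by simp
  have one: "((q \<circ> transpose x y) (Suc a) < (q \<circ> transpose x y) a \<and> cv x y q) \<longleftrightarrow>
      (q (Suc a) < q a \<and> cv (\<tau> x) (\<tau> y) (q \<circ> \<tau>))"
    and two: "(q \<circ> transpose x y) (Suc a) < (q \<circ> transpose x y) a \<longleftrightarrow>
      (q \<circ> transpose y x) (Suc a) < (q \<circ> transpose y x) a"
    if ne: "\<not> (x = a \<and> y = Suc a)" "\<not> (x = Suc a \<and> y = a)" for x y
  proof -
    show two: "(q \<circ> transpose x y) (Suc a) < (q \<circ> transpose x y) a \<longleftrightarrow>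
      (q \<circ> transpose y x) (Suc a) < (q \<circ> transpose y x) a" by (simp add: transpose_commute)
    have bet: "(\<forall>z. \<tau> x < z \<and> z < \<tau> y \<longrightarrow> P (\<tau> z)) \<longleftrightarrow> (\<forall>z. \<tau> x < \<tau> z \<and> \<tau> z < \<tau> y \<longrightarrow> P z)" for P
      by (metis \<tau>_def transpose_involutory)
    have cv': "cv (\<tau> x) (\<tau> y) (q \<circ> \<tau>) \<longleftrightarrow> \<tau> x < \<tau> y \<and> q x < q y \<and>
        (\<forall>z. \<tau> x < \<tau> z \<and> \<tau> z < \<tau> y \<longrightarrow> \<not> (q x < q z \<and> q z < q y))"
      unfolding cv_def using bet[of "\<lambda>z. \<not> (q x < q z \<and> q z < q y)"] by (simp add: \<tau>_def)
    have t: "\<tau> z = (if z = a then Suc a else if z = Suc a then a else z)" for z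
      by (simp add: \<tau>_def transpose_def)
    have lt: "(\<tau> i < \<tau> j) = (if i = a \<and> j = Suc a then False else if i = Suc a \<and> j = a then True else i < j)" for i j
      by (auto simp: t)
    have sp: "(\<forall>z. x < z \<and> z < y \<longrightarrow> P z) \<longleftrightarrow> (x < b \<and> b < y \<longrightarrow> P b) \<and> (\<forall>z. z \<noteq> b \<and> x < z \<and> z < y \<longrightarrow> P z)" for b P
      by metis
    have sp2: "(\<forall>z. z = b \<or> x < z \<and> z < y \<longrightarrow> P z) \<longleftrightarrow> P b \<and> (\<forall>z. x < z \<and> z < y \<longrightarrow> P z)" for b P
      by metis
    consider "x = a" "y \<noteq> a" "y \<noteq> Suc a" | "x = Suc a" "y \<noteq> a" "y \<noteq> Suc a" |
      "y = a" "x \<noteq> a" "x \<noteq> Suc a" | "y = Suc a" "x \<noteq> a" "x \<noteq> Suc a" |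
      "x \<noteq> a" "x \<noteq> Suc a" "y \<noteq> a" "y \<noteq> Suc a" | "x = y"
      using ne by fastforce
    then show "((q \<circ> transpose x y) (Suc a) < (q \<circ> transpose x y) a \<and> cv x y q) \<longleftrightarrow>
      (q (Suc a) < q a \<and> cv (\<tau> x) (\<tau> y) (q \<circ> \<tau>))"
    proof cases
      case 1
      have "x < y \<Longrightarrow> Suc a < y" using 1 by auto
      have "((q \<circ> transpose x y) (Suc a) < (q \<circ> transpose x y) a) = (q (Suc a) < q y)"
        using 1 by (simp add: transpose_def)
      moreover have "cv (\<tau> x) (\<tau> y) (q \<circ> \<tau>) \<longleftrightarrow> x < y \<and> q x < q y \<and>
          (\<forall>z. z \<noteq> Suc a \<and> x < z \<and> z < y \<longrightarrow> \<not> (q x < q z \<and> q z < q y))"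
      proof -
        have "\<tau> x < \<tau> y \<longleftrightarrow> x < y" "\<tau> x < \<tau> z \<and> \<tau> z < \<tau> y \<longleftrightarrow> z \<noteq> Suc a \<and> x < z \<and> z < y" for z
          using 1 unfolding lt by auto
        then show ?thesis unfolding cv' by simp
      qed
      moreover have "q x \<noteq> q (Suc a)" "q y \<noteq> q (Suc a)" using 1 neq by auto
      ultimately show ?thesis using 1 \<open>x < y \<Longrightarrow> Suc a < y\<close> unfolding cv_def sp[of _ "Suc a"]
        by auto
    next
      case 2
      have "x < y \<Longrightarrow> a < y" "a < y \<Longrightarrow> x < y" using 2 by auto
      have "((q \<circ> transpose x y) (Suc a) < (q \<circ> transpose x y) a) = (q y < q a)"
        using 2 by (simp add: transpose_def)
      moreover have "cv (\<tau> x) (\<tau> y) (q \<circ> \<tau>) \<longleftrightarrow> x < y \<and> q x < q y \<and>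
          (\<forall>z. z = a \<or> x < z \<and> z < y \<longrightarrow> \<not> (q x < q z \<and> q z < q y))"
      proof -
        have "\<tau> x < \<tau> y \<longleftrightarrow> x < y" "x < y \<Longrightarrow> \<tau> x < \<tau> z \<and> \<tau> z < \<tau> y \<longleftrightarrow> z = a \<or> x < z \<and> z < y" for z
          using 2 unfolding lt by auto
        then show ?thesis unfolding cv' by blast
      qed
      moreover have "q x \<noteq> q a" "q y \<noteq> q a" using 2 neq by auto
      ultimately show ?thesis using 2 unfolding cv_def sp2
        by auto
    next
      case 3
      have "((q \<circ> transpose x y) (Suc a) < (q \<circ> transpose x y) a) = (q (Suc a) < q x)"
        using 3 by (simp add: transpose_def)
      moreover have "cv (\<tau> x) (\<tau> y) (q \<circ> \<tau>) \<longleftrightarrow> x < y \<and> q x < q y \<and>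
          (\<forall>z. z = Suc a \<or> x < z \<and> z < y \<longrightarrow> \<not> (q x < q z \<and> q z < q y))"
      proof -
        have "\<tau> x < \<tau> y \<longleftrightarrow> x < y" using 3 unfolding lt by simp
        moreover have "\<tau> x < \<tau> z \<and> \<tau> z < \<tau> y \<longleftrightarrow> z = Suc a \<or> x < z \<and> z < y" if "x < y" for z
        proof -
          have "\<tau> x < \<tau> z \<longleftrightarrow> x < z" using 3 unfolding lt by simp
          moreover have "\<tau> z < \<tau> y \<longleftrightarrow> z = Suc a \<or> z < y" using 3 unfolding lt by simp
          moreover have "x < Suc a" using that 3 by simp
          ultimately show ?thesis by blast
        qed
        ultimately show ?thesis unfolding cv' by blast
      qed
      moreover have "q x \<noteq> q (Suc a)" "q y \<noteq> q (Suc a)" using 3 neq by auto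
      ultimately show ?thesis using 3 unfolding cv_def sp2
        by auto
    next
      case 4
      have "x < y \<Longrightarrow> x < a" using 4 by auto
      have "((q \<circ> transpose x y) (Suc a) < (q \<circ> transpose x y) a) = (q x < q a)"
        using 4 by (simp add: transpose_def)
      moreover have "cv (\<tau> x) (\<tau> y) (q \<circ> \<tau>) \<longleftrightarrow> x < y \<and> q x < q y \<and>
          (\<forall>z. z \<noteq> a \<and> x < z \<and> z < y \<longrightarrow> \<not> (q x < q z \<and> q z < q y))"
      proof -
        have "\<tau> x < \<tau> y \<longleftrightarrow> x < y" "\<tau> x < \<tau> z \<longleftrightarrow> x < z" for z
          using 4 unfolding lt by auto
        moreover have "\<tau> z < \<tau> y \<longleftrightarrow> z \<noteq> a \<and> z < y" for z
          using 4 unfolding lt by (cases "z = a") auto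
        ultimately show ?thesis unfolding cv' by blast
      qed
      moreover have "q x \<noteq> q a" "q y \<noteq> q a" using 4 neq by auto
      ultimately show ?thesis using 4 \<open>x < y \<Longrightarrow> x < a\<close> unfolding cv_def sp[of _ a]
        by auto
    next
      case 5
      have "((q \<circ> transpose x y) (Suc a) < (q \<circ> transpose x y) a) = (q (Suc a) < q a)"
        using 5 by (simp add: transpose_def)
      moreover have "cv (\<tau> x) (\<tau> y) (q \<circ> \<tau>) \<longleftrightarrow> cv x y q"
      proof -
        have "\<tau> x < \<tau> y \<longleftrightarrow> x < y" "\<tau> x < \<tau> z \<longleftrightarrow> x < z" "\<tau> z < \<tau> y \<longleftrightarrow> z < y" for z
          using 5 unfolding lt by auto
        then show ?thesis unfolding cv' cv_def[of x y] by simp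
      qed
      ultimately show ?thesis by auto
    next
      case 6
      then show ?thesis by (simp add: cv_def)
    qed
  qed
  have "cv x y q \<Longrightarrow> \<not> cv y x q" for x y q by (auto simp: cv_def)
  then show ?thesis
    unfolding sgc_def using one[OF ne] one[of y x] two[OF ne] ne by auto
qed

text \<open>Under the reindexing of y by the simple transposition the two sums agree term by term,
  except where x and y are a and a+1. There the difference is f q up to sign, whether q ascends or
  descends at a, and this yields the two correction terms.\<close>

lemma mnk_dop:
  assumes inj: "inj q" and B: "Suc a < B"
  shows "mnk B x (dop a f) q = dop a (\<lambda>q'. mnk B (transpose a (Suc a) x) f q') q +
    (if x = a then f q else 0) - (if x = Suc a then f q else 0)"
proof -
  define \<tau> where "\<tau> = transpose a (Suc a)"
  define D where "D = (\<lambda>q::nat \<Rightarrow> nat. q (Suc a) < q a)"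
  have tt: "\<tau> (\<tau> z) = z" for z by (simp add: \<tau>_def)
  have bij: "bij_betw \<tau> {..<B} {..<B}"
    by (rule bij_betwI[where g = \<tau>]) (use B in \<open>auto simp: \<tau>_def transpose_def\<close>)
  have conj: "\<tau> \<circ> transpose (\<tau> x) (\<tau> y) = transpose x y \<circ> \<tau>" for y
    by (auto simp: fun_eq_iff \<tau>_def transpose_def)
  have "dop a (\<lambda>q'. mnk B (\<tau> x) f q') q =
      (\<Sum>y<B. (if D q then sgc (\<tau> x) y (q \<circ> \<tau>) else 0) * f (q \<circ> \<tau> \<circ> transpose (\<tau> x) y))"
    by (simp add: dop_def mnk_def D_def \<tau>_def)
  also have "\<dots> = (\<Sum>y<B. (if D q then sgc (\<tau> x) (\<tau> y) (q \<circ> \<tau>) else 0) * f (q \<circ> \<tau> \<circ> transpose (\<tau> x) (\<tau> y)))"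
    using sum.reindex_bij_betw[OF bij, of "\<lambda>y. (if D q then sgc (\<tau> x) y (q \<circ> \<tau>) else 0) * f (q \<circ> \<tau> \<circ> transpose (\<tau> x) y)"]
    by simp
  also have "\<dots> = (\<Sum>y<B. (if D q then sgc (\<tau> x) (\<tau> y) (q \<circ> \<tau>) else 0) * f (q \<circ> transpose x y \<circ> \<tau>))"
    by (simp only: comp_assoc conj)
  finally have R: "dop a (\<lambda>q'. mnk B (\<tau> x) f q') q = \<dots>" .
  have L: "mnk B x (dop a f) q =
      (\<Sum>y<B. (if D (q \<circ> transpose x y) then sgc x y q else 0) * f (q \<circ> transpose x y \<circ> \<tau>))"
    unfolding mnk_def by (rule sum.cong) (simp_all add: dop_def D_def \<tau>_def)
  define E where "E = (\<lambda>y. ((if D (q \<circ> transpose x y) then sgc x y q else 0) -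
      (if D q then sgc (\<tau> x) (\<tau> y) (q \<circ> \<tau>) else 0)) * f (q \<circ> transpose x y \<circ> \<tau>))"
  have E: "mnk B x (dop a f) q - dop a (\<lambda>q'. mnk B (\<tau> x) f q') q = sum E {..<B}"
    unfolding L R E_def by (simp add: sum_subtractf algebra_simps)
  have z: "E y = 0" if "\<not> (x = a \<and> y = Suc a)" "\<not> (x = Suc a \<and> y = a)" for y
    using sgc_swap[OF inj that] by (simp add: E_def D_def \<tau>_def)
  have qne: "q a \<noteq> q (Suc a)" using injD[OF inj, of a "Suc a"] by auto
  have cva: "cv a (Suc a) q \<longleftrightarrow> q a < q (Suc a)" for q by (auto simp: cv_def)
  have ncva: "\<not> cv (Suc a) a q" for q by (auto simp: cv_def)
  have idc: "q \<circ> transpose a (Suc a) \<circ> \<tau> = q" "q \<circ> transpose (Suc a) a \<circ> \<tau> = q"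
    by (auto simp: fun_eq_iff \<tau>_def transpose_def)
  have ta: "\<tau> a = Suc a" "\<tau> (Suc a) = a" by (simp_all add: \<tau>_def)
  have "sum E {..<B} = (if x = a then f q else 0) - (if x = Suc a then f q else 0)"
  proof -
    consider "x = a" | "x = Suc a" | "x \<noteq> a" "x \<noteq> Suc a" by auto
    then show ?thesis
    proof cases
      case 1
      have "sum E {..<B} = sum E {Suc a}"
        by (rule sum.mono_neutral_right) (use B z 1 in auto)
      also have "\<dots> = f q"
        using 1 qne by (auto simp: E_def D_def sgc_def cva ncva idc ta)
      finally show ?thesis using 1 by simp
    next
      case 2
      have "sum E {..<B} = sum E {a}"
        by (rule sum.mono_neutral_right) (use B z 2 in auto)
      also have "\<dots> = - f q"
        using 2 qne by (auto simp: E_def D_def sgc_def cva ncva idc ta)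
      finally show ?thesis using 2 by simp
    next
      case 3
      then show ?thesis using z by simp
    qed
  qed
  then show ?thesis using E by (simp add: \<tau>_def)
qed

fun nn :: "nat \<Rightarrow> nat list \<Rightarrow> (nat \<Rightarrow> nat) \<Rightarrow> real" where
  "nn m [] q = (if q = id then 1 else 0)"
| "nn m (k # \<alpha>) q = hop (rev [1..<Suc m]) k (nn m \<alpha>) q"

text \<open>A smaller entry at a positive position to the left keeps x away from position 1, the
  boundary case of \<open>mnk_hop\<close>. The property is inherited along descents, so it can be
  assumed throughout the recursion.\<close>

definition hasdown :: "nat \<Rightarrow> nat \<Rightarrow> (nat \<Rightarrow> nat) \<Rightarrow> bool" where
  "hasdown m x q \<longleftrightarrow> q permutes {1..m} \<and> x \<in> {1..m} \<and> (\<exists>z\<ge>1. z < x \<and> q z < q x)"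

lemma desc_bounds:
  assumes q: "q permutes {1..m}" and a: "a \<ge> 1" and d: "q (Suc a) < q a"
  shows "Suc a \<le> m"
proof (rule ccontr)
  assume "\<not> Suc a \<le> m"
  then have sa: "q (Suc a) = Suc a" using q by (simp add: permutes_def)
  show False
  proof (cases "a \<le> m")
    case True
    then have "q a \<in> {1..m}" using permutes_in_image[OF q, of a] a by auto
    then show False using d sa \<open>\<not> Suc a \<le> m\<close> by simp
  next
    case False
    then have "q a = a" using q by (simp add: permutes_def)
    then show False using d sa by simp
  qed
qed

lemma permutes_desc:
  assumes q: "q permutes {1..m}" and a: "a \<ge> 1" and d: "q (Suc a) < q a"
  shows "q \<circ> transpose a (Suc a) permutes {1..m}"
proof -
  have "Suc a \<le> m" using desc_bounds[OF assms] .
  then have "transpose a (Suc a) permutes {1..m}" using a by (intro permutes_swap_id) auto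
  then show ?thesis using q by (rule permutes_compose)
qed

lemma hasdown_desc:
  assumes h: "hasdown m x q" and a: "a \<ge> 1" and d: "q (Suc a) < q a"
  shows "hasdown m (transpose a (Suc a) x) (q \<circ> transpose a (Suc a))"
proof -
  have q: "q permutes {1..m}" and x: "x \<in> {1..m}" using h by (auto simp: hasdown_def)
  obtain z where z: "z \<ge> 1" "z < x" "q z < q x" using h by (auto simp: hasdown_def)
  have b: "Suc a \<le> m" using desc_bounds[OF q a d] .
  have "transpose a (Suc a) z < transpose a (Suc a) x"
    using z d by (auto simp: transpose_def)
  moreover have "transpose a (Suc a) z \<ge> 1" using z a by (auto simp: transpose_def)
  moreover have "transpose a (Suc a) x \<in> {1..m}" using x a b by (auto simp: transpose_def)
  ultimately show ?thesis
    unfolding hasdown_def using permutes_desc[OF q a d] z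
    by (intro conjI exI[of _ "transpose a (Suc a) z"]) auto
qed

lemma mnk_add: "mnk B x (\<lambda>q. f q + g q) q = mnk B x f q + mnk B x g q"
  by (simp add: mnk_def sum.distrib algebra_simps)

lemma mnk_sum: "mnk B x (\<lambda>q. \<Sum>i\<in>A. c i * g i q) q = (\<Sum>i\<in>A. c i * mnk B x (g i) q)"
proof -
  have "mnk B x (\<lambda>q. \<Sum>i\<in>A. c i * g i q) q = (\<Sum>y<B. \<Sum>i\<in>A. c i * (sgc x y q * g i (q \<circ> transpose x y)))"
    by (simp add: mnk_def sum_distrib_left algebra_simps)
  also have "\<dots> = (\<Sum>i\<in>A. c i * mnk B x (g i) q)"
    by (subst sum.swap) (simp add: mnk_def sum_distrib_left)
  finally show ?thesis .
qed

text \<open>The correction terms of \<open>mnk_dop\<close> telescope: adding the letter a, its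
  positive term at x = a cancels the term left over by the smaller letters, and its negative term at
  x = a+1 combines with the inherited one into a single \<open>hop\<close> of degree one
  less.\<close>

lemma mnk_hop:
  assumes f: "\<And>x q. hasdown m x q \<Longrightarrow> mnk B x f q = 0" and B: "Suc (Suc m) \<le> B"
    and b: "b \<le> m" and h: "hasdown m x q"
  shows "mnk B x (hop (rev [1..<Suc b]) k f) q =
    - (if x = Suc b \<and> k > 0 then hop (rev [1..<Suc b]) (k - 1) f q else 0)"
  using b h
proof (induction b arbitrary: k x q)
  case 0
  have "x \<noteq> Suc 0" using 0 by (auto simp: hasdown_def)
  moreover have "mnk B x (\<lambda>q. if k = 0 then f q else 0) q = 0"
    using f[OF 0(2)] by (cases k) (simp_all add: mnk_def)
  moreover have "hop [] k f = (\<lambda>q. if k = 0 then f q else 0)" by (rule ext) simp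
  ultimately show ?case by simp
next
  case (Suc b)
  define L where "L = rev [1..<Suc b]"
  define a where "a = Suc b"
  have L: "rev [1..<Suc (Suc b)] = a # L" by (simp add: L_def a_def)
  have q: "q permutes {1..m}" using Suc by (simp add: hasdown_def)
  have inj: "inj q" using q by (simp add: permutes_inj)
  have IH: "mnk B x (hop L k f) q = - (if x = a \<and> k > 0 then hop L (k - 1) f q else 0)"
    if "hasdown m x q" for x q k using Suc.IH[OF _ that, of k] Suc.prems(1) by (simp add: L_def a_def)
  have e: "hop (a # L) k f = (\<lambda>q. hop L k f q + (if k = 0 then 0 else dop a (hop L (k - 1) f) q))"
    by (rule ext) simp
  show ?case
  proof (cases k)
    case 0
    then show ?thesis unfolding L e using IH[OF Suc.prems(2), of 0] by (simp add: a_def)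
  next
    case (Suc j)
    have aB: "Suc a < B" using B Suc.prems(1) by (simp add: a_def)
    have d: "dop a (\<lambda>q'. mnk B (transpose a (Suc a) x) (hop L j f) q') q =
        - (if x = Suc a \<and> j > 0 then dop a (hop L (j - 1) f) q else 0)"
    proof (cases "q (Suc a) < q a")
      case True
      have "hasdown m (transpose a (Suc a) x) (q \<circ> transpose a (Suc a))"
        by (rule hasdown_desc) (use Suc.prems(2) True in \<open>auto simp: a_def\<close>)
      moreover have "transpose a (Suc a) x = a \<longleftrightarrow> x = Suc a" by (auto simp: transpose_def)
      ultimately show ?thesis using IH[of "transpose a (Suc a) x" "q \<circ> transpose a (Suc a)" j] True
        by (simp add: dop_def)
    qed (simp add: dop_def)
    have "mnk B x (hop (a # L) k f) q = mnk B x (hop L k f) q + mnk B x (dop a (hop L j f)) q"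
      unfolding e using Suc by (simp add: mnk_add)
    also have "\<dots> = - (if x = Suc a then hop (a # L) j f q else 0)"
      unfolding mnk_dop[OF inj aB] d IH[OF Suc.prems(2)] using Suc by (auto simp: a_def)
    finally show ?thesis unfolding L using Suc by (simp add: a_def del: hop.simps)
  qed
qed

text \<open>The exceptional position m+1 of \<open>mnk_hop\<close> is out of reach because x is at
  most m. For the empty composition a nonzero summand would require q to be the transposition of x
  and y, from which exchanging them goes down and not up.\<close>

lemma mnk_nn:
  assumes h: "hasdown m x q" and B: "Suc (Suc m) \<le> B"
  shows "mnk B x (nn m \<alpha>) q = 0"
  using h
proof (induction \<alpha> arbitrary: x q)
  case Nil
  have "sgc x y q * nn m [] (q \<circ> transpose x y) = 0" for y
  proof (cases "q \<circ> transpose x y = id")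
    case True
    then have "q \<circ> transpose x y \<circ> transpose x y = transpose x y" by simp
    then have "q = transpose x y" by (simp add: comp_assoc)
    then show ?thesis by (auto simp: sgc_def cv_def)
  qed simp
  then show ?case unfolding mnk_def by (intro sum.neutral) blast
next
  case (Cons k \<alpha>)
  have "mnk B x (hop (rev [1..<Suc m]) k (nn m \<alpha>)) q =
    - (if x = Suc m \<and> k > 0 then hop (rev [1..<Suc m]) (k - 1) (nn m \<alpha>) q else 0)"
    by (rule mnk_hop) (use Cons B in auto)
  moreover have "x \<noteq> Suc m" using Cons by (auto simp: hasdown_def)
  moreover have "nn m (k # \<alpha>) = hop (rev [1..<Suc m]) k (nn m \<alpha>)" by (rule ext) simp
  ultimately show ?case by simp
qed

section \<open>Cancellation and Edelman--Greene tableaux\<close>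

text \<open>These are descending paths in the weak order; by \<open>reduced_word_pth\<close> the
  paths from q to the identity with positive letters are the reduced words of the inverse of
  q.\<close>

fun pth :: "(nat \<Rightarrow> nat) \<Rightarrow> nat list \<Rightarrow> bool" where
  "pth q [] \<longleftrightarrow> True"
| "pth q (a # as) \<longleftrightarrow> q (Suc a) < q a \<and> pth (q \<circ> transpose a (Suc a)) as"

fun endq :: "(nat \<Rightarrow> nat) \<Rightarrow> nat list \<Rightarrow> nat \<Rightarrow> nat" where
  "endq q [] = q"
| "endq q (a # as) = endq (q \<circ> transpose a (Suc a)) as"

lemma pth_append: "pth q (as @ bs) \<longleftrightarrow> pth q as \<and> pth (endq q as) bs"
  by (induction as arbitrary: q) auto

lemma endq_append: "endq q (as @ bs) = endq (endq q as) bs"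
  by (induction as arbitrary: q) auto

definition dl :: "nat list \<Rightarrow> nat \<Rightarrow> nat list set" where
  "dl L k = {c. sorted_wrt (>) c \<and> set c \<subseteq> set L \<and> length c = k}"

lemma sorted_gt_distinct: "sorted_wrt (>) (c :: nat list) \<Longrightarrow> distinct c"
  by (induction c) auto

lemma finite_dl: "finite (dl L k)"
proof (rule finite_subset)
  show "dl L k \<subseteq> {c. set c \<subseteq> set L \<and> length c = k}" by (auto simp: dl_def)
qed (simp add: finite_lists_length_eq)

lemma dl_Cons:
  assumes "sorted_wrt (>) (a # L)"
  shows "dl (a # L) k = dl L k \<union> (if k = 0 then {} else (#) a ` dl L (k - 1))"
proof -
  have "c \<in> dl (a # L) k \<longleftrightarrow> c \<in> dl L k \<union> (if k = 0 then {} else (#) a ` dl L (k - 1))" for c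
  proof (cases c)
    case Nil
    then show ?thesis by (auto simp: dl_def)
  next
    case (Cons b c')
    show ?thesis
    proof (cases "b = a")
      case True
      have "set c' \<subseteq> set (a # L) \<longleftrightarrow> set c' \<subseteq> set L" if "\<forall>y\<in>set c'. y < a"
        using that by auto
      then show ?thesis using Cons True assms by (auto simp: dl_def image_iff)
    next
      case False
      have "b \<in> set L \<and> set c' \<subseteq> set (a # L) \<longleftrightarrow> b \<in> set L \<and> set c' \<subseteq> set L" if "\<forall>y\<in>set c'. y < b"
        using that assms by fastforce
      then show ?thesis using Cons False by (auto simp: dl_def image_iff)
    qed
  qed
  then show ?thesis by blast
qed

lemma hop_dl:
  assumes "sorted_wrt (>) L"
  shows "hop L k f q = (\<Sum>c\<in>{c \<in> dl L k. pth q c}. f (endq q c))"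
  using assms
proof (induction L arbitrary: k q)
  case Nil
  have "{c \<in> dl [] k. pth q c} = (if k = 0 then {[]} else {})" by (auto simp: dl_def)
  then show ?case by auto
next
  case (Cons a L)
  have IH: "hop L k f q = (\<Sum>c\<in>{c \<in> dl L k. pth q c}. f (endq q c))" for k q
    using Cons by simp
  show ?case
  proof (cases k)
    case 0
    then show ?thesis using Cons.prems by (simp add: IH dl_Cons)
  next
    case (Suc j)
    have e: "{c \<in> dl (a # L) k. pth q c} = {c \<in> dl L k. pth q c} \<union> (#) a ` {c \<in> dl L j. pth q (a # c)}"
      using Suc dl_Cons[OF Cons.prems, of k] by auto
    have dis: "{c \<in> dl L k. pth q c} \<inter> (#) a ` {c \<in> dl L j. pth q (a # c)} = {}"
      using Cons.prems by (auto simp: dl_def)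
    have "(\<Sum>c\<in>{c \<in> dl (a # L) k. pth q c}. f (endq q c)) =
        hop L k f q + (\<Sum>c\<in>(#) a ` {c \<in> dl L j. pth q (a # c)}. f (endq q c))"
      unfolding e using dis by (subst sum.union_disjoint) (auto simp: finite_dl IH)
    also have "(\<Sum>c\<in>(#) a ` {c \<in> dl L j. pth q (a # c)}. f (endq q c)) = dop a (hop L j f) q"
    proof (cases "q (Suc a) < q a")
      case True
      have "(\<Sum>c\<in>(#) a ` {c \<in> dl L j. pth q (a # c)}. f (endq q c)) =
          (\<Sum>c\<in>{c \<in> dl L j. pth q (a # c)}. f (endq q (a # c)))"
        by (subst sum.reindex) (auto simp: inj_on_def)
      then show ?thesis using True by (simp add: dop_def IH)
    qed (simp add: dop_def)
    finally show ?thesis using Suc by simp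
  qed
qed

lemma sorted_gt_rev_upt: "sorted_wrt (>) (rev [a..<b])"
  by (simp add: sorted_wrt_rev)

text \<open>Factorizations of a descending path into M decreasing words, empty ones included: the
  candidates for the columns of a tableau, each read from bottom to top.\<close>

definition fs :: "nat \<Rightarrow> nat \<Rightarrow> (nat \<Rightarrow> nat) \<Rightarrow> nat list list set" where
  "fs m M q = {cs. length cs = M \<and> (\<forall>c\<in>set cs. sorted_wrt (>) c \<and> set c \<subseteq> {1..m}) \<and>
     pth q (concat cs) \<and> endq q (concat cs) = id}"

lemma decr_length: "sorted_wrt (>) c \<Longrightarrow> set c \<subseteq> {1..m::nat} \<Longrightarrow> length c \<le> m"
  using sorted_gt_distinct[of c] card_mono[of "{1..m}" "set c"] by (simp add: distinct_card)

lemma finite_fs: "finite (fs m M q)"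
proof (rule finite_subset)
  show "fs m M q \<subseteq> {cs. set cs \<subseteq> {c. set c \<subseteq> {1..m} \<and> length c \<le> m} \<and> length cs = M}"
    using decr_length by (auto simp: fs_def)
qed (simp add: finite_lists_length_eq finite_lists_length_le)

lemma nn_card: "nn m \<alpha> q = card {cs \<in> fs m (length \<alpha>) q. map length cs = \<alpha>}"
proof (induction \<alpha> arbitrary: q)
  case Nil
  have "{cs \<in> fs m 0 q. map length cs = []} = (if q = id then {[]} else {})"
    by (auto simp: fs_def)
  then show ?case by simp
next
  case (Cons k \<alpha>)
  define F where "F = (\<lambda>\<alpha> q. {cs \<in> fs m (length \<alpha>) q. map length cs = \<alpha>})"
  define D where "D = {c \<in> dl (rev [1..<Suc m]) k. pth q c}"
  have fin: "finite (F \<alpha> q)" for \<alpha> q unfolding F_def using finite_fs by simp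
  have finD: "finite D" by (simp add: D_def finite_dl)
  have "nn m (k # \<alpha>) q = (\<Sum>c\<in>D. real (card (F \<alpha> (endq q c))))"
    by (simp only: nn.simps hop_dl[OF sorted_gt_rev_upt] Cons D_def F_def)
  also have "\<dots> = real (card (SIGMA c:D. F \<alpha> (endq q c)))"
    using finD fin by simp
  also have "card (SIGMA c:D. F \<alpha> (endq q c)) = card (F (k # \<alpha>) q)"
  proof (rule bij_betw_same_card[of "\<lambda>(c, cs). c # cs"])
    have D: "c \<in> D \<longleftrightarrow> sorted_wrt (>) c \<and> set c \<subseteq> {1..m} \<and> length c = k \<and> pth q c" for c
    proof -
      have "set (rev [1..<Suc m]) = {1..m}" by auto
      then show ?thesis unfolding D_def dl_def by simp
    qed
    have "(\<lambda>(c, cs). c # cs) ` (SIGMA c:D. F \<alpha> (endq q c)) = F (k # \<alpha>) q"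
    proof (intro equalityI subsetI)
      fix cs assume "cs \<in> F (k # \<alpha>) q"
      then obtain c cs' where "cs = c # cs'" by (cases cs) (auto simp: F_def fs_def)
      with \<open>cs \<in> F (k # \<alpha>) q\<close> show "cs \<in> (\<lambda>(c, cs). c # cs) ` (SIGMA c:D. F \<alpha> (endq q c))"
        by (intro image_eqI[of _ _ "(c, cs')"])
          (auto simp: F_def fs_def D pth_append endq_append)
    next
      fix cs assume "cs \<in> (\<lambda>(c, cs). c # cs) ` (SIGMA c:D. F \<alpha> (endq q c))"
      then obtain c cs' where "cs = c # cs'" "c \<in> D" "cs' \<in> F \<alpha> (endq q c)" by auto
      then show "cs \<in> F (k # \<alpha>) q" unfolding F_def fs_def D
        by (simp add: pth_append endq_append)
    qed
    then show "bij_betw (\<lambda>(c, cs). c # cs) (SIGMA c:D. F \<alpha> (endq q c)) (F (k # \<alpha>) q)"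
      by (auto simp: bij_betw_def inj_on_def)
  qed
  finally show ?case by (simp add: F_def)
qed

text \<open>The sign of the exponent \<open>\<alpha> + \<delta>\<close> in the Jacobi--Trudi expansion; it vanishes when two entries agree.\<close>

fun shf :: "nat list \<Rightarrow> nat list" where
  "shf [] = []"
| "shf (k # \<alpha>) = (k + length \<alpha>) # shf \<alpha>"

fun sg :: "nat list \<Rightarrow> real" where
  "sg [] = 1"
| "sg (x # xs) = (\<Prod>y\<leftarrow>xs. sgn (real x - real y)) * sg xs"

lemma sg_swap: "sg (xs @ x # y # ys) = - sg (xs @ y # x # ys)"
proof (induction xs)
  case Nil
  have "sgn (real x - real y) = - sgn (real y - real x)" by (simp add: sgn_if)
  then show ?case by simp
next
  case (Cons a xs)
  then show ?case by (simp add: algebra_simps)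
qed

lemma shf_append: "shf (xs @ ys) = map (\<lambda>k. k + length ys) (shf xs) @ shf ys"
  by (induction xs) auto

lemma sg_decr: "sorted_wrt (>) xs \<Longrightarrow> sg xs = 1"
proof (induction xs)
  case (Cons a xs)
  have "(\<Prod>y\<leftarrow>xs. sgn (real a - real y)) = (\<Prod>y\<leftarrow>xs. 1)"
    by (rule arg_cong[of _ _ prod_list], rule map_cong) (use Cons.prems in auto)
  also have "\<dots> = 1" by (induction xs) auto
  finally show ?case using Cons by simp
qed simp

text \<open>The staircase raises i by one more than the entry to its right, so both positions gain
  the same amount and exchanging i and j becomes a plain transposition. This is how the lengths
  change when the large parts of two neighbouring columns exchange their sizes.\<close>

lemma sg_shf_swap: "sg (shf (xs @ i # Suc j # ys)) = - sg (shf (xs @ j # Suc i # ys))"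
proof -
  have "shf (xs @ i # Suc j # ys) = map (\<lambda>k. k + Suc (Suc (length ys))) (shf xs) @
      (i + Suc (length ys)) # (j + Suc (length ys)) # shf ys" for i j
    by (simp add: shf_append)
  then show ?thesis using sg_swap by metis
qed

lemma sorted_shf: "sorted_wrt (\<ge>) \<alpha> \<Longrightarrow> sorted_wrt (>) (shf \<alpha>)"
proof (induction \<alpha>)
  case (Cons k \<alpha>)
  have "\<forall>y\<in>set (shf \<alpha>). y < K + length \<alpha>" if "\<forall>y\<in>set \<alpha>. y \<le> K" for K
    using that by (induction \<alpha>) auto
  then show ?case using Cons by auto
qed simp

definition wt :: "nat list list \<Rightarrow> real" where
  "wt cs = sg (shf (map length cs))"

definition lo :: "nat \<Rightarrow> nat list \<Rightarrow> nat list" where "lo x c = filter (\<lambda>a. a \<le> x) c"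
definition hi :: "nat \<Rightarrow> nat list \<Rightarrow> nat list" where "hi x c = filter (\<lambda>a. x < a) c"

lemma hi_lo: "sorted_wrt (>) c \<Longrightarrow> c = hi x c @ lo x c"
proof (induction c)
  case (Cons a c)
  show ?case
  proof (cases "a \<le> x")
    case True
    then have "hi x (a # c) = []" "lo x (a # c) = a # c" using Cons.prems by (auto simp: hi_def lo_def filter_empty_conv filter_id_conv)
    then show ?thesis by simp
  next
    case False
    then show ?thesis using Cons by (simp add: hi_def lo_def)
  qed
qed (simp add: hi_def lo_def)

text \<open>Rows increase weakly and heights decrease weakly exactly if no column has fewer letters
  up to some bound x than its right neighbour. In this form a violation at x does not depend on the
  letters above x, which may therefore be rearranged freely.\<close>

definition viol :: "nat list list \<Rightarrow> nat \<Rightarrow> nat \<Rightarrow> bool" where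
  "viol cs x k \<longleftrightarrow> Suc k < length cs \<and> length (lo x (cs ! k)) < length (lo x (cs ! Suc k))"

definition good :: "nat list list \<Rightarrow> bool" where
  "good cs \<longleftrightarrow> (\<forall>x k. \<not> viol cs x k)"

text \<open>Two letters \<open>a < x < b\<close> commute; hence the small part of one column moves past the large part of the next.\<close>

lemma pth_comm1:
  assumes "Suc a < b"
  shows "pth q (a # b # as) = pth q (b # a # as)" "endq q (a # b # as) = endq q (b # a # as)"
proof -
  have "transpose a (Suc a) \<circ> transpose b (Suc b) = transpose b (Suc b) \<circ> transpose a (Suc a)"
    using assms by (auto simp: fun_eq_iff transpose_def)
  then have "q \<circ> transpose a (Suc a) \<circ> transpose b (Suc b) = q \<circ> transpose b (Suc b) \<circ> transpose a (Suc a)"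
    by (simp add: comp_assoc)
  then show "pth q (a # b # as) = pth q (b # a # as)" "endq q (a # b # as) = endq q (b # a # as)"
    using assms by auto
qed

lemma pth_comm2:
  assumes "\<forall>b\<in>set B. Suc a < b"
  shows "pth q (a # B @ as) = pth q (B @ a # as) \<and> endq q (a # B @ as) = endq q (B @ a # as)"
  using assms
proof (induction B arbitrary: q)
  case (Cons b B)
  have IH: "pth q' (a # B @ as) = pth q' (B @ a # as) \<and> endq q' (a # B @ as) = endq q' (B @ a # as)" for q'
    using Cons by simp
  have b: "Suc a < b" using Cons by simp
  have "pth q (a # (b # B) @ as) = pth q (b # (a # B @ as))"
    using pth_comm1(1)[OF b, of q "B @ as"] by simp
  also have "\<dots> = pth q ((b # B) @ a # as)"
    using IH[of "q \<circ> transpose b (Suc b)"] unfolding append_Cons pth.simps(2)[of q b] by blast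
  finally have 1: "pth q (a # (b # B) @ as) = pth q ((b # B) @ a # as)" .
  have "endq q (a # (b # B) @ as) = endq q (b # (a # B @ as))"
    using pth_comm1(2)[OF b, of q "B @ as"] by simp
  also have "\<dots> = endq q ((b # B) @ a # as)" using IH by simp
  finally show ?case using 1 by simp
qed simp

lemma pth_comm:
  assumes "\<forall>a\<in>set A. \<forall>b\<in>set B. Suc a < b"
  shows "pth q (A @ B @ as) = pth q (B @ A @ as)" "endq q (A @ B @ as) = endq q (B @ A @ as)"
proof -
  have "pth q (A @ B @ as) = pth q (B @ A @ as) \<and> endq q (A @ B @ as) = endq q (B @ A @ as)"
    using assms
  proof (induction A arbitrary: q)
    case (Cons a A)
    then show ?case using pth_comm2[of B a q "A @ as"] by simp
  qed simp
  then show "pth q (A @ B @ as) = pth q (B @ A @ as)" "endq q (A @ B @ as) = endq q (B @ A @ as)" by auto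
qed

definition pairs :: "nat \<Rightarrow> nat \<Rightarrow> (nat \<Rightarrow> nat) \<Rightarrow> (nat \<Rightarrow> nat) \<Rightarrow> nat \<Rightarrow> nat \<Rightarrow> (nat list \<times> nat list) set" where
  "pairs x m q1 q2 i j = {(A, B). A \<in> dl (rev [x..<Suc m]) i \<and> B \<in> dl (rev [x..<Suc m]) j \<and>
     pth q1 (A @ B) \<and> endq q1 (A @ B) = q2}"

lemma finite_pairs: "finite (pairs x m q1 q2 i j)"
  by (rule finite_subset[of _ "dl (rev [x..<Suc m]) i \<times> dl (rev [x..<Suc m]) j"])
    (auto simp: pairs_def finite_dl)

text \<open>Applied to the indicator function of the end point \<open>q2\<close>, the commuting
  operators count pairs of decreasing words with prescribed lengths; no explicit bijection between
  the two sets of pairs is constructed.\<close>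

lemma card_pairs: "card (pairs x m q1 q2 i j) = card (pairs x m q1 q2 j i)"
proof -
  define L where "L = rev [x..<Suc m]"
  define f where "f = (\<lambda>q. if q = q2 then 1 else 0 :: real)"
  have "hop L i (hop L j f) q1 = card (pairs x m q1 q2 i j)" for i j
  proof -
    define D where "D = (\<lambda>k q. {c \<in> dl L k. pth q c})"
    define G where "G = (\<lambda>A. {B \<in> D j (endq q1 A). endq (endq q1 A) B = q2})"
    have fin: "finite (D k q)" for k q by (simp add: D_def finite_dl)
    have "hop L i (hop L j f) q1 = (\<Sum>A\<in>D i q1. \<Sum>B\<in>D j (endq q1 A). f (endq (endq q1 A) B))"
      by (simp only: hop_dl[OF sorted_gt_rev_upt] L_def D_def)
    also have "\<dots> = (\<Sum>A\<in>D i q1. real (card (G A)))"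
      by (rule sum.cong) (auto simp: f_def G_def fin Int_def sum.If_cases)
    also have "\<dots> = real (card (SIGMA A:D i q1. G A))"
      using fin by (simp add: G_def)
    also have "(SIGMA A:D i q1. G A) = pairs x m q1 q2 i j"
      by (auto simp: pairs_def D_def G_def L_def pth_append endq_append)
    finally show ?thesis .
  qed
  then show ?thesis using hop_comm[of x "Suc m" i j f q1] by (metis L_def of_nat_eq_iff)
qed

definition lvio :: "nat list list \<Rightarrow> nat" where "lvio cs = (LEAST x. \<exists>k. viol cs x k)"
definition lcol :: "nat list list \<Rightarrow> nat" where "lcol cs = (LEAST k. viol cs (lvio cs) k)"

text \<open>The key lists everything that the cancellation leaves alone: the place of the leftmost
  violation at the least bound, the other columns, the letters up to the bound in the two columns
  concerned, and the permutation reached after their large letters.\<close>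

definition vkey :: "(nat \<Rightarrow> nat) \<Rightarrow> nat list list \<Rightarrow>
    nat \<times> nat \<times> nat list list \<times> nat list \<times> nat list \<times> nat list list \<times> (nat \<Rightarrow> nat)" where
  "vkey q cs = (let x = lvio cs; k = lcol cs; c = cs ! k; d = cs ! Suc k in
     (x, k, take k cs, lo x c, lo x d, drop (Suc (Suc k)) cs,
      endq q (concat (take k cs) @ hi x c @ hi x d)))"

lemma lvio_viol:
  assumes "\<not> good cs"
  shows "viol cs (lvio cs) (lcol cs)" "y < lvio cs \<Longrightarrow> \<not> viol cs y k"
proof -
  have "\<exists>k. viol cs (lvio cs) k"
    unfolding lvio_def using assms LeastI_ex[of "\<lambda>x. \<exists>k. viol cs x k"] by (auto simp: good_def)
  then show "viol cs (lvio cs) (lcol cs)"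
    unfolding lcol_def using LeastI_ex[of "\<lambda>k. viol cs (lvio cs) k"] by simp
  show "\<not> viol cs y k" if "y < lvio cs"
    using not_less_Least[of y "\<lambda>x. \<exists>k. viol cs x k"] that by (auto simp: lvio_def)
qed

lemma lo_lo: "y \<le> x \<Longrightarrow> lo y (lo x c) = lo y c"
  by (auto simp: lo_def intro: filter_cong)

lemma lo_append: "lo x (c @ d) = lo x c @ lo x d" by (simp add: lo_def)
lemma hi_append: "hi x (c @ d) = hi x c @ hi x d" by (simp add: hi_def)

lemma lo_pred_length:
  assumes "distinct c"
  shows "length (lo (Suc x) c) = length (lo x c) + (if Suc x \<in> set c then 1 else 0)"
  using assms by (induction c) (auto simp: lo_def le_Suc_eq)

lemma take_drop2: "Suc k < length cs \<Longrightarrow> cs = take k cs @ cs ! k # cs ! Suc k # drop (Suc (Suc k)) cs"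
  by (metis Cons_nth_drop_Suc Suc_lessD append_take_drop_id)

text \<open>Since x is the least violated bound, x is missing in the left column and the right
  column has exactly one letter up to x more. Hence the small letters of the left column commute
  past the large letters of the right one, and the two large parts range over all of
  \<open>pairs\<close>. Exchanging their lengths keeps the number of pairs and reverses the sign of
  \<open>wt\<close>.\<close>

lemma sum_wt_class:
  assumes cs0: "cs0 \<in> fs m M q" "\<not> good cs0"
  shows "(\<Sum>cs\<in>{cs \<in> fs m M q. \<not> good cs \<and> vkey q cs = vkey q cs0}. wt cs) = 0"
proof -
  define x where "x = lvio cs0"
  define k where "k = lcol cs0"
  define P where "P = take k cs0"
  define R where "R = drop (Suc (Suc k)) cs0"
  define c0 where "c0 = cs0 ! k"
  define d0 where "d0 = cs0 ! Suc k"
  define a where "a = lo x c0"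
  define b where "b = lo x d0"
  define q1 where "q1 = endq q (concat P)"
  define q2 where "q2 = endq q1 (hi x c0 @ hi x d0)"
  have v: "viol cs0 x k" and vmin: "\<And>y k. y < x \<Longrightarrow> \<not> viol cs0 y k"
    using lvio_viol[OF cs0(2)] by (auto simp: x_def k_def)
  then have kl: "Suc k < length cs0" and ab: "length a < length b"
    by (auto simp: viol_def a_def b_def c0_def d0_def)
  have lP: "length P = k" using kl by (simp add: P_def)
  have dec: "cs0 = P @ c0 # d0 # R"
    unfolding P_def R_def c0_def d0_def using take_drop2[OF kl] .
  have props: "sorted_wrt (>) c \<and> set c \<subseteq> {1..m}" if "c \<in> set cs0" for c
    using cs0(1) that by (auto simp: fs_def)
  have c0: "sorted_wrt (>) c0" "set c0 \<subseteq> {1..m}" and d0: "sorted_wrt (>) d0" "set d0 \<subseteq> {1..m}"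
    using props[of c0] props[of d0] dec by auto
  have x0: "x \<noteq> 0"
  proof
    assume "x = 0"
    then have "b = []" using d0 by (auto simp: b_def lo_def filter_empty_conv)
    then show False using ab by simp
  qed
  then obtain x' where x': "x = Suc x'" by (cases x) auto
  have "\<not> viol cs0 x' k" using vmin x' by simp
  then have "length (lo x' d0) \<le> length (lo x' c0)"
    using kl by (auto simp: viol_def c0_def d0_def)
  then have lb: "length b = Suc (length a)" and xa: "x \<notin> set c0"
    using ab lo_pred_length[OF sorted_gt_distinct[OF c0(1)], of x'] lo_pred_length[OF sorted_gt_distinct[OF d0(1)], of x']
    by (auto simp: a_def b_def x' split: if_splits)
  have asmall: "Suc y \<le> x" if "y \<in> set a" for y
    using that xa by (auto simp: a_def lo_def le_eq_less_or_eq)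
  define mk where "mk = (\<lambda>(A, B). P @ (A @ a) # (B @ b) # R)"
  define X where "X = (\<lambda>(i, j). pairs (Suc x) m q1 q2 i j)"
  have s: "set (rev [Suc x..<Suc m]) = {Suc x..m}" by auto
  have move: "pth q (concat (mk (A, B))) \<longleftrightarrow> pth q (concat P @ A @ B @ a @ b @ concat R)"
    "endq q (concat (mk (A, B))) = endq q (concat P @ A @ B @ a @ b @ concat R)"
    if "set B \<subseteq> {Suc x..m}" for A B
  proof -
    have "\<forall>y\<in>set a. \<forall>z\<in>set B. Suc y < z" using asmall that by fastforce
    note * = pth_comm[OF this, of _ "b @ concat R"]
    show "pth q (concat (mk (A, B))) \<longleftrightarrow> pth q (concat P @ A @ B @ a @ b @ concat R)"
      "endq q (concat (mk (A, B))) = endq q (concat P @ A @ B @ a @ b @ concat R)"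
      by (simp_all add: mk_def pth_append endq_append *[unfolded pth_append endq_append])
  qed
  have hid: "set (hi x d0) \<subseteq> {Suc x..m}" "set (hi x c0) \<subseteq> {Suc x..m}" using d0 c0 by (auto simp: hi_def)
  have cs0mk: "cs0 = mk (hi x c0, hi x d0)"
    using dec hi_lo[OF c0(1), of x] hi_lo[OF d0(1), of x] by (simp add: mk_def a_def b_def)
  have pth0: "pth q (concat P)" "pth q2 (a @ b @ concat R)" "endq q2 (a @ b @ concat R) = id"
  proof -
    have "pth q (concat cs0)" "endq q (concat cs0) = id" using cs0(1) by (auto simp: fs_def)
    then have "pth q (concat P @ hi x c0 @ hi x d0 @ a @ b @ concat R)"
      "endq q (concat P @ hi x c0 @ hi x d0 @ a @ b @ concat R) = id"
      using move[OF hid(1), of "hi x c0"] cs0mk by simp_all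
    then show "pth q (concat P)" "pth q2 (a @ b @ concat R)" "endq q2 (a @ b @ concat R) = id"
      by (auto simp: pth_append endq_append q1_def q2_def)
  qed
  have key0: "vkey q cs0 = (x, k, P, a, b, R, q2)"
    by (simp add: vkey_def Let_def x_def k_def P_def R_def a_def b_def c0_def d0_def q2_def q1_def endq_append)
  define C where "C = {cs \<in> fs m M q. \<not> good cs \<and> vkey q cs = vkey q cs0}"
  have C: "C = mk ` (\<Union>ij\<in>{..m} \<times> {..m}. X ij)"
  proof (intro equalityI subsetI)
    fix cs assume "cs \<in> C"
    then have cs: "cs \<in> fs m M q" "\<not> good cs" and key: "vkey q cs = (x, k, P, a, b, R, q2)"
      by (auto simp: C_def key0)
    define c where "c = cs ! k"
    define d where "d = cs ! Suc k"
    have xk: "lvio cs = x" "lcol cs = k" using key by (auto simp: vkey_def Let_def)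
    have pr: "take k cs = P" "lo x c = a" "lo x d = b" "drop (Suc (Suc k)) cs = R"
      "endq q1 (hi x c @ hi x d) = q2"
      using key xk by (auto simp: vkey_def Let_def c_def d_def endq_append q1_def)
    have kl': "Suc k < length cs" using lvio_viol(1)[OF cs(2)] xk by (auto simp: viol_def)
    then have cdec: "cs = P @ c # d # R" using take_drop2[OF kl'] pr by (simp add: c_def d_def)
    have "c \<in> set cs" "d \<in> set cs" using cdec by auto
    then have c: "sorted_wrt (>) c" "set c \<subseteq> {1..m}" and d: "sorted_wrt (>) d" "set d \<subseteq> {1..m}"
      using cs(1) unfolding fs_def by blast+
    have csmk: "cs = mk (hi x c, hi x d)"
      using cdec hi_lo[OF c(1), of x] hi_lo[OF d(1), of x] pr by (simp add: mk_def)
    have sb: "set (hi x d) \<subseteq> {Suc x..m}" "set (hi x c) \<subseteq> {Suc x..m}" using d c by (auto simp: hi_def)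
    have so: "sorted_wrt (>) (hi x c)" "sorted_wrt (>) (hi x d)"
      using c d by (simp_all add: hi_def sorted_wrt_filter)
    have "pth q (concat P @ hi x c @ hi x d @ a @ b @ concat R)"
      using cs(1) move(1)[OF sb(1), of "hi x c"] csmk by (simp add: fs_def)
    then have "pth q1 (hi x c @ hi x d)" by (simp add: pth_append q1_def)
    moreover have "length (hi x c) \<le> m" "length (hi x d) \<le> m"
      using decr_length[OF so(1), of m] decr_length[OF so(2), of m] sb by fastforce+
    ultimately show "cs \<in> mk ` (\<Union>ij\<in>{..m} \<times> {..m}. X ij)"
      unfolding csmk X_def pairs_def dl_def s using pr(5) sb so
      by (intro imageI) (auto intro!: bexI[of _ "(length (hi x c), length (hi x d))"])
  next
    fix cs assume "cs \<in> mk ` (\<Union>ij\<in>{..m} \<times> {..m}. X ij)"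
    then obtain A B i j where cs: "cs = mk (A, B)" and AB: "(A, B) \<in> pairs (Suc x) m q1 q2 i j"
      by (auto simp: X_def)
    have A: "sorted_wrt (>) A" "set A \<subseteq> {Suc x..m}" and B: "sorted_wrt (>) B" "set B \<subseteq> {Suc x..m}"
      and p: "pth q1 (A @ B)" "endq q1 (A @ B) = q2"
      using AB unfolding pairs_def dl_def s by auto
    have "pth q (concat cs)" "endq q (concat cs) = id"
      unfolding cs move[OF B(2)] using p pth0 by (auto simp: pth_append endq_append q1_def)
    moreover have "length cs = M" using cs0(1) dec by (simp add: fs_def cs mk_def)
    moreover have "sorted_wrt (>) (A @ a) \<and> set (A @ a) \<subseteq> {1..m}"
    proof -
      have "sorted_wrt (>) a" "set a \<subseteq> set c0" "\<forall>y\<in>set a. y \<le> x" using c0(1) by (auto simp: a_def lo_def sorted_wrt_filter)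
      then show ?thesis using A c0(2) by (fastforce simp: sorted_wrt_append)
    qed
    moreover have "sorted_wrt (>) (B @ b) \<and> set (B @ b) \<subseteq> {1..m}"
    proof -
      have "sorted_wrt (>) b" "set b \<subseteq> set d0" "\<forall>y\<in>set b. y \<le> x" using d0(1) by (auto simp: b_def lo_def sorted_wrt_filter)
      then show ?thesis using B d0(2) by (fastforce simp: sorted_wrt_append)
    qed
    moreover have "sorted_wrt (>) c \<and> set c \<subseteq> {1..m}" if "c \<in> set P \<or> c \<in> set R" for c
      using props[of c] dec that by auto
    ultimately have fs: "cs \<in> fs m M q" unfolding fs_def by (auto simp: cs mk_def)
    have loA: "lo y A = []" "lo y B = []" if "y \<le> x" for y
      using A B that by (auto simp: lo_def filter_empty_conv)
    have nth: "lo y (cs ! l) = lo y (cs0 ! l)" if "y \<le> x" for y l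
    proof -
      have "lo y (A @ a) = lo y c0" "lo y (B @ b) = lo y d0"
        using that by (simp_all add: lo_append loA a_def b_def lo_lo)
      then show ?thesis unfolding cs mk_def dec using lP
        by (auto simp: nth_append nth_Cons split: nat.split)
    qed
    \<comment> \<open>Violations at bounds up to x involve only letters up to x, which are the same
      in \<open>cs\<close> and \<open>cs0\<close>; hence the first violation stays in place and the
      key is constant on the class.\<close>
    have vi: "viol cs y l = viol cs0 y l" if "y \<le> x" for y l
      using nth[OF that] \<open>length cs = M\<close> cs0(1) by (auto simp: viol_def fs_def)
    have ng: "\<not> good cs" using v vi[of x k] by (auto simp: good_def)
    have lx: "lvio cs = x" unfolding lvio_def
    proof (rule Least_equality)
      show "\<exists>k. viol cs x k" using v vi by blast
      show "x \<le> y" if "\<exists>k. viol cs y k" for y using that vi vmin by (meson not_le_imp_less order.order_iff_strict)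
    qed
    have lk: "lcol cs = k" unfolding lcol_def
    proof -
      have "viol cs x = viol cs0 x" using vi[of x] by (simp add: fun_eq_iff)
      then show "(LEAST k. viol cs (lvio cs) k) = k" by (simp add: lx k_def lcol_def x_def[symmetric])
    qed
    have n1: "cs ! k = A @ a" "cs ! Suc k = B @ b" "take k cs = P" "drop (Suc (Suc k)) cs = R"
      using lP by (simp_all add: cs mk_def nth_append)
    have "hi x A = A" "hi x B = B" "hi x a = []" "hi x b = []"
      using A B by (auto simp: hi_def filter_id_conv filter_empty_conv a_def b_def lo_def)
    moreover have "lo x a = a" "lo x b = b" by (simp_all add: a_def b_def lo_lo)
    ultimately have "vkey q cs = (x, k, P, a, b, R, q2)"
      unfolding vkey_def Let_def lx lk n1 using p
      by (simp add: lo_append hi_append loA endq_append q1_def)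
    then show "cs \<in> C" unfolding C_def key0 using fs ng by simp
  qed
  define h where "h = (\<lambda>(i, j). sg (shf (map length P @ (i + length a) # Suc (j + length a) # map length R)))"
  have h: "h (i, j) = - h (j, i)" for i j
    unfolding h_def using sg_shf_swap[of "map length P" "i + length a" "j + length a" "map length R"] by simp
  have inj: "inj mk" by (auto simp: inj_def mk_def)
  have "(\<Sum>cs\<in>C. wt cs) = (\<Sum>AB\<in>(\<Union>ij\<in>{..m} \<times> {..m}. X ij). wt (mk AB))"
    unfolding C by (subst sum.reindex) (use inj in \<open>auto simp: inj_on_def inj_def\<close>)
  also have "\<dots> = (\<Sum>ij\<in>{..m} \<times> {..m}. \<Sum>AB\<in>X ij. wt (mk AB))"
  proof (rule sum.UNION_disjoint)
    show "\<forall>i\<in>{..m} \<times> {..m}. finite (X i)" by (auto simp: X_def finite_pairs)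
    show "\<forall>i\<in>{..m} \<times> {..m}. \<forall>j\<in>{..m} \<times> {..m}. i \<noteq> j \<longrightarrow> X i \<inter> X j = {}"
      by (auto simp: X_def pairs_def dl_def)
  qed simp
  also have "\<dots> = (\<Sum>ij\<in>{..m} \<times> {..m}. card (X ij) * h ij)"
  proof (rule sum.cong)
    fix ij assume "ij \<in> {..m} \<times> {..m}"
    obtain i j where ij: "ij = (i, j)" by (cases ij)
    have "wt (mk AB) = h ij" if "AB \<in> X ij" for AB
      using that lb by (auto simp: ij X_def pairs_def dl_def wt_def mk_def h_def)
    then show "(\<Sum>AB\<in>X ij. wt (mk AB)) = card (X ij) * h ij" by simp
  qed simp
  finally have S: "(\<Sum>cs\<in>C. wt cs) = (\<Sum>ij\<in>{..m} \<times> {..m}. card (X ij) * h ij)" .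
  also have "\<dots> = (\<Sum>ij\<in>{..m} \<times> {..m}. card (X (prod.swap ij)) * h (prod.swap ij))"
    by (rule sum.reindex_bij_witness[of _ prod.swap prod.swap]) auto
  also have "\<dots> = (\<Sum>ij\<in>{..m} \<times> {..m}. - (card (X ij) * h ij))"
  proof (rule sum.cong)
    fix ij assume "ij \<in> {..m} \<times> {..m}"
    obtain i j where ij: "ij = (i, j)" by (cases ij)
    show "card (X (prod.swap ij)) * h (prod.swap ij) = - (card (X ij) * h ij)"
      unfolding ij using h[of i j] card_pairs[of "Suc x" m q1 q2 i j] by (simp add: X_def)
  qed simp
  also have "\<dots> = - (\<Sum>cs\<in>C. wt cs)" unfolding S by (simp add: sum_negf)
  finally show ?thesis unfolding C_def by simp
qed

text \<open>The bad factorizations cancel within each fibre of \<open>vkey\<close>. A good one has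
  weakly decreasing column lengths, by goodness at the bound m, so its shifted exponent decreases
  strictly and has sign 1.\<close>

lemma sum_wt_good: "(\<Sum>cs\<in>fs m M q. wt cs) = card {cs \<in> fs m M q. good cs}"
proof -
  define Bd where "Bd = {cs \<in> fs m M q. \<not> good cs}"
  define G where "G = {cs \<in> fs m M q. good cs}"
  have fin: "finite Bd" "finite G" by (simp_all add: Bd_def G_def finite_fs)
  have "(\<Sum>cs\<in>Bd. wt cs) = (\<Sum>\<kappa>\<in>vkey q ` Bd. \<Sum>cs\<in>{cs \<in> Bd. vkey q cs = \<kappa>}. wt cs)"
    using fin(1) by (rule sum.image_gen)
  also have "\<dots> = 0"
  proof (rule sum.neutral, rule ballI)
    fix \<kappa> assume "\<kappa> \<in> vkey q ` Bd"
    then obtain cs0 where cs0: "cs0 \<in> Bd" "\<kappa> = vkey q cs0" by auto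
    have "{cs \<in> Bd. vkey q cs = \<kappa>} = {cs \<in> fs m M q. \<not> good cs \<and> vkey q cs = vkey q cs0}"
      by (auto simp: Bd_def cs0)
    then show "(\<Sum>cs\<in>{cs \<in> Bd. vkey q cs = \<kappa>}. wt cs) = 0"
      using sum_wt_class[of cs0 m M q] cs0 by (simp add: Bd_def)
  qed
  finally have 0: "(\<Sum>cs\<in>Bd. wt cs) = 0" .
  have "wt cs = 1" if "cs \<in> G" for cs
  proof -
    have fs: "cs \<in> fs m M q" and g: "good cs" using that by (auto simp: G_def)
    have "length (cs ! k) \<ge> length (cs ! Suc k)" if "Suc k < length cs" for k
    proof -
      have "lo m (cs ! i) = cs ! i" if "i < length cs" for i
      proof -
        have "\<forall>c\<in>set cs. set c \<subseteq> {1..m}" using fs by (simp add: fs_def)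
        then have "set (cs ! i) \<subseteq> {1..m}" using nth_mem[OF that] by (rule bspec)
        then show ?thesis by (auto simp: lo_def filter_id_conv)
      qed
      then have "lo m (cs ! k) = cs ! k" "lo m (cs ! Suc k) = cs ! Suc k" using that by auto
      moreover have "\<not> viol cs m k" using g unfolding good_def by blast
      ultimately show ?thesis using that unfolding viol_def by (simp add: not_less)
    qed
    then have "sorted_wrt (\<ge>) (map length cs)"
      by (subst sorted_wrt_iff_nth_Suc_transp) (simp_all add: transp_def)
    then show ?thesis by (simp add: wt_def sg_decr sorted_shf)
  qed
  then have 1: "(\<Sum>cs\<in>G. wt cs) = card G" by simp
  have "fs m M q = Bd \<union> G" "Bd \<inter> G = {}" by (auto simp: Bd_def G_def)
  then have "sum wt (fs m M q) = sum wt Bd + sum wt G" using fin by (simp add: sum.union_disjoint)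
  then show ?thesis using 0 1 by (simp add: G_def)
qed

definition ngood :: "nat \<Rightarrow> nat \<Rightarrow> (nat \<Rightarrow> nat) \<Rightarrow> real" where
  "ngood m M q = card {cs \<in> fs m M q. good cs}"

lemma ngood_nn:
  "ngood m M q = (\<Sum>\<alpha>\<in>{\<alpha>. set \<alpha> \<subseteq> {..m} \<and> length \<alpha> = M}. sg (shf \<alpha>) * nn m \<alpha> q)"
proof -
  define A where "A = {\<alpha>. set \<alpha> \<subseteq> {..m} \<and> length \<alpha> = M}"
  have "ngood m M q = (\<Sum>cs\<in>fs m M q. wt cs)" by (simp add: ngood_def sum_wt_good)
  also have "\<dots> = (\<Sum>\<alpha>\<in>A. \<Sum>cs\<in>{cs \<in> fs m M q. map length cs = \<alpha>}. wt cs)"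
  proof (rule sum.group[symmetric])
    show "map length ` fs m M q \<subseteq> A" using decr_length by (fastforce simp: fs_def A_def)
  qed (simp_all add: finite_fs A_def finite_lists_length_eq)
  also have "\<dots> = (\<Sum>\<alpha>\<in>A. sg (shf \<alpha>) * nn m \<alpha> q)"
  proof (rule sum.cong)
    fix \<alpha> assume "\<alpha> \<in> A"
    then have l: "length \<alpha> = M" by (simp add: A_def)
    have "(\<Sum>cs\<in>{cs \<in> fs m M q. map length cs = \<alpha>}. wt cs) = (\<Sum>cs\<in>{cs \<in> fs m M q. map length cs = \<alpha>}. sg (shf \<alpha>))"
      by (rule sum.cong) (auto simp: wt_def)
    then show "(\<Sum>cs\<in>{cs \<in> fs m M q. map length cs = \<alpha>}. wt cs) = sg (shf \<alpha>) * nn m \<alpha> q"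
      by (simp add: nn_card l)
  qed simp
  finally show ?thesis by (simp add: A_def)
qed

text \<open>The signs in the alternating sum do not depend on q, so the linear relation passes from
  each \<open>nn\<close> to \<open>ngood\<close>.\<close>

theorem ngood_transition:
  assumes h: "hasdown m x q" and B: "Suc (Suc m) \<le> B"
  shows "mnk B x (ngood m M) q = 0"
proof -
  define A where "A = {\<alpha>. set \<alpha> \<subseteq> {..m} \<and> length \<alpha> = M}"
  have "ngood m M = (\<lambda>q. \<Sum>\<alpha>\<in>A. sg (shf \<alpha>) * nn m \<alpha> q)" by (simp add: fun_eq_iff ngood_nn A_def)
  then show ?thesis by (simp add: mnk_sum mnk_nn[OF assms])
qed

section \<open>Inversions, reduced words and descending paths\<close>

definition ivs :: "(nat \<Rightarrow> nat) \<Rightarrow> (nat \<times> nat) set" where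
  "ivs q = {(i, j). i < j \<and> q j < q i}"

lemma ivs_bound:
  assumes "q permutes {1..m}"
  shows "ivs q \<subseteq> {1..m} \<times> {1..m}"
proof
  fix p assume "p \<in> ivs q"
  then obtain i j where p: "p = (i, j)" "i < j" "q j < q i" by (auto simp: ivs_def)
  have out: "q k = k" if "k \<notin> {1..m}" for k using assms that by (auto simp: permutes_def)
  have ins: "q k \<in> {1..m}" if "k \<in> {1..m}" for k using permutes_in_image[OF assms] that by blast
  have "j \<in> {1..m}"
  proof (rule ccontr)
    assume j: "j \<notin> {1..m}"
    then have "j > m" using p by auto
    then show False using p out[OF j] out[of i] ins[of i] by (cases "i \<in> {1..m}") auto
  qed
  moreover have "i \<in> {1..m}"
  proof (rule ccontr)
    assume "i \<notin> {1..m}"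
    then have "i = 0" using p \<open>j \<in> {1..m}\<close> by auto
    then show False using p out[of 0] by simp
  qed
  ultimately show "p \<in> {1..m} \<times> {1..m}" using p by simp
qed

lemma finite_ivs: "q permutes {1..m} \<Longrightarrow> finite (ivs q)"
  using finite_subset[OF ivs_bound] by blast

lemma ivs_step:
  assumes q: "q permutes {1..m}" and d: "q (Suc a) < q a"
  shows "card (ivs q) = Suc (card (ivs (q \<circ> transpose a (Suc a))))"
proof -
  define t where "t = transpose a (Suc a)"
  have t: "t z = (if z = a then Suc a else if z = Suc a then a else z)" for z by (simp add: t_def transpose_def)
  have tt: "t (t z) = z" for z by (simp add: t_def)
  have lt: "t i < t j \<longleftrightarrow> (if i = a \<and> j = Suc a then False else if i = Suc a \<and> j = a then True else i < j)" for i j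
    by (auto simp: t)
  have e: "ivs q = insert (a, Suc a) (map_prod t t ` ivs (q \<circ> t))"
  proof (intro equalityI subsetI)
    fix p assume "p \<in> ivs q"
    then obtain i j where p: "p = (i, j)" "i < j" "q j < q i" by (auto simp: ivs_def)
    show "p \<in> insert (a, Suc a) (map_prod t t ` ivs (q \<circ> t))"
    proof (cases "i = a \<and> j = Suc a")
      case False
      then have "(t i, t j) \<in> ivs (q \<circ> t)" using p lt[of i j] by (auto simp: ivs_def tt)
      then have "map_prod t t (t i, t j) \<in> map_prod t t ` ivs (q \<circ> t)" by (rule imageI)
      then show ?thesis using p by (simp add: tt)
    qed (simp add: p)
  next
    fix p assume "p \<in> insert (a, Suc a) (map_prod t t ` ivs (q \<circ> t))"
    then consider "p = (a, Suc a)" | i j where "p = (t i, t j)" "i < j" "q (t j) < q (t i)" by (auto simp: ivs_def)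
    then show "p \<in> ivs q"
    proof cases
      case 1
      then show ?thesis using d by (simp add: ivs_def)
    next
      case 2
      have "\<not> (i = a \<and> j = Suc a)" using 2 d by (auto simp: t)
      then show ?thesis using 2 lt[of i j] by (auto simp: ivs_def)
    qed
  qed
  have n: "(a, Suc a) \<notin> map_prod t t ` ivs (q \<circ> t)"
  proof
    assume "(a, Suc a) \<in> map_prod t t ` ivs (q \<circ> t)"
    then obtain i j where ij: "t i = a" "t j = Suc a" "i < j" by (auto simp: ivs_def)
    then have "i = Suc a" "j = a" using tt[of i] tt[of j] by (simp_all add: t)
    then show False using ij by simp
  qed
  have "finite (ivs q)" using finite_ivs[OF q] .
  then have "finite (map_prod t t ` ivs (q \<circ> t))" unfolding e by simp
  moreover have "card (map_prod t t ` ivs (q \<circ> t)) = card (ivs (q \<circ> t))"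
    by (rule card_image) (metis injI inj_on_subset map_prod_inj_on subset_UNIV tt UNIV_Times_UNIV)
  ultimately show ?thesis unfolding e using n by (simp add: t_def)
qed

lemma endq_word_product: "endq q as = q \<circ> word_product as"
  by (induction as arbitrary: q) (auto simp: word_product_def)

lemma transpose_comp_permutes:
  assumes "q permutes {1..m}" "a \<ge> 1"
  shows "q \<circ> transpose a (Suc a) permutes {1..max m (Suc a)}"
proof -
  have "q permutes {1..max m (Suc a)}" by (rule permutes_subset[OF assms(1)]) auto
  moreover have "transpose a (Suc a) permutes {1..max m (Suc a)}"
    using assms by (intro permutes_swap_id) auto
  ultimately show ?thesis by (rule permutes_compose[rotated])
qed

lemma ivs_id: "ivs id = {}" "ivs (\<lambda>a. a) = {}" by (auto simp: ivs_def)

text \<open>Every letter changes the number of inversions by exactly one. A word leading from q to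
  the identity thus has at least as many letters as q has inversions, with equality exactly if every
  letter removes one.\<close>

lemma word_length:
  assumes "q permutes {1..m}" "\<forall>a\<in>set as. 1 \<le> a" "endq q as = id"
  shows "card (ivs q) \<le> length as \<and> (card (ivs q) = length as \<longleftrightarrow> pth q as)"
  using assms
proof (induction as arbitrary: q m)
  case Nil
  then show ?case by (simp add: ivs_id)
next
  case (Cons a as)
  let ?q = "q \<circ> transpose a (Suc a)"
  have p: "?q permutes {1..max m (Suc a)}" using transpose_comp_permutes Cons by simp
  have IH: "card (ivs ?q) \<le> length as \<and> (card (ivs ?q) = length as \<longleftrightarrow> pth ?q as)"
  proof (rule Cons.IH[OF p])
    show "\<forall>a\<in>set as. 1 \<le> a" using Cons.prems(2) by simp
    show "endq ?q as = id" using Cons.prems(3) unfolding endq.simps .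
  qed
  show ?case
  proof (cases "q (Suc a) < q a")
    case True
    then show ?thesis using ivs_step[OF Cons.prems(1) True] IH by auto
  next
    case False
    moreover have "q (Suc a) \<noteq> q a" using permutes_inj[OF Cons.prems(1)] by (simp add: inj_eq)
    ultimately have "?q (Suc a) < ?q a" by simp
    then have "card (ivs ?q) = Suc (card (ivs (?q \<circ> transpose a (Suc a))))" by (rule ivs_step[OF p])
    then have "card (ivs ?q) = Suc (card (ivs q))" by (simp add: comp_assoc)
    then show ?thesis using IH False by auto
  qed
qed

lemma exists_path:
  assumes "q permutes {1..m}"
  shows "\<exists>as. (\<forall>a\<in>set as. 1 \<le> a) \<and> pth q as \<and> endq q as = id"
  using assms
proof (induction "card (ivs q)" arbitrary: q)
  case 0
  then have "ivs q = {}" using finite_ivs[OF 0(2)] by simp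
  have step: "q a < q (Suc a)" for a
  proof -
    have "q a \<noteq> q (Suc a)" using permutes_inj[OF 0(2)] by (simp add: inj_eq)
    moreover have "\<not> q (Suc a) < q a" using \<open>ivs q = {}\<close> by (auto simp: ivs_def)
    ultimately show ?thesis by simp
  qed
  then have mono: "strict_mono q" by (simp add: strict_mono_Suc_iff)
  have "inv q permutes {1..m}" using 0(2) by (rule permutes_inv)
  have "q a = a" for a
  proof -
    have ge: "b \<le> q b" for b using strict_mono_imp_increasing[OF mono] .
    have sur: "q (inv q b) = b" for b using 0(2) by (simp add: permutes_inverses)
    have "strict_mono (inv q)"
      by (metis mono strict_monoI strict_mono_less sur)
    then have "b \<le> inv q b" for b by (rule strict_mono_imp_increasing)
    then have "q a \<le> inv q (q a)" .
    then have "q a \<le> a" using 0(2) by (simp add: permutes_inverses)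
    then show ?thesis using ge[of a] by simp
  qed
  then have "q = id" by auto
  then show ?case by (intro exI[of _ "[]"]) simp
next
  case (Suc n)
  then have "ivs q \<noteq> {}" by auto
  have "\<exists>a\<ge>1. q (Suc a) < q a"
  proof (rule ccontr)
    assume "\<not> (\<exists>a\<ge>1. q (Suc a) < q a)"
    then have "q a \<le> q (Suc a)" if "a \<ge> 1" for a using that by (meson not_le)
    moreover have "q 0 = 0" using Suc(3) by (simp add: permutes_def)
    ultimately have "q a \<le> q (Suc a)" for a by (cases a) auto
    then have "mono q" by (simp add: mono_iff_le_Suc)
    then show False using \<open>ivs q \<noteq> {}\<close> by (auto simp: ivs_def mono_def) (meson leD less_imp_le_nat)
  qed
  then obtain a where a: "a \<ge> 1" "q (Suc a) < q a" by auto
  have "n = card (ivs (q \<circ> transpose a (Suc a)))" using ivs_step[OF Suc(3) a(2)] Suc(2) by simp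
  from Suc(1)[OF this permutes_desc[OF Suc(3) a]] obtain as where
    "\<forall>b\<in>set as. 1 \<le> b" "pth (q \<circ> transpose a (Suc a)) as" "endq (q \<circ> transpose a (Suc a)) as = id" by auto
  then show ?case using a by (intro exI[of _ "a # as"]) auto
qed

lemma word_for_endq:
  assumes "w permutes {1..m}"
  shows "word_for w as \<longleftrightarrow> (\<forall>a\<in>set as. 1 \<le> a) \<and> endq (inv w) as = id"
proof -
  have "inv w \<circ> word_product as = id \<longleftrightarrow> word_product as = w"
    by (metis assms comp_assoc comp_id id_comp permutes_inv_o(1) permutes_inv_o(2))
  then show ?thesis by (simp add: word_for_def endq_word_product)
qed

text \<open>The product of a word is w exactly if following the word from the inverse of w ends at
  the identity; by \<open>word_length\<close>, minimal length then means that every step is a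
  descent.\<close>

lemma reduced_word_pth:
  assumes w: "w permutes {1..m}"
  shows "reduced_word w as \<longleftrightarrow> (\<forall>a\<in>set as. 1 \<le> a) \<and> pth (inv w) as \<and> endq (inv w) as = id"
proof -
  have q: "inv w permutes {1..m}" using w by (rule permutes_inv)
  note wl = word_length[OF q] and wf = word_for_endq[OF w]
  obtain bs where bs: "\<forall>a\<in>set bs. 1 \<le> a" "pth (inv w) bs" "endq (inv w) bs = id" using exists_path[OF q] by auto
  show ?thesis
  proof
    assume r: "reduced_word w as"
    then have a: "\<forall>a\<in>set as. 1 \<le> a" "endq (inv w) as = id" by (auto simp: reduced_word_def wf)
    have "length as \<le> length bs" using r bs by (auto simp: reduced_word_def wf)
    then have "card (ivs (inv w)) = length as" using wl[OF a] wl[OF bs(1,3)] bs by simp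
    then show "(\<forall>a\<in>set as. 1 \<le> a) \<and> pth (inv w) as \<and> endq (inv w) as = id" using a wl[OF a] by simp
  next
    assume "(\<forall>a\<in>set as. 1 \<le> a) \<and> pth (inv w) as \<and> endq (inv w) as = id"
    then have a: "\<forall>a\<in>set as. 1 \<le> a" "pth (inv w) as" "endq (inv w) as = id" by blast+
    have "length as = card (ivs (inv w))" using wl[OF a(1,3)] a(2) by simp
    moreover have "card (ivs (inv w)) \<le> length cs" if "word_for w cs" for cs using that wl[of cs] by (simp add: wf)
    ultimately show "reduced_word w as" unfolding reduced_word_def using a wf by simp
  qed
qed

lemma pth_letters:
  assumes "q permutes {1..m}" "\<forall>a\<in>set as. 1 \<le> a" "pth q as"
  shows "set as \<subseteq> {1..m}"
  using assms
proof (induction as arbitrary: q)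
  case (Cons a as)
  then have "Suc a \<le> m" using desc_bounds[of q m a] by simp
  moreover have "q \<circ> transpose a (Suc a) permutes {1..m}" using permutes_desc[of q m a] Cons by simp
  ultimately show ?case using Cons by auto
qed simp

text \<open>The heights of the columns of a tableau.\<close>

definition colh :: "nat list list \<Rightarrow> nat \<Rightarrow> nat" where
  "colh T j = length (filter (\<lambda>r. j < length r) T)"

lemma sorted_filter_take:
  assumes "sorted_wrt (\<ge>) (map length T)"
  shows "filter (\<lambda>r. j < length r) T = take (colh T j) T"
  using assms
proof (induction T)
  case (Cons r T)
  show ?case
  proof (cases "j < length r")
    case True
    then show ?thesis using Cons by (simp add: colh_def)
  next
    case False
    then have "filter (\<lambda>r. j < length r) T = []" using Cons.prems by (auto simp: filter_empty_conv)
    then show ?thesis using False by (simp add: colh_def)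
  qed
qed (simp add: colh_def)

lemma colh_le: "colh T j \<le> length T" by (simp add: colh_def)

lemma less_colh:
  assumes "sorted_wrt (\<ge>) (map length T)"
  shows "i < colh T j \<longleftrightarrow> i < length T \<and> j < length (T ! i)"
proof
  assume i: "i < colh T j"
  then have "T ! i \<in> set (filter (\<lambda>r. j < length r) T)"
    unfolding sorted_filter_take[OF assms] using colh_le[of T j] nth_mem[of i "take (colh T j) T"] by simp
  then show "i < length T \<and> j < length (T ! i)" using i colh_le[of T j] by auto
next
  assume i: "i < length T \<and> j < length (T ! i)"
  show "i < colh T j"
  proof (rule ccontr)
    assume "\<not> i < colh T j"
    then have "drop (colh T j) T ! (i - colh T j) = T ! i" "i - colh T j < length (drop (colh T j) T)"
      using i by auto
    then have mem: "T ! i \<in> set (drop (colh T j) T)" using nth_mem by metis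
    have "filter (\<lambda>r. j < length r) T =
        filter (\<lambda>r. j < length r) (take (colh T j) T) @ filter (\<lambda>r. j < length r) (drop (colh T j) T)"
      using filter_append[of _ "take (colh T j) T" "drop (colh T j) T"] by simp
    moreover have "filter (\<lambda>r. j < length r) (take (colh T j) T) = take (colh T j) T"
      using sorted_filter_take[OF assms, of j, symmetric] by simp
    ultimately have "filter (\<lambda>r. j < length r) (drop (colh T j) T) = []"
      using sorted_filter_take[OF assms, of j] by simp
    then show False using mem i by (auto simp: filter_empty_conv)
  qed
qed

lemma column_eq:
  assumes "sorted_wrt (\<ge>) (map length T)"
  shows "column T j = map (\<lambda>i. T ! i ! j) [0..<colh T j]"
  unfolding column_def sorted_filter_take[OF assms] using colh_le[of T j]
  by (intro nth_equalityI) auto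

section \<open>Tableaux as good sequences of columns\<close>

definition tocols :: "nat \<Rightarrow> nat list list \<Rightarrow> nat list list" where
  "tocols M T = map (\<lambda>j. rev (column T j)) [0..<M]"

lemma colh_0:
  assumes "sorted_wrt (\<ge>) (map length T)" "num_columns T \<le> j"
  shows "colh T j = 0"
proof (rule ccontr)
  assume "colh T j \<noteq> 0"
  then have "0 < length T \<and> j < length (T ! 0)" using less_colh[OF assms(1), of 0 j] by simp
  then show False using assms(2) by (cases T) (auto simp: num_columns_def)
qed

lemma concat_tocols:
  assumes T: "sorted_wrt (\<ge>) (map length T)" and M: "num_columns T \<le> M"
  shows "concat (tocols M T) = column_word T"
proof -
  have "[0..<M] = [0..<num_columns T] @ [num_columns T..<M]" using M by (metis le0 le_add_diff_inverse upt_add_eq_append)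
  moreover have "concat (map (\<lambda>j. rev (column T j)) [num_columns T..<M]) = []"
    using colh_0[OF T] by (simp add: column_eq[OF T])
  ultimately show ?thesis by (simp add: tocols_def column_word_def)
qed

lemma sorted_gt_rev: "sorted_wrt (>) (rev (xs :: nat list)) \<longleftrightarrow> sorted_wrt (<) xs"
  by (simp add: sorted_wrt_rev)

lemma length_lo_rev: "length (lo x (rev c)) = card {i. i < length c \<and> c ! i \<le> x}"
proof -
  have "length (lo x (rev c)) = length (filter (\<lambda>a. a \<le> x) c)" unfolding lo_def by (metis length_rev rev_filter)
  then show ?thesis by (simp add: length_filter_conv_card)
qed

lemma column_word_length:
  assumes T: "semistandard T"
  shows "num_columns T \<le> length (column_word T)"
proof -
  have s: "sorted_wrt (\<ge>) (map length T)" using T by (simp add: semistandard_def)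
  have "1 \<le> length (rev (column T j))" if "j < num_columns T" for j
  proof -
    have "0 < colh T j" using that less_colh[OF s, of 0 j] by (cases T) (auto simp: num_columns_def)
    then show ?thesis by (simp add: column_eq[OF s])
  qed
  then have "sum_list (map (\<lambda>j. 1) [0..<num_columns T]) \<le> sum_list (map (\<lambda>j. length (rev (column T j))) [0..<num_columns T])"
    by (intro sum_list_mono) auto
  then show ?thesis by (simp add: column_word_def length_concat comp_def sum_list_triv)
qed

lemma card_ivs_le: "q permutes {1..m} \<Longrightarrow> card (ivs q) \<le> m * m"
  using card_mono[OF _ ivs_bound, of m q] by (simp add: card_cartesian_product)

lemma tocols_good:
  assumes w: "w permutes {1..m}" and M: "m * m \<le> M" and T: "T \<in> EG_tableaux w"
  shows "tocols M T \<in> {cs \<in> fs m M (inv w). good cs}" "num_columns T \<le> M"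
proof -
  have ss: "semistandard T" and red: "reduced_word w (column_word T)" using T by (auto simp: EG_tableaux_def)
  have s: "sorted_wrt (\<ge>) (map length T)" using ss by (simp add: semistandard_def)
  have q: "inv w permutes {1..m}" using w by (rule permutes_inv)
  have r: "\<forall>a\<in>set (column_word T). 1 \<le> a" "pth (inv w) (column_word T)" "endq (inv w) (column_word T) = id"
    using red reduced_word_pth[OF w] by auto
  have "card (ivs (inv w)) = length (column_word T)" using word_length[OF q r(1,3)] r(2) by simp
  then show nc: "num_columns T \<le> M" using column_word_length[OF ss] card_ivs_le[OF q] M by simp
  have cw: "concat (tocols M T) = column_word T" using concat_tocols[OF s nc] .
  have "set (column_word T) \<subseteq> {1..m}" using pth_letters[OF q] r by simp
  then have letters: "set c \<subseteq> {1..m}" if "c \<in> set (tocols M T)" for c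
    using that unfolding cw[symmetric] by auto
  have dec: "sorted_wrt (>) c" if "c \<in> set (tocols M T)" for c
  proof -
    obtain j where c: "c = rev (column T j)" using \<open>c \<in> set (tocols M T)\<close> by (auto simp: tocols_def)
    have "sorted_wrt (<) (column T j)"
    proof (subst sorted_wrt_iff_nth_Suc_transp)
      show "\<forall>i. Suc i < length (column T j) \<longrightarrow> column T j ! i < column T j ! Suc i"
      proof (intro allI impI)
        fix i assume "Suc i < length (column T j)"
        then have i: "Suc i < colh T j" by (simp add: column_eq[OF s])
        then have "Suc i < length T \<and> j < length (T ! Suc i)" using less_colh[OF s] by blast
        then have "T ! i ! j < T ! Suc i ! j" using ss by (simp add: semistandard_def)
        then show "column T j ! i < column T j ! Suc i" using i by (simp add: column_eq[OF s])
      qed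
    qed (simp add: transp_def)
    then show ?thesis by (simp add: c sorted_gt_rev)
  qed
  have "good (tocols M T)"
    unfolding good_def viol_def
  proof (intro allI notI)
    fix x k assume v: "Suc k < length (tocols M T) \<and>
      length (lo x (tocols M T ! k)) < length (lo x (tocols M T ! Suc k))"
    have "{i. i < colh T (Suc k) \<and> T ! i ! Suc k \<le> x} \<subseteq> {i. i < colh T k \<and> T ! i ! k \<le> x}"
    proof safe
      fix i assume i: "i < colh T (Suc k)" "T ! i ! Suc k \<le> x"
      then have il: "i < length T" "Suc k < length (T ! i)" using less_colh[OF s] by auto
      then show "i < colh T k" using less_colh[OF s] by auto
      have "sorted (T ! i)" using ss il by (auto simp: semistandard_def)
      then have "T ! i ! k \<le> T ! i ! Suc k" using il sorted_nth_mono[of "T ! i" k "Suc k"] by simp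
      then show "T ! i ! k \<le> x" using i by simp
    qed
    then have "card {i. i < colh T (Suc k) \<and> T ! i ! Suc k \<le> x} \<le> card {i. i < colh T k \<and> T ! i ! k \<le> x}"
      by (intro card_mono) auto
    moreover have "length (lo x (tocols M T ! j)) = card {i. i < colh T j \<and> T ! i ! j \<le> x}" if "j < M" for j
    proof -
      have "{i. i < length (column T j) \<and> column T j ! i \<le> x} = {i. i < colh T j \<and> T ! i ! j \<le> x}"
        by (auto simp: column_eq[OF s])
      then show ?thesis using that by (simp add: tocols_def length_lo_rev)
    qed
    moreover have "Suc k < M" "k < M" using v by (auto simp: tocols_def)
    ultimately show False using v by simp
  qed
  then show "tocols M T \<in> {cs \<in> fs m M (inv w). good cs}"
    unfolding fs_def using dec letters r cw by (auto simp: tocols_def)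
qed

lemma tocols_inj:
  assumes T: "semistandard T" "num_columns T \<le> M" and T': "semistandard T'" "num_columns T' \<le> M"
    and M: "0 < M" and eq: "tocols M T = tocols M T'"
  shows "T = T'"
proof -
  have s: "sorted_wrt (\<ge>) (map length T)" "sorted_wrt (\<ge>) (map length T')"
    using T T' by (auto simp: semistandard_def)
  have col: "column T j = column T' j" if "j < M" for j
  proof -
    have "tocols M T ! j = tocols M T' ! j" using eq by simp
    then show ?thesis using that by (simp add: tocols_def)
  qed
  have h: "colh T j = colh T' j" for j
  proof (cases "j < M")
    case True
    then have "length (column T j) = length (column T' j)" using col by simp
    then show ?thesis by (simp add: column_eq[OF s(1)] column_eq[OF s(2)])
  next
    case False
    then show ?thesis using colh_0[OF s(1)] colh_0[OF s(2)] T T' by simp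
  qed
  have len0: "colh U 0 = length U" if "semistandard U" for U
  proof -
    have "filter (\<lambda>r. 0 < length r) U = U" using that by (auto simp: semistandard_def filter_id_conv)
    then show ?thesis by (simp add: colh_def)
  qed
  have l: "length T = length T'" using len0[OF T(1)] len0[OF T'(1)] h[of 0] by simp
  show "T = T'"
  proof (rule nth_equalityI[OF l])
    fix i assume i: "i < length T"
    have lr: "j < length (T ! i) \<longleftrightarrow> j < length (T' ! i)" for j
      using less_colh[OF s(1), of i j] less_colh[OF s(2), of i j] h i l by simp
    have lreq: "length (T ! i) = length (T' ! i)" using lr by (metis linorder_neqE_nat less_irrefl)
    show "T ! i = T' ! i"
    proof (rule nth_equalityI[OF lreq])
      fix j assume j: "j < length (T ! i)"
      then have ij: "i < colh T j" using i less_colh[OF s(1)] by simp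
      have "j < M"
      proof (rule ccontr)
        assume "\<not> j < M"
        then show False using colh_0[OF s(1), of j] T(2) ij by simp
      qed
      then have "column T j ! i = column T' j ! i" using col by simp
      then show "T ! i ! j = T' ! i ! j" using ij h by (simp add: column_eq[OF s(1)] column_eq[OF s(2)])
    qed
  qed
qed

text \<open>Use the bound x = d ! i: at least i + 1 entries of d are at most x, hence also of c, and
  c increases.\<close>

lemma good_nth_le:
  assumes c: "sorted_wrt (<) c" and d: "sorted_wrt (<) d" and i: "i < length d"
    and g: "\<And>x. card {i. i < length d \<and> d ! i \<le> x} \<le> card {i. i < length c \<and> c ! i \<le> x}"
  shows "i < length c \<and> c ! i \<le> (d ! i :: nat)"
proof -
  let ?x = "d ! i"
  have "{..i} \<subseteq> {i. i < length d \<and> d ! i \<le> ?x}"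
    using d i by (auto simp: sorted_wrt_iff_nth_less le_eq_less_or_eq)
  then have "card {..i} \<le> card {i. i < length d \<and> d ! i \<le> ?x}" by (intro card_mono) auto
  then have le: "Suc i \<le> card {i. i < length c \<and> c ! i \<le> ?x}" using g[of ?x] by simp
  show ?thesis
  proof (rule ccontr)
    assume n: "\<not> ?thesis"
    have "{k. k < length c \<and> c ! k \<le> ?x} \<subseteq> {..<i}"
    proof
      fix k assume k: "k \<in> {k. k < length c \<and> c ! k \<le> ?x}"
      show "k \<in> {..<i}"
      proof (rule ccontr)
        assume "k \<notin> {..<i}"
        then have "i \<le> k" by simp
        then have "c ! i \<le> c ! k"
          using sorted_wrt_nth_less[OF c, of i k] k by (cases "i = k") auto
        then show False using n k \<open>i \<le> k\<close> by auto
      qed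
    qed
    then have "card {k. k < length c \<and> c ! k \<le> ?x} \<le> i" using card_mono[of "{..<i}"] by fastforce
    then show False using le by simp
  qed
qed

lemma tocols_surj:
  assumes w: "w permutes {1..m}" and M: "0 < M" and cs: "cs \<in> fs m M (inv w)" "good cs"
  shows "\<exists>T \<in> EG_tableaux w. tocols M T = cs"
proof -
  define c where "c = (\<lambda>j. rev (cs ! j))"
  define h where "h = (\<lambda>j. if j < M then length (c j) else 0)"
  have lM: "length cs = M" using cs by (simp add: fs_def)
  have cj: "sorted_wrt (<) (c j)" "set (c j) \<subseteq> {1..m}" if "j < M" for j
  proof -
    have "cs ! j \<in> set cs" using that lM by simp
    then have "sorted_wrt (>) (cs ! j)" "set (cs ! j) \<subseteq> {1..m}" using cs(1) unfolding fs_def by blast+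
    then show "sorted_wrt (<) (c j)" "set (c j) \<subseteq> {1..m}" using sorted_gt_rev[of "c j"] by (simp_all add: c_def)
  qed
  have nle: "i < length (c j) \<and> c j ! i \<le> c (Suc j) ! i" if "Suc j < M" "i < length (c (Suc j))" for i j
  proof (rule good_nth_le)
    show "sorted_wrt (<) (c j)" "sorted_wrt (<) (c (Suc j))" using cj that by auto
    fix x
    have "\<not> viol cs x j" using cs(2) by (simp add: good_def)
    then show "card {i. i < length (c (Suc j)) \<and> c (Suc j) ! i \<le> x} \<le> card {i. i < length (c j) \<and> c j ! i \<le> x}"
      using length_lo_rev[of x "c j"] length_lo_rev[of x "c (Suc j)"] that lM by (simp add: viol_def c_def)
  qed (use that in simp)
  have hS: "h (Suc j) \<le> h j" for j
  proof (rule ccontr)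
    assume "\<not> h (Suc j) \<le> h j"
    then have "h j < h (Suc j)" by simp
    then have "Suc j < M" by (auto simp: h_def split: if_splits)
    then show False using nle[of j "h j"] \<open>h j < h (Suc j)\<close> by (simp add: h_def)
  qed
  have hmono: "h k \<le> h j" if "j \<le> k" for j k using that hS by (rule lift_Suc_antimono_le[of h, rotated])
  \<comment> \<open>\<open>rl\<close> is the partition conjugate to the column heights
    \<open>h\<close>, that is, the row lengths of the tableau to be built.\<close>
  define rl where "rl = (\<lambda>i. LEAST j. h j \<le> i)"
  have rl: "j < rl i \<longleftrightarrow> i < h j" for i j
  proof -
    have "h M \<le> i" by (simp add: h_def)
    then have "h (rl i) \<le> i" unfolding rl_def by (rule LeastI)
    then have "rl i \<le> j \<Longrightarrow> h j \<le> i" using hmono by (meson le_trans)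
    moreover have "j < rl i \<Longrightarrow> \<not> h j \<le> i" unfolding rl_def by (rule not_less_Least)
    ultimately show ?thesis by linarith
  qed
  define T where "T = map (\<lambda>i. map (\<lambda>j. c j ! i) [0..<rl i]) [0..<h 0]"
  have lT: "length T = h 0" by (simp add: T_def)
  have T: "T ! i ! j = c j ! i" "length (T ! i) = rl i" if "i < h 0" "j < rl i" for i j
    using that by (simp_all add: T_def)
  have lTi: "length (T ! i) = rl i" if "i < h 0" for i using that by (simp add: T_def)
  have jM: "j < M \<and> i < length (c j)" if "j < rl i" for i j using that unfolding rl by (auto simp: h_def split: if_splits)
  have rlmono: "rl k \<le> rl i" if "i \<le> k" for i k
  proof (rule ccontr)
    assume "\<not> rl k \<le> rl i"
    then have "k < h (rl i)" using rl[of "rl i" k] by simp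
    then have "rl i < rl i" using rl[of "rl i" i] that by simp
    then show False by simp
  qed
  have s: "sorted_wrt (\<ge>) (map length T)"
    using rlmono by (simp add: T_def sorted_wrt_map comp_def sorted_wrt_iff_nth_less)
  have ss: "semistandard T"
    unfolding semistandard_def
  proof (intro conjI s ballI allI impI)
    fix r assume "r \<in> set T"
    then obtain i where i: "i < h 0" and r: "r = map (\<lambda>j. c j ! i) [0..<rl i]" by (auto simp: T_def)
    show "r \<noteq> []" using i rl[of 0 i] by (simp add: r)
    show "sorted r"
      unfolding r sorted_iff_nth_Suc
    proof (intro allI impI)
      fix j assume "Suc j < length (map (\<lambda>j. c j ! i) [0..<rl i])"
      then have j: "Suc j < rl i" by simp
      show "map (\<lambda>j. c j ! i) [0..<rl i] ! j \<le> map (\<lambda>j. c j ! i) [0..<rl i] ! Suc j"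
        using j jM[OF j] nle[of j i] by simp
    qed
    fix a assume "a \<in> set r"
    then obtain j where "j < rl i" "a = c j ! i" by (auto simp: r)
    then have "a \<in> set (c j)" "j < M" using jM by auto
    then show "1 \<le> a" using cj(2) by fastforce
  next
    fix i j assume ij: "Suc i < length T" "j < length (T ! Suc i)"
    then have "j < rl (Suc i)" using lT by (simp add: T_def)
    moreover have "j < rl i" using calculation rlmono[of i "Suc i"] by simp
    ultimately show "T ! i ! j < T ! Suc i ! j"
      using ij lT jM[of j "Suc i"] cj(1)[of j] T by (simp add: sorted_wrt_iff_nth_less)
  qed
  have colh: "colh T j = h j" for j
  proof -
    have "i < colh T j \<longleftrightarrow> i < h j" for i
      using less_colh[OF s, of i j] lT lTi[of i] rl[of j i] hmono[of 0 j] by auto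
    then show ?thesis by (metis linorder_neqE_nat less_irrefl)
  qed
  have col: "column T j = c j" if "j < M" for j
  proof (rule nth_equalityI)
    show "length (column T j) = length (c j)" using that by (simp add: column_eq[OF s] colh h_def)
    fix i assume "i < length (column T j)"
    then have "i < h j" by (simp add: column_eq[OF s] colh)
    then show "column T j ! i = c j ! i"
      using T(1)[of i j] rl[of j i] hmono[of 0 j] by (simp add: column_eq[OF s] colh)
  qed
  have tc: "tocols M T = cs"
    by (rule nth_equalityI) (simp_all add: tocols_def lM col, simp add: c_def)
  have nc: "num_columns T \<le> M"
  proof (rule ccontr)
    assume "\<not> num_columns T \<le> M"
    then have "0 < length T \<and> M < length (T ! 0)" by (cases T) (auto simp: num_columns_def)
    then have "0 < colh T M" using less_colh[OF s] by blast
    then show False by (simp add: colh h_def)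
  qed
  have cw: "concat cs = column_word T" using concat_tocols[OF s nc] tc by simp
  have "\<forall>a\<in>set (column_word T). 1 \<le> a" using cs(1) unfolding cw[symmetric] by (fastforce simp: fs_def)
  then have "reduced_word w (column_word T)"
    using cs(1) by (simp add: reduced_word_pth[OF w] fs_def cw)
  then show ?thesis using ss tc by (auto simp: EG_tableaux_def)
qed

text \<open>Padding with empty columns makes the number of columns uniform. The bound on M suffices
  because columns of a tableau are nonempty, so there are no more of them than inversions, hence at
  most m * m.\<close>

theorem EG_ngood:
  assumes w: "w permutes {1..m}" and M: "m * m < M"
  shows "real (EG w) = ngood m M (inv w)" "finite (EG_tableaux w)"
proof -
  have b: "bij_betw (tocols M) (EG_tableaux w) {cs \<in> fs m M (inv w). good cs}"
    unfolding bij_betw_def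
  proof
    show "inj_on (tocols M) (EG_tableaux w)"
    proof (rule inj_onI)
      fix T T' assume T: "T \<in> EG_tableaux w" "T' \<in> EG_tableaux w" and eq: "tocols M T = tocols M T'"
      have "num_columns T \<le> M" "num_columns T' \<le> M" using tocols_good(2)[OF w, of M] M T by auto
      then show "T = T'" using tocols_inj[of T M T'] T eq M by (simp add: EG_tableaux_def)
    qed
    show "tocols M ` EG_tableaux w = {cs \<in> fs m M (inv w). good cs}"
      using tocols_good(1)[OF w, of M] tocols_surj[OF w, of M] M by fastforce
  qed
  then show "real (EG w) = ngood m M (inv w)" by (simp add: EG_def ngood_def bij_betw_same_card)
  show "finite (EG_tableaux w)" using bij_betw_finite[OF b] finite_fs by simp
qed

section \<open>The transition recurrence\<close>

definition child :: "(nat \<Rightarrow> nat) \<Rightarrow> nat \<Rightarrow> nat \<Rightarrow> nat \<Rightarrow> nat \<Rightarrow> nat" where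
  "child w a r s = w(a := w s, r := w a, s := w r)"

lemma child_comp:
  assumes "a < r" "r < s"
  shows "child w a r s = w \<circ> transpose r s \<circ> transpose a r"
  using assms by (auto simp: child_def fun_eq_iff transpose_def)

text \<open>Let v arise from w by removing the inversion of r and s. The vanishing Monk sum at the
  inverse of v and at x = v r has a single positive term, leading back to w, because
  \<open>valid\<close> rules out every other cover to the right. Its negative terms lead to the
  children.\<close>

theorem EG_corner:
  assumes w: "w permutes {1..m}" and rs: "r < s" "w s < w r"
    and valid: "\<And>t. r < t \<Longrightarrow> t \<noteq> s \<Longrightarrow> w s < w t \<Longrightarrow> s < t \<and> w r < w t"
    and ex: "\<exists>i\<ge>1. i < r \<and> w i < w s"
  shows "EG w = (\<Sum>a\<in>{a. 1 \<le> a \<and> a < r \<and> w a < w s \<and> (\<forall>p. a < p \<and> p < r \<longrightarrow> \<not> (w a < w p \<and> w p < w s))}.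
    EG (child w a r s))"
proof -
  define I where "I = {a. 1 \<le> a \<and> a < r \<and> w a < w s \<and> (\<forall>p. a < p \<and> p < r \<longrightarrow> \<not> (w a < w p \<and> w p < w s))}"
  have out: "w k = k" if "k \<notin> {1..m}" for k using w that by (auto simp: permutes_def)
  have ins: "w k \<in> {1..m}" if "k \<in> {1..m}" for k using permutes_in_image[OF w] that by blast
  have sm: "s \<in> {1..m}"
  proof (rule ccontr)
    assume s: "s \<notin> {1..m}"
    then have "s > m" using rs by auto
    then show False using rs out[OF s] out[of r] ins[of r] by (cases "r \<in> {1..m}") auto
  qed
  have rm: "r \<in> {1..m}" using rs sm ex by auto
  define v where "v = w \<circ> transpose r s"
  have vp: "v permutes {1..m}" unfolding v_def
    using permutes_swap_id[OF rm sm] w by (rule permutes_compose)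
  define q where "q = inv v"
  have qp: "q permutes {1..m}" unfolding q_def using vp by (rule permutes_inv)
  have qv: "q (v k) = k" "v (q k) = k" for k using vp by (simp_all add: q_def permutes_inverses)
  have injq: "inj q" and injv: "inj v" using qp vp by (simp_all add: permutes_inj)
  define x where "x = v r"
  have vrs: "v r = w s" "v s = w r" and vt: "v t = w t" if "t \<noteq> r" "t \<noteq> s" for t
    using that rs by (auto simp: v_def transpose_def)
  note vv = v_def transpose_def
  have vr: "v r = w s" and vs: "v s = w r" by (simp_all add: vv)
  have hd: "hasdown m x q"
  proof -
    obtain i where i: "i \<ge> 1" "i < r" "w i < w s" using ex by auto
    have "v i = w i" using i rs by (simp add: vv)
    moreover have "w i \<ge> 1" using i rm ins[of i] by auto
    moreover have "x \<in> {1..m}" using sm ins by (simp add: x_def vr)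
    moreover have "q (w i) = i" using qv(1)[of i] \<open>v i = w i\<close> by simp
    moreover have "q x = r" using qv(1) by (simp add: x_def)
    ultimately show ?thesis unfolding hasdown_def using qp i
      by (intro conjI exI[of _ "w i"]) (auto simp: x_def vr)
  qed
  define M where "M = Suc (m * m)"
  define B where "B = Suc (Suc m)"
  have tr: "mnk B x (ngood m M) q = 0" using ngood_transition[OF hd] by (simp add: B_def)
  have inv_eq: "q \<circ> transpose (v i) (v j) = inv (v \<circ> transpose i j)" for i j
  proof -
    have "v \<circ> transpose i j \<circ> (q \<circ> transpose (v i) (v j)) = id"
    proof
      fix z
      have "transpose i j (q z') = q (transpose (v i) (v j) z')" for z'
        using qv injv by (metis transpose_apply_commute transpose_apply_first transpose_apply_other transpose_apply_second)
      then show "(v \<circ> transpose i j \<circ> (q \<circ> transpose (v i) (v j))) z = id z"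
        using qv by (simp add: transpose_involutory)
    qed
    moreover have "bij (v \<circ> transpose i j)" using vp by (simp add: permutes_bij bij_comp)
    ultimately show ?thesis by (metis bij_is_inj inv_o_cancel comp_assoc comp_id id_comp)
  qed
  have perm_t: "v \<circ> transpose i j permutes {1..m}" if "i \<in> {1..m}" "j \<in> {1..m}" for i j
    using permutes_swap_id[OF that] vp by (rule permutes_compose)
  have EGn: "ngood m M (q \<circ> transpose (v i) (v j)) = EG (v \<circ> transpose i j)" if "i \<in> {1..m}" "j \<in> {1..m}" for i j
    using EG_ngood(1)[OF perm_t[OF that], of M] by (simp add: inv_eq M_def)
  have cvp: "cv (v i) (v j) q \<longleftrightarrow> v i < v j \<and> i < j \<and> (\<forall>p. i < p \<and> p < j \<longrightarrow> \<not> (v i < v p \<and> v p < v j))" for i j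
    unfolding cv_def qv by (metis qv)
  have up: "cv (v r) (v t) q \<longleftrightarrow> t = s" for t
  proof
    assume c: "cv (v r) (v t) q"
    then have t: "r < t" "w s < v t" using cvp[of r t] unfolding vr by blast+
    show "t = s"
    proof (rule ccontr)
      assume ts: "t \<noteq> s"
      then have "v t = w t" using t by (simp add: vv)
      then have "s < t" "w r < w t" using valid t ts by auto
      then show False using c cvp[of r t] vr vs rs \<open>v t = w t\<close> by auto
    qed
  next
    assume "t = s"
    moreover have "\<not> (w s < v p \<and> v p < w r)" if "r < p" "p < s" for p
      using valid[of p] that vt[of p] by auto
    ultimately show "cv (v r) (v t) q" using cvp[of r s] vr vs rs by auto
  qed
  have dn: "cv (v a) (v r) q \<longleftrightarrow> a \<in> I" for a
  proof -
    have "cv (v a) (v r) q \<longleftrightarrow> a < r \<and> w a < w s \<and> (\<forall>p. a < p \<and> p < r \<longrightarrow> \<not> (w a < w p \<and> w p < w s))"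
      using cvp[of a r] rs by (auto simp: vv)
    \<comment> \<open>Position 0 carries the value 0 and would be a spurious child point; an entry
      provided by \<open>ex\<close> lies between it and the corner.\<close>
    moreover have False if "a = 0" "\<forall>p. a < p \<and> p < r \<longrightarrow> \<not> (w a < w p \<and> w p < w s)"
    proof -
      obtain i where i: "i \<ge> 1" "i < r" "w i < w s" using ex by auto
      moreover have "w 0 = 0" using out by simp
      moreover have "w i \<ge> 1" using i rm ins[of i] by auto
      ultimately show False using that by (auto dest: spec[of _ i])
    qed
    ultimately show ?thesis unfolding I_def by (cases "a = 0") auto
  qed
  have Im: "I \<subseteq> {1..m}" using rm by (auto simp: I_def)
  then have finI: "finite I" by (rule finite_subset) simp
  have vB: "v t < B" if "t \<in> {1..m}" for t
  proof -
    have "v t \<in> {1..m}" using permutes_in_image[OF vp] that by blast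
    then show ?thesis by (simp add: B_def)
  qed
  have "0 = (\<Sum>y<B. sgc x y q * ngood m M (q \<circ> transpose x y))" using tr by (simp add: mnk_def)
  also have "\<dots> = (\<Sum>y\<in>insert (v s) (v ` I). sgc x y q * ngood m M (q \<circ> transpose x y))"
  proof (rule sum.mono_neutral_right)
    show "insert (v s) (v ` I) \<subseteq> {..<B}" using vB sm Im by auto
    show "\<forall>y\<in>{..<B} - insert (v s) (v ` I). sgc x y q * ngood m M (q \<circ> transpose x y) = 0"
    proof
      fix y assume y: "y \<in> {..<B} - insert (v s) (v ` I)"
      have "\<not> cv x y q" using up[of "q y"] y by (auto simp: x_def qv)
      moreover have "\<not> cv y x q" using dn[of "q y"] y image_eqI[of y v "q y" I] by (auto simp: x_def qv)
      ultimately show "sgc x y q * ngood m M (q \<circ> transpose x y) = 0" by (simp add: sgc_def)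
    qed
  qed simp
  also have "\<dots> = sgc x (v s) q * ngood m M (q \<circ> transpose x (v s)) +
      (\<Sum>y\<in>v ` I. sgc x y q * ngood m M (q \<circ> transpose x y))"
  proof (rule sum.insert)
    show "v s \<notin> v ` I"
    proof
      assume "v s \<in> v ` I"
      then have "s \<in> I" using injv by (simp add: inj_image_mem_iff)
      then show False using rs by (simp add: I_def)
    qed
  qed (simp add: finI)
  also have "sgc x (v s) q * ngood m M (q \<circ> transpose x (v s)) = EG w"
  proof -
    have "v \<circ> transpose r s = w" by (simp add: v_def comp_assoc)
    then show ?thesis using EGn[OF rm sm] up[of s] by (simp add: sgc_def x_def)
  qed
  also have "(\<Sum>y\<in>v ` I. sgc x y q * ngood m M (q \<circ> transpose x y)) = (\<Sum>a\<in>I. sgc x (v a) q * ngood m M (q \<circ> transpose x (v a)))"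
    using sum.reindex[of v I] inj_on_subset[OF injv] by simp
  also have "\<dots> = (\<Sum>a\<in>I. - real (EG (child w a r s)))"
  proof (rule sum.cong)
    fix a assume a: "a \<in> I"
    have "cv (v a) x q" using dn a by (simp add: x_def)
    moreover from this have "\<not> cv x (v a) q" by (auto simp: cv_def)
    moreover have "v \<circ> transpose r a = child w a r s"
      using a rs by (simp add: child_comp I_def v_def transpose_commute)
    ultimately show "sgc x (v a) q * ngood m M (q \<circ> transpose x (v a)) = - real (EG (child w a r s))"
      using EGn[OF rm, of a] a Im by (auto simp: sgc_def x_def)
  qed simp
  finally have "real (EG w) = (\<Sum>a\<in>I. real (EG (child w a r s)))" by (simp add: sum_negf)
  then have "EG w = (\<Sum>a\<in>I. EG (child w a r s))" by (metis of_nat_eq_iff of_nat_sum)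
  then show ?thesis by (simp add: I_def)
qed

section \<open>Permutations without 132 have exactly one tableau\<close>

lemma pth_run:
  "pth q (rev [e..<k]) \<longleftrightarrow> (\<forall>a\<in>{e..<k}. q k < q a)" (is ?A)
  "endq q (rev [e..<k]) = (\<lambda>v. if e < k \<and> v = e then q k else if e < v \<and> v \<le> k then q (v - 1) else q v)" (is ?B)
proof -
  have "?A \<and> ?B"
  proof (induction k arbitrary: q)
    case (Suc k)
    show ?case
    proof (cases "e \<le> k")
      case True
      let ?q = "q \<circ> transpose k (Suc k)"
      have r: "rev [e..<Suc k] = k # rev [e..<k]" using True by simp
      have A: "pth ?q (rev [e..<k]) \<longleftrightarrow> (\<forall>a\<in>{e..<k}. q (Suc k) < q a)"
      proof -
        have e: "?q k = q (Suc k)" "a \<in> {e..<k} \<Longrightarrow> ?q a = q a" for a by auto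
        have "pth ?q (rev [e..<k]) \<longleftrightarrow> (\<forall>a\<in>{e..<k}. ?q k < ?q a)" using Suc[of ?q] by blast
        also have "\<dots> \<longleftrightarrow> (\<forall>a\<in>{e..<k}. q (Suc k) < q a)"
          by (rule ball_cong) (simp_all only: e)
        finally show ?thesis .
      qed
      have B: "endq ?q (rev [e..<k]) = (\<lambda>v. if e < k \<and> v = e then ?q k else if e < v \<and> v \<le> k then ?q (v - 1) else ?q v)"
        using Suc[of ?q] by blast
      have "{e..<Suc k} = insert k {e..<k}" using True by auto
      then have "pth q (rev [e..<Suc k]) \<longleftrightarrow> (\<forall>a\<in>{e..<Suc k}. q (Suc k) < q a)"
        unfolding r pth.simps A by simp
      moreover have "endq q (rev [e..<Suc k]) = (\<lambda>v. if e < Suc k \<and> v = e then q (Suc k) else if e < v \<and> v \<le> Suc k then q (v - 1) else q v)"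
        unfolding r endq.simps B using True by (auto simp: fun_eq_iff transpose_def)
      ultimately show ?thesis by simp
    qed (auto simp: fun_eq_iff)
  qed (auto simp: fun_eq_iff)
  then show ?A ?B by blast+
qed

text \<open>After one run the former entry of position n + 1 stands at t and the former entry of n
  at n + 1. The first run required the former to be the smaller one, the second run would require
  the opposite.\<close>

lemma no_double_run: "t \<le> n \<Longrightarrow> \<not> pth q (rev [t..<Suc n] @ rev [t..<Suc n] @ as)"
proof
  assume t: "t \<le> n" and p: "pth q (rev [t..<Suc n] @ rev [t..<Suc n] @ as)"
  let ?q = "endq q (rev [t..<Suc n])"
  have 1: "\<forall>a\<in>{t..<Suc n}. q (Suc n) < q a" and 2: "\<forall>a\<in>{t..<Suc n}. ?q (Suc n) < ?q a"
    using p unfolding pth_append pth_run(1) by auto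
  have "?q (Suc n) = q n" "?q t = q (Suc n)" using t by (auto simp: pth_run(2))
  then show False using 1 2 t by (metis atLeastLessThan_iff less_Suc_eq_le less_asym order_refl le_imp_less_Suc)
qed

text \<open>The state of an induction that raises d: the positions up to d are settled, and the
  values above d contain no 132.\<close>

definition dom :: "nat \<Rightarrow> nat \<Rightarrow> (nat \<Rightarrow> nat) \<Rightarrow> bool" where
  "dom m d q \<longleftrightarrow> q permutes {1..m} \<and> (\<forall>i\<le>d. q i = i) \<and>
     (\<forall>x y z. d < q x \<longrightarrow> q x < q z \<longrightarrow> q z < q y \<longrightarrow> \<not> (x < y \<and> y < z))"

lemma pth_fix_letters:
  assumes "q permutes {1..m}" "\<forall>i\<le>d. q i = i" "\<forall>a\<in>set as. 1 \<le> a" "pth q as"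
  shows "\<forall>a\<in>set as. d < a"
  using assms
proof (induction as arbitrary: q)
  case (Cons a as)
  have inj: "inj q" using Cons.prems(1) by (rule permutes_inj)
  have d: "q (Suc a) < q a" using Cons.prems by simp
  have da: "d < a"
  proof (rule ccontr)
    assume "\<not> d < a"
    then have "q a = a" using Cons.prems by simp
    then have "q (q (Suc a)) = q (Suc a)" using Cons.prems(2) d \<open>\<not> d < a\<close> by simp
    then have "q (Suc a) = Suc a" using inj by (simp add: inj_eq)
    then show False using d \<open>q a = a\<close> by simp
  qed
  have "\<forall>b\<in>set as. d < b"
  proof (rule Cons.IH)
    show "q \<circ> transpose a (Suc a) permutes {1..m}"
      using permutes_desc[OF Cons.prems(1) _ d] Cons.prems(3) by simp
    show "\<forall>i\<le>d. (q \<circ> transpose a (Suc a)) i = i" using Cons.prems(2) da by (auto simp: transpose_def)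
    show "pth (q \<circ> transpose a (Suc a)) as" using Cons.prems(4) unfolding pth.simps by blast
    show "\<forall>a\<in>set as. 1 \<le> a" using Cons.prems(3) by simp
  qed
  then show ?case using da by simp
qed simp

lemma endq_permutes:
  assumes "q permutes {1..m}" "\<forall>a\<in>set as. 1 \<le> a" "pth q as"
  shows "endq q as permutes {1..m}"
  using assms
proof (induction as arbitrary: q)
  case (Cons a as)
  have "endq (q \<circ> transpose a (Suc a)) as permutes {1..m}"
  proof (rule Cons.IH)
    show "q \<circ> transpose a (Suc a) permutes {1..m}"
      using permutes_desc[OF Cons.prems(1)] Cons.prems(2,3) by simp
    show "pth (q \<circ> transpose a (Suc a)) as" using Cons.prems(3) unfolding pth.simps by blast
    show "\<forall>a\<in>set as. 1 \<le> a" using Cons.prems(2) by simp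
  qed
  then show ?case by (simp only: endq.simps)
qed simp

text \<open>The value e has to travel from the right of e to position e, and only the letter e
  exchanges the positions e and e + 1.\<close>

lemma wire_letter:
  assumes "endq q as = id" "q v = e" "e < v"
  shows "e \<in> set as"
  using assms
proof (induction as arbitrary: q v)
  case (Cons a as)
  let ?t = "transpose a (Suc a)"
  have q: "(q \<circ> ?t) (?t v) = e" using Cons.prems by simp
  show ?case
  proof (cases "e < ?t v")
    case True
    have "e \<in> set as"
    proof (rule Cons.IH)
      show "endq (q \<circ> ?t) as = id" using Cons.prems(1) unfolding endq.simps .
    qed (use q True in auto)
    then show ?thesis by simp
  next
    case False
    then have "a = e" using Cons.prems(3) by (auto simp: transpose_def split: if_splits)
    then show ?thesis by simp
  qed
qed simp

text \<open>A value that is minimal among the positions from e on cannot move to the right along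
  descents, and it moves to the left one position at a time; thus every letter from e to k - 1 is
  used.\<close>

lemma wire_down:
  assumes "sorted_wrt (>) c" "pth q c" "inj q" "q k = p" "\<forall>v\<ge>e. p \<le> q v" "\<forall>a\<in>set c. e \<le> a" "endq q c e = p" "e \<le> k"
  shows "{e..<k} \<subseteq> set c"
  using assms
proof (induction c arbitrary: q k)
  case Nil
  then have "q e = q k" by simp
  then have "e = k" using Nil.prems(3) by (simp add: inj_eq)
  then show ?case by simp
next
  case (Cons a c)
  let ?t = "transpose a (Suc a)"
  have d: "q (Suc a) < q a" and ae: "e \<le> a" using Cons.prems by auto
  have ak: "a \<noteq> k"
  proof
    assume "a = k"
    then have "p \<le> q (Suc k)" using Cons.prems(5,8) by simp
    then show False using d Cons.prems(4) \<open>a = k\<close> by simp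
  qed
  have inj: "inj (q \<circ> ?t)" using Cons.prems(3) by (simp add: inj_compose bij_is_inj)
  have min: "\<forall>v\<ge>e. p \<le> (q \<circ> ?t) v" using Cons.prems(5) ae by (auto simp: transpose_def)
  have P: "pth (q \<circ> ?t) c" using Cons.prems(2) unfolding pth.simps by blast
  have E: "endq (q \<circ> ?t) c e = p" using Cons.prems(7) unfolding endq.simps .
  have S: "sorted_wrt (>) c" "\<forall>a\<in>set c. e \<le> a" using Cons.prems(1,6) by auto
  show ?case
  proof (cases "Suc a = k")
    case True
    have "(q \<circ> ?t) a = p" using True Cons.prems(4) by simp
    from Cons.IH[OF S(1) P inj this min S(2) E ae]
    have "{e..<a} \<subseteq> set c" .
    moreover have "{e..<k} = insert a {e..<a}" using True ae by auto
    ultimately show ?thesis by auto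
  next
    case False
    have "(q \<circ> ?t) k = p" using False ak Cons.prems(4) by simp
    from Cons.IH[OF S(1) P inj this min S(2) E Cons.prems(8)]
    have "{e..<k} \<subseteq> set c" .
    then show ?thesis by auto
  qed
qed

lemma dom_gt:
  assumes "dom m d q" "d < v"
  shows "d < q v"
proof (rule ccontr)
  assume "\<not> d < q v"
  then have "q (q v) = q v" using assms(1) by (simp add: dom_def)
  moreover have "inj q" using assms(1) by (auto simp: dom_def permutes_inj)
  ultimately have "q v = v" by (simp add: inj_eq)
  then show False using assms(2) \<open>\<not> d < q v\<close> by simp
qed

lemma sorted_gt_eq:
  assumes "sorted_wrt (>) c" "sorted_wrt (>) d" "set c = set (d :: nat list)"
  shows "c = d"
proof -
  have "rev c = rev d"
    by (rule strict_sorted_equal) (use assms in \<open>auto simp: sorted_wrt_rev\<close>)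
  then show ?thesis by simp
qed

text \<open>The letter d + 1 occurs only in this column. Otherwise goodness would put it into the
  next column too, together with a run which, again by goodness, both columns share; after commuting
  letters the run would be doubled, against \<open>no_double_run\<close>. Hence this column alone
  brings the value d + 1 home and contains all letters of the claimed run. A letter beyond the run
  would start at a descent to the right of k, and this would be a 132.\<close>

lemma dom_first_column:
  assumes cs: "c # cs \<in> fs m M q" "good (c # cs)" and D: "dom m d q" and k: "q k = Suc d" "Suc d < k"
  shows "c = rev [Suc d..<k]"
proof -
  have q: "q permutes {1..m}" and fx: "\<forall>i\<le>d. q i = i" using D by (auto simp: dom_def)
  have inj: "inj q" using q by (rule permutes_inj)
  have srt: "sorted_wrt (>) b" "set b \<subseteq> {1..m}" if "b \<in> set (c # cs)" for b
    using cs(1) that unfolding fs_def by blast+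
  have p: "pth q (concat (c # cs))" "endq q (concat (c # cs)) = id" using cs(1) unfolding fs_def by blast+
  have pos: "\<forall>a\<in>set (concat (c # cs)). 1 \<le> a" using srt by fastforce
  have big: "d < a" if "b \<in> set (c # cs)" "a \<in> set b" for a b
    using pth_fix_letters[OF q fx pos p(1)] that by auto
  have gl: "length (lo x ((c # cs) ! Suc j)) \<le> length (lo x ((c # cs) ! j))" if "Suc j < length (c # cs)" for j x
    using cs(2) that unfolding good_def viol_def by (meson not_le)
  have lo_all: "length (lo x b) = card {a \<in> set b. a \<le> x}" if "b \<in> set (c # cs)" for b x
    using sorted_gt_distinct[OF srt(1)[OF that]] distinct_length_filter[of b "\<lambda>a. a \<le> x"]
    unfolding lo_def by (simp add: Int_def conj_commute)
  have lo1: "Suc d \<in> set b \<longleftrightarrow> 0 < length (lo (Suc d) b)" if "b \<in> set (c # cs)" for b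
  proof -
    have "a \<le> Suc d \<longleftrightarrow> a = Suc d" if "a \<in> set b" for a using big[OF \<open>b \<in> _\<close> that] by auto
    then have "{a \<in> set b. a \<le> Suc d} = (if Suc d \<in> set b then {Suc d} else {})" by auto
    then show ?thesis unfolding lo_all[OF that] by simp
  qed
  have notin: "Suc d \<notin> set b" if "b \<in> set cs" for b
  proof
    assume "Suc d \<in> set b"
    then obtain j where j: "j < length cs" "cs ! j = b" using \<open>b \<in> set cs\<close> by (auto simp: in_set_conv_nth)
    have A: "0 < length (lo (Suc d) ((c # cs) ! Suc j)) \<Longrightarrow> j < length cs \<Longrightarrow> 0 < length (lo (Suc d) ((c # cs) ! Suc 0))" for j
    proof (induction j)
      case (Suc j)
      have "length (lo (Suc d) ((c # cs) ! Suc (Suc j))) \<le> length (lo (Suc d) ((c # cs) ! Suc j))"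
        using gl[of "Suc j" "Suc d"] Suc.prems(2) by simp
      then have "0 < length (lo (Suc d) ((c # cs) ! Suc j))" using Suc.prems(1) by linarith
      then show ?case using Suc.IH Suc.prems(2) by simp
    qed simp
    have "0 < length (lo (Suc d) ((c # cs) ! Suc j))" using lo1[of b] that j \<open>Suc d \<in> set b\<close> by simp
    then have 1: "0 < length (lo (Suc d) ((c # cs) ! Suc 0))" using A j(1) by blast
    obtain D cs2 where cs2: "cs = D # cs2" using j(1) by (cases cs) auto
    have Dm: "D \<in> set (c # cs)" "c \<in> set (c # cs)" using cs2 by auto
    have eD: "Suc d \<in> set D" using 1 lo1[OF Dm(1)] cs2 by simp
    \<comment> \<open>The letters d + 1, ..., n form the maximal run of consecutive letters starting
      with d + 1 in the column \<open>D\<close>.\<close>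
    define n where "n = (LEAST n. Suc d \<le> n \<and> Suc n \<notin> set D)"
    have "finite (set D)" by simp
    then obtain B where "\<forall>x\<in>set D. x \<le> B" using finite_nat_set_iff_bounded_le by blast
    then have "Suc d \<le> B \<and> Suc B \<notin> set D" using eD by fastforce
    then have n: "Suc d \<le> n" "Suc n \<notin> set D"
      unfolding n_def using LeastI[of "\<lambda>n. Suc d \<le> n \<and> Suc n \<notin> set D" B] by blast+
    have runD: "{Suc d..n} \<subseteq> set D"
    proof
      fix z assume z: "z \<in> {Suc d..n}"
      show "z \<in> set D"
      proof (cases "z = Suc d")
        case False
        then have "z - 1 < n" "Suc d \<le> z - 1" "Suc (z - 1) = z" using z by auto
        then show ?thesis using not_less_Least[of "z - 1" "\<lambda>n. Suc d \<le> n \<and> Suc n \<notin> set D"] unfolding n_def by auto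
      qed (use eD in simp)
    qed
    have eqD: "{a \<in> set D. a \<le> n} = {Suc d..n}" using runD big[OF Dm(1)] by (auto simp: Suc_le_eq)
    have "length (lo n D) \<le> length (lo n c)" using gl[of 0 n] cs2 by simp
    then have "card {Suc d..n} \<le> card {a \<in> set c. a \<le> n}" unfolding lo_all[OF Dm(1)] lo_all[OF Dm(2)] eqD .
    moreover have "{a \<in> set c. a \<le> n} \<subseteq> {Suc d..n}" using big[OF Dm(2)] by (auto simp: Suc_le_eq)
    ultimately have eqc: "{a \<in> set c. a \<le> n} = {Suc d..n}" by (intro card_seteq) auto
    let ?r = "rev [Suc d..<Suc n]"
    have lor: "lo n b = ?r" if "b \<in> set (c # cs)" "{a \<in> set b. a \<le> n} = {Suc d..n}" for b
    proof (rule sorted_gt_eq)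
      show "sorted_wrt (>) (lo n b)" unfolding lo_def using srt(1)[OF that(1)] by (rule sorted_wrt_filter)
      show "sorted_wrt (>) ?r" by (rule sorted_gt_rev_upt)
      have "set (lo n b) = {a \<in> set b. a \<le> n}" unfolding lo_def by (rule set_filter)
      also have "\<dots> = {Suc d..n}" by (rule that(2))
      finally show "set (lo n b) = set ?r" by (simp only: set_rev set_upt atLeastLessThanSuc_atLeastAtMost)
    qed
    have eqs: "c = hi n c @ ?r" "D = hi n D @ ?r"
      using hi_lo[OF srt(1)[OF Dm(2)], of n] hi_lo[OF srt(1)[OF Dm(1)], of n] lor[OF Dm(2) eqc] lor[OF Dm(1) eqD] by simp_all
    let ?q = "endq q (hi n c)"
    have "concat (c # cs) = c @ D @ concat cs2" using cs2 by simp
    also have "\<dots> = (hi n c @ ?r) @ (hi n D @ ?r) @ concat cs2" unfolding eqs[symmetric] ..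
    finally have cc: "concat (c # cs) = hi n c @ (?r @ hi n D @ (?r @ concat cs2))"
      by (simp only: append_assoc)
    have "pth ?q (?r @ hi n D @ (?r @ concat cs2))" using p(1) unfolding cc pth_append by blast
    moreover have "\<forall>a\<in>set ?r. \<forall>b\<in>set (hi n D). Suc a < b"
    proof (intro ballI)
      fix a b assume "a \<in> set ?r" "b \<in> set (hi n D)"
      then have "a \<le> n" "n < b" "b \<in> set D" by (auto simp: hi_def)
      moreover have "b \<noteq> Suc n" using n(2) \<open>b \<in> set D\<close> by auto
      ultimately show "Suc a < b" by simp
    qed
    ultimately have "pth ?q (hi n D @ ?r @ (?r @ concat cs2))" using pth_comm(1) by blast
    then have "pth (endq ?q (hi n D)) (?r @ ?r @ concat cs2)" unfolding pth_append by blast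
    then show False using no_double_run[OF n(1)] by blast
  qed
  let ?q1 = "endq q c"
  have pc: "pth q c" "endq ?q1 (concat cs) = id" using p by (simp_all add: pth_append endq_append)
  have posc: "\<forall>a\<in>set c. 1 \<le> a" using pos by simp
  have q1: "?q1 permutes {1..m}" using endq_permutes[OF q posc pc(1)] .
  have fx1: "\<forall>a\<in>set as. d < a \<Longrightarrow> \<forall>i\<le>d. endq q' as i = q' i" for as q'
  proof (induction as arbitrary: q')
    case (Cons a as)
    show ?case
    proof (intro allI impI)
      fix i assume "i \<le> d"
      moreover have "d < a" "\<forall>a\<in>set as. d < a" using Cons.prems by auto
      ultimately have "endq (q' \<circ> transpose a (Suc a)) as i = (q' \<circ> transpose a (Suc a)) i" using Cons.IH by blast
      also have "\<dots> = q' i" using \<open>i \<le> d\<close> \<open>d < a\<close> by (simp add: transpose_def)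
      finally show "endq q' (a # as) i = q' i" unfolding endq.simps .
    qed
  qed simp
  have "?q1 (Suc d) = Suc d"
  proof -
    obtain v where v: "?q1 v = Suc d" using permutes_surj[OF q1] by (metis surjD)
    have "\<not> Suc d < v"
    proof
      assume "Suc d < v"
      from wire_letter[OF pc(2) v this] show False using notin by auto
    qed
    moreover have "\<not> v \<le> d" using fx1[of c q] big[of c] fx v by auto
    ultimately show ?thesis using v by (metis le_neq_implies_less not_less_eq_eq not_le_imp_less)
  qed
  have sub: "{Suc d..<k} \<subseteq> set c"
  proof (rule wire_down[OF _ pc(1) inj k(1)])
    show "\<forall>v\<ge>Suc d. Suc d \<le> q v" using dom_gt[OF D] by (simp add: Suc_le_eq)
    show "\<forall>a\<in>set c. Suc d \<le> a" using big[of c] by (simp add: Suc_le_eq)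
  qed (use srt[of c] k \<open>?q1 (Suc d) = Suc d\<close> in auto)
  then obtain a c' where c: "c = a # c'" using k(2) by (cases c) auto
  have desc: "q (Suc a) < q a" using pc(1) c by simp
  have "d < a" using big[of c a] c by simp
  have "a < k"
  proof (rule ccontr)
    assume "\<not> a < k"
    moreover have "a \<noteq> k" using desc k dom_gt[OF D, of "Suc k"] \<open>d < a\<close> by auto
    ultimately have "k < a" by simp
    have "q k < q (Suc a)"
    proof -
      have "d < q (Suc a)" using dom_gt[OF D] \<open>d < a\<close> by simp
      moreover have "q (Suc a) \<noteq> q k" using inj \<open>k < a\<close> by (simp add: inj_eq)
      ultimately show ?thesis using k(1) by simp
    qed
    then show False using D desc \<open>k < a\<close> k(1) unfolding dom_def by (metis lessI)
  qed
  have "set c \<subseteq> {Suc d..<k}"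
  proof
    fix b assume b: "b \<in> set c"
    then have "b \<le> a" using srt(1)[of c] c by auto
    then show "b \<in> {Suc d..<k}" using \<open>a < k\<close> big[of c b] b by auto
  qed
  then have "set c = set (rev [Suc d..<k])" using sub by auto
  then show ?thesis using sorted_gt_eq[OF srt(1)[of c] sorted_gt_rev_upt] by simp
qed

lemma dom_step:
  assumes D: "dom m d q" and k: "q k = Suc d" "Suc d < k"
  shows "pth q (rev [Suc d..<k])" "dom m (Suc d) (endq q (rev [Suc d..<k]))"
proof -
  have q: "q permutes {1..m}" and fx: "\<forall>i\<le>d. q i = i" using D by (auto simp: dom_def)
  have inj: "inj q" using q by (rule permutes_inj)
  show P: "pth q (rev [Suc d..<k])"
  proof -
    have "q k < q a" if "a \<in> {Suc d..<k}" for a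
    proof -
      have "d < q a" using dom_gt[OF D] that by simp
      moreover have "q a \<noteq> q k" using inj that by (simp add: inj_eq)
      ultimately show ?thesis using k(1) by simp
    qed
    then show ?thesis by (simp add: pth_run(1))
  qed
  let ?q = "endq q (rev [Suc d..<k])"
  have q': "?q v = (if v = Suc d then Suc d else if Suc d < v \<and> v \<le> k then q (v - 1) else q v)" for v
    unfolding pth_run(2) using k by simp
  have "?q permutes {1..m}" by (rule endq_permutes[OF q _ P]) simp
  moreover have "\<forall>i\<le>Suc d. ?q i = i" using fx by (auto simp: q')
  moreover have False if xyz: "Suc d < ?q x" "?q x < ?q z" "?q z < ?q y" "x < y" "y < z" for x y z
  proof -
    define \<sigma> where "\<sigma> v = (if v \<le> k then v - 1 else v)" for v :: nat
    have "Suc d < x"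
    proof (rule ccontr)
      assume "\<not> Suc d < x"
      then have "?q x = x" using fx by (auto simp: q')
      then show False using xyz(1) \<open>\<not> Suc d < x\<close> by simp
    qed
    then have "?q v = q (\<sigma> v)" if "v \<in> {x, y, z}" for v using xyz that by (auto simp: q' \<sigma>_def)
    moreover have "\<sigma> x < \<sigma> y" "\<sigma> y < \<sigma> z" using xyz \<open>Suc d < x\<close> by (auto simp: \<sigma>_def)
    ultimately show False using D xyz unfolding dom_def by (metis Suc_lessD insertCI)
  qed
  ultimately show "dom m (Suc d) ?q" unfolding dom_def by blast
qed

lemma dom_nonfixed:
  assumes D: "dom m d q" and "q \<noteq> id"
  shows "\<exists>e\<ge>d. \<exists>k. dom m e q \<and> q k = Suc e \<and> Suc e < k"
proof -
  have q: "q permutes {1..m}" and fx: "\<forall>i\<le>d. q i = i" using D by (auto simp: dom_def)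
  have inj: "inj q" using q by (rule permutes_inj)
  define n where "n = (LEAST n. q n \<noteq> n)"
  have "\<exists>n. q n \<noteq> n" using \<open>q \<noteq> id\<close> by (auto simp: fun_eq_iff)
  then have n: "q n \<noteq> n" unfolding n_def by (rule LeastI_ex[of "\<lambda>n. q n \<noteq> n"])
  have below: "q i = i" if "i < n" for i using not_less_Least[of i "\<lambda>n. q n \<noteq> n"] that unfolding n_def by blast
  have "d < n" using n fx by (meson not_le)
  then obtain e where e: "n = Suc e" "d \<le> e" by (cases n) auto
  obtain k where k: "q k = n" using permutes_surj[OF q] by (metis surjD)
  have "n < k"
  proof (rule ccontr)
    assume "\<not> n < k"
    then show False using n k below[of k] by (cases "k = n") auto
  qed
  moreover have "dom m e q" unfolding dom_def
  proof (intro conjI allI impI notI)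
    fix x y z assume "e < q x" "q x < q z" "q z < q y" "x < y \<and> y < z"
    then show False using D e(2) unfolding dom_def by (meson le_less_trans)
  qed (use q below e in auto)
  ultimately show ?thesis using e k by auto
qed

lemma length_lo_run: "length (lo x (rev [e..<k])) = min (Suc x) k - e"
proof -
  have "length (lo x (rev [e..<k])) = length (filter (\<lambda>a. a \<le> x) [e..<k])" unfolding lo_def by (metis length_rev rev_filter)
  also have "\<dots> = card {a \<in> {e..<k}. a \<le> x}"
    using distinct_length_filter[of "[e..<k]" "\<lambda>a. a \<le> x"] by (simp add: Int_def conj_commute)
  also have "{a \<in> {e..<k}. a \<le> x} = {e..<min (Suc x) k}" by auto
  finally show ?thesis by simp
qed

lemma fs_id: "fs m M id = {replicate M []}"
proof -
  have "concat cs = []" if "pth id (concat cs)" for cs using that by (cases "concat cs") auto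
  then have "cs = replicate (length cs) []" if "pth id (concat cs)" for cs
    using that by (metis concat_eq_Nil_conv replicate_length_same)
  then show ?thesis by (auto simp: fs_def in_set_replicate)
qed

lemma fs_Cons: "c # cs \<in> fs m (Suc M) q \<longleftrightarrow>
    sorted_wrt (>) c \<and> set c \<subseteq> {1..m} \<and> pth q c \<and> cs \<in> fs m M (endq q c)"
  unfolding fs_def by (auto simp: pth_append endq_append)

lemma good_Cons: "good (c # cs) \<longleftrightarrow> good cs \<and> (cs \<noteq> [] \<longrightarrow> (\<forall>x. length (lo x (cs ! 0)) \<le> length (lo x c)))"
proof -
  have "viol (c # cs) x 0 \<longleftrightarrow> cs \<noteq> [] \<and> length (lo x c) < length (lo x (cs ! 0))"
    "viol (c # cs) x (Suc j) \<longleftrightarrow> viol cs x j" for x j by (auto simp: viol_def)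
  then show ?thesis unfolding good_def by (metis not_le nat.exhaust)
qed

text \<open>The leading column is forced to be the run that brings d + 1 home, and the rest is
  handled by induction. For existence the next nonempty run, from position \<open>k'\<close> down,
  must fit beside the run from k: this needs \<open>k'\<close> \<le> k + 1, and a larger
  \<open>k'\<close> would produce a 132 beginning at position k.\<close>

lemma dom_unique: "dom m d q \<Longrightarrow> m \<le> d + M \<Longrightarrow> \<exists>!cs. cs \<in> fs m M q \<and> good cs"
proof (induction "m - d" arbitrary: d M q)
  case 0
  have "q = id"
  proof
    fix x
    have "x \<notin> {1..m}" if "\<not> x \<le> d" using that 0 by simp
    then show "q x = id x" using 0(2) unfolding dom_def permutes_def id_apply by blast
  qed
  moreover have "good (replicate M [])" by (auto simp: good_def viol_def)
  moreover have iff: "cs \<in> fs m M q \<longleftrightarrow> cs = replicate M []" for cs using fs_id[of m M] \<open>q = id\<close> by blast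
  show ?case unfolding iff using calculation(2) by blast
next
  case (Suc n)
  have dm: "d < m" using Suc by simp
  have q: "q permutes {1..m}" and fx: "\<forall>i\<le>d. q i = i" using Suc.prems by (auto simp: dom_def)
  have inj: "inj q" using q by (rule permutes_inj)
  obtain k where k: "q k = Suc d" using permutes_surj[OF q] by (metis surjD)
  have kd: "d < k" using k fx by (metis Suc_n_not_le_n not_le)
  have IH: "dom m (Suc d) q' \<Longrightarrow> m \<le> Suc d + M' \<Longrightarrow> \<exists>!cs. cs \<in> fs m M' q' \<and> good cs" for q' M'
    using Suc.hyps(1)[of "Suc d"] Suc.hyps(2) by simp
  show ?case
  proof (cases "k = Suc d")
    case True
    have "dom m (Suc d) q" unfolding dom_def
    proof (intro conjI allI impI notI)
      fix x y z assume "Suc d < q x" "q x < q z" "q z < q y" "x < y \<and> y < z"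
      then show False using Suc.prems(1) unfolding dom_def by (meson Suc_lessD)
    next
      fix i assume "i \<le> Suc d"
      then show "q i = i" using fx k True by (auto simp: le_Suc_eq)
    qed (rule q)
    then show ?thesis using IH[of q M] Suc.prems(2) by simp
  next
    case False
    then have dk: "Suc d < k" using kd by simp
    obtain M' where M: "M = Suc M'" using Suc.prems(2) dm by (cases M) auto
    let ?c = "rev [Suc d..<k]" and ?q = "endq q (rev [Suc d..<k])"
    note st = dom_step[OF Suc.prems(1) k dk]
    have ex: "\<exists>!cs. cs \<in> fs m M' ?q \<and> good cs" using IH[OF st(2)] Suc.prems(2) M by simp
    then obtain cs where cs: "cs \<in> fs m M' ?q" "good cs" by blast
    have km: "k \<le> m" using permutes_in_image[OF q, of k] k dm by auto
    have le: "length (lo x (cs ! 0)) \<le> length (lo x ?c)" if ne: "cs \<noteq> []" for x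
    proof (cases "?q = id")
      case True
      then have "cs = replicate M' []" using cs(1) by (simp add: fs_id)
      then show ?thesis using ne by (simp add: lo_def)
    next
      case False
      obtain e k' where e: "Suc d \<le> e" "dom m e ?q" "?q k' = Suc e" "Suc e < k'"
        using dom_nonfixed[OF st(2) False] by blast
      obtain c' cs' where cs': "cs = c' # cs'" using ne by (cases cs) auto
      have c': "c' = rev [Suc e..<k']" using dom_first_column[OF _ _ e(2,3,4), of c' cs' M'] cs cs' by simp
      have "k' \<le> Suc k"
      proof (rule ccontr)
        assume gt: "\<not> k' \<le> Suc k"
        have qv: "?q v = q v" if "k < v" for v using that dk unfolding pth_run(2) by auto
        have fe: "?q i = i" if "i \<le> e" for i using e(2) that by (simp add: dom_def)
        have injq: "inj ?q" using e(2) permutes_inj unfolding dom_def by blast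
        have "k' - 1 \<le> e"
        proof -
          have p: "k < k' - 1" "k' - 1 < k'" using gt by auto
          have "\<not> q k' < q (k' - 1)"
          proof
            assume "q k' < q (k' - 1)"
            moreover have "q k < q k'" using k e(1,3) qv[of k'] p by simp
            ultimately show False using Suc.prems(1) p k unfolding dom_def by (metis lessI)
          qed
          moreover have "q k' \<noteq> q (k' - 1)" using inj p(2) by (simp add: inj_eq)
          ultimately have "?q (k' - 1) \<le> e" using qv[of k'] qv[of "k' - 1"] p e(3) by simp
          then have "?q (?q (k' - 1)) = ?q (k' - 1)" using fe by blast
          then have "?q (k' - 1) = k' - 1" using injq by (simp add: inj_eq)
          then show ?thesis using \<open>?q (k' - 1) \<le> e\<close> by simp
        qed
        then show False using e(4) by simp
      qed
      then show ?thesis unfolding cs' c' using e(1) by (simp add: length_lo_run min_def) arith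
    qed
    have "?c # cs \<in> fs m M q" unfolding M fs_Cons using cs(1) st(1) km by (auto simp: sorted_wrt_rev)
    moreover have "good (?c # cs)" using cs(2) le by (simp add: good_Cons)
    moreover have "bs = ?c # cs" if bs: "bs \<in> fs m M q" "good bs" for bs
    proof -
      obtain b bs' where b: "bs = b # bs'" using bs(1) M by (cases bs) (auto simp: fs_def)
      have "b = ?c" using dom_first_column[OF _ _ Suc.prems(1) k dk] bs b by blast
      then have "bs' \<in> fs m M' ?q" "good bs'" using bs unfolding b M fs_Cons good_Cons by blast+
      then show ?thesis using ex cs b \<open>b = ?c\<close> by blast
    qed
    ultimately show ?thesis by blast
  qed
qed

text \<open>The pattern 132 is its own inverse, so the inverse of w satisfies \<open>dom\<close>
  with d = 0.\<close>

theorem EG_132_avoiding: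
  assumes w: "w permutes {1..m}"
    and av: "\<And>a b c. 1 \<le> a \<Longrightarrow> a < b \<Longrightarrow> b < c \<Longrightarrow> \<not> (w a < w c \<and> w c < w b)"
  shows "EG w = 1"
proof -
  let ?q = "inv w"
  have q: "?q permutes {1..m}" using w by (rule permutes_inv)
  have wq: "w (?q x) = x" for x using w by (simp add: permutes_inverses)
  have "dom m 0 ?q" unfolding dom_def
  proof (intro conjI allI impI notI)
    fix x y z assume *: "0 < ?q x" "?q x < ?q z" "?q z < ?q y" "x < y \<and> y < z"
    show False using av[of "?q x" "?q z" "?q y"] * by (simp add: wq)
  next
    fix i :: nat assume "i \<le> 0"
    then show "?q i = i" using q by (simp add: permutes_def)
  qed (rule q)
  then have "\<exists>!cs. cs \<in> fs m (Suc (m * m)) ?q \<and> good cs" by (rule dom_unique) (cases m; simp)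
  then obtain cs where "{cs \<in> fs m (Suc (m * m)) ?q. good cs} = {cs}" by blast
  then have "ngood m (Suc (m * m)) ?q = 1" by (simp add: ngood_def)
  then show ?thesis using EG_ngood(1)[OF w, of "Suc (m * m)"] by simp
qed

section \<open>Executable versions of the finite checks\<close>

text \<open>Small numbers are opaque constants, so that evaluation by the simplifier never meets numerals.
A word with a corner formed by the letters \<open>vr\<close> and \<open>vs\<close> is represented by \<open>L vr M vs R\<close>, where the part \<open>L\<close>
to the left of the corner is stored in reverse. Equations collected under names ending in \<open>run\<close> dispatch on
an already evaluated boolean, which keeps the simplifier from descending into branches that are not taken.\<close>

definition c0 :: nat where "c0 = 0"
definition c1 :: nat where "c1 = 1"
definition c2 :: nat where "c2 = 2"
definition c3 :: nat where "c3 = 3"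
definition c4 :: nat where "c4 = 4"
definition c5 :: nat where "c5 = 5"
definition c6 :: nat where "c6 = 6"
definition c7 :: nat where "c7 = 7"
definition c8 :: nat where "c8 = 8"
definition c9 :: nat where "c9 = 9"
definition ca :: nat where "ca = 10"
definition cb :: nat where "cb = 11"
definition cc :: nat where "cc = 12"

lemmas c_defs = c0_def c1_def c2_def c3_def c4_def c5_def c6_def c7_def c8_def c9_def ca_def cb_def cc_def

fun vl :: "nat \<Rightarrow> nat list" where
  "vl 0 = [0]"
| "vl (Suc n) = Suc n # vl n"

fun ups :: "bool \<Rightarrow> nat \<Rightarrow> nat" where
  "ups True x = x"
| "ups False x = Suc x"

fun up :: "nat \<Rightarrow> nat list \<Rightarrow> nat list" where
  "up c [] = []"
| "up c (x # xs) = ups (x < c) x # up c xs"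

fun rap :: "'a list \<Rightarrow> 'a list \<Rightarrow> 'a list" where
  "rap [] l = l"
| "rap (x # xs) l = rap xs (x # l)"

text \<open>Maximality of a corner is visible behind it in this form: the letters not below t
  increase and start at b or higher.\<close>

fun inr :: "nat \<Rightarrow> nat \<Rightarrow> nat list \<Rightarrow> bool" where
  "inr t b [] = True"
| "inr t b (x # xs) = (if x < t then inr t b xs else if x < b then False else inr t x xs)"

definition "inr2 c t x xs = (if c then False else inr t x xs)"
definition "inr1 c t b x xs = (if c then inr t b xs else inr2 (x < b) t x xs)"
lemma inr_run: "inr t b [] = True" "inr t b (x # xs) = inr1 (x < t) t b x xs"
  "inr1 True t b x xs = inr t b xs" "inr1 False t b x xs = inr2 (x < b) t x xs"
  "inr2 True t x xs = False" "inr2 False t x xs = inr t x xs"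
  by (simp_all add: inr1_def inr2_def)

fun allt :: "nat \<Rightarrow> nat list \<Rightarrow> bool" where
  "allt v [] = True"
| "allt v (x # xs) = (if x < v then allt v xs else False)"

definition "allt1 c v xs = (if c then allt v xs else False)"
lemma allt_run: "allt v [] = True" "allt v (x # xs) = allt1 (x < v) v xs" "allt1 True v xs = allt v xs" "allt1 False v xs = False"
  by (simp_all add: allt1_def)

fun nb :: "nat \<Rightarrow> nat \<Rightarrow> nat list \<Rightarrow> bool" where
  "nb a b [] = True"
| "nb a b (x # xs) = (if x < a then nb a b xs else if x < b then False else nb a b xs)"

definition "nb2 c a b xs = (if c then False else nb a b xs)"
definition "nb1 c a b x xs = (if c then nb a b xs else nb2 (x < b) a b xs)"
lemma nb_run: "nb a b [] = True" "nb a b (x # xs) = nb1 (x < a) a b x xs"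
  "nb1 True a b x xs = nb a b xs" "nb1 False a b x xs = nb2 (x < b) a b xs"
  "nb2 True a b xs = False" "nb2 False a b xs = nb a b xs"
  by (simp_all add: nb1_def nb2_def)

fun mna :: "nat \<Rightarrow> nat \<Rightarrow> nat list \<Rightarrow> nat" where
  "mna x b [] = b"
| "mna x b (y # ys) = (if y < x then mna x b ys else if y < b then mna x y ys else mna x b ys)"

definition "mna2 c x b y ys = (if c then mna x y ys else mna x b ys)"
definition "mna1 c x b y ys = (if c then mna x b ys else mna2 (y < b) x b y ys)"
lemma mna_run: "mna x b [] = b" "mna x b (y # ys) = mna1 (y < x) x b y ys"
  "mna1 True x b y ys = mna x b ys" "mna1 False x b y ys = mna2 (y < b) x b y ys"
  "mna2 True x b y ys = mna x y ys" "mna2 False x b y ys = mna x b ys"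
  by (simp_all add: mna1_def mna2_def)

text \<open>On a reversed prefix this is the least letter that precedes a smaller one, capped by b:
  the cheapest choice of the letter 2 in a 21, which the letters 4 and 3 of a 2143 have to
  exceed.\<close>

fun hm :: "nat \<Rightarrow> nat list \<Rightarrow> nat" where
  "hm b [] = b"
| "hm b (x # r) = hm (mna x b r) r"

text \<open>Here \<open>mx\<close> is the greatest letter below vs met so far on the way from the
  corner to the left, so that x is an unobstructed child point exactly if it is below vs and not
  below \<open>mx\<close>. The tail \<open>T\<close> is supplied with vr already moved to the place
  of vs.\<close>

fun kd :: "nat \<Rightarrow> nat list \<Rightarrow> nat list \<Rightarrow> nat \<Rightarrow> nat list \<Rightarrow> nat list list" where
  "kd mx [] L2 vs T = []"
| "kd mx (x # r) L2 vs T = (if x < vs then if x < mx then kd mx r (x # L2) vs T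
     else rap r (vs # L2 @ x # T) # kd x r (x # L2) vs T else kd mx r (x # L2) vs T)"

definition "kd2 c mx x r L2 vs T = (if c then kd mx r (x # L2) vs T else rap r (vs # L2 @ x # T) # kd x r (x # L2) vs T)"
definition "kd1 c mx x r L2 vs T = (if c then kd2 (x < mx) mx x r L2 vs T else kd mx r (x # L2) vs T)"
lemma kd_run: "kd mx [] L2 vs T = []" "kd mx (x # r) L2 vs T = kd1 (x < vs) mx x r L2 vs T"
  "kd1 False mx x r L2 vs T = kd mx r (x # L2) vs T" "kd1 True mx x r L2 vs T = kd2 (x < mx) mx x r L2 vs T"
  "kd2 True mx x r L2 vs T = kd mx r (x # L2) vs T"
  "kd2 False mx x r L2 vs T = rap r (vs # L2 @ x # T) # kd x r (x # L2) vs T"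
  by (simp_all add: kd1_def kd2_def)

fun ci :: "nat \<Rightarrow> nat list \<Rightarrow> nat \<Rightarrow> nat" where
  "ci mx [] vs = 0"
| "ci mx (x # r) vs = (if x < vs then if x < mx then ci mx r vs else Suc (ci x r vs) else ci mx r vs)"

definition "ci2 c mx x r vs = (if c then ci mx r vs else Suc (ci x r vs))"
definition "ci1 c mx x r vs = (if c then ci2 (x < mx) mx x r vs else ci mx r vs)"
lemma ci_run: "ci mx [] vs = 0" "ci mx (x # r) vs = ci1 (x < vs) mx x r vs"
  "ci1 False mx x r vs = ci mx r vs" "ci1 True mx x r vs = ci2 (x < mx) mx x r vs"
  "ci2 True mx x r vs = ci mx r vs" "ci2 False mx x r vs = Suc (ci x r vs)"
  by (simp_all add: ci1_def ci2_def)

datatype cres = NoC | Cr "nat list" nat "nat list" nat "nat list"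

fun lsr :: "cres \<Rightarrow> nat list \<Rightarrow> nat \<Rightarrow> nat \<Rightarrow> nat list \<Rightarrow> nat \<Rightarrow> nat list \<Rightarrow> cres" where
  "lsr (Cr A b C d E) rP x h rM y T = Cr A b C d E"
| "lsr NoC rP x h rM y T = (if y < x then if h < y then Cr rP x rM y T else NoC else NoC)"

definition "lsr2 c rP x rM y T = (if c then Cr rP x rM y T else NoC)"
definition "lsr1 c rP x h rM y T = (if c then lsr2 (h < y) rP x rM y T else NoC)"
lemma lsr_run: "lsr (Cr A b C d E) rP x h rM y T = Cr A b C d E" "lsr NoC rP x h rM y T = lsr1 (y < x) rP x h rM y T"
  "lsr1 False rP x h rM y T = NoC" "lsr1 True rP x h rM y T = lsr2 (h < y) rP x rM y T"
  "lsr2 False rP x rM y T = NoC" "lsr2 True rP x rM y T = Cr rP x rM y T"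
  by (simp_all add: lsr1_def lsr2_def)

fun ls :: "nat list \<Rightarrow> nat \<Rightarrow> nat \<Rightarrow> nat list \<Rightarrow> nat list \<Rightarrow> cres" where
  "ls rP x h rM [] = NoC"
| "ls rP x h rM (y # T) = lsr (ls rP x h (y # rM) T) rP x h rM y T"

fun cnr :: "cres \<Rightarrow> nat \<Rightarrow> nat list \<Rightarrow> nat \<Rightarrow> nat list \<Rightarrow> cres" where
  "cnr (Cr A b C d E) h rP x T = Cr A b C d E"
| "cnr NoC h rP x T = (if h < x then ls rP x h [] T else NoC)"

definition "cnr1 c h rP x T = (if c then ls rP x h [] T else NoC)"
lemma cnr_run: "cnr (Cr A b C d E) h rP x T = Cr A b C d E" "cnr NoC h rP x T = cnr1 (h < x) h rP x T"
  "cnr1 True h rP x T = ls rP x h [] T" "cnr1 False h rP x T = NoC"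
  by (simp_all add: cnr1_def)

text \<open>Later positions are tried before earlier ones, for the upper corner letter here and for
  the lower one in \<open>ls\<close>, so the result is the lexicographically last corner above the
  threshold h.\<close>

fun cn :: "nat \<Rightarrow> nat list \<Rightarrow> nat list \<Rightarrow> cres" where
  "cn h rP [] = NoC"
| "cn h rP (x # T) = cnr (cn (mna x h rP) (x # rP) T) h rP x T"

text \<open>\<open>need\<close> computes the truncated difference of \<open>e\<close> and the value of \<open>EG\<close> by running through the children,
stopping as soon as it is zero; its first argument is fuel.\<close>

fun strip :: "nat \<Rightarrow> nat list list \<Rightarrow> nat" where
  "strip e [] = e"
| "strip e [k] = e"
| "strip 0 (k # l # ks) = 0"
| "strip (Suc e) (k # l # ks) = strip e (l # ks)"

fun needs :: "(nat \<Rightarrow> nat list \<Rightarrow> nat) \<Rightarrow> nat \<Rightarrow> nat list list \<Rightarrow> nat" where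
  "needs N e [] = e"
| "needs N 0 (k # ks) = 0"
| "needs N (Suc e) (k # ks) = needs N (N (Suc e) k) ks"

fun needk :: "(nat \<Rightarrow> nat list \<Rightarrow> nat) \<Rightarrow> nat \<Rightarrow> nat list list \<Rightarrow> nat" where
  "needk N e [] = e"
| "needk N e (k # ks) = needs N (strip e (k # ks)) (k # ks)"

fun needv :: "bool \<Rightarrow> bool \<Rightarrow> (nat \<Rightarrow> nat list \<Rightarrow> nat) \<Rightarrow> nat \<Rightarrow> nat list \<Rightarrow> nat \<Rightarrow> nat list \<Rightarrow> nat \<Rightarrow> nat list \<Rightarrow> nat" where
  "needv True True N e rL vr rM vs R = needk N e (kd c0 rL [] vs (rap rM (vr # R)))"
| "needv True False N e rL vr rM vs R = e"
| "needv False b N e rL vr rM vs R = e"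

fun needc :: "(nat \<Rightarrow> nat list \<Rightarrow> nat) \<Rightarrow> nat \<Rightarrow> cres \<Rightarrow> nat" where
  "needc N e NoC = e"
| "needc N e (Cr rL vr rM vs R) = needv (allt vs rM) (nb vs vr R) N e rL vr rM vs R"

fun need :: "nat \<Rightarrow> nat \<Rightarrow> nat list \<Rightarrow> nat" where
  "need 0 e l = e"
| "need (Suc f) 0 l = 0"
| "need (Suc f) (Suc e) l = needc (need f) (Suc e) (cn cc [] l)"

fun zero :: "nat \<Rightarrow> bool" where "zero 0 = True" | "zero (Suc n) = False"

text \<open>The fuel bounds the depth of the recursion; when it is exhausted the deficit is returned
  unchanged, so the test errs only towards False. It certifies a value of at least e + 1.\<close>

definition ge :: "nat \<Rightarrow> nat list \<Rightarrow> bool" where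
  "ge e l = zero (need (Suc (Suc (Suc (Suc (Suc (Suc (Suc (Suc (Suc (Suc (Suc (Suc 0)))))))))))) e l)"

fun ges :: "nat \<Rightarrow> nat list list \<Rightarrow> bool" where
  "ges e [] = True"
| "ges e (l # ks) = (if ge e l then ges e ks else False)"

fun lq :: "nat \<Rightarrow> nat \<Rightarrow> bool" where
  "lq 0 n = True"
| "lq (Suc m) 0 = False"
| "lq (Suc m) (Suc n) = lq m n"

fun eqn :: "nat \<Rightarrow> nat \<Rightarrow> bool" where
  "eqn 0 0 = True"
| "eqn (Suc m) 0 = False"
| "eqn 0 (Suc n) = False"
| "eqn (Suc m) (Suc n) = eqn m n"

fun bel :: "nat \<Rightarrow> nat \<Rightarrow> nat list \<Rightarrow> bool" where
  "bel x z [] = False"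
| "bel x z (y # ys) = (if y < z then if x < y then True else bel x z ys else bel x z ys)"

fun inv43 :: "nat \<Rightarrow> nat list \<Rightarrow> bool" where
  "inv43 x [] = False"
| "inv43 x (z # zs) = (if z < x then inv43 x zs else if bel x z zs then True else inv43 x zs)"

fun f21 :: "nat \<Rightarrow> nat list \<Rightarrow> bool" where
  "f21 x [] = False"
| "f21 x (y # ys) = (if y < x then inv43 x ys else f21 x ys)"

text \<open>The test for 2143. Once a letter below x has been met, what remains is to find a descent
  above x behind it, and the earliest such letter leaves the most room.\<close>

fun nv :: "nat list \<Rightarrow> bool" where
  "nv [] = False"
| "nv (x # xs) = (if f21 x xs then True else nv xs)"

fun nvs :: "nat list list \<Rightarrow> bool" where
  "nvs [] = True"
| "nvs (k # ks) = (if nv k then nvs ks else False)"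

text \<open>Equality is decided through the order alone, so that the rewrite rules for
  \<open><\<close> on the constants suffice.\<close>

fun eqv :: "nat list \<Rightarrow> nat list \<Rightarrow> bool" where
  "eqv [] [] = True"
| "eqv [] (y # ys) = False"
| "eqv (x # xs) [] = False"
| "eqv (x # xs) (y # ys) = (if x < y then False else if y < x then False else eqv xs ys)"

fun memb :: "nat list \<Rightarrow> nat list list \<Rightarrow> bool" where
  "memb l [] = False"
| "memb l (p # ps) = (if eqv p l then True else memb l ps)"

fun anydel :: "nat \<Rightarrow> nat list \<Rightarrow> nat list \<Rightarrow> bool" where
  "anydel e A [] = False"
| "anydel e A (x # xs) = (if ge e (rap A xs) then True else anydel e (x # A) xs)"

definition wl :: "nat list \<Rightarrow> nat \<Rightarrow> nat list \<Rightarrow> nat \<Rightarrow> nat list \<Rightarrow> nat list" where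
  "wl L vr M vs R = rap L (vr # M @ vs # R)"

definition xl :: "nat list \<Rightarrow> nat \<Rightarrow> nat list \<Rightarrow> nat \<Rightarrow> nat list \<Rightarrow> nat \<Rightarrow> nat list \<Rightarrow> nat list" where
  "xl L1 va L2 vr M vs R = rap L1 (vs # rap L2 (va # M @ vr # R))"

text \<open>What a check has to show for a configuration: deleting some letter keeps the value above
  e, so the word is not minimal, or the word is in the list P. Deleting a corner letter is merely
  tried before the other deletions.\<close>

definition concl :: "nat \<Rightarrow> nat list list \<Rightarrow> nat list \<Rightarrow> nat \<Rightarrow> nat list \<Rightarrow> nat \<Rightarrow> nat list \<Rightarrow> bool" where
  "concl e P L vr M vs R = (if ge e (rap L (M @ vs # R)) then True else if ge e (rap L (vr # M @ R)) then True
     else if memb (wl L vr M vs R) P then True else anydel e [] (wl L vr M vs R))"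

definition okh1 :: "nat \<Rightarrow> nat \<Rightarrow> nat list \<Rightarrow> nat \<Rightarrow> nat list \<Rightarrow> bool" where
  "okh1 h vr M vs R = (if h < vs then if inr h h M then nb h vr R else False else False)"

text \<open>A necessary condition for vr and vs to be the 43 of the lexicographically last 2143; it
  passes to windows that contain the corner and still show a 21 below vs in front of it.\<close>

definition okh :: "nat list \<Rightarrow> nat \<Rightarrow> nat list \<Rightarrow> nat \<Rightarrow> nat list \<Rightarrow> bool" where
  "okh L vr M vs R = okh1 (hm vs L) vr M vs R"

section \<open>Generation of windows from a pattern in a child\<close>

type_synonym fin7 = "nat list \<Rightarrow> nat \<Rightarrow> nat list \<Rightarrow> nat \<Rightarrow> nat list \<Rightarrow> nat \<Rightarrow> nat list \<Rightarrow> bool"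
type_synonym fin5 = "nat list \<Rightarrow> nat \<Rightarrow> nat list \<Rightarrow> nat \<Rightarrow> nat list \<Rightarrow> bool"

text \<open>The conditions on va as a child point. If it is the only one (\<open>one\<close>), no
  letter below vs stands between va and the corner, and no letter to the left of va lies between va
  and vs.\<close>

definition f2 :: "bool \<Rightarrow> nat \<Rightarrow> nat \<Rightarrow> nat list \<Rightarrow> nat list \<Rightarrow> nat list \<Rightarrow> bool" where
  "f2 one va vs L1 L2 M = (if va < vs then if nb (if one then c0 else va) vs L2 then
     if allt vs M then if one then nb va vs L1 else True else False else False else False)"

text \<open>The functions \<open>p\<close> choose a letter of the pattern for a role (corner letter \<open>vr\<close>, corner letter \<open>vs\<close>, child
letter \<open>va\<close>), the functions \<open>i\<close> insert a new letter in all possible ways, shifting the larger values by \<open>up\<close>.\<close>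

fun p2 :: "fin7 \<Rightarrow> bool \<Rightarrow> nat list \<Rightarrow> nat \<Rightarrow> nat list \<Rightarrow> nat list \<Rightarrow> nat \<Rightarrow> nat list \<Rightarrow> bool" where
  "p2 F one L1 vs L2 [] vr R = True"
| "p2 F one L1 vs L2 (va # M) vr R =
     (if (if f2 one va vs L1 L2 M then F L1 va L2 vr M vs R else True) then p2 F one L1 vs (va # L2) M vr R else False)"

fun i2s :: "fin7 \<Rightarrow> bool \<Rightarrow> nat list \<Rightarrow> nat \<Rightarrow> nat \<Rightarrow> nat list \<Rightarrow> nat list \<Rightarrow> nat \<Rightarrow> nat list \<Rightarrow> bool" where
  "i2s F one L1 va vs L2 [] vr R = (if f2 one va vs L1 L2 [] then F L1 va L2 vr [] vs R else True)"
| "i2s F one L1 va vs L2 (x # M) vr R =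
     (if (if f2 one va vs L1 L2 (x # M) then F L1 va L2 vr (x # M) vs R else True) then i2s F one L1 va vs (x # L2) M vr R else False)"

fun i2 :: "fin7 \<Rightarrow> bool \<Rightarrow> nat list \<Rightarrow> nat \<Rightarrow> nat list \<Rightarrow> nat \<Rightarrow> nat list \<Rightarrow> nat list \<Rightarrow> bool" where
  "i2 F one L1 vs Q vr R [] = True"
| "i2 F one L1 vs Q vr R (v # ws) =
     (if i2s F one (up v L1) v (Suc vs) [] (up v Q) (Suc vr) (up v R) then i2 F one L1 vs Q vr R ws else False)"

definition s2 :: "bool \<Rightarrow> fin7 \<Rightarrow> bool \<Rightarrow> nat list \<Rightarrow> nat \<Rightarrow> nat list \<Rightarrow> nat \<Rightarrow> nat list \<Rightarrow> bool" where
  "s2 b2 F one L1 vs Q vr R = (if b2 then p2 F one L1 vs [] Q vr R else i2 F one L1 vs Q vr R (vl vs))"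

fun p1 :: "bool \<Rightarrow> fin7 \<Rightarrow> bool \<Rightarrow> nat list \<Rightarrow> nat list \<Rightarrow> nat \<Rightarrow> nat list \<Rightarrow> bool" where
  "p1 b2 F one L1 [] vr R = True"
| "p1 b2 F one L1 (vs # Q) vr R =
     (if (if vs < vr then if inr vs vr R then s2 b2 F one L1 vs Q vr R else True else True) then p1 b2 F one (vs # L1) Q vr R else False)"

fun i1s :: "bool \<Rightarrow> fin7 \<Rightarrow> bool \<Rightarrow> nat list \<Rightarrow> nat \<Rightarrow> nat list \<Rightarrow> nat \<Rightarrow> nat list \<Rightarrow> bool" where
  "i1s b2 F one L1 vs [] vr R = s2 b2 F one L1 vs [] vr R"
| "i1s b2 F one L1 vs (x # Q) vr R = (if s2 b2 F one L1 vs (x # Q) vr R then i1s b2 F one (x # L1) vs Q vr R else False)"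

fun i1 :: "bool \<Rightarrow> fin7 \<Rightarrow> bool \<Rightarrow> nat list \<Rightarrow> nat \<Rightarrow> nat list \<Rightarrow> nat list \<Rightarrow> bool" where
  "i1 b2 F one P vr R [] = True"
| "i1 b2 F one P vr R (v # ws) =
     (if (if inr v (Suc vr) (up v R) then i1s b2 F one [] v (up v P) (Suc vr) (up v R) else True) then i1 b2 F one P vr R ws else False)"

definition s1 :: "bool \<Rightarrow> bool \<Rightarrow> fin7 \<Rightarrow> bool \<Rightarrow> nat list \<Rightarrow> nat \<Rightarrow> nat list \<Rightarrow> bool" where
  "s1 b1 b2 F one P vr R = (if b1 then p1 b2 F one [] P vr R else i1 b2 F one P vr R (vl vr))"

fun p3 :: "bool \<Rightarrow> bool \<Rightarrow> fin7 \<Rightarrow> bool \<Rightarrow> nat list \<Rightarrow> nat list \<Rightarrow> bool" where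
  "p3 b1 b2 F one A [] = True"
| "p3 b1 b2 F one A (vr # R) =
     (if (if inr vr vr R then s1 b1 b2 F one (rap A []) vr R else True) then p3 b1 b2 F one (vr # A) R else False)"

fun i3s :: "bool \<Rightarrow> bool \<Rightarrow> fin7 \<Rightarrow> bool \<Rightarrow> nat list \<Rightarrow> nat \<Rightarrow> nat list \<Rightarrow> bool" where
  "i3s b1 b2 F one A vr [] = s1 b1 b2 F one (rap A []) vr []"
| "i3s b1 b2 F one A vr (x # R) =
     (if (if inr vr vr (x # R) then s1 b1 b2 F one (rap A []) vr (x # R) else True) then i3s b1 b2 F one (x # A) vr R else False)"

fun i3 :: "bool \<Rightarrow> bool \<Rightarrow> fin7 \<Rightarrow> bool \<Rightarrow> nat list \<Rightarrow> nat list \<Rightarrow> bool" where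
  "i3 b1 b2 F one T [] = True"
| "i3 b1 b2 F one T (v # ws) = (if i3s b1 b2 F one [] v (up v T) then i3 b1 b2 F one T ws else False)"

text \<open>The flags tell which of vs, va, vr take part in the occurrence of the pattern q in the
  child; the other roles are filled by new letters. The roles are assigned in the order vr, vs, va,
  so that each choice is confined by the previous ones.\<close>

definition gn :: "bool \<Rightarrow> bool \<Rightarrow> bool \<Rightarrow> fin7 \<Rightarrow> bool \<Rightarrow> nat \<Rightarrow> nat list \<Rightarrow> bool" where
  "gn b1 b2 b3 F one N q = (if b3 then p3 b1 b2 F one [] q else i3 b1 b2 F one q (vl N))"

text \<open>The combination with none of the three letters is left out: such an occurrence is also
  present in the parent and is treated separately, by \<open>gens0\<close> where needed.\<close>

definition gen :: "fin7 \<Rightarrow> bool \<Rightarrow> nat \<Rightarrow> nat list \<Rightarrow> bool" where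
  "gen F one N q = (if gn True True True F one N q then if gn True True False F one N q then
     if gn True False True F one N q then if gn False True True F one N q then
     if gn True False False F one N q then if gn False True False F one N q then gn False False True F one N q
     else False else False else False else False else False else False)"

fun gens :: "fin7 \<Rightarrow> bool \<Rightarrow> nat \<Rightarrow> nat list list \<Rightarrow> bool" where
  "gens F one N [] = True"
| "gens F one N (q # qs) = (if gen F one N q then gens F one N qs else False)"

fun gens0 :: "fin7 \<Rightarrow> nat \<Rightarrow> nat list list \<Rightarrow> bool" where
  "gens0 F N [] = True"
| "gens0 F N (q # qs) = (if gn False False False F False N q then gens0 F N qs else False)"

type_synonym fin8 = "nat \<Rightarrow> fin7"

fun ijs :: "fin8 \<Rightarrow> nat \<Rightarrow> nat list \<Rightarrow> nat \<Rightarrow> nat list \<Rightarrow> nat \<Rightarrow> nat list \<Rightarrow> nat \<Rightarrow> nat list \<Rightarrow> bool" where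
  "ijs F t J2 v [] vr M vs R = (if nb v vs J2 then F t [] v (rap J2 []) vr M vs R else True)"
| "ijs F t J2 v (x # J1) vr M vs R =
     (if (if nb v vs J2 then F t (x # J1) v (rap J2 []) vr M vs R else True) then ijs F t (x # J2) v J1 vr M vs R else False)"

text \<open>Inserts one more child point v into the prefix, in all places and with all values below
  vs; t is the rank of a letter to be remembered and moves up when v is inserted below it.\<close>

fun ij :: "fin8 \<Rightarrow> nat \<Rightarrow> nat list \<Rightarrow> nat \<Rightarrow> nat list \<Rightarrow> nat \<Rightarrow> nat list \<Rightarrow> nat list \<Rightarrow> bool" where
  "ij F t L vr M vs R [] = True"
| "ij F t L vr M vs R (v # ws) =
     (if ijs F (ups (t < v) t) [] v (up v L) (Suc vr) (up v M) (Suc vs) (up v R) then ij F t L vr M vs R ws else False)"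

definition FVC :: fin7 where "FVC L1 va L2 vr M vs R = nv (wl (L2 @ va # L1) vr M vs R)"

text \<open>The letter t is a child point once v has been deleted. The check says: if t stands left
  of v and below it, a 2143 in the child at t without v forces one in the child at v. The condition
  \<open>nb t (Suc t) J1\<close> means that t does not occur in \<open>J1\<close>.\<close>

definition HR1 :: fin8 where
  "HR1 t J1 v J2 vr M vs R = (if t < v then if nb t (Suc t) J1 then True else nv (xl J1 v J2 vr M vs R) else True)"
definition FR1 :: fin7 where "FR1 L1 va L2 vr M vs R = ij HR1 va (L2 @ va # L1) vr M vs R (vl vs)"

section \<open>The lists of patterns and the exceptional windows\<close>

definition "qc1 = [[c1,c0,c3,c2,c5,c4], [c3,c1,c5,c0,c4,c2]]"
definition "qc2 = [[c1,c4,c3,c6,c0,c5,c2], [c3,c1,c5,c4,c0,c6,c2], [c4,c0,c6,c2,c1,c5,c3],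
    [c4,c1,c6,c0,c3,c2,c5], [c4,c1,c6,c5,c0,c3,c2], [c4,c3,c6,c1,c0,c5,c2]]"
definition "qc3 = [[c1,c4,c3,c6,c5,c0,c7,c2], [c1,c5,c3,c7,c0,c4,c2,c6], [c1,c5,c3,c7,c6,c0,c4,c2],
    [c1,c5,c4,c7,c0,c3,c2,c6], [c1,c5,c4,c7,c6,c0,c3,c2], [c4,c0,c6,c2,c5,c1,c7,c3]]"
definition "qc4 = [[c4,c0,c6,c5,c2,c1,c7,c3], [c4,c3,c6,c1,c5,c0,c7,c2], [c4,c3,c6,c5,c1,c0,c7,c2],
    [c5,c0,c7,c2,c1,c4,c3,c6], [c5,c0,c7,c2,c6,c1,c4,c3], [c5,c0,c7,c6,c2,c1,c4,c3]]"
definition "qc5 = [[c5,c3,c7,c1,c0,c4,c2,c6], [c5,c3,c7,c6,c1,c0,c4,c2], [c5,c4,c7,c1,c0,c3,c2,c6],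
    [c5,c4,c7,c1,c6,c0,c3,c2], [c5,c4,c7,c6,c1,c0,c3,c2]]"
definition "qa1 = [[c1,c0,c4,c3,c2], [c2,c1,c0,c4,c3]]"
definition "qa2 = [[c1,c0,c3,c5,c2,c4], [c1,c0,c4,c2,c5,c3], [c1,c2,c0,c4,c5,c3],
    [c1,c3,c0,c2,c5,c4]]"
definition "qa3 = [[c1,c3,c0,c5,c2,c4], [c2,c0,c1,c5,c3,c4], [c2,c0,c3,c1,c5,c4],
    [c2,c0,c4,c1,c5,c3]]"
definition "qb1 = [[c1,c0,c5,c4,c3,c2], [c1,c2,c0,c5,c4,c3], [c1,c3,c0,c5,c4,c2],
    [c2,c0,c1,c5,c4,c3], [c2,c0,c5,c1,c4,c3], [c2,c1,c0,c4,c5,c3],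
    [c2,c1,c0,c5,c3,c4]]"
definition "qb2 = [[c2,c1,c0,c5,c4,c3], [c2,c1,c4,c0,c5,c3], [c2,c1,c5,c0,c4,c3],
    [c3,c1,c0,c5,c2,c4], [c3,c1,c0,c5,c4,c2], [c3,c2,c1,c0,c5,c4]]"
definition "qb3 = [[c1,c0,c3,c6,c5,c2,c4], [c1,c0,c4,c6,c2,c5,c3], [c1,c0,c4,c6,c3,c2,c5],
    [c1,c0,c4,c6,c3,c5,c2], [c1,c0,c5,c2,c6,c4,c3], [c1,c0,c5,c3,c6,c2,c4],
    [c1,c0,c5,c3,c6,c4,c2]]"
definition "qb4 = [[c1,c0,c5,c4,c2,c6,c3], [c1,c0,c6,c3,c5,c2,c4], [c1,c0,c6,c4,c2,c5,c3],
    [c1,c2,c0,c4,c6,c3,c5], [c1,c2,c0,c5,c3,c6,c4], [c1,c3,c0,c2,c5,c6,c4],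
    [c1,c3,c0,c2,c6,c4,c5]]"
definition "qb5 = [[c1,c3,c0,c4,c6,c2,c5], [c1,c3,c0,c5,c2,c6,c4], [c1,c3,c0,c5,c6,c2,c4],
    [c1,c4,c0,c2,c6,c3,c5], [c1,c4,c0,c3,c6,c2,c5], [c1,c4,c0,c6,c3,c2,c5],
    [c1,c4,c3,c0,c2,c6,c5]]"
definition "qb6 = [[c1,c4,c3,c0,c6,c2,c5], [c2,c0,c1,c4,c6,c3,c5], [c2,c0,c1,c5,c3,c6,c4],
    [c2,c0,c3,c1,c5,c6,c4], [c2,c0,c3,c1,c6,c4,c5], [c2,c0,c3,c5,c1,c6,c4],
    [c2,c0,c4,c1,c6,c3,c5]]"
definition "qb7 = [[c2,c0,c5,c1,c3,c6,c4], [c2,c0,c5,c1,c6,c3,c4], [c2,c0,c5,c3,c1,c6,c4],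
    [c2,c0,c5,c4,c1,c6,c3], [c2,c3,c0,c5,c1,c6,c4], [c2,c4,c0,c1,c6,c3,c5],
    [c2,c4,c0,c3,c1,c6,c5]]"
definition "qb8 = [[c2,c4,c1,c0,c3,c6,c5], [c2,c4,c1,c3,c0,c6,c5], [c3,c0,c4,c2,c1,c6,c5],
    [c3,c0,c5,c2,c1,c6,c4], [c3,c1,c4,c0,c2,c6,c5], [c3,c1,c4,c2,c0,c6,c5],
    [c3,c2,c0,c4,c1,c6,c5]]"
definition "qb9 = [[c4,c1,c3,c0,c2,c6,c5], [c4,c2,c0,c3,c1,c6,c5]]"
definition "qb10 = [[c1,c0,c3,c5,c7,c2,c4,c6], [c1,c0,c5,c2,c6,c3,c7,c4], [c1,c2,c3,c0,c5,c6,c7,c4],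
    [c1,c3,c5,c0,c2,c4,c7,c6], [c1,c3,c5,c0,c7,c2,c4,c6]]"
definition "qb11 = [[c2,c3,c0,c1,c6,c7,c4,c5], [c3,c0,c1,c2,c7,c4,c5,c6], [c3,c0,c4,c1,c5,c2,c7,c6],
    [c3,c0,c5,c1,c6,c2,c7,c4]]"
lemmas q_defs = qc1_def qc2_def qc3_def qc4_def qc5_def qa1_def qa2_def qa3_def qb1_def qb2_def qb3_def qb4_def qb5_def qb6_def qb7_def qb8_def qb9_def qb10_def qb11_def

text \<open>Words are written with letters from 0 and grouped by length into chunks of manageable
  size. The chunks \<open>qc\<close> belong to both lists, since their values jump past 3:
  \<open>run_ge4\<close> certifies at least 4 for them.\<close>

definition pats3 :: "nat list list" where "pats3 = qc1 @ qc2 @ qc3 @ qc4 @ qc5 @ qa1 @ qa2 @ qa3"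
definition pats4 :: "nat list list" where
  "pats4 = qc1 @ qc2 @ qc3 @ qc4 @ qc5 @ qb1 @ qb2 @ qb3 @ qb4 @ qb5 @ qb6 @ qb7 @ qb8 @ qb9 @ qb10 @ qb11"
lemmas pats_run = pats3_def[unfolded q_defs append.simps] pats4_def[unfolded q_defs append.simps]

text \<open>Order types of windows consisting of a corner, two child points and a 2143 in one of the
  two children whose value is not certified to reach 4. That the list is exhaustive is part of the
  check of \<open>F32\<close>.\<close>

definition types22 :: "(nat list \<times> nat \<times> nat list \<times> nat \<times> nat list) list" where "types22 = [([c0,c3,c1,c2], c5, [], c4, []),
    ([c5,c0,c1], c3, [], c2, [c4]),
    ([c1,c0,c2], c5, [c3], c4, []),
    ([c4,c0,c1], c3, [], c2, []),
    ([c3,c5,c0,c1], c4, [], c2, []),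
    ([c3,c4,c0,c1], c5, [], c2, []),
    ([c1,c3,c0,c2], c5, [], c4, []),
    ([c1,c4,c0,c2], c5, [], c3, []),
    ([c4,c0,c2,c1], c5, [], c3, []),
    ([c2,c0,c1,c3], c5, [], c4, []),
    ([c5,c0,c2,c1], c6, [c3], c4, []),
    ([c0,c3,c1], c5, [c2], c4, []),
    ([c5,c1,c0,c2], c6, [c3], c4, []),
    ([c2,c0,c3,c1], c5, [], c4, []),
    ([c1,c0,c3,c2], c6, [c4], c5, []),
    ([c5,c1,c0,c3,c2], c6, [], c4, [])]"

text \<open>As \<open>ge e\<close> certifies a value of at least e + 1, these encode the thresholds
  3 and 4. The same constants serve as the child counts two and three.\<close>

definition E3 :: nat where "E3 = Suc (Suc 0)"
definition E4 :: nat where "E4 = Suc (Suc (Suc 0))"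

definition F3k1 :: fin7 where
  "F3k1 L1 va L2 vr M vs R = (if okh (L2 @ va # L1) vr M vs R then concl E3 pats3 (L2 @ va # L1) vr M vs R else True)"
definition F4k1 :: fin7 where
  "F4k1 L1 va L2 vr M vs R = (if okh (L2 @ va # L1) vr M vs R then concl E4 pats4 (L2 @ va # L1) vr M vs R else True)"

text \<open>Final test for threshold 4 at a corner with two children of which one has no 2143;
  windows where both have one belong to \<open>a2\<close>.\<close>

definition fin42 :: fin5 where
  "fin42 L vr M vs R = (if okh L vr M vs R then if nvs (kd c0 L [] vs (M @ vr # R)) then True
     else concl E4 pats4 L vr M vs R else True)"
definition F4k2 :: fin7 where
  "F4k2 L1 va L2 vr M vs R = (if eqn (ci c0 (L2 @ va # L1) vs) E3 then fin42 (L2 @ va # L1) vr M vs R else True)"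
definition H4k2 :: fin8 where
  "H4k2 t J1 v J2 vr M vs R = (if (if t < v then nb t (Suc t) J1 else True) then fin42 (J2 @ v # J1) vr M vs R else True)"
text \<open>With at most one child point in the window, the second one lies outside it and still has
  to be inserted.\<close>

definition F4k2x :: fin7 where
  "F4k2x L1 va L2 vr M vs R = (if lq (ci c0 (L2 @ va # L1) vs) (Suc 0) then ij H4k2 va (L2 @ va # L1) vr M vs R (vl vs)
     else F4k2 L1 va L2 vr M vs R)"

definition fin43 :: fin5 where
  "fin43 L vr M vs R = (if okh L vr M vs R then if eqn (ci c0 L vs) E4 then concl E4 pats4 L vr M vs R else True else True)"
definition H43 :: fin8 where
  "H43 t J1 v J2 vr M vs R = fin43 (J2 @ v # J1) vr M vs R"
fun memb5 :: "nat list \<Rightarrow> nat \<Rightarrow> nat list \<Rightarrow> nat \<Rightarrow> nat list \<Rightarrow> (nat list \<times> nat \<times> nat list \<times> nat \<times> nat list) list \<Rightarrow> bool" where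
  "memb5 L vr M vs R [] = False"
| "memb5 L vr M vs R ((L', vr', M', vs', R') # ps) = (if eqv L' L then if eqv M' M then if eqv (vr' # vs' # R') (vr # vs # R)
     then True else memb5 L vr M vs R ps else memb5 L vr M vs R ps else memb5 L vr M vs R ps)"

text \<open>One test for both thresholds at a corner with two child points. Threshold 3 is settled
  by \<open>concl\<close>. For threshold 4 either the value is already reached, or the window is
  exceptional; then it is also tested with a third child point.\<close>

definition fin32 :: fin5 where
  "fin32 L vr M vs R = (if okh L vr M vs R then if concl E3 pats3 L vr M vs R then
     if ge E4 (wl L vr M vs R) then if nvs (kd c0 L [] vs (M @ vr # R)) then concl E4 pats4 L vr M vs R else True
     else if memb5 L vr M vs R types22 then ij H43 c0 L vr M vs R (vl vs) else False
     else False else True)"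
definition H32 :: fin8 where
  "H32 t J1 v J2 vr M vs R = (if (if t < v then nb t (Suc t) J1 else True) then
     if eqn (ci c0 (J2 @ v # J1) vs) E3 then fin32 (J2 @ v # J1) vr M vs R else True else True)"
definition F32b :: fin7 where
  "F32b L1 va L2 vr M vs R = (if ge E4 (wl (L2 @ va # L1) vr M vs R) then True else ij H32 va (L2 @ va # L1) vr M vs R (vl vs))"
text \<open>Branches on the number of child points in the window: a single one calls for a second,
  two may be complete or call for another one, three leave threshold 4 only. Other counts do not
  arise where this test is applied.\<close>

fun F32c :: "nat \<Rightarrow> fin7" where
  "F32c (Suc 0) L1 va L2 vr M vs R = ij H32 va (L2 @ va # L1) vr M vs R (vl vs)"
| "F32c (Suc (Suc 0)) L1 va L2 vr M vs R = (if fin32 (L2 @ va # L1) vr M vs R then F32b L1 va L2 vr M vs R else False)"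
| "F32c (Suc (Suc (Suc 0))) L1 va L2 vr M vs R = fin43 (L2 @ va # L1) vr M vs R"
| "F32c (Suc (Suc (Suc (Suc n)))) L1 va L2 vr M vs R = True"
| "F32c 0 L1 va L2 vr M vs R = True"
definition F32 :: fin7 where
  "F32 L1 va L2 vr M vs R = F32c (ci c0 (L2 @ va # L1) vs) L1 va L2 vr M vs R"

fun a2l :: "fin5 \<Rightarrow> nat list \<Rightarrow> nat \<Rightarrow> fin5" where
  "a2l F A v [] vr M vs R = F (rap A [v]) vr M vs R"
| "a2l F A v (x # L) vr M vs R = (if F (rap A (v # x # L)) vr M vs R then a2l F (x # A) v L vr M vs R else False)"

fun a2m :: "fin5 \<Rightarrow> nat list \<Rightarrow> nat \<Rightarrow> fin5" where
  "a2m F A v L vr [] vs R = F L vr (rap A [v]) vs R"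
| "a2m F A v L vr (x # M) vs R = (if F L vr (rap A (v # x # M)) vs R then a2m F (x # A) v L vr M vs R else False)"

fun a2r :: "fin5 \<Rightarrow> nat list \<Rightarrow> nat \<Rightarrow> fin5" where
  "a2r F A v L vr M vs [] = F L vr M vs (rap A [v])"
| "a2r F A v L vr M vs (x # R) = (if F L vr M vs (rap A (v # x # R)) then a2r F (x # A) v L vr M vs R else False)"

fun a2v :: "fin5 \<Rightarrow> nat list \<Rightarrow> nat \<Rightarrow> nat list \<Rightarrow> nat \<Rightarrow> nat list \<Rightarrow> nat list \<Rightarrow> bool" where
  "a2v F L vr M vs R [] = True"
| "a2v F L vr M vs R (v # ws) =
    (if a2l F [] v (up v L) (ups (vr < v) vr) (up v M) (ups (vs < v) vs) (up v R) then
     if a2m F [] v (up v L) (ups (vr < v) vr) (up v M) (ups (vs < v) vs) (up v R) then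
     if a2r F [] v (up v L) (ups (vr < v) vr) (up v M) (ups (vs < v) vs) (up v R) then
     a2v F L vr M vs R ws else False else False else False)"

definition a2f :: "nat list \<Rightarrow> nat \<Rightarrow> nat list \<Rightarrow> nat \<Rightarrow> nat list \<Rightarrow> bool" where
  "a2f L vr M vs R = (if allt vs M then if inr vs vr R then if okh L vr M vs R then eqn (ci c0 L vs) E3
     else False else False else False)"

text \<open>Extends a window by up to n arbitrary letters until both children contain a 2143. The
  search stops when the value 4 is certified earlier: a proper window of a minimal word cannot reach
  it.\<close>

fun a2 :: "nat \<Rightarrow> nat \<Rightarrow> fin5" where
  "a2 0 N L vr M vs R = (if a2f L vr M vs R then
     if nvs (kd c0 L [] vs (M @ vr # R)) then concl E4 pats4 L vr M vs R else True else True)"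
| "a2 (Suc n) N L vr M vs R = (if a2f L vr M vs R then
     if nvs (kd c0 L [] vs (M @ vr # R)) then concl E4 pats4 L vr M vs R
     else if ge E4 (wl L vr M vs R) then True else a2v (a2 n (Suc N)) L vr M vs R (vl N) else True)"

fun pR :: "fin5 \<Rightarrow> nat list \<Rightarrow> nat list \<Rightarrow> nat \<Rightarrow> nat list \<Rightarrow> bool" where
  "pR G L [] vs R = True"
| "pR G L (vr # M) vs R = (if (if vs < vr then if inr vs vr R then if allt vs M then G L vr M vs R else True else True else True)
     then pR G (vr # L) M vs R else False)"

fun iRs :: "fin5 \<Rightarrow> nat list \<Rightarrow> nat \<Rightarrow> nat list \<Rightarrow> nat \<Rightarrow> nat list \<Rightarrow> bool" where
  "iRs G L vr [] vs R = G L vr [] vs R"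
| "iRs G L vr (x # M) vs R = (if (if allt vs (x # M) then G L vr (x # M) vs R else True) then iRs G (x # L) vr M vs R else False)"

fun iR :: "fin5 \<Rightarrow> nat list \<Rightarrow> nat \<Rightarrow> nat list \<Rightarrow> nat list \<Rightarrow> bool" where
  "iR G P vs R [] = True"
| "iR G P vs R (v # ws) = (if (if vs < v then if inr vs v (up v R) then iRs G [] v (up v P) vs (up v R) else True else True)
     then iR G P vs R ws else False)"

definition sR :: "bool \<Rightarrow> fin5 \<Rightarrow> nat \<Rightarrow> nat list \<Rightarrow> nat \<Rightarrow> nat list \<Rightarrow> bool" where
  "sR b G N P vs R = (if b then pR G [] P vs R else iR G P vs R (vl N))"

fun pS :: "bool \<Rightarrow> fin5 \<Rightarrow> nat \<Rightarrow> nat list \<Rightarrow> nat list \<Rightarrow> bool" where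
  "pS b G N A [] = True"
| "pS b G N A (vs # R) = (if (if inr vs vs R then sR b G N (rap A []) vs R else True) then pS b G N (vs # A) R else False)"

fun iSs :: "bool \<Rightarrow> fin5 \<Rightarrow> nat \<Rightarrow> nat list \<Rightarrow> nat \<Rightarrow> nat list \<Rightarrow> bool" where
  "iSs b G N A vs [] = sR b G N (rap A []) vs []"
| "iSs b G N A vs (x # R) = (if (if inr vs vs (x # R) then sR b G N (rap A []) vs (x # R) else True) then iSs b G N (x # A) vs R else False)"

fun iS :: "bool \<Rightarrow> fin5 \<Rightarrow> nat \<Rightarrow> nat list \<Rightarrow> nat list \<Rightarrow> bool" where
  "iS b G N T [] = True"
| "iS b G N T (v # ws) = (if iSs b G (Suc N) [] v (up v T) then iS b G N T ws else False)"

definition gA :: "bool \<Rightarrow> bool \<Rightarrow> fin5 \<Rightarrow> nat \<Rightarrow> nat list \<Rightarrow> bool" where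
  "gA bs br G N q = (if bs then pS br G N [] q else iS br G N q (vl N))"

section \<open>The checks for monotonicity\<close>

fun exl :: "nat \<Rightarrow> nat list \<Rightarrow> bool" where
  "exl v [] = False"
| "exl v (x # xs) = (if x < v then True else exl v xs)"

definition chA :: "nat \<Rightarrow> fin5" where
  "chA e L vr M vs R = (if okh L vr M vs R then if lq (ci c0 L vs) e then ge e (wl L vr M vs R) else True else True)"

text \<open>The conditions known about a child point v that is missing in the pattern: a smaller
  letter precedes it, the number of child points is below e and does not drop when v is deleted, and
  with several children the one at v contains a 2143.\<close>

definition hA :: "nat \<Rightarrow> fin7" where
  "hA e J1 v J2 vr M vs R = (if exl v J1 then if okh (J2 @ v # J1) vr M vs R then
     if lq (Suc (ci c0 (J2 @ v # J1) vs)) e then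
     if lq (ci c0 (J2 @ v # J1) vs) (ci c0 (J2 @ J1) vs) then
     if (if lq (ci c0 (J2 @ v # J1) vs) (Suc 0) then True else nv (xl J1 v J2 vr M vs R)) then ge e (wl (J2 @ v # J1) vr M vs R)
     else True else True else True else True else True)"
definition HA3 :: fin8 where "HA3 t J1 v J2 vr M vs R = hA E3 J1 v J2 vr M vs R"
definition HA4 :: fin8 where "HA4 t J1 v J2 vr M vs R = hA E4 J1 v J2 vr M vs R"
definition GJ3 :: fin5 where "GJ3 L vr M vs R = ij HA3 c0 L vr M vs R (vl vs)"
definition GJ4 :: fin5 where "GJ4 L vr M vs R = ij HA4 c0 L vr M vs R (vl vs)"
definition GC3 :: fin5 where "GC3 L vr M vs R = chA E3 L vr M vs R"
definition GC4 :: fin5 where "GC4 L vr M vs R = chA E4 L vr M vs R"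
definition GB3 :: fin5 where "GB3 L vr M vs R = (if GC3 L vr M vs R then GJ3 L vr M vs R else False)"
definition GB4 :: fin5 where "GB4 L vr M vs R = (if GC4 L vr M vs R then GJ4 L vr M vs R else False)"

text \<open>The flags tell whether vs and vr belong to the pattern. If both do, a child point must
  be missing; if neither does, no child point is missing; in the mixed cases both possibilities are
  tested.\<close>

definition allA :: "fin5 \<Rightarrow> fin5 \<Rightarrow> fin5 \<Rightarrow> nat \<Rightarrow> nat list \<Rightarrow> bool" where
  "allA GJ GB GC N q = (if gA True True GJ N q then if gA True False GB N q then if gA False True GB N q then gA False False GC N q
     else False else False else False)"

fun allAs :: "fin5 \<Rightarrow> fin5 \<Rightarrow> fin5 \<Rightarrow> nat \<Rightarrow> nat list list \<Rightarrow> bool" where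
  "allAs GJ GB GC N [] = True"
| "allAs GJ GB GC N (q # qs) = (if allA GJ GB GC N q then allAs GJ GB GC N qs else False)"
lemma c_rules:
  "(c0<c0)=False" "(c0<c1)=True" "(c0<c2)=True" "(c0<c3)=True" "(c0<c4)=True" "(c0<c5)=True" "(c0<c6)=True" "(c0<c7)=True" "(c0<c8)=True" "(c0<c9)=True" "(c0<ca)=True" "(c0<cb)=True" "(c0<cc)=True"
  "(c1<c0)=False" "(c1<c1)=False" "(c1<c2)=True" "(c1<c3)=True" "(c1<c4)=True" "(c1<c5)=True" "(c1<c6)=True" "(c1<c7)=True" "(c1<c8)=True" "(c1<c9)=True" "(c1<ca)=True" "(c1<cb)=True" "(c1<cc)=True"
  "(c2<c0)=False" "(c2<c1)=False" "(c2<c2)=False" "(c2<c3)=True" "(c2<c4)=True" "(c2<c5)=True" "(c2<c6)=True" "(c2<c7)=True" "(c2<c8)=True" "(c2<c9)=True" "(c2<ca)=True" "(c2<cb)=True" "(c2<cc)=True"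
  "(c3<c0)=False" "(c3<c1)=False" "(c3<c2)=False" "(c3<c3)=False" "(c3<c4)=True" "(c3<c5)=True" "(c3<c6)=True" "(c3<c7)=True" "(c3<c8)=True" "(c3<c9)=True" "(c3<ca)=True" "(c3<cb)=True" "(c3<cc)=True"
  "(c4<c0)=False" "(c4<c1)=False" "(c4<c2)=False" "(c4<c3)=False" "(c4<c4)=False" "(c4<c5)=True" "(c4<c6)=True" "(c4<c7)=True" "(c4<c8)=True" "(c4<c9)=True" "(c4<ca)=True" "(c4<cb)=True" "(c4<cc)=True"
  "(c5<c0)=False" "(c5<c1)=False" "(c5<c2)=False" "(c5<c3)=False" "(c5<c4)=False" "(c5<c5)=False" "(c5<c6)=True" "(c5<c7)=True" "(c5<c8)=True" "(c5<c9)=True" "(c5<ca)=True" "(c5<cb)=True" "(c5<cc)=True"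
  "(c6<c0)=False" "(c6<c1)=False" "(c6<c2)=False" "(c6<c3)=False" "(c6<c4)=False" "(c6<c5)=False" "(c6<c6)=False" "(c6<c7)=True" "(c6<c8)=True" "(c6<c9)=True" "(c6<ca)=True" "(c6<cb)=True" "(c6<cc)=True"
  "(c7<c0)=False" "(c7<c1)=False" "(c7<c2)=False" "(c7<c3)=False" "(c7<c4)=False" "(c7<c5)=False" "(c7<c6)=False" "(c7<c7)=False" "(c7<c8)=True" "(c7<c9)=True" "(c7<ca)=True" "(c7<cb)=True" "(c7<cc)=True"
  "(c8<c0)=False" "(c8<c1)=False" "(c8<c2)=False" "(c8<c3)=False" "(c8<c4)=False" "(c8<c5)=False" "(c8<c6)=False" "(c8<c7)=False" "(c8<c8)=False" "(c8<c9)=True" "(c8<ca)=True" "(c8<cb)=True" "(c8<cc)=True"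
  "(c9<c0)=False" "(c9<c1)=False" "(c9<c2)=False" "(c9<c3)=False" "(c9<c4)=False" "(c9<c5)=False" "(c9<c6)=False" "(c9<c7)=False" "(c9<c8)=False" "(c9<c9)=False" "(c9<ca)=True" "(c9<cb)=True" "(c9<cc)=True"
  "(ca<c0)=False" "(ca<c1)=False" "(ca<c2)=False" "(ca<c3)=False" "(ca<c4)=False" "(ca<c5)=False" "(ca<c6)=False" "(ca<c7)=False" "(ca<c8)=False" "(ca<c9)=False" "(ca<ca)=False" "(ca<cb)=True" "(ca<cc)=True"
  "(cb<c0)=False" "(cb<c1)=False" "(cb<c2)=False" "(cb<c3)=False" "(cb<c4)=False" "(cb<c5)=False" "(cb<c6)=False" "(cb<c7)=False" "(cb<c8)=False" "(cb<c9)=False" "(cb<ca)=False" "(cb<cb)=False" "(cb<cc)=True"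
  "(cc<c0)=False" "(cc<c1)=False" "(cc<c2)=False" "(cc<c3)=False" "(cc<c4)=False" "(cc<c5)=False" "(cc<c6)=False" "(cc<c7)=False" "(cc<c8)=False" "(cc<c9)=False" "(cc<ca)=False" "(cc<cb)=False" "(cc<cc)=False"
  "Suc c0 = c1"
  "Suc c1 = c2"
  "Suc c2 = c3"
  "Suc c3 = c4"
  "Suc c4 = c5"
  "Suc c5 = c6"
  "Suc c6 = c7"
  "Suc c7 = c8"
  "Suc c8 = c9"
  "Suc c9 = ca"
  "Suc ca = cb"
  "Suc cb = cc"
  "vl c0 = [c0]"
  "vl c1 = [c1,c0]"
  "vl c2 = [c2,c1,c0]"
  "vl c3 = [c3,c2,c1,c0]"
  "vl c4 = [c4,c3,c2,c1,c0]"
  "vl c5 = [c5,c4,c3,c2,c1,c0]"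
  "vl c6 = [c6,c5,c4,c3,c2,c1,c0]"
  "vl c7 = [c7,c6,c5,c4,c3,c2,c1,c0]"
  "vl c8 = [c8,c7,c6,c5,c4,c3,c2,c1,c0]"
  "vl c9 = [c9,c8,c7,c6,c5,c4,c3,c2,c1,c0]"
  "vl ca = [ca,c9,c8,c7,c6,c5,c4,c3,c2,c1,c0]"
  "vl cb = [cb,ca,c9,c8,c7,c6,c5,c4,c3,c2,c1,c0]"
  by (simp_all add: c_defs numeral_eq_Suc)

text \<open>The lists of patterns are unfolded chunk by chunk, so that a membership test does not traverse all of them in each step.\<close>

lemma memb_append: "memb l (xs @ ys) \<longleftrightarrow> memb l xs \<or> memb l ys"
  by (induction xs) auto

lemma memb_pats:
  "memb l pats3 = (if memb l qc1 then True else if memb l qc2 then True else if memb l qc3 then True else if memb l qc4 then True else if memb l qc5 then True else if memb l qa1 then True else if memb l qa2 then True else memb l qa3)"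
  "memb l pats4 = (if memb l qc1 then True else if memb l qc2 then True else if memb l qc3 then True else if memb l qc4 then True else if memb l qc5 then True else if memb l qb1 then True else if memb l qb2 then True else if memb l qb3 then True else if memb l qb4 then True else if memb l qb5 then True else if memb l qb6 then True else if memb l qb7 then True else if memb l qb8 then True else if memb l qb9 then True else if memb l qb10 then True else memb l qb11)"
  unfolding pats3_def pats4_def memb_append by argo+

lemma if_rules: "(if True then x else y) = x" "(if False then x else y) = y" by simp_all

lemmas run_rules = c_rules if_rules ups.simps up.simps rap.simps inr_run allt_run
  nb_run mna_run hm.simps kd_run ci_run
  lsr_run ls.simps cnr_run cn.simps strip.simps need.simps needc.simps needv.simps
  needk.simps needs.simps zero.simps ge_def ges.simps lq.simps eqn.simps bel.simps inv43.simps f21.simps nv.simps nvs.simps eqv.simps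
  memb.simps anydel.simps wl_def xl_def concl_def okh1_def okh_def f2_def p2.simps i2s.simps i2.simps s2_def p1.simps i1s.simps
  i1.simps s1_def p3.simps i3s.simps i3.simps gn_def gen_def gens.simps gens0.simps ijs.simps ij.simps FVC_def HR1_def FR1_def
  E3_def E4_def F3k1_def F4k1_def fin42_def F4k2_def H4k2_def F4k2x_def fin43_def H43_def memb5.simps fin32_def H32_def F32b_def
  F32c.simps F32_def a2.simps a2f_def a2v.simps a2l.simps a2m.simps a2r.simps pR.simps iRs.simps iR.simps sR_def pS.simps iSs.simps
  iS.simps gA_def exl.simps chA_def hA_def HA3_def HA4_def GJ3_def GJ4_def GC3_def GC4_def GB3_def GB4_def allA_def allAs.simps
  append.simps q_defs memb_pats types22_def

section \<open>Corners and children\<close>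

text \<open>Generated configurations use letters from 0 without gaps, so a window is compared with
  them through ranks in its set of letters.\<close>

definition rk :: "nat set \<Rightarrow> nat \<Rightarrow> nat" where
  "rk V x = card {u \<in> V. u < x}"

lemma rk_mono: "finite V \<Longrightarrow> x \<le> y \<Longrightarrow> rk V x \<le> rk V y"
  unfolding rk_def by (rule card_mono) auto

lemma rk_less: "finite V \<Longrightarrow> x \<in> V \<Longrightarrow> rk V x < rk V y \<longleftrightarrow> x < y"
proof
  assume V: "finite V" "x \<in> V" "x < y"
  have "{u \<in> V. u < x} \<subset> {u \<in> V. u < y}" using V by fastforce
  then show "rk V x < rk V y" unfolding rk_def using V by (intro psubset_card_mono) auto
next
  assume "finite V" "x \<in> V" "rk V x < rk V y"
  then show "x < y" using rk_mono[of V y x] by (meson not_le)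
qed

lemma rk_le: "finite V \<Longrightarrow> rk V v \<le> card V"
  unfolding rk_def by (rule card_mono) auto

lemma rk_insert_same: "rk (insert v V) v = rk V v"
proof -
  have "{u \<in> insert v V. u < v} = {u \<in> V. u < v}" by auto
  then show ?thesis by (simp add: rk_def)
qed

text \<open>This justifies the shift \<open>ups\<close>: a new letter of rank r raises exactly the
  letters that are not below r.\<close>

lemma rk_insert: "finite V \<Longrightarrow> v \<notin> V \<Longrightarrow> x \<in> V \<Longrightarrow> rk (insert v V) x = ups (rk V x < rk V v) (rk V x)"
proof -
  assume V: "finite V" "v \<notin> V" "x \<in> V"
  show ?thesis
  proof (cases "x < v")
    case True
    then have "{u \<in> insert v V. u < x} = {u \<in> V. u < x}" by auto
    then show ?thesis using True V by (simp add: rk_less) (simp add: rk_def)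
  next
    case False
    then have "v < x" using V by (metis linorder_neqE_nat)
    then have "{u \<in> insert v V. u < x} = insert v {u \<in> V. u < x}" by auto
    then show ?thesis using False V by (simp add: rk_less) (simp add: rk_def)
  qed
qed

lemma rk_insert_Suc: "finite V \<Longrightarrow> v \<notin> V \<Longrightarrow> x \<in> V \<Longrightarrow> v < x \<Longrightarrow> rk (insert v V) x = Suc (rk V x)"
  by (simp add: rk_insert rk_less)

lemma up_map: "finite V \<Longrightarrow> v \<notin> V \<Longrightarrow> set X \<subseteq> V \<Longrightarrow> up (rk V v) (map (rk V) X) = map (rk (insert v V)) X"
  by (induction X) (simp_all add: rk_insert)

text \<open>The executable predicates inspect letters only by comparing them, so they are invariant
  under order isomorphisms; this transfers them between ranks and letters.\<close>

definition om :: "(nat \<Rightarrow> nat) \<Rightarrow> nat set \<Rightarrow> bool" where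
  "om \<rho> S \<longleftrightarrow> (\<forall>x\<in>S. \<forall>y\<in>S. \<rho> x < \<rho> y \<longleftrightarrow> x < y)"

lemma om_rk: "finite V \<Longrightarrow> om (rk V) V"
  by (simp add: om_def rk_less)

lemma om_subset: "om \<rho> S \<Longrightarrow> T \<subseteq> S \<Longrightarrow> om \<rho> T"
  by (auto simp: om_def)

lemma om_inj: "om \<rho> S \<Longrightarrow> inj_on \<rho> S"
  unfolding om_def inj_on_def by (metis linorder_neqE_nat less_irrefl)

lemma rap_rev: "rap xs l = rev xs @ l"
  by (induction xs arbitrary: l) auto

lemma set_vl: "set (vl n) = {..n}"
  by (induction n) (auto simp: le_Suc_eq)

lemma nb_iff: "nb a b X \<longleftrightarrow> (\<forall>x\<in>set X. \<not> (a \<le> x \<and> x < b))"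
  by (induction X) auto

lemma allt_iff: "allt v X \<longleftrightarrow> (\<forall>x\<in>set X. x < v)"
  by (induction X) auto

lemma inr_om: "om \<rho> S \<Longrightarrow> t \<in> S \<Longrightarrow> b \<in> S \<Longrightarrow> set X \<subseteq> S \<Longrightarrow> inr (\<rho> t) (\<rho> b) (map \<rho> X) = inr t b X"
  by (induction X arbitrary: b) (auto simp: om_def)

lemma allt_om: "om \<rho> S \<Longrightarrow> t \<in> S \<Longrightarrow> set X \<subseteq> S \<Longrightarrow> allt (\<rho> t) (map \<rho> X) = allt t X"
  by (induction X) (auto simp: om_def)

lemma nb_om: "om \<rho> S \<Longrightarrow> t \<in> S \<Longrightarrow> b \<in> S \<Longrightarrow> set X \<subseteq> S \<Longrightarrow> nb (\<rho> t) (\<rho> b) (map \<rho> X) = nb t b X"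
  by (induction X) (auto simp: om_def)

lemma nb0_om: "om \<rho> S \<Longrightarrow> b \<in> S \<Longrightarrow> set X \<subseteq> S \<Longrightarrow> nb c0 (\<rho> b) (map \<rho> X) = nb c0 b X"
  by (induction X) (auto simp: om_def c0_def)

lemma mna_om: "om \<rho> S \<Longrightarrow> x \<in> S \<Longrightarrow> b \<in> S \<Longrightarrow> set X \<subseteq> S \<Longrightarrow>
    mna (\<rho> x) (\<rho> b) (map \<rho> X) = \<rho> (mna x b X) \<and> mna x b X \<in> S"
  by (induction X arbitrary: b) (auto simp: om_def)

lemma hm_om: "om \<rho> S \<Longrightarrow> b \<in> S \<Longrightarrow> set X \<subseteq> S \<Longrightarrow> hm (\<rho> b) (map \<rho> X) = \<rho> (hm b X) \<and> hm b X \<in> S"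
  by (induction X arbitrary: b) (simp_all add: mna_om)

lemma okh_om:
  assumes "om \<rho> S" "set L \<subseteq> S" "vr \<in> S" "set M \<subseteq> S" "vs \<in> S" "set R \<subseteq> S"
  shows "okh (map \<rho> L) (\<rho> vr) (map \<rho> M) (\<rho> vs) (map \<rho> R) = okh L vr M vs R"
proof -
  have h: "hm (\<rho> vs) (map \<rho> L) = \<rho> (hm vs L)" "hm vs L \<in> S" using hm_om[OF assms(1,5,2)] by auto
  then have "\<rho> (hm vs L) < \<rho> vs \<longleftrightarrow> hm vs L < vs" using assms unfolding om_def by blast
  then show ?thesis unfolding okh_def okh1_def using h assms by (simp add: inr_om[of \<rho> S] nb_om[of \<rho> S])
qed

lemma ci_om:
  assumes "om \<rho> S" "vs \<in> S" "set X \<subseteq> S" "\<forall>x\<in>set X. \<rho> x < m' \<longleftrightarrow> x < m"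
  shows "ci m' (map \<rho> X) (\<rho> vs) = ci m X vs"
  using assms
proof (induction X arbitrary: m m')
  case (Cons x X)
  have *: "\<rho> x < m' \<longleftrightarrow> x < m" "\<rho> x < \<rho> vs \<longleftrightarrow> x < vs" "\<forall>y\<in>set X. \<rho> y < \<rho> x \<longleftrightarrow> y < x"
    using Cons.prems unfolding om_def by auto
  show ?case using Cons.IH[of m' m] Cons.IH[of "\<rho> x" x] Cons.prems * by simp
qed simp

lemma kd_om:
  assumes "om \<rho> S" "vs \<in> S" "set X \<subseteq> S" "\<forall>x\<in>set X. \<rho> x < m' \<longleftrightarrow> x < m"
  shows "kd m' (map \<rho> X) (map \<rho> L2) (\<rho> vs) (map \<rho> T) = map (map \<rho>) (kd m X L2 vs T)"
  using assms
proof (induction X arbitrary: m m' L2)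
  case (Cons x X)
  have *: "\<rho> x < m' \<longleftrightarrow> x < m" "\<rho> x < \<rho> vs \<longleftrightarrow> x < vs" "\<forall>y\<in>set X. \<rho> y < \<rho> x \<longleftrightarrow> y < x"
    using Cons.prems unfolding om_def by auto
  show ?case using Cons.IH[of m' m "x # L2"] Cons.IH[of "\<rho> x" x "x # L2"] Cons.prems * by (simp add: rap_rev rev_map)
qed simp

lemma nv_om: "om \<rho> (set l) \<Longrightarrow> nv (map \<rho> l) = nv l"
proof (induction l)
  case (Cons x l)
  have o: "om \<rho> (insert x (set l))" using Cons.prems by simp
  have b: "bel (\<rho> x) (\<rho> z) (map \<rho> Y) = bel x z Y" if "set Y \<subseteq> insert x (set l)" "z \<in> insert x (set l)" for Y z
    using that o by (induction Y) (auto simp: om_def)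
  have i: "inv43 (\<rho> x) (map \<rho> Y) = inv43 x Y" if "set Y \<subseteq> insert x (set l)" for Y
    using that
  proof (induction Y)
    case (Cons z Y)
    have "\<rho> z < \<rho> x \<longleftrightarrow> z < x" using o Cons.prems unfolding om_def by auto
    then show ?case using Cons b[of Y z] by simp
  qed simp
  have f: "f21 (\<rho> x) (map \<rho> Y) = f21 x Y" if "set Y \<subseteq> insert x (set l)" for Y
    using that
  proof (induction Y)
    case (Cons z Y)
    have "\<rho> z < \<rho> x \<longleftrightarrow> z < x" using o Cons.prems unfolding om_def by auto
    then show ?case using Cons i[of Y] by simp
  qed simp
  have "om \<rho> (set l)" using o by (rule om_subset) auto
  then show ?case using Cons.IH f[of l] by auto
qed simp

lemma f2_om:
  assumes "om \<rho> S" "va \<in> S" "vs \<in> S" "set L1 \<subseteq> S" "set L2 \<subseteq> S" "set M \<subseteq> S"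
  shows "f2 one (\<rho> va) (\<rho> vs) (map \<rho> L1) (map \<rho> L2) (map \<rho> M) = f2 one va vs L1 L2 M"
proof -
  have "\<rho> va < \<rho> vs \<longleftrightarrow> va < vs" using assms unfolding om_def by blast
  then show ?thesis unfolding f2_def using assms by (simp add: nb_om[of \<rho> S] nb0_om[of \<rho> S] allt_om[of \<rho> S])
qed

section \<open>Every window is among the generated configurations\<close>

lemma p2_sound: "p2 F one L1 vs A (X @ va # M) vr R \<Longrightarrow> f2 one va vs L1 (rev X @ A) M \<Longrightarrow> F L1 va (rev X @ A) vr M vs R"
  by (induction X arbitrary: A) (auto split: if_splits)

lemma i2s_sound: "i2s F one L1 va vs A (X @ M) vr R \<Longrightarrow> f2 one va vs L1 (rev X @ A) M \<Longrightarrow> F L1 va (rev X @ A) vr M vs R"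
proof (induction X arbitrary: A)
  case Nil
  then show ?case by (cases M) (auto split: if_splits)
qed (auto split: if_splits)

lemma i2_sound: "i2 F one L1 vs Q vr R ws \<Longrightarrow> v \<in> set ws \<Longrightarrow> i2s F one (up v L1) v (Suc vs) [] (up v Q) (Suc vr) (up v R)"
  by (induction ws) (auto split: if_splits)

lemma p1_sound: "p1 b2 F one A (X @ vs # Q) vr R \<Longrightarrow> vs < vr \<Longrightarrow> inr vs vr R \<Longrightarrow> s2 b2 F one (rev X @ A) vs Q vr R"
  by (induction X arbitrary: A) (auto split: if_splits)

lemma i1s_sound: "i1s b2 F one A vs (X @ Q) vr R \<Longrightarrow> s2 b2 F one (rev X @ A) vs Q vr R"
proof (induction X arbitrary: A)
  case Nil
  then show ?case by (cases Q) (auto split: if_splits)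
qed (auto split: if_splits)

lemma i1_sound: "i1 b2 F one P vr R ws \<Longrightarrow> v \<in> set ws \<Longrightarrow> inr v (Suc vr) (up v R) \<Longrightarrow> i1s b2 F one [] v (up v P) (Suc vr) (up v R)"
  by (induction ws) (auto split: if_splits)

lemma p3_sound: "p3 b1 b2 F one A (X @ vr # R) \<Longrightarrow> inr vr vr R \<Longrightarrow> s1 b1 b2 F one (rev A @ X) vr R"
proof (induction X arbitrary: A)
  case (Cons x X)
  then have "p3 b1 b2 F one (x # A) (X @ vr # R)" by (simp split: if_splits)
  from Cons.IH[OF this Cons.prems(2)] show ?case by simp
qed (simp add: rap_rev split: if_splits)

lemma i3s_sound: "i3s b1 b2 F one A vr (X @ R) \<Longrightarrow> inr vr vr R \<Longrightarrow> s1 b1 b2 F one (rev A @ X) vr R"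
proof (induction X arbitrary: A)
  case Nil
  then show ?case by (cases R) (simp_all add: rap_rev split: if_splits)
next
  case (Cons x X)
  then have "i3s b1 b2 F one (x # A) vr (X @ R)" by (simp split: if_splits)
  from Cons.IH[OF this Cons.prems(2)] show ?case by simp
qed

lemma i3_sound: "i3 b1 b2 F one T ws \<Longrightarrow> v \<in> set ws \<Longrightarrow> i3s b1 b2 F one [] v (up v T)"
  by (induction ws) (auto split: if_splits)

lemma inr_weaken: "inr s b R \<Longrightarrow> s \<le> t \<Longrightarrow> t \<le> b \<Longrightarrow> inr t b R"
  by (induction R arbitrary: b) (auto split: if_splits)

abbreviation fin_at :: "fin7 \<Rightarrow> nat set \<Rightarrow> fin7" where
  "fin_at F W L1 va L2 vr M vs R \<equiv>
     F (map (rk W) L1) (rk W va) (map (rk W) L2) (rk W vr) (map (rk W) M) (rk W vs) (map (rk W) R)"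

locale config =
  fixes L1 L2 M R :: "nat list" and va vr vs :: nat and one :: bool
  assumes dist: "distinct (L1 @ L2 @ M @ R @ [va, vr, vs])"
    and vsr: "vs < vr" and iR: "inr vs vr R" and F2: "f2 one va vs L1 L2 M"
begin

definition W :: "nat set" where "W = set L1 \<union> set L2 \<union> set M \<union> set R \<union> {va, vr, vs}"

lemma vas: "va < vs" using F2 by (simp add: f2_def split: if_splits)
lemma finW: "finite W" by (simp add: W_def)
lemma inW: "set L1 \<subseteq> W" "set L2 \<subseteq> W" "set M \<subseteq> W" "set R \<subseteq> W" "va \<in> W" "vr \<in> W" "vs \<in> W" by (auto simp: W_def)

text \<open>If va is part of the pattern, the scan meets it; otherwise its rank among the other
  letters is one of the values tried, and \<open>up\<close> turns ranks in V into ranks in W. The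
  same dichotomy for vs and vr yields \<open>s1_sound\<close> and \<open>gn_sound\<close>.\<close>

lemma s2_sound:
  assumes "s2 b2 F one (map (rk V) L1) (rk V vs) (map (rk V) (rev L2 @ (if b2 then [va] else []) @ M)) (rk V vr) (map (rk V) R)"
    and V: "V = (if b2 then W else W - {va})"
  shows "fin_at F W L1 va L2 vr M vs R"
proof -
  have o: "f2 one (rk W va) (rk W vs) (map (rk W) L1) (map (rk W) L2) (map (rk W) M)"
    using f2_om[OF om_rk[OF finW] inW(5,7,1,2,3)] F2 by simp
  show ?thesis
  proof (cases b2)
    case True
    then have "p2 F one (map (rk W) L1) (rk W vs) [] (map (rk W) (rev L2) @ rk W va # map (rk W) M) (rk W vr) (map (rk W) R)"
      using assms by (simp add: s2_def)
    from p2_sound[OF this] show ?thesis using o by (simp add: rev_map)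
  next
    case False
    have Veq: "V = W - {va}" using V False by simp
    have V: "finite V" "va \<notin> V" "insert va V = W" using Veq finW inW by auto
    have mem: "set L1 \<subseteq> V" "set L2 \<subseteq> V" "set M \<subseteq> V" "set R \<subseteq> V" "vs \<in> V" "vr \<in> V"
      using dist unfolding Veq W_def by auto
    have i: "i2 F one (map (rk V) L1) (rk V vs) (map (rk V) (rev L2 @ M)) (rk V vr) (map (rk V) R) (vl (rk V vs))"
      using assms(1) False by (simp add: s2_def)
    have v: "rk V va \<in> set (vl (rk V vs))" using rk_mono[OF V(1), of va vs] vas by (simp add: set_vl)
    have "i2s F one (map (rk W) L1) (rk W va) (rk W vs) [] (map (rk W) (rev L2 @ M)) (rk W vr) (map (rk W) R)"
      using i2_sound[OF i v] up_map[OF V(1,2) mem(1)] up_map[OF V(1,2) mem(4)] up_map[OF V(1,2), of "rev L2 @ M"] mem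
        rk_insert_same[of va V] rk_insert_Suc[OF V(1,2) mem(5) vas] rk_insert_Suc[OF V(1,2) mem(6)] vas vsr
      by (simp add: V(3))
    then have "i2s F one (map (rk W) L1) (rk W va) (rk W vs) [] (map (rk W) (rev L2) @ map (rk W) M) (rk W vr) (map (rk W) R)" by simp
    from i2s_sound[OF this] show ?thesis using o by (simp add: rev_map)
  qed
qed

lemma s1_sound:
  assumes "s1 b1 b2 F one (map (rk V) (rev L1 @ (if b1 then [vs] else []) @ rev L2 @ (if b2 then [va] else []) @ M)) (rk V vr) (map (rk V) R)"
    and V: "V = W - (if b1 then {} else {vs}) - (if b2 then {} else {va})"
  shows "fin_at F W L1 va L2 vr M vs R"
proof -
  define U where "U = (if b2 then W else W - {va})"
  have U: "finite U" "set L1 \<subseteq> U" "set L2 \<subseteq> U" "set M \<subseteq> U" "set R \<subseteq> U" "vs \<in> U" "vr \<in> U"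
    using dist finW unfolding U_def W_def by auto
  have oR: "inr (rk U vs) (rk U vr) (map (rk U) R)" using inr_om[OF om_rk[OF U(1)] U(6,7,5)] iR by simp
  let ?Q = "rev L2 @ (if b2 then [va] else []) @ M"
  have "s2 b2 F one (map (rk U) L1) (rk U vs) (map (rk U) ?Q) (rk U vr) (map (rk U) R)"
  proof (cases b1)
    case True
    then have "V = U" using V by (auto simp: U_def)
    then have "p1 b2 F one [] (map (rk U) (rev L1) @ rk U vs # map (rk U) ?Q) (rk U vr) (map (rk U) R)"
      using assms(1) True by (simp add: s1_def)
    from p1_sound[OF this _ oR] show ?thesis using rk_less[OF U(1,6)] vsr by (simp add: rev_map)
  next
    case False
    have Veq: "V = U - {vs}" using V False by (auto simp: U_def)
    have VU: "finite V" "vs \<notin> V" "insert vs V = U" using Veq U by auto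
    have mem: "set L1 \<subseteq> V" "set ?Q \<subseteq> V" "set R \<subseteq> V" "vr \<in> V"
      using dist unfolding Veq U_def W_def by auto
    have i: "i1 b2 F one (map (rk V) (rev L1 @ ?Q)) (rk V vr) (map (rk V) R) (vl (rk V vr))"
      using assms(1) False by (simp add: s1_def)
    have v: "rk V vs \<in> set (vl (rk V vr))" using rk_mono[OF VU(1), of vs vr] vsr by (simp add: set_vl)
    have e: "up (rk V vs) (map (rk V) R) = map (rk U) R" "Suc (rk V vr) = rk U vr" "rk U vs = rk V vs"
      "up (rk V vs) (map (rk V) (rev L1 @ ?Q)) = map (rk U) (rev L1 @ ?Q)"
      using up_map[OF VU(1,2) mem(3)] rk_insert_Suc[OF VU(1,2) mem(4) vsr] rk_insert_same[of vs V]
        up_map[OF VU(1,2), of "rev L1 @ ?Q"] mem(1,2) by (simp_all only: VU(3)) auto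
    have "i1s b2 F one [] (rk U vs) (map (rk U) (rev L1 @ ?Q)) (rk U vr) (map (rk U) R)"
      using i1_sound[OF i v] oR unfolding e by (simp only: e(3))
    then have "i1s b2 F one [] (rk U vs) (map (rk U) (rev L1) @ map (rk U) ?Q) (rk U vr) (map (rk U) R)"
      by (simp only: map_append)
    from i1s_sound[OF this] show ?thesis by (simp add: rev_map)
  qed
  then show ?thesis using s2_sound[of b2 F U] by (simp add: U_def)
qed

lemma gn_sound:
  assumes "gn b1 b2 b3 F one N (map (rk V) (rev L1 @ (if b1 then [vs] else []) @ rev L2 @ (if b2 then [va] else []) @ M @
      (if b3 then [vr] else []) @ R))"
    and V: "V = W - (if b1 then {} else {vs}) - (if b2 then {} else {va}) - (if b3 then {} else {vr})" and N: "card V \<le> N"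
  shows "fin_at F W L1 va L2 vr M vs R"
proof -
  define U where "U = W - (if b1 then {} else {vs}) - (if b2 then {} else {va})"
  have U: "finite U" "set R \<subseteq> U" "vr \<in> U"
    using dist finW unfolding U_def W_def by auto
  have "inr vr vr R" using inr_weaken[OF iR] vsr by simp
  then have oR: "inr (rk U vr) (rk U vr) (map (rk U) R)" using inr_om[OF om_rk[OF U(1)] U(3,3,2)] by simp
  let ?P = "rev L1 @ (if b1 then [vs] else []) @ rev L2 @ (if b2 then [va] else []) @ M"
  have "s1 b1 b2 F one (map (rk U) ?P) (rk U vr) (map (rk U) R)"
  proof (cases b3)
    case True
    then have "V = U" using V by (simp add: U_def)
    then have "p3 b1 b2 F one [] (map (rk U) ?P @ rk U vr # map (rk U) R)"
      using assms(1) True by (simp add: gn_def)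
    from p3_sound[OF this oR] show ?thesis by simp
  next
    case False
    have Veq: "V = U - {vr}" using V False by (simp add: U_def)
    have VU: "finite V" "vr \<notin> V" "insert vr V = U" using Veq U by auto
    have mem: "set (?P @ R) \<subseteq> V"
      using dist unfolding Veq U_def W_def by auto
    have i: "i3 b1 b2 F one (map (rk V) (?P @ R)) (vl N)"
      using assms(1) False by (simp add: gn_def)
    have v: "rk V vr \<in> set (vl N)" using rk_le[OF VU(1), of vr] N by (simp add: set_vl)
    have e: "up (rk V vr) (map (rk V) (?P @ R)) = map (rk U) (?P @ R)" "rk U vr = rk V vr"
      using up_map[OF VU(1,2) mem] rk_insert_same[of vr V] by (simp_all only: VU(3))
    have "i3s b1 b2 F one [] (rk U vr) (map (rk U) (?P @ R))"
      using i3_sound[OF i v] unfolding e(1) by (simp only: e(2))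
    then have "i3s b1 b2 F one [] (rk U vr) (map (rk U) ?P @ map (rk U) R)" by (simp only: map_append)
    from i3s_sound[OF this oR] show ?thesis by simp
  qed
  then show ?thesis using s1_sound[of b1 b2 F U] by (simp add: U_def)
qed

lemma gen_sound:
  assumes "gen F one N (map (rk V) (rev L1 @ (if b1 then [vs] else []) @ rev L2 @ (if b2 then [va] else []) @ M @
      (if b3 then [vr] else []) @ R))"
    and "V = W - (if b1 then {} else {vs}) - (if b2 then {} else {va}) - (if b3 then {} else {vr})" and "card V \<le> N"
    and "b1 \<or> b2 \<or> b3"
  shows "fin_at F W L1 va L2 vr M vs R"
proof -
  have *: "gn b1 b2 b3 F one N q" if "gen F one N q" for q
    using that assms(4) unfolding gen_def by (cases b1; cases b2; cases b3) (auto split: if_splits)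
  show ?thesis by (rule gn_sound[OF *[OF assms(1)] assms(2,3)])
qed

end

lemma gens_sound: "gens F one N qs \<Longrightarrow> q \<in> set qs \<Longrightarrow> gen F one N q"
  by (induction qs) (auto split: if_splits)

lemma gens0_sound: "gens0 F N qs \<Longrightarrow> q \<in> set qs \<Longrightarrow> gn False False False F False N q"
  by (induction qs) (auto split: if_splits)

lemma ijs_sound: "ijs F t A v (X @ J1) vr M vs R \<Longrightarrow> nb v vs X \<Longrightarrow> nb v vs A \<Longrightarrow> F t J1 v (rev A @ X) vr M vs R"
proof (induction X arbitrary: A)
  case Nil
  then show ?case by (cases J1) (auto simp: rap_rev split: if_splits)
next
  case (Cons x X)
  then have "ijs F t (x # A) v (X @ J1) vr M vs R" by (simp split: if_splits)
  from Cons.IH[OF this] show ?case using Cons.prems by (auto simp: nb_iff)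
qed

lemma ij_sound: "ij F t L vr M vs R ws \<Longrightarrow> v \<in> set ws \<Longrightarrow>
    ijs F (ups (t < v) t) [] v (up v L) (Suc vr) (up v M) (Suc vs) (up v R)"
  by (induction ws) (auto split: if_splits)

lemma ij_rk:
  assumes "ij F t (map (rk V) (J2 @ J1)) (rk V vr) (map (rk V) M) (rk V vs) (map (rk V) R) (vl (rk V vs))"
    and V: "finite V" "set J1 \<subseteq> V" "set J2 \<subseteq> V" "set M \<subseteq> V" "set R \<subseteq> V" "vr \<in> V" "vs \<in> V"
    and j: "vj \<notin> V" "vj < vs" "vs < vr" "nb vj vs J2"
  shows "fin_at (F (ups (t < rk V vj) t)) (insert vj V) J1 vj J2 vr M vs R"
proof -
  let ?W = "insert vj V"
  have v: "rk V vj \<in> set (vl (rk V vs))" using rk_mono[OF V(1), of vj vs] j by (simp add: set_vl)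
  have e: "up (rk V vj) (map (rk V) R) = map (rk ?W) R" "up (rk V vj) (map (rk V) M) = map (rk ?W) M"
    "up (rk V vj) (map (rk V) (J2 @ J1)) = map (rk ?W) J2 @ map (rk ?W) J1" "rk ?W vj = rk V vj"
    "Suc (rk V vr) = rk ?W vr" "Suc (rk V vs) = rk ?W vs"
    using up_map[OF V(1) j(1)] up_map[OF V(1) j(1), of "J2 @ J1"] V rk_insert_same[of vj V] rk_insert_Suc[OF V(1) j(1)] j
    by simp_all
  have "nb (rk ?W vj) (rk ?W vs) (map (rk ?W) J2)"
    using nb_om[OF om_rk[of ?W], of vj vs J2] V j by auto
  then show ?thesis
    using ijs_sound[OF ij_sound[OF assms(1) v, unfolded e]] by (simp add: e(4) nb_iff)
qed

lemma pR_sound: "pR G A (X @ vr # M) vs R \<Longrightarrow> vs < vr \<Longrightarrow> inr vs vr R \<Longrightarrow> allt vs M \<Longrightarrow> G (rev X @ A) vr M vs R"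
  by (induction X arbitrary: A) (auto split: if_splits)

lemma iRs_sound: "iRs G A vr (X @ M) vs R \<Longrightarrow> allt vs M \<Longrightarrow> G (rev X @ A) vr M vs R"
proof (induction X arbitrary: A)
  case Nil
  then show ?case by (cases M) (auto split: if_splits)
qed (auto split: if_splits)

lemma iR_sound: "iR G P vs R ws \<Longrightarrow> v \<in> set ws \<Longrightarrow> vs < v \<Longrightarrow> inr vs v (up v R) \<Longrightarrow> iRs G [] v (up v P) vs (up v R)"
  by (induction ws) (auto split: if_splits)

lemma pS_sound: "pS b G N A (X @ vs # R) \<Longrightarrow> inr vs vs R \<Longrightarrow> sR b G N (rev A @ X) vs R"
proof (induction X arbitrary: A)
  case (Cons x X)
  then have "pS b G N (x # A) (X @ vs # R)" by (simp split: if_splits)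
  from Cons.IH[OF this Cons.prems(2)] show ?case by simp
qed (simp add: rap_rev split: if_splits)

lemma iSs_sound: "iSs b G N A vs (X @ R) \<Longrightarrow> inr vs vs R \<Longrightarrow> sR b G N (rev A @ X) vs R"
proof (induction X arbitrary: A)
  case Nil
  then show ?case by (cases R) (simp_all add: rap_rev split: if_splits)
next
  case (Cons x X)
  then have "iSs b G N (x # A) vs (X @ R)" by (simp split: if_splits)
  from Cons.IH[OF this Cons.prems(2)] show ?case by simp
qed

lemma iS_sound: "iS b G N T ws \<Longrightarrow> v \<in> set ws \<Longrightarrow> iSs b G (Suc N) [] v (up v T)"
  by (induction ws) (auto split: if_splits)

lemma inr_lower: "inr s b R \<Longrightarrow> s \<le> b \<Longrightarrow> inr s s R"
  by (induction R arbitrary: b) (auto split: if_splits)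

lemma gA_rk:
  assumes "gA bs br G N (map (rk V) (rev L @ (if br then [vr] else []) @ M @ (if bs then [vs] else []) @ R))"
    and D: "distinct (L @ M @ R @ [vr, vs])" "vs < vr" "inr vs vr R" "allt vs M"
    and W: "W = set L \<union> set M \<union> set R \<union> {vr, vs}"
    and V: "V = W - (if bs then {} else {vs}) - (if br then {} else {vr})" and N: "card V \<le> N"
  shows "G (map (rk W) L) (rk W vr) (map (rk W) M) (rk W vs) (map (rk W) R)"
proof -
  have finW: "finite W" by (simp add: W)
  have inW: "set L \<subseteq> W" "set M \<subseteq> W" "set R \<subseteq> W" "vr \<in> W" "vs \<in> W" by (auto simp: W)
  define U where "U = W - (if br then {} else {vr})"
  have U: "finite U" "set L \<subseteq> U" "set M \<subseteq> U" "set R \<subseteq> U" "vs \<in> U" using D(1,2) unfolding U_def W by auto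
  have oR: "inr (rk U vs) (rk U vs) (map (rk U) R)"
    using inr_om[OF om_rk[OF U(1)] U(5,5,4)] inr_lower[OF D(3)] D(2) by simp
  let ?P = "rev L @ (if br then [vr] else []) @ M"
  have "\<exists>N'. card U \<le> N' \<and> sR br G N' (map (rk U) ?P) (rk U vs) (map (rk U) R)"
  proof (cases bs)
    case True
    then have "V = U" using V by (simp add: U_def)
    then have "pS br G N [] (map (rk U) ?P @ rk U vs # map (rk U) R)" using assms(1) True by (simp add: gA_def)
    from pS_sound[OF this oR] show ?thesis using N \<open>V = U\<close> by auto
  next
    case False
    have Veq: "V = U - {vs}" using V False by (auto simp: U_def)
    have VU: "finite V" "vs \<notin> V" "insert vs V = U" using Veq U by auto
    have mem: "set (?P @ R) \<subseteq> V" using D(1) unfolding Veq U_def W by auto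
    have i: "iS br G N (map (rk V) (?P @ R)) (vl N)" using assms(1) False by (simp add: gA_def)
    have v: "rk V vs \<in> set (vl N)" using rk_le[OF VU(1), of vs] N by (simp add: set_vl)
    have e: "up (rk V vs) (map (rk V) (?P @ R)) = map (rk U) (?P @ R)" "rk U vs = rk V vs"
      using up_map[OF VU(1,2) mem] rk_insert_same[of vs V] by (simp_all only: VU(3))
    have "iSs br G (Suc N) [] (rk U vs) (map (rk U) ?P @ map (rk U) R)"
      using iS_sound[OF i v] unfolding e(1) by (simp only: e(2) map_append)
    from iSs_sound[OF this oR] have "sR br G (Suc N) (map (rk U) ?P) (rk U vs) (map (rk U) R)" by simp
    moreover have "card U \<le> Suc N" using N VU by (metis card_insert_disjoint Suc_le_mono)
    ultimately show ?thesis by blast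
  qed
  then obtain N' where N': "card U \<le> N'" and s: "sR br G N' (map (rk U) ?P) (rk U vs) (map (rk U) R)" by blast
  have wR: "inr (rk W vs) (rk W vr) (map (rk W) R)" using inr_om[OF om_rk[OF finW] inW(5,4,3)] D(3) by simp
  have wM: "allt (rk W vs) (map (rk W) M)" using allt_om[OF om_rk[OF finW] inW(5,2)] D(4) by simp
  have ws: "rk W vs < rk W vr" using rk_less[OF finW inW(5)] D(2) by simp
  show ?thesis
  proof (cases br)
    case True
    then have "U = W" by (simp add: U_def)
    then have "pR G [] (map (rk W) (rev L) @ rk W vr # map (rk W) M) (rk W vs) (map (rk W) R)"
      using s True by (simp add: sR_def)
    from pR_sound[OF this ws wR wM] show ?thesis by (simp add: rev_map)
  next
    case False
    have UW: "vr \<notin> U" "insert vr U = W" using inW False by (auto simp: U_def)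
    have i: "iR G (map (rk U) (rev L @ M)) (rk U vs) (map (rk U) R) (vl N')" using s False by (simp add: sR_def)
    have v: "rk U vr \<in> set (vl N')" using rk_le[OF U(1), of vr] N' by (simp add: set_vl)
    have "rk U vs < rk U vr" using rk_less[OF U(1,5)] D(2) by simp
    then have e: "up (rk U vr) (map (rk U) R) = map (rk W) R" "rk W vr = rk U vr"
      "up (rk U vr) (map (rk U) (rev L @ M)) = map (rk W) (rev L @ M)" "rk W vs = rk U vs"
      using up_map[OF U(1) UW(1) U(4)] rk_insert_same[of vr U] up_map[OF U(1) UW(1), of "rev L @ M"] U(2,3)
        rk_insert[OF U(1) UW(1) U(5)] by (simp_all add: UW(2))
    have "iRs G [] (rk U vr) (map (rk W) (rev L @ M)) (rk U vs) (map (rk W) R)"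
      using iR_sound[OF i v \<open>rk U vs < rk U vr\<close>] wR unfolding e by blast
    then have "iRs G [] (rk W vr) (map (rk W) (rev L) @ map (rk W) M) (rk W vs) (map (rk W) R)"
      by (simp only: map_append e)
    from iRs_sound[OF this wM] show ?thesis by (simp add: rev_map)
  qed
qed

section \<open>Transition for words of distinct letters\<close>

definition pw :: "nat list \<Rightarrow> nat \<Rightarrow> nat" where
  "pw l i = (if 1 \<le> i \<and> i \<le> length l then l ! (i - 1) else i)"

definition g :: "nat list \<Rightarrow> nat" where "g l = EG (pw (fl l))"

lemma fl_spec: "distinct l \<Longrightarrow> fl l \<in> Sym (length l) \<and> same_relative_order (fl l) l"
  unfolding fl_def by (rule theI'[OF ex1_fl])

lemma fl_eqI: "distinct l \<Longrightarrow> v \<in> Sym (length l) \<Longrightarrow> same_relative_order v l \<Longrightarrow> fl l = v"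
  using ex1_fl[of l] fl_spec[of l] by blast

lemma Sym_iff: "v \<in> Sym n \<longleftrightarrow> distinct v \<and> set v = {1..n}"
  by (auto simp: Sym_def permutations_of_set_def)

lemma fl_rk:
  assumes "distinct l"
  shows "fl l = map (\<lambda>x. Suc (rk (set l) x)) l"
proof (rule fl_eqI[OF assms])
  have inj: "inj_on (\<lambda>x. Suc (rk (set l) x)) (set l)"
    using om_inj[OF om_rk[of "set l"]] by (auto simp: inj_on_def)
  have "rk (set l) x < card (set l)" if "x \<in> set l" for x
    unfolding rk_def using that by (intro psubset_card_mono) auto
  then have "(\<lambda>x. Suc (rk (set l) x)) ` set l \<subseteq> {1..length l}"
    using distinct_card[OF assms] by (auto simp: Suc_le_eq)
  moreover have "card ((\<lambda>x. Suc (rk (set l) x)) ` set l) = card {1..length l}"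
    using card_image[OF inj] distinct_card[OF assms] by simp
  ultimately have "(\<lambda>x. Suc (rk (set l) x)) ` set l = {1..length l}" by (intro card_subset_eq) auto
  then show "map (\<lambda>x. Suc (rk (set l) x)) l \<in> Sym (length l)"
    using inj assms by (simp add: Sym_iff distinct_map)
  show "same_relative_order (map (\<lambda>x. Suc (rk (set l) x)) l) l"
    by (simp add: same_relative_order_def rk_less)
qed

lemma fl_map:
  assumes "distinct l" "om \<rho> (set l)"
  shows "fl (map \<rho> l) = fl l"
proof (rule fl_eqI)
  show "distinct (map \<rho> l)" using assms om_inj by (simp add: distinct_map)
  show "fl l \<in> Sym (length (map \<rho> l))" using fl_spec[OF assms(1)] by simp
  show "same_relative_order (fl l) (map \<rho> l)"
    using fl_spec[OF assms(1)] assms(2) unfolding same_relative_order_def om_def by auto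
qed

lemma g_map: "distinct l \<Longrightarrow> om \<rho> (set l) \<Longrightarrow> g (map \<rho> l) = g l"
  by (simp add: g_def fl_map)

lemma pw_permutes:
  assumes "u \<in> Sym n"
  shows "pw u permutes {1..n}"
proof -
  have u: "distinct u" "set u = {1..n}" "length u = n"
    using assms distinct_card[of u] by (auto simp: Sym_iff)
  have "bij_betw (pw u) {1..n} {1..n}"
  proof -
    have "bij_betw (\<lambda>i. u ! i) {..<n} {1..n}" using bij_betw_nth[OF u(1), of "{..<n}" "{1..n}"] u by simp
    moreover have "bij_betw (\<lambda>i. i - 1) {1..n} {..<n}"
      by (rule bij_betw_byWitness[where f' = Suc]) auto
    ultimately have "bij_betw ((\<lambda>i. u ! i) \<circ> (\<lambda>i. i - 1)) {1..n} {1..n}" by (rule bij_betw_trans[rotated])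
    then show ?thesis by (rule bij_betw_cong[THEN iffD1, rotated]) (auto simp: pw_def u)
  qed
  then show ?thesis by (rule bij_imp_permutes) (auto simp: pw_def u)
qed

text \<open>The passage to a child, acting on letters instead of positions. In this form it commutes
  with restriction to a set of letters containing the three moved ones and disappears on sets
  disjoint from them.\<close>

definition tau :: "nat \<Rightarrow> nat \<Rightarrow> nat \<Rightarrow> nat \<Rightarrow> nat" where
  "tau va vr vs x = (if x = va then vs else if x = vr then va else if x = vs then vr else x)"

definition Iv :: "nat \<Rightarrow> nat list \<Rightarrow> nat set" where
  "Iv vs L = {a. \<exists>L2 L1. L = L2 @ a # L1 \<and> a < vs \<and> (\<forall>x\<in>set L2. \<not> (a < x \<and> x < vs))}"

lemma Iv_sub: "Iv vs L \<subseteq> set L" by (auto simp: Iv_def)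
lemma finite_Iv: "finite (Iv vs L)" using Iv_sub finite_subset by blast

lemma wl_eq: "wl L vr M vs R = rev L @ vr # M @ vs # R" by (simp add: wl_def rap_rev)

lemma tau_map:
  assumes "distinct (wl (L2 @ va # L1) vr M vs R)"
  shows "map (tau va vr vs) (wl (L2 @ va # L1) vr M vs R) = rev L1 @ vs # rev L2 @ va # M @ vr # R"
proof -
  have "map (tau va vr vs) X = X" if "set X \<inter> {va, vr, vs} = {}" for X
    using that by (intro map_idI) (auto simp: tau_def)
  then show ?thesis using assms by (auto simp: wl_eq tau_def)
qed

lemma tau_bij: "distinct [va, vr, vs] \<Longrightarrow> bij (tau va vr vs)"
  by (rule o_bij[of "tau vs vr va"]) (auto simp: tau_def fun_eq_iff)

lemma tau_inj: "distinct [va, vr, vs] \<Longrightarrow> inj_on (tau va vr vs) V"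
  by (rule inj_on_subset[OF bij_is_inj[OF tau_bij]]) simp_all

lemma tau_image: "distinct [va, vr, vs] \<Longrightarrow> {va, vr, vs} \<subseteq> V \<Longrightarrow> tau va vr vs ` V = V"
proof -
  assume d: "distinct [va, vr, vs]" "{va, vr, vs} \<subseteq> V"
  have "tau vs vr va (tau va vr vs x) = x" "tau va vr vs (tau vs vr va x) = x" for x using d by (auto simp: tau_def)
  moreover have "tau va vr vs x \<in> V" "tau vs vr va x \<in> V" if "x \<in> V" for x using d that by (auto simp: tau_def)
  ultimately show ?thesis by (intro equalityI subsetI) (blast, metis image_eqI)
qed

text \<open>The hypotheses on M and R are the condition \<open>valid\<close> of
  \<open>EG_corner\<close> for the positions inside the word; behind the word the permutation has
  fixed points exceeding all its letters.\<close>

lemma g_transition: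
  assumes D: "distinct (wl L vr M vs R)" and vs: "vs < vr" "allt vs M" "nb vs vr R" and ex: "\<exists>x\<in>set L. x < vs"
  shows "g (wl L vr M vs R) = (\<Sum>a\<in>Iv vs L. g (map (tau a vr vs) (wl L vr M vs R)))"
proof -
  define l where "l = wl L vr M vs R"
  define \<sigma> where "\<sigma> = (\<lambda>x. Suc (rk (set l) x))"
  define n where "n = length l"
  define r where "r = Suc (length L)"
  define s where "s = r + Suc (length M)"
  have l: "l = rev L @ vr # M @ vs # R" by (simp add: l_def wl_eq)
  have Dl: "distinct l" using D by (simp add: l_def)
  have \<sigma>: "\<sigma> x < \<sigma> y \<longleftrightarrow> x < y" if "x \<in> set l" for x y using that by (simp add: \<sigma>_def rk_less)
  have fl: "fl l = map \<sigma> l" using fl_rk[OF Dl] by (simp add: \<sigma>_def)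
  let ?w = "pw (fl l)"
  have w: "?w permutes {1..n}" using pw_permutes fl_spec[OF Dl] by (simp add: n_def)
  have wi: "?w i = \<sigma> (l ! (i - 1))" if "1 \<le> i" "i \<le> n" for i using that by (simp add: pw_def fl n_def)
  have len: "n = length L + length M + length R + 2" by (simp add: n_def l)
  have lr: "l ! (r - 1) = vr" "l ! (s - 1) = vs" by (simp_all add: l r_def s_def nth_append)
  have wr: "?w r = \<sigma> vr" "?w s = \<sigma> vs" using wi[of r] wi[of s] lr len by (simp_all add: r_def s_def)
  have mem: "vr \<in> set l" "vs \<in> set l" by (auto simp: l)
  have lL: "l ! (p - 1) = rev L ! (p - 1)" if "1 \<le> p" "p < r" for p
  proof -
    have "p - 1 < length L" using that by (auto simp: r_def)
    then show ?thesis by (simp add: l nth_append)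
  qed
  have nthin: "l ! (p - 1) \<in> set l" if "1 \<le> p" "p \<le> n" for p using that by (auto simp: n_def)
  have le_n: "\<sigma> x \<le> n" if "x \<in> set l" for x
  proof -
    have "rk (set l) x < card (set l)" unfolding rk_def using that by (intro psubset_card_mono) auto
    then show ?thesis using distinct_card[OF Dl] by (simp add: \<sigma>_def n_def)
  qed
  let ?I = "{a. 1 \<le> a \<and> a < r \<and> ?w a < ?w s \<and> (\<forall>p. a < p \<and> p < r \<longrightarrow> \<not> (?w a < ?w p \<and> ?w p < ?w s))}"
  have "EG ?w = (\<Sum>a\<in>?I. EG (child ?w a r s))"
  proof (rule EG_corner[OF w])
    show "r < s" by (simp add: s_def)
    show "?w s < ?w r" using vs(1) mem by (simp add: wr \<sigma>)
    show "\<exists>i\<ge>1. i < r \<and> ?w i < ?w s"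
    proof -
      obtain x where "x \<in> set (rev L)" "x < vs" using ex by auto
      then obtain k where k: "k < length L" "rev L ! k = x" by (metis in_set_conv_nth length_rev)
      then have "?w (Suc k) = \<sigma> x" using wi[of "Suc k"] lL[of "Suc k"] len by (simp add: r_def)
      moreover have "x \<in> set l" using \<open>x \<in> set (rev L)\<close> by (simp add: l)
      ultimately show ?thesis using k \<open>x < vs\<close> by (intro exI[of _ "Suc k"]) (simp add: r_def wr \<sigma>)
    qed
    fix t assume t: "r < t" "t \<noteq> s" "?w s < ?w t"
    show "s < t \<and> ?w r < ?w t"
    proof (cases "t \<le> n")
      case False
      then have "?w t = t" by (simp add: pw_def fl n_def)
      moreover have "s \<le> n" by (simp add: len s_def r_def)
      ultimately show ?thesis using False le_n[OF mem(1)] wr by simp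
    next
      case True
      have wt: "?w t = \<sigma> (l ! (t - 1))" using wi[of t] True t by simp
      then have big: "vs < l ! (t - 1)" using t(3) mem by (simp add: wr \<sigma>)
      show ?thesis
      proof (cases "t < s")
        case True
        obtain k where k: "t = r + Suc k" using t(1) less_iff_Suc_add by auto
        have "t - 1 = length (rev L) + Suc k" by (simp add: k r_def)
        moreover have km: "k < length M" using True by (simp add: k s_def)
        ultimately have "l ! (t - 1) = M ! k" unfolding l by (simp only: nth_append_length_plus nth_Cons_Suc) (simp add: nth_append)
        moreover note km
        ultimately have "l ! (t - 1) \<in> set M" by simp
        then show ?thesis using vs(2) big by (auto simp: allt_iff)
      next
        case False
        then have st: "s < t" using t by simp
        obtain k where k: "t = s + Suc k" using st less_iff_Suc_add by auto
        have "t - 1 = length (rev L) + Suc (length M + Suc k)" by (simp add: k r_def s_def)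
        then have "l ! (t - 1) = R ! k" unfolding l by (simp only: nth_append_length_plus nth_Cons_Suc)
        moreover have "k < length R" using \<open>t \<le> n\<close> unfolding k len by (simp add: r_def s_def)
        ultimately have "l ! (t - 1) \<in> set R" by simp
        then have "vr \<le> l ! (t - 1)" "l ! (t - 1) \<noteq> vr" using vs(3) big Dl by (auto simp: nb_iff l)
        then show ?thesis using st mem by (simp add: wt wr \<sigma>)
      qed
    qed
  qed
  also have "\<dots> = (\<Sum>a\<in>?I. g (map (tau (l ! (a - 1)) vr vs) l))"
  proof (rule sum.cong)
    fix a assume a: "a \<in> ?I"
    let ?va = "l ! (a - 1)" and ?l = "map (tau (l ! (a - 1)) vr vs) l"
    have an: "1 \<le> a" "a < r" "r < s" "s \<le> n" using a len by (auto simp: r_def s_def)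
    have eqi: "l ! (i - 1) = l ! (j - 1) \<longleftrightarrow> i = j" if "1 \<le> i" "i \<le> n" "1 \<le> j" "j \<le> n" for i j
      using that Dl by (auto simp: nth_eq_iff_index_eq n_def)
    have ne: "distinct [?va, vr, vs]" using eqi[of a r] eqi[of a s] eqi[of r s] an lr by auto
    have "set ?l = set l" using tau_image[OF ne, of "set l"] nthin[of a] an mem by simp
    moreover have "distinct ?l" using Dl tau_inj[OF ne] by (simp add: distinct_map)
    ultimately have "fl ?l = map \<sigma> ?l" using fl_rk[of ?l] by (simp add: \<sigma>_def)
    moreover have "child ?w a r s i = pw (map \<sigma> ?l) i" for i
    proof (cases "1 \<le> i \<and> i \<le> n")
      case True
      have p: "pw (map \<sigma> ?l) i = \<sigma> (tau ?va vr vs (l ! (i - 1)))" proof -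
        have "i - 1 < length l" using True by (auto simp: n_def)
        then show ?thesis using True by (simp add: pw_def n_def)
      qed
      show ?thesis unfolding p child_def
        using True wi[of i] wi[of a] wr an eqi[of i a] eqi[of i r] eqi[of i s] lr ne by (auto simp: tau_def)
    next
      case False
      then show ?thesis using an by (auto simp: child_def pw_def fl n_def)
    qed
    ultimately show "EG (child ?w a r s) = g ?l" unfolding g_def by (metis ext)
  qed simp
  also have "\<dots> = (\<Sum>a\<in>(\<lambda>a. l ! (a - 1)) ` ?I. g (map (tau a vr vs) l))"
  proof (rule sum.reindex[symmetric, unfolded comp_def])
    show "inj_on (\<lambda>a. l ! (a - 1)) ?I"
      using Dl len by (auto simp: inj_on_def nth_eq_iff_index_eq n_def[symmetric] r_def)
  qed
  also have "(\<lambda>a. l ! (a - 1)) ` ?I = Iv vs L"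
  proof (intro set_eqI iffI)
    fix x assume "x \<in> (\<lambda>a. l ! (a - 1)) ` ?I"
    then obtain a where a: "a \<in> ?I" "x = l ! (a - 1)" by blast
    then have ar: "1 \<le> a" "a < r" by auto
    let ?i = "a - 1"
    have i: "?i < length (rev L)" using ar by (auto simp: r_def)
    have xr: "x = rev L ! ?i" using lL ar a(2) by simp
    have "rev L = take ?i (rev L) @ x # drop a (rev L)" using id_take_nth_drop[OF i] xr ar by simp
    then have "L = rev (drop a (rev L)) @ x # rev (take ?i (rev L))" by (metis rev_append rev.simps(2) rev_rev_ident append.assoc append_Cons append_Nil)
    moreover have "x < vs" using a wi[of a] ar len nthin[of a] by (simp add: wr \<sigma> r_def)
    moreover have "\<not> (x < y \<and> y < vs)" if "y \<in> set (rev (drop a (rev L)))" for y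
    proof -
      have al: "a \<le> length (rev L)" using ar by (simp add: r_def)
      have "y \<in> set (drop a (rev L))" using that by simp
      then obtain k where "k < length (drop a (rev L))" "drop a (rev L) ! k = y" unfolding in_set_conv_nth by blast
      then have k: "k < length (rev L) - a" "y = rev L ! (a + k)" using al by simp_all
      let ?p = "Suc (a + k)"
      have p: "a < ?p" "?p < r" using k ar by (auto simp: r_def)
      have y: "l ! (?p - 1) = y" using lL[of ?p] p k by simp
      have "?w ?p = \<sigma> y" "?w a = \<sigma> x" using wi[of ?p] wi[of a] p ar len y a(2) by (simp_all add: r_def)
      moreover have "\<not> (?w a < ?w ?p \<and> ?w ?p < ?w s)" using a(1) p by blast
      moreover have "y \<in> set l" "x \<in> set l" using nthin[of ?p] nthin[of a] p ar len y a(2) by (auto simp: r_def)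
      ultimately show ?thesis by (simp add: wr \<sigma>)
    qed
    ultimately show "x \<in> Iv vs L" unfolding Iv_def by blast
  next
    fix x assume "x \<in> Iv vs L"
    then obtain L2 L1 where L: "L = L2 @ x # L1" "x < vs" "\<forall>y\<in>set L2. \<not> (x < y \<and> y < vs)" by (auto simp: Iv_def)
    let ?a = "Suc (length L1)"
    have a: "1 \<le> ?a" "?a < r" "l ! (?a - 1) = x" by (simp_all add: r_def L l nth_append)
    have wa: "?w ?a = \<sigma> x" using wi[of ?a] a len by (simp add: r_def)
    have xl: "x \<in> set l" by (simp add: l L)
    have "\<not> (?w ?a < ?w p \<and> ?w p < ?w s)" if p: "?a < p" "p < r" for p
    proof -
      obtain k where k: "p = Suc (Suc (length L1 + k))" using p(1) less_iff_Suc_add by auto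
      have "l ! (p - 1) = rev L2 ! k" "k < length L2" using p(2) unfolding k by (auto simp: l L nth_append r_def)
      then have "l ! (p - 1) \<in> set L2" by (metis length_rev nth_mem set_rev)
      moreover have "?w p = \<sigma> (l ! (p - 1))" using wi[of p] p len by (simp add: r_def)
      moreover have "l ! (p - 1) \<in> set l" using calculation(1) by (simp add: l L)
      ultimately show ?thesis using L(3) by (simp add: wa wr \<sigma> xl)
    qed
    then have "?a \<in> ?I" using a L(2) by (simp add: wa wr \<sigma> xl)
    then show "x \<in> (\<lambda>a. l ! (a - 1)) ` ?I" using a(3) by (metis (mono_tags, lifting) image_eqI)
  qed
  finally show ?thesis unfolding g_def l_def .
qed

text \<open>The function h is arbitrary, so that one induction transfers sums of values, the number
  of children and universal statements from \<open>kd\<close> to the set of child points. The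
  invariant says that \<open>m\<close> recognizes the letters obstructed by
  \<open>L2\<close>.\<close>

lemma kd_sum:
  assumes "distinct (X @ L2 @ M @ R @ [vr, vs])" "\<forall>x\<in>set X. x < m \<longleftrightarrow> (\<exists>y\<in>set L2. x < y \<and> y < vs)"
  shows "(\<Sum>k\<leftarrow>kd m X L2 vs (M @ vr # R). h k) =
    (\<Sum>a\<in>{a. \<exists>X2 X1. X = X2 @ a # X1 \<and> a < vs \<and> (\<forall>x\<in>set L2 \<union> set X2. \<not> (a < x \<and> x < vs))}.
      h (map (tau a vr vs) (rev X @ L2 @ vr # M @ vs # R)))"
  using assms
proof (induction X arbitrary: m L2)
  case (Cons x X)
  let ?D = "\<lambda>L2 X. {a. \<exists>X2 X1. X = X2 @ a # X1 \<and> a < vs \<and> (\<forall>x\<in>set L2 \<union> set X2. \<not> (a < x \<and> x < vs))}"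
  let ?k = "\<lambda>a. h (map (tau a vr vs) (rev (x # X) @ L2 @ vr # M @ vs # R))"
  have ds: "distinct (X @ (x # L2) @ M @ R @ [vr, vs])" using Cons.prems(1) by auto
  have fin: "finite (?D (x # L2) X)" by (rule finite_subset[of _ "set X"]) auto
  have xn: "x \<notin> ?D (x # L2) X" using Cons.prems(1) by auto
  have split: "?D L2 (x # X) = (if x < vs \<and> \<not> x < m then {x} else {}) \<union> ?D (x # L2) X"
  proof (intro set_eqI iffI)
    fix a assume "a \<in> ?D L2 (x # X)"
    then obtain X2 X1 where X: "x # X = X2 @ a # X1" "a < vs" "\<forall>x\<in>set L2 \<union> set X2. \<not> (a < x \<and> x < vs)" by blast
    show "a \<in> (if x < vs \<and> \<not> x < m then {x} else {}) \<union> ?D (x # L2) X"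
    proof (cases X2)
      case Nil
      then show ?thesis using X Cons.prems(2) by auto
    next
      case (Cons y X3)
      then have "X = X3 @ a # X1" "\<forall>z\<in>set (x # L2) \<union> set X3. \<not> (a < z \<and> z < vs)" using X by auto
      then show ?thesis using X(2) by blast
    qed
  next
    fix a assume a: "a \<in> (if x < vs \<and> \<not> x < m then {x} else {}) \<union> ?D (x # L2) X"
    show "a \<in> ?D L2 (x # X)"
    proof (cases "a = x \<and> x < vs \<and> \<not> x < m")
      case True
      then have "x # X = [] @ a # X" "a < vs" "\<forall>z\<in>set L2 \<union> set []. \<not> (a < z \<and> z < vs)" using Cons.prems(2) by auto
      then show ?thesis by blast
    next
      case False
      then obtain X2 X1 where "X = X2 @ a # X1" "a < vs" "\<forall>z\<in>set (x # L2) \<union> set X2. \<not> (a < z \<and> z < vs)" using a by (auto split: if_splits)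
      then have "x # X = (x # X2) @ a # X1" "\<forall>z\<in>set L2 \<union> set (x # X2). \<not> (a < z \<and> z < vs)" by auto
      then show ?thesis using \<open>a < vs\<close> by blast
    qed
  qed
  have IH: "(\<Sum>k\<leftarrow>kd m' X (x # L2) vs (M @ vr # R). h k) = (\<Sum>a\<in>?D (x # L2) X. ?k a)"
    if "\<forall>z\<in>set X. z < m' \<longleftrightarrow> (\<exists>y\<in>set (x # L2). z < y \<and> y < vs)" for m'
    using Cons.IH[OF ds that] by simp
  have xk: "h (rev X @ vs # L2 @ x # M @ vr # R) = ?k x"
    using tau_map[of "rev L2" x X vr M vs R] Cons.prems(1) by (auto simp: wl_eq)
  show ?case
  proof (cases "x < vs")
    case False
    then have "\<forall>z\<in>set X. z < m \<longleftrightarrow> (\<exists>y\<in>set (x # L2). z < y \<and> y < vs)" using Cons.prems(2) by auto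
    from IH[OF this] show ?thesis using False unfolding split by simp
  next
    case xv: True
    show ?thesis
    proof (cases "x < m")
      case True
      then obtain y where "y \<in> set L2" "x < y" "y < vs" using Cons.prems(2) by auto
      then have "\<forall>z\<in>set X. z < m \<longleftrightarrow> (\<exists>y\<in>set (x # L2). z < y \<and> y < vs)" using Cons.prems(2) by (auto intro: less_trans)
      from IH[OF this] show ?thesis using True xv unfolding split by simp
    next
      case False
      have "\<forall>z\<in>set X. z < x \<longleftrightarrow> (\<exists>y\<in>set (x # L2). z < y \<and> y < vs)"
      proof
        fix z assume z: "z \<in> set X"
        show "z < x \<longleftrightarrow> (\<exists>y\<in>set (x # L2). z < y \<and> y < vs)"
        proof
          assume "\<exists>y\<in>set (x # L2). z < y \<and> y < vs"
          then obtain y where y: "y \<in> set (x # L2)" "z < y" "y < vs" by blast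
          show "z < x"
          proof (rule ccontr)
            assume "\<not> z < x"
            then have "x < z" using z Cons.prems(1) by (metis distinct.simps(2) append_Cons in_set_conv_decomp linorder_neqE_nat set_append UnI1)
            then have "x < y" "y \<noteq> x" using y by auto
            then have "y \<in> set L2" using y by auto
            then show False using \<open>x < y\<close> y False Cons.prems(2) by auto
          qed
        qed (use xv in auto)
      qed
      from IH[OF this] show ?thesis using False xv fin xn unfolding split by (simp add: rap_rev xk)
    qed
  qed
qed simp

lemma distinct_wl: "distinct (wl L vr M vs R) \<longleftrightarrow> distinct (L @ M @ R @ [vr, vs])"
  by (auto simp: wl_eq)

lemma kd_sum_Iv:
  assumes "distinct (wl L vr M vs R)"
  shows "(\<Sum>k\<leftarrow>kd c0 L [] vs (M @ vr # R). h k) = (\<Sum>a\<in>Iv vs L. h (map (tau a vr vs) (wl L vr M vs R)))"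
  using kd_sum[of L "[]" M R vr vs c0 h] assms unfolding distinct_wl by (simp add: c0_def wl_eq Iv_def)

lemma length_kd: "length (kd m X L2 vs T) = ci m X vs"
  by (induction X arbitrary: m L2) auto

lemma ci_card:
  assumes "distinct (wl L vr M vs R)"
  shows "ci c0 L vs = card (Iv vs L)"
proof -
  have "(\<Sum>k\<leftarrow>kd c0 L [] vs (M @ vr # R). 1) = ci c0 L vs"
    by (simp add: sum_list_triv length_kd)
  also have "(\<Sum>k\<leftarrow>kd c0 L [] vs (M @ vr # R). 1) = (\<Sum>a\<in>Iv vs L. 1)" by (rule kd_sum_Iv[OF assms])
  finally show ?thesis by simp
qed

lemma kd_elem: "k \<in> set (kd m X L2 vs T) \<Longrightarrow> (\<exists>x\<in>set X. x < vs) \<and> mset k = mset (X @ vs # L2 @ T)"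
  by (induction X arbitrary: m L2) (auto simp: rap_rev split: if_splits)

lemma Iv_nonempty: "x \<in> set L \<Longrightarrow> x < vs \<Longrightarrow> Iv vs L \<noteq> {}"
proof (induction L)
  case (Cons y L)
  show ?case
  proof (cases "y < vs")
    case True
    have "y \<in> Iv vs (y # L)" unfolding Iv_def using True by (intro CollectI exI[of _ "[]"] exI[of _ L]) simp
    then show ?thesis by blast
  next
    case False
    then have "Iv vs L \<noteq> {}" using Cons by auto
    then obtain a L2 L1 where "L = L2 @ a # L1" "a < vs" "\<forall>x\<in>set L2. \<not> (a < x \<and> x < vs)" by (auto simp: Iv_def)
    then have "a \<in> Iv vs (y # L)" unfolding Iv_def using False by (intro CollectI exI[of _ "y # L2"] exI[of _ L1]) simp
    then show ?thesis by blast
  qed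
qed simp

section \<open>Termination: children are lexicographically larger\<close>

fun bv :: "nat \<Rightarrow> nat list \<Rightarrow> nat" where
  "bv N [] = 0"
| "bv N (x # xs) = x * N ^ length xs + bv N xs"

lemma bv_less: "set l \<subseteq> {..<N} \<Longrightarrow> bv N l < N ^ length l"
proof (induction l)
  case (Cons x l)
  have "x * N ^ length l + bv N l < x * N ^ length l + N ^ length l" using Cons by simp
  also have "\<dots> = Suc x * N ^ length l" by simp
  also have "\<dots> \<le> N * N ^ length l" using Cons.prems by (intro mult_le_mono1) auto
  finally show ?case by simp
qed simp

lemma bv_mono:
  assumes "set (A @ x # B) \<subseteq> {..<N}" "x < y" "length B = length C"
  shows "bv N (A @ x # B) < bv N (A @ y # C)"
proof -
  have "bv N (x # B) < bv N (y # C)"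
  proof -
    have "bv N (x # B) < Suc x * N ^ length B" using bv_less[of B N] assms(1) by simp
    also have "\<dots> \<le> y * N ^ length B" using assms(2) by (intro mult_le_mono1) simp
    also have "\<dots> \<le> bv N (y # C)" by (simp add: assms(3))
    finally show ?thesis .
  qed
  then show ?thesis using assms(3) by (induction A) simp_all
qed

text \<open>Words are compared by length and, for equal length, as numerals to base N. At the place
  of the child point a the child has the larger letter vs and agrees with the parent before it, so
  its distance from the upper bound N to the power of the length decreases.\<close>

definition lt :: "nat \<Rightarrow> (nat list \<times> nat list) set" where
  "lt N = measures [length, \<lambda>l. N ^ length l - bv N l]"

lemma wf_lt: "wf (lt N)" by (simp add: lt_def)

lemma lt_shorter: "length k < length l \<Longrightarrow> (k, l) \<in> lt N" by (simp add: lt_def)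

lemma lt_tau:
  assumes D: "distinct (wl L vr M vs R)" and S: "set (wl L vr M vs R) \<subseteq> {..<N}" and a: "a \<in> Iv vs L" "vs < vr"
  shows "(map (tau a vr vs) (wl L vr M vs R), wl L vr M vs R) \<in> lt N"
proof -
  obtain L2 L1 where L: "L = L2 @ a # L1" "a < vs" using a by (auto simp: Iv_def)
  let ?l = "wl L vr M vs R" and ?k = "rev L1 @ vs # rev L2 @ a # M @ vr # R"
  have k: "map (tau a vr vs) ?l = ?k" using tau_map D unfolding L by blast
  have l: "?l = rev L1 @ a # rev L2 @ vr # M @ vs # R" by (simp add: wl_eq L)
  have "bv N ?l < bv N ?k" unfolding l by (rule bv_mono) (use S L(2) in \<open>auto simp: l\<close>)
  moreover have "length ?k = length ?l" by (simp add: l)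
  moreover have "bv N ?k < N ^ length ?k" using S by (intro bv_less) (auto simp: l)
  ultimately show ?thesis unfolding k by (simp add: lt_def)
qed

definition vc :: "nat list \<Rightarrow> nat \<Rightarrow> nat list \<Rightarrow> nat \<Rightarrow> nat list \<Rightarrow> bool" where
  "vc L vr M vs R \<longleftrightarrow> distinct (wl L vr M vs R) \<and> vs < vr \<and> allt vs M \<and> inr vs vr R"

lemma inr_nb: "inr t b R \<Longrightarrow> t \<le> b \<Longrightarrow> nb t b R"
proof (induction R arbitrary: b)
  case (Cons x R)
  show ?case
  proof (cases "x < t")
    case False
    then have "b \<le> x" "inr t x R" using Cons.prems by (auto split: if_splits)
    then have "nb t x R" using Cons by simp
    then show ?thesis using False \<open>b \<le> x\<close> by (auto simp: nb_iff)
  qed (use Cons in auto)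
qed simp

lemma inr_le: "inr t b R \<Longrightarrow> a \<le> b \<Longrightarrow> inr t a R"
  by (induction R) (auto split: if_splits)

lemma inr_filter: "inr t b R \<Longrightarrow> inr t b (filter P R)"
proof (induction R arbitrary: b)
  case (Cons x R)
  show ?case
  proof (cases "x < t")
    case False
    then have "b \<le> x" "inr t x (filter P R)" using Cons by (auto split: if_splits)
    then show ?thesis using False inr_le[of t x "filter P R" b] by simp
  qed (use Cons in simp)
qed simp

lemma inr_split:
  assumes "\<And>x. x \<in> set R \<Longrightarrow> t \<le> x \<Longrightarrow> b \<le> x" "\<And>A x B y C. R = A @ x # B @ y # C \<Longrightarrow> t \<le> x \<Longrightarrow> t \<le> y \<Longrightarrow> x \<le> y"
  shows "inr t b R"
  using assms
proof (induction R arbitrary: b)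
  case (Cons z R)
  have sp: "x \<le> y" if "R = A @ x # B @ y # C" "t \<le> x" "t \<le> y" for A x B y C
    using Cons.prems(2)[of "z # A" x B y C] that by simp
  show ?case
  proof (cases "z < t")
    case True
    then show ?thesis using Cons.IH[of b] Cons.prems(1) sp by auto
  next
    case False
    have "inr t z R"
    proof (rule Cons.IH[OF _ sp])
      fix x assume "x \<in> set R" "t \<le> x"
      then obtain B C where "R = B @ x # C" by (auto simp: in_set_conv_decomp)
      then show "z \<le> x" using Cons.prems(2)[of "[]" z B x C] False \<open>t \<le> x\<close> by simp
    qed blast+
    then show ?thesis using False Cons.prems(1)[of z] by simp
  qed
qed simp

lemma vc_transition:
  assumes "vc L vr M vs R" "\<exists>x\<in>set L. x < vs"
  shows "g (wl L vr M vs R) = (\<Sum>a\<in>Iv vs L. g (map (tau a vr vs) (wl L vr M vs R)))"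
  by (rule g_transition) (use assms inr_nb in \<open>auto simp: vc_def\<close>)

text \<open>A corner that is lexicographically maximal among those whose lower point dominates some point
  satisfying \<open>Q\<close>, a property of the prefix that is inherited by longer prefixes and larger bounds.\<close>

lemma max_corner:
  assumes ex: "\<exists>P x M y R. l = P @ x # M @ y # R \<and> y < x \<and> Q P y"
    and mono: "\<And>P P' y z. Q P y \<Longrightarrow> y \<le> z \<Longrightarrow> Q (P @ P') z"
  obtains P vr M vs R where "l = P @ vr # M @ vs # R" "vs < vr" "Q P vs"
    "\<And>A x B y C. M @ vs # R = A @ x # B @ y # C \<Longrightarrow> y < x \<Longrightarrow> \<not> Q (P @ vr # A) y"
    "\<And>y. y \<in> set R \<Longrightarrow> y < vr \<Longrightarrow> \<not> Q P y"
proof -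
  define S where "S = {r. \<exists>P x M y R. l = P @ x # M @ y # R \<and> y < x \<and> Q P y \<and> length P = r}"
  have "S \<subseteq> {..length l}" by (auto simp: S_def)
  then have finS: "finite S" by (rule finite_subset) simp
  have "S \<noteq> {}" using ex unfolding S_def by blast
  then have r: "Max S \<in> S" using finS by simp
  define T where "T = {s. \<exists>P x M y R. l = P @ x # M @ y # R \<and> y < x \<and> Q P y \<and> length P = Max S \<and> length M = s}"
  have "T \<subseteq> {..length l}" by (auto simp: T_def)
  then have finT: "finite T" by (rule finite_subset) simp
  have "T \<noteq> {}" using r unfolding S_def T_def by blast
  then have "Max T \<in> T" using finT by simp
  then obtain P x M y R where l: "l = P @ x # M @ y # R" "y < x" "Q P y" "length P = Max S" "length M = Max T"
    unfolding T_def by blast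
  show ?thesis
  proof (rule that[OF l(1-3)])
    fix A x' B y' C assume e: "M @ y # R = A @ x' # B @ y' # C" "y' < x'"
    show "\<not> Q (P @ x # A) y'"
    proof
      assume "Q (P @ x # A) y'"
      moreover have "l = (P @ x # A) @ x' # B @ y' # C" using l(1) e(1) by simp
      ultimately have "length (P @ x # A) \<in> S" unfolding S_def using e(2) by blast
      then show False using Max_ge[OF finS] l(4) by fastforce
    qed
  next
    fix z assume z: "z \<in> set R" "z < x"
    show "\<not> Q P z"
    proof
      assume q: "Q P z"
      obtain B C where R: "R = B @ z # C" using z(1) by (auto simp: in_set_conv_decomp)
      have "l = P @ x # (M @ y # B) @ z # C" using l(1) R by simp
      then have "length (M @ y # B) \<in> T" unfolding T_def using q z(2) l(4) by blast
      then show False using Max_ge[OF finT] l(5) by fastforce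
    qed
  qed
qed

lemma vc_max:
  assumes D: "distinct (P @ vr # M @ vs # R)" and vs: "vs < vr" "Q P vs"
    and mono: "\<And>P P' y z. Q P y \<Longrightarrow> y \<le> z \<Longrightarrow> Q (P @ P') z"
    and m1: "\<And>A x B y C. M @ vs # R = A @ x # B @ y # C \<Longrightarrow> y < x \<Longrightarrow> \<not> Q (P @ vr # A) y"
    and m2: "\<And>y. y \<in> set R \<Longrightarrow> y < vr \<Longrightarrow> \<not> Q P y"
  shows "vc (rev P) vr M vs R"
  unfolding vc_def
proof (intro conjI)
  show "distinct (wl (rev P) vr M vs R)" using D by (simp add: wl_eq)
  show "allt vs M" unfolding allt_iff
  proof
    fix x assume x: "x \<in> set M"
    then obtain A B where M: "M = A @ x # B" by (auto simp: in_set_conv_decomp)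
    have "\<not> Q (P @ vr # A) vs \<or> \<not> vs < x" using m1[of A x B vs R] M by auto
    moreover have "Q (P @ vr # A) vs" using mono[OF vs(2), of vs] by simp
    moreover have "x \<noteq> vs" using D x by auto
    ultimately show "x < vs" by linarith
  qed
  show "inr vs vr R"
  proof (rule inr_split)
    fix x assume "x \<in> set R" "vs \<le> x"
    then show "vr \<le> x" using m2[of x] mono[OF vs(2), of x "[]"] by force
  next
    fix A x B y C assume R: "R = A @ x # B @ y # C" "vs \<le> x" "vs \<le> y"
    have "\<not> y < x"
    proof
      assume "y < x"
      then have "\<not> Q (P @ vr # M @ vs # A) y" using m1[of "M @ vs # A" x B y C] R by simp
      then show False using mono[OF vs(2), of y "vr # M @ vs # A"] R(3) by simp
    qed
    then show "x \<le> y" by simp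
  qed
qed (rule vs(1))

lemma max_vc:
  assumes D: "distinct l"
    and ex: "\<exists>P x M y R. l = P @ x # M @ y # R \<and> y < x \<and> Q P y"
    and mono: "\<And>P P' y z. Q P y \<Longrightarrow> y \<le> z \<Longrightarrow> Q (P @ P') z"
  obtains P vr M vs R where "l = P @ vr # M @ vs # R" "vs < vr" "Q P vs" "vc (rev P) vr M vs R"
    "\<And>A x B y C. M @ vs # R = A @ x # B @ y # C \<Longrightarrow> y < x \<Longrightarrow> \<not> Q (P @ vr # A) y"
    "\<And>y. y \<in> set R \<Longrightarrow> y < vr \<Longrightarrow> \<not> Q P y"
proof (rule max_corner[OF ex mono])
  fix P vr M vs R assume l: "l = P @ vr # M @ vs # R" "vs < vr" "Q P vs"
    and m1: "\<And>A x B y C. M @ vs # R = A @ x # B @ y # C \<Longrightarrow> y < x \<Longrightarrow> \<not> Q (P @ vr # A) y"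
    and m2: "\<And>y. y \<in> set R \<Longrightarrow> y < vr \<Longrightarrow> \<not> Q P y"
  have "distinct (P @ vr # M @ vs # R)" using D l(1) by simp
  from vc_max[of P vr M vs R Q, OF this l(2,3) mono m1 m2] have "vc (rev P) vr M vs R" .
  from that[OF l this m1 m2] show thesis .
qed

text \<open>The corner consists of the letters 3 and 2 of a 132, chosen lexicographically last; the
  letter 1 guarantees a child point.\<close>

lemma corner132:
  assumes D: "distinct l" and ex: "\<exists>A i B k C j E. l = A @ i # B @ k # C @ j # E \<and> i < j \<and> j < k"
  obtains L vr M vs R where "l = wl L vr M vs R" "vc L vr M vs R" "\<exists>x\<in>set L. x < vs"
proof -
  define Q :: "nat list \<Rightarrow> nat \<Rightarrow> bool" where "Q P y \<longleftrightarrow> (\<exists>i\<in>set P. i < y)" for P y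
  have mono: "Q (P @ P') z" if q: "Q P y" and yz: "y \<le> z" for P P' y z
  proof -
    from q obtain i where "i \<in> set P" "i < y" unfolding Q_def by blast
    then have "i \<in> set (P @ P')" "i < z" using yz by auto
    then show ?thesis unfolding Q_def by blast
  qed
  have ex': "\<exists>P x M y R. l = P @ x # M @ y # R \<and> y < x \<and> Q P y"
  proof -
    obtain A i B k C j E where l: "l = A @ i # B @ k # C @ j # E" "i < j" "j < k" using ex by blast
    then have "l = (A @ i # B) @ k # C @ j # E" "Q (A @ i # B) j" by (auto simp: Q_def)
    then show ?thesis using l(3) by blast
  qed
  obtain P vr M vs R where l: "l = P @ vr # M @ vs # R" "vs < vr" "Q P vs" "vc (rev P) vr M vs R"
    by (rule max_vc[OF D ex' mono]) blast+
  have "l = wl (rev P) vr M vs R" using l(1) by (simp add: wl_eq)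
  then show ?thesis using that[OF _ l(4)] l(3) unfolding Q_def by auto
qed

lemma g_132_avoiding:
  assumes D: "distinct l" and av: "\<nexists>A i B k C j E. l = A @ i # B @ k # C @ j # E \<and> i < j \<and> j < k"
  shows "g l = 1"
  unfolding g_def
proof (rule EG_132_avoiding)
  let ?w = "pw (fl l)"
  have S: "fl l \<in> Sym (length l)" "same_relative_order (fl l) l" using fl_spec[OF D] by auto
  show "?w permutes {1..length l}" using pw_permutes S by blast
  have len: "length (fl l) = length l" using S(2) by (simp add: same_relative_order_def)
  have rel: "?w i < ?w j \<longleftrightarrow> l ! (i - 1) < l ! (j - 1)" if "1 \<le> i" "i \<le> length l" "1 \<le> j" "j \<le> length l" for i j
  proof -
    have "i - 1 < length l" "j - 1 < length l" using that by auto
    then show ?thesis using S(2) that len by (auto simp: same_relative_order_def pw_def)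
  qed
  have le: "?w i \<le> length l" if "1 \<le> i" "i \<le> length l" for i
    using permutes_in_image[OF \<open>?w permutes {1..length l}\<close>, of i] that by simp
  fix a b c :: nat assume abc: "1 \<le> a" "a < b" "b < c"
  show "\<not> (?w a < ?w c \<and> ?w c < ?w b)"
  proof
    assume w: "?w a < ?w c \<and> ?w c < ?w b"
    have "c \<le> length l"
    proof (rule ccontr)
      assume c: "\<not> c \<le> length l"
      then have wc: "?w c = c" by (simp add: pw_def len)
      show False
      proof (cases "b \<le> length l")
        case True
        then show False using le[of b] abc w wc c by linarith
      next
        case False
        then have "?w b = b" by (simp add: pw_def len)
        then show False using w wc abc by simp
      qed
    qed
    then have lt: "l ! (a - 1) < l ! (c - 1)" "l ! (c - 1) < l ! (b - 1)" using rel[of a c] rel[of c b] w abc by auto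
    obtain i where i: "a = Suc i" using abc by (cases a) auto
    obtain j where j: "b = Suc (i + Suc j)" using abc(2) i less_iff_Suc_add by auto
    obtain k where k: "c = Suc (i + Suc j + Suc k)" using abc(3) j less_iff_Suc_add by (metis add_Suc add_Suc_right add_Suc_shift)
    have n: "i < length l" "i + Suc j < length l" "i + Suc j + Suc k < length l" using \<open>c \<le> length l\<close> i j k by auto
    define X where "X = drop (Suc i) l"
    define Y where "Y = drop (Suc j) X"
    have 1: "l = take i l @ l ! i # X" unfolding X_def by (rule id_take_nth_drop[OF n(1)])
    have "j < length X" using n by (simp add: X_def)
    then have 2: "X = take j X @ X ! j # Y" unfolding Y_def by (rule id_take_nth_drop)
    have "k < length Y" using n by (simp add: Y_def X_def)
    then have 3: "Y = take k Y @ Y ! k # drop (Suc k) Y" by (rule id_take_nth_drop)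
    have e: "X ! j = l ! (i + Suc j)" "Y ! k = l ! (i + Suc j + Suc k)" using n by (simp_all add: X_def Y_def algebra_simps)
    have "l = take i l @ l ! i # take j X @ X ! j # take k Y @ Y ! k # drop (Suc k) Y"
      using 1 2 3 by metis
    moreover have "l ! i < Y ! k" "Y ! k < X ! j" unfolding e using lt unfolding i j k by simp_all
    ultimately show False using av by blast
  qed
qed

lemma g_pos: "distinct l \<Longrightarrow> 1 \<le> g l"
proof -
  assume "distinct l"
  obtain N where "set l \<subseteq> {..<N}" using finite_nat_set_iff_bounded[of "set l"] by auto
  then show ?thesis using \<open>distinct l\<close>
  proof (induction l rule: wf_induct_rule[OF wf_lt[of N]])
    case (1 l)
    show ?case
    proof (cases "\<exists>A i B k C j E. l = A @ i # B @ k # C @ j # E \<and> i < j \<and> j < k")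
      case True
      obtain L vr M vs R where l: "l = wl L vr M vs R" "vc L vr M vs R" "\<exists>x\<in>set L. x < vs"
        using corner132[OF 1(3) True] by blast
      obtain a where a: "a \<in> Iv vs L" using l(3) Iv_nonempty by blast
      have vs: "vs < vr" using l(2) by (simp add: vc_def)
      have aL: "a \<in> set L" "a < vs" using a Iv_sub[of vs L] by (auto simp: Iv_def)
      have d: "distinct [a, vr, vs]" "{a, vr, vs} \<subseteq> set l" using 1(3) aL by (auto simp: l(1) wl_eq)
      have "1 \<le> g (map (tau a vr vs) l)"
      proof (rule 1(1))
        show "(map (tau a vr vs) l, l) \<in> lt N" using lt_tau[OF _ _ a vs] 1(2,3) l(1) by simp
        show "set (map (tau a vr vs) l) \<subseteq> {..<N}" using tau_image[OF d] 1(2) by simp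
        show "distinct (map (tau a vr vs) l)" using 1(3) tau_inj[OF d(1)] by (simp add: distinct_map)
      qed
      also have "\<dots> \<le> g l" using vc_transition[OF l(2,3)] member_le_sum[OF a, of "\<lambda>a. g (map (tau a vr vs) l)"] finite_Iv
        by (simp add: l(1))
      finally show ?thesis .
    qed (use g_132_avoiding[OF 1(3)] in simp)
  qed
qed

section \<open>Soundness of the certified lower bounds\<close>

lemma ls_split: "ls rP x h rM T = Cr A b C d E \<Longrightarrow> A = rP \<and> b = x \<and> rev rM @ T = rev C @ d # E \<and> d < x"
proof (induction T arbitrary: rM)
  case (Cons y T)
  show ?case
  proof (cases "ls rP x h (y # rM) T")
    case NoC
    then show ?thesis using Cons.prems by (auto split: if_splits)
  next
    case (Cr A' b' C' d' E')
    then show ?thesis using Cons.IH[of "y # rM"] Cons.prems by auto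
  qed
qed simp

lemma cn_split: "cn h rP T = Cr A b C d E \<Longrightarrow> rev rP @ T = rev A @ b # rev C @ d # E \<and> d < b"
proof (induction T arbitrary: h rP)
  case (Cons y T)
  show ?case
  proof (cases "cn (mna y h rP) (y # rP) T")
    case NoC
    then have "ls rP y h [] T = Cr A b C d E" using Cons.prems by (simp split: if_splits)
    from ls_split[OF this] show ?thesis by auto
  next
    case (Cr A' b' C' d' E')
    then have "cn (mna y h rP) (y # rP) T = Cr A b C d E" using Cons.prems by simp
    from Cons.IH[OF this] show ?thesis by simp
  qed
qed simp

lemma strip_le: "e \<le> strip e ks + (length ks - 1)"
  by (induction e ks rule: strip.induct) auto

lemma needs_le:
  assumes "\<And>e k. k \<in> set ks \<Longrightarrow> Suc e \<le> N e k + g k"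
  shows "e \<le> needs N e ks + (\<Sum>k\<leftarrow>ks. g k - 1)"
  using assms
proof (induction N e ks rule: needs.induct)
  case (3 N e k ks)
  have "Suc (Suc e) \<le> N (Suc e) k + g k" using 3(2)[of k "Suc e"] by simp
  moreover have "N (Suc e) k \<le> needs N (N (Suc e) k) ks + (\<Sum>k\<leftarrow>ks. g k - 1)" using 3 by simp
  ultimately show ?case by simp
qed auto

text \<open>Every value is at least 1, so n children reduce the deficit by n - 1 at once and
  afterwards each by its value minus one. That the search finds the last corner plays into
  efficiency only: the hypotheses of \<open>g_transition\<close> are retested, and the deficit is
  returned unchanged if they fail.\<close>

lemma need_sound: "distinct l \<Longrightarrow> Suc e \<le> need f e l + g l"
proof (induction f arbitrary: e l)
  case 0
  then show ?case using g_pos[of l] by simp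
next
  case (Suc f)
  note pos = g_pos[OF Suc.prems]
  show ?case
  proof (cases e)
    case 0
    then show ?thesis using pos by simp
  next
    case e: (Suc e')
    show ?thesis
    proof (cases "cn cc [] l")
      case NoC
      then show ?thesis using pos e by simp
    next
      case (Cr L vr rM vs R)
      have l: "l = wl L vr (rev rM) vs R" "vs < vr" using cn_split[OF Cr] by (simp_all add: wl_eq)
      let ?ks = "kd c0 L [] vs (rev rM @ vr # R)"
      show ?thesis
      proof (cases "allt vs rM \<and> nb vs vr R \<and> ?ks \<noteq> []")
        case False
        then have "need (Suc f) e l = e" using e Cr by (cases "allt vs rM"; cases "nb vs vr R") (simp_all add: rap_rev)
        then show ?thesis using pos by simp
      next
        case True
        obtain k ks where k: "?ks = k # ks" using True by (cases ?ks) auto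
        have n: "need (Suc f) e l = needs (need f) (strip e ?ks) ?ks" using True e Cr k by (simp add: rap_rev)
        have el: "(\<exists>x\<in>set L. x < vs) \<and> distinct k'" if "k' \<in> set ?ks" for k'
        proof -
          have "mset k' = mset l" using kd_elem[OF that] by (simp add: l wl_eq)
          then show ?thesis using kd_elem[OF that] Suc.prems by (metis mset_eq_imp_distinct_iff)
        qed
        have "g l = (\<Sum>a\<in>Iv vs L. g (map (tau a vr vs) l))"
          unfolding l(1) by (rule g_transition) (use Suc.prems l True el k in \<open>auto simp: allt_iff\<close>)
        also have "\<dots> = (\<Sum>k\<leftarrow>?ks. g k)" using kd_sum_Iv[of L vr "rev rM" vs R g] Suc.prems l by simp
        also have "\<dots> = (\<Sum>k\<leftarrow>?ks. g k - 1) + length ?ks"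
        proof -
          have "(\<Sum>k\<leftarrow>xs. g k) = (\<Sum>k\<leftarrow>xs. g k - 1) + length xs" if "\<forall>k\<in>set xs. 1 \<le> g k" for xs
            using that by (induction xs) auto
          then show ?thesis using el g_pos by blast
        qed
        finally have gl: "g l = (\<Sum>k\<leftarrow>?ks. g k - 1) + length ?ks" .
        have "strip e ?ks \<le> needs (need f) (strip e ?ks) ?ks + (\<Sum>k\<leftarrow>?ks. g k - 1)"
          by (rule needs_le) (use Suc.IH el in blast)
        then show ?thesis using n gl strip_le[of e ?ks] k by simp
      qed
    qed
  qed
qed

lemma ge_sound: "distinct l \<Longrightarrow> ge e l \<Longrightarrow> Suc e \<le> g l"
proof -
  have z: "zero n \<Longrightarrow> n = 0" for n by (cases n) auto
  assume "distinct l" "ge e l"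
  then show ?thesis using need_sound[of l e "Suc (Suc (Suc (Suc (Suc (Suc (Suc (Suc (Suc (Suc (Suc (Suc 0)))))))))))"] z
    unfolding ge_def by force
qed

section \<open>The finite checks\<close>

text \<open>With \<open>if_weak_cong\<close> only the condition of a conditional is rewritten until
  it is decided, so that rewriting runs the functions as a program.\<close>

lemma run_VC: "gens FVC True c4 [[c1,c0,c3,c2]]"
  by (simp only: run_rules cong: if_weak_cong)

lemma run_R1: "gens FR1 False c4 [[c1,c0,c3,c2]]"
  by (simp only: run_rules cong: if_weak_cong)

lemma run_F32: "gens F32 False c4 [[c1,c0,c3,c2]]"
  by (simp only: run_rules cong: if_weak_cong)

lemma run_F32_0: "gens0 F32 c4 [[c1,c0,c3,c2]]"
  by (simp only: run_rules cong: if_weak_cong)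

text \<open>The first argument is the number of letters that may still be added, three for windows
  of seven letters and two for smaller ones; the second is the size of the window.\<close>

lemma run_22_1: "a2 (Suc (Suc 0)) c6 [c0,c3,c1,c2] c5 [] c4 []"
  by (simp only: run_rules cong: if_weak_cong)

lemma run_22_2: "a2 (Suc (Suc 0)) c6 [c5,c0,c1] c3 [] c2 [c4]"
  by (simp only: run_rules cong: if_weak_cong)

lemma run_22_3: "a2 (Suc (Suc 0)) c6 [c1,c0,c2] c5 [c3] c4 []"
  by (simp only: run_rules cong: if_weak_cong)

lemma run_22_4: "a2 (Suc (Suc 0)) c5 [c4,c0,c1] c3 [] c2 []"
  by (simp only: run_rules cong: if_weak_cong)

lemma run_22_5: "a2 (Suc (Suc 0)) c6 [c3,c5,c0,c1] c4 [] c2 []"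
  by (simp only: run_rules cong: if_weak_cong)

lemma run_22_6: "a2 (Suc (Suc 0)) c6 [c3,c4,c0,c1] c5 [] c2 []"
  by (simp only: run_rules cong: if_weak_cong)

lemma run_22_7: "a2 (Suc (Suc 0)) c6 [c1,c3,c0,c2] c5 [] c4 []"
  by (simp only: run_rules cong: if_weak_cong)

lemma run_22_8: "a2 (Suc (Suc 0)) c6 [c1,c4,c0,c2] c5 [] c3 []"
  by (simp only: run_rules cong: if_weak_cong)

lemma run_22_9: "a2 (Suc (Suc 0)) c6 [c4,c0,c2,c1] c5 [] c3 []"
  by (simp only: run_rules cong: if_weak_cong)

lemma run_22_10: "a2 (Suc (Suc 0)) c6 [c2,c0,c1,c3] c5 [] c4 []"
  by (simp only: run_rules cong: if_weak_cong)

lemma run_22_11: "a2 (Suc (Suc (Suc 0))) c7 [c5,c0,c2,c1] c6 [c3] c4 []"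
  by (simp only: run_rules cong: if_weak_cong)

lemma run_22_12: "a2 (Suc (Suc 0)) c6 [c0,c3,c1] c5 [c2] c4 []"
  by (simp only: run_rules cong: if_weak_cong)

lemma run_22_13: "a2 (Suc (Suc (Suc 0))) c7 [c5,c1,c0,c2] c6 [c3] c4 []"
  by (simp only: run_rules cong: if_weak_cong)

lemma run_22_14: "a2 (Suc (Suc 0)) c6 [c2,c0,c3,c1] c5 [] c4 []"
  by (simp only: run_rules cong: if_weak_cong)

lemma run_22_15: "a2 (Suc (Suc (Suc 0))) c7 [c1,c0,c3,c2] c6 [c4] c5 []"
  by (simp only: run_rules cong: if_weak_cong)

lemma run_22_16: "a2 (Suc (Suc (Suc 0))) c7 [c5,c1,c0,c3,c2] c6 [] c4 []"
  by (simp only: run_rules cong: if_weak_cong)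

lemma run_ge3: "ges E3 pats3"
  by (simp only: run_rules pats_run cong: if_weak_cong)

lemma run_ge4: "ges E4 pats4"
  by (simp only: run_rules pats_run cong: if_weak_cong)

lemma run_3k1_qc1: "gens F3k1 True c6 qc1"
  by (simp only: run_rules cong: if_weak_cong)

lemma run_3k1_qc2: "gens F3k1 True c7 qc2"
  by (simp only: run_rules cong: if_weak_cong)

lemma run_3k1_qc3: "gens F3k1 True c8 qc3"
  by (simp only: run_rules cong: if_weak_cong)

lemma run_3k1_qc4: "gens F3k1 True c8 qc4"
  by (simp only: run_rules cong: if_weak_cong)

lemma run_3k1_qc5: "gens F3k1 True c8 qc5"
  by (simp only: run_rules cong: if_weak_cong)

lemma run_3k1_qa1: "gens F3k1 True c5 qa1"
  by (simp only: run_rules cong: if_weak_cong)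

lemma run_3k1_qa2: "gens F3k1 True c6 qa2"
  by (simp only: run_rules cong: if_weak_cong)

lemma run_3k1_qa3: "gens F3k1 True c6 qa3"
  by (simp only: run_rules cong: if_weak_cong)

lemma run_4k2_qc1: "gens F4k2 False c6 qc1"
  by (simp only: run_rules cong: if_weak_cong)

lemma run_4k2_qc2: "gens F4k2 False c7 qc2"
  by (simp only: run_rules cong: if_weak_cong)

lemma run_4k2_qc3: "gens F4k2 False c8 qc3"
  by (simp only: run_rules cong: if_weak_cong)

lemma run_4k2_qc4: "gens F4k2 False c8 qc4"
  by (simp only: run_rules cong: if_weak_cong)

lemma run_4k2_qc5: "gens F4k2 False c8 qc5"
  by (simp only: run_rules cong: if_weak_cong)

lemma run_4k2x_qa1: "gens F4k2x False c5 qa1"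
  by (simp only: run_rules cong: if_weak_cong)

lemma run_4k2x_qa2: "gens F4k2x False c6 qa2"
  by (simp only: run_rules cong: if_weak_cong)

lemma run_4k2x_qa3: "gens F4k2x False c6 qa3"
  by (simp only: run_rules cong: if_weak_cong)

lemma run_4k20_qa1: "gens0 F4k2 c5 qa1"
  by (simp only: run_rules cong: if_weak_cong)

lemma run_4k20_qa2: "gens0 F4k2 c6 qa2"
  by (simp only: run_rules cong: if_weak_cong)

lemma run_4k20_qa3: "gens0 F4k2 c6 qa3"
  by (simp only: run_rules cong: if_weak_cong)

lemma run_4k1_qc1: "gens F4k1 True c6 qc1"
  by (simp only: run_rules cong: if_weak_cong)

lemma run_4k1_qc2: "gens F4k1 True c7 qc2"
  by (simp only: run_rules cong: if_weak_cong)

lemma run_4k1_qc3: "gens F4k1 True c8 qc3"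
  by (simp only: run_rules cong: if_weak_cong)

lemma run_4k1_qc4: "gens F4k1 True c8 qc4"
  by (simp only: run_rules cong: if_weak_cong)

lemma run_4k1_qc5: "gens F4k1 True c8 qc5"
  by (simp only: run_rules cong: if_weak_cong)

lemma run_4k1_qb1: "gens F4k1 True c6 qb1"
  by (simp only: run_rules cong: if_weak_cong)

lemma run_4k1_qb2: "gens F4k1 True c6 qb2"
  by (simp only: run_rules cong: if_weak_cong)

lemma run_4k1_qb3: "gens F4k1 True c7 qb3"
  by (simp only: run_rules cong: if_weak_cong)

lemma run_4k1_qb4: "gens F4k1 True c7 qb4"
  by (simp only: run_rules cong: if_weak_cong)

lemma run_4k1_qb5: "gens F4k1 True c7 qb5"
  by (simp only: run_rules cong: if_weak_cong)

lemma run_4k1_qb6: "gens F4k1 True c7 qb6"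
  by (simp only: run_rules cong: if_weak_cong)

lemma run_4k1_qb7: "gens F4k1 True c7 qb7"
  by (simp only: run_rules cong: if_weak_cong)

lemma run_4k1_qb8: "gens F4k1 True c7 qb8"
  by (simp only: run_rules cong: if_weak_cong)

lemma run_4k1_qb9: "gens F4k1 True c7 qb9"
  by (simp only: run_rules cong: if_weak_cong)

lemma run_4k1_qb10: "gens F4k1 True c8 qb10"
  by (simp only: run_rules cong: if_weak_cong)

lemma run_4k1_qb11: "gens F4k1 True c8 qb11"
  by (simp only: run_rules cong: if_weak_cong)

lemma run_A3_qc1: "allAs GJ3 GB3 GC3 c6 qc1"
  by (simp only: run_rules cong: if_weak_cong)

lemma run_A3_qc2: "allAs GJ3 GB3 GC3 c7 qc2"
  by (simp only: run_rules cong: if_weak_cong)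

lemma run_A3_qc3: "allAs GJ3 GB3 GC3 c8 qc3"
  by (simp only: run_rules cong: if_weak_cong)

lemma run_A3_qc4: "allAs GJ3 GB3 GC3 c8 qc4"
  by (simp only: run_rules cong: if_weak_cong)

lemma run_A3_qc5: "allAs GJ3 GB3 GC3 c8 qc5"
  by (simp only: run_rules cong: if_weak_cong)

lemma run_A3_qa1: "allAs GJ3 GB3 GC3 c5 qa1"
  by (simp only: run_rules cong: if_weak_cong)

lemma run_A3_qa2: "allAs GJ3 GB3 GC3 c6 qa2"
  by (simp only: run_rules cong: if_weak_cong)

lemma run_A3_qa3: "allAs GJ3 GB3 GC3 c6 qa3"
  by (simp only: run_rules cong: if_weak_cong)

lemma run_A4_qc1: "allAs GJ4 GB4 GC4 c6 qc1"
  by (simp only: run_rules cong: if_weak_cong)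

lemma run_A4_qc2: "allAs GJ4 GB4 GC4 c7 qc2"
  by (simp only: run_rules cong: if_weak_cong)

lemma run_A4_qc3: "allAs GJ4 GB4 GC4 c8 qc3"
  by (simp only: run_rules cong: if_weak_cong)

lemma run_A4_qc4: "allAs GJ4 GB4 GC4 c8 qc4"
  by (simp only: run_rules cong: if_weak_cong)

lemma run_A4_qc5: "allAs GJ4 GB4 GC4 c8 qc5"
  by (simp only: run_rules cong: if_weak_cong)

lemma run_A4_qb1: "allAs GJ4 GB4 GC4 c6 qb1"
  by (simp only: run_rules cong: if_weak_cong)

lemma run_A4_qb2: "allAs GJ4 GB4 GC4 c6 qb2"
  by (simp only: run_rules cong: if_weak_cong)

lemma run_A4_qb3: "allAs GJ4 GB4 GC4 c7 qb3"
  by (simp only: run_rules cong: if_weak_cong)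

lemma run_A4_qb4: "allAs GJ4 GB4 GC4 c7 qb4"
  by (simp only: run_rules cong: if_weak_cong)

lemma run_A4_qb5: "allAs GJ4 GB4 GC4 c7 qb5"
  by (simp only: run_rules cong: if_weak_cong)

lemma run_A4_qb6: "allAs GJ4 GB4 GC4 c7 qb6"
  by (simp only: run_rules cong: if_weak_cong)

lemma run_A4_qb7: "allAs GJ4 GB4 GC4 c7 qb7"
  by (simp only: run_rules cong: if_weak_cong)

lemma run_A4_qb8: "allAs GJ4 GB4 GC4 c7 qb8"
  by (simp only: run_rules cong: if_weak_cong)

lemma run_A4_qb9: "allAs GJ4 GB4 GC4 c7 qb9"
  by (simp only: run_rules cong: if_weak_cong)

lemma run_A4_qb10: "allAs GJ4 GB4 GC4 c8 qb10"
  by (simp only: run_rules cong: if_weak_cong)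

lemma run_A4_qb11: "allAs GJ4 GB4 GC4 c8 qb11"
  by (simp only: run_rules cong: if_weak_cong)

lemma gens_all: "gens F one N qs \<Longrightarrow> list_all (\<lambda>q. length q = N) qs \<Longrightarrow> list_all (\<lambda>q. gen F one (length q) q) qs"
  by (induction qs) (auto split: if_splits)

lemma gens0_all: "gens0 F N qs \<Longrightarrow> list_all (\<lambda>q. length q = N) qs \<Longrightarrow> list_all (\<lambda>q. gn False False False F False (length q) q) qs"
  by (induction qs) (auto split: if_splits)

lemma allAs_all: "allAs GJ GB GC N qs \<Longrightarrow> list_all (\<lambda>q. length q = N) qs \<Longrightarrow> list_all (\<lambda>q. allA GJ GB GC (length q) q) qs"
  by (induction qs) (auto split: if_splits)

lemma len_qc1: "list_all (\<lambda>q. length q = c6) qc1"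
  and len_qc2: "list_all (\<lambda>q. length q = c7) qc2"
  and len_qc3: "list_all (\<lambda>q. length q = c8) qc3"
  and len_qc4: "list_all (\<lambda>q. length q = c8) qc4"
  and len_qc5: "list_all (\<lambda>q. length q = c8) qc5"
  and len_qa1: "list_all (\<lambda>q. length q = c5) qa1"
  and len_qa2: "list_all (\<lambda>q. length q = c6) qa2"
  and len_qa3: "list_all (\<lambda>q. length q = c6) qa3"
  and len_qb1: "list_all (\<lambda>q. length q = c6) qb1"
  and len_qb2: "list_all (\<lambda>q. length q = c6) qb2"
  and len_qb3: "list_all (\<lambda>q. length q = c7) qb3"
  and len_qb4: "list_all (\<lambda>q. length q = c7) qb4"
  and len_qb5: "list_all (\<lambda>q. length q = c7) qb5"
  and len_qb6: "list_all (\<lambda>q. length q = c7) qb6"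
  and len_qb7: "list_all (\<lambda>q. length q = c7) qb7"
  and len_qb8: "list_all (\<lambda>q. length q = c7) qb8"
  and len_qb9: "list_all (\<lambda>q. length q = c7) qb9"
  and len_qb10: "list_all (\<lambda>q. length q = c8) qb10"
  and len_qb11: "list_all (\<lambda>q. length q = c8) qb11"
  by (simp_all add: q_defs c_defs)

lemma run_3k1: "list_all (\<lambda>q. gen F3k1 True (length q) q) pats3"
  unfolding pats3_def list_all_append
  by (intro conjI gens_all[OF run_3k1_qc1 len_qc1] gens_all[OF run_3k1_qc2 len_qc2] gens_all[OF run_3k1_qc3 len_qc3] gens_all[OF run_3k1_qc4 len_qc4] gens_all[OF run_3k1_qc5 len_qc5] gens_all[OF run_3k1_qa1 len_qa1] gens_all[OF run_3k1_qa2 len_qa2] gens_all[OF run_3k1_qa3 len_qa3])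

lemma run_4k1: "list_all (\<lambda>q. gen F4k1 True (length q) q) pats4"
  unfolding pats4_def list_all_append
  by (intro conjI gens_all[OF run_4k1_qc1 len_qc1] gens_all[OF run_4k1_qc2 len_qc2] gens_all[OF run_4k1_qc3 len_qc3] gens_all[OF run_4k1_qc4 len_qc4] gens_all[OF run_4k1_qc5 len_qc5] gens_all[OF run_4k1_qb1 len_qb1] gens_all[OF run_4k1_qb2 len_qb2] gens_all[OF run_4k1_qb3 len_qb3] gens_all[OF run_4k1_qb4 len_qb4] gens_all[OF run_4k1_qb5 len_qb5] gens_all[OF run_4k1_qb6 len_qb6] gens_all[OF run_4k1_qb7 len_qb7] gens_all[OF run_4k1_qb8 len_qb8] gens_all[OF run_4k1_qb9 len_qb9] gens_all[OF run_4k1_qb10 len_qb10] gens_all[OF run_4k1_qb11 len_qb11])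

lemma run_A3: "list_all (\<lambda>q. allA GJ3 GB3 GC3 (length q) q) pats3"
  unfolding pats3_def list_all_append
  by (intro conjI allAs_all[OF run_A3_qc1 len_qc1] allAs_all[OF run_A3_qc2 len_qc2] allAs_all[OF run_A3_qc3 len_qc3] allAs_all[OF run_A3_qc4 len_qc4] allAs_all[OF run_A3_qc5 len_qc5] allAs_all[OF run_A3_qa1 len_qa1] allAs_all[OF run_A3_qa2 len_qa2] allAs_all[OF run_A3_qa3 len_qa3])

lemma run_A4: "list_all (\<lambda>q. allA GJ4 GB4 GC4 (length q) q) pats4"
  unfolding pats4_def list_all_append
  by (intro conjI allAs_all[OF run_A4_qc1 len_qc1] allAs_all[OF run_A4_qc2 len_qc2] allAs_all[OF run_A4_qc3 len_qc3] allAs_all[OF run_A4_qc4 len_qc4] allAs_all[OF run_A4_qc5 len_qc5] allAs_all[OF run_A4_qb1 len_qb1] allAs_all[OF run_A4_qb2 len_qb2] allAs_all[OF run_A4_qb3 len_qb3] allAs_all[OF run_A4_qb4 len_qb4] allAs_all[OF run_A4_qb5 len_qb5] allAs_all[OF run_A4_qb6 len_qb6] allAs_all[OF run_A4_qb7 len_qb7] allAs_all[OF run_A4_qb8 len_qb8] allAs_all[OF run_A4_qb9 len_qb9] allAs_all[OF run_A4_qb10 len_qb10] allAs_all[OF run_A4_qb11 len_qb11])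

lemma run_4k2_common: "gens F4k2 False N qs \<Longrightarrow> list_all (\<lambda>q. length q = N) qs \<Longrightarrow> set qs \<subseteq> set pats4 \<Longrightarrow>
  list_all (\<lambda>q. q \<in> set pats4 \<and> gen F4k2 False (length q) q \<or>
   gen F4k2x False (length q) q \<and> gn False False False F4k2 False (length q) q) qs"
  by (drule (1) gens_all) (auto simp: list_all_iff)

lemma run_4k2_only: "gens F4k2x False N qs \<Longrightarrow> gens0 F4k2 N qs \<Longrightarrow> list_all (\<lambda>q. length q = N) qs \<Longrightarrow>
  list_all (\<lambda>q. q \<in> set pats4 \<and> gen F4k2 False (length q) q \<or>
   gen F4k2x False (length q) q \<and> gn False False False F4k2 False (length q) q) qs"
  using gens_all[of F4k2x False N qs] gens0_all[of F4k2 N qs] by (auto simp: list_all_iff)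

lemma sub_qc1: "set qc1 \<subseteq> set pats4"
  and sub_qc2: "set qc2 \<subseteq> set pats4"
  and sub_qc3: "set qc3 \<subseteq> set pats4"
  and sub_qc4: "set qc4 \<subseteq> set pats4"
  and sub_qc5: "set qc5 \<subseteq> set pats4"
  by (auto simp: pats4_def)

text \<open>A pattern common to both lists already gives the child the value 4, so its window is the
  whole word. For the other patterns the second child point may have to be inserted, unless the
  pattern avoids the three moved letters.\<close>

lemma run_4k2: "list_all (\<lambda>q. q \<in> set pats4 \<and> gen F4k2 False (length q) q \<or>
   gen F4k2x False (length q) q \<and> gn False False False F4k2 False (length q) q) pats3"
  unfolding pats3_def list_all_append
  by (intro conjI run_4k2_common[OF run_4k2_qc1 len_qc1 sub_qc1] run_4k2_common[OF run_4k2_qc2 len_qc2 sub_qc2] run_4k2_common[OF run_4k2_qc3 len_qc3 sub_qc3] run_4k2_common[OF run_4k2_qc4 len_qc4 sub_qc4] run_4k2_common[OF run_4k2_qc5 len_qc5 sub_qc5] run_4k2_only[OF run_4k2x_qa1 run_4k20_qa1 len_qa1] run_4k2_only[OF run_4k2x_qa2 run_4k20_qa2 len_qa2] run_4k2_only[OF run_4k2x_qa3 run_4k20_qa3 len_qa3])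

lemma types22_length: "list_all (\<lambda>(L, vr, M, vs, R). length L + length M + length R \<le> 5) types22"
  by (simp add: types22_def)

lemma run_22: "list_all (\<lambda>(L, vr, M, vs, R). a2 (if length L + length M + length R = 5 then 3 else 2)
  (length L + length M + length R + 2) L vr M vs R) types22"
  using run_22_1 run_22_2 run_22_3 run_22_4 run_22_5 run_22_6 run_22_7 run_22_8 run_22_9 run_22_10 run_22_11 run_22_12 run_22_13 run_22_14 run_22_15 run_22_16
  by (simp add: types22_def c_defs numeral_eq_Suc del: a2.simps)

section \<open>Patterns and windows\<close>

text \<open>Patterns are handled as restrictions to sets of letters instead of positions, because a
  word and its children have the same letters.\<close>

definition rs :: "nat set \<Rightarrow> nat list \<Rightarrow> nat list" where
  "rs V l = filter (\<lambda>x. x \<in> V) l"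

lemma rs_simps [simp]: "rs V [] = []" "rs V (x # l) = (if x \<in> V then x # rs V l else rs V l)"
  "rs V (A @ B) = rs V A @ rs V B" "rs V (rev A) = rev (rs V A)" "set (rs V l) = set l \<inter> V"
  by (auto simp: rs_def rev_filter)

lemma distinct_rs: "distinct l \<Longrightarrow> distinct (rs V l)" by (simp add: rs_def)

lemma rs_rs: "rs U (rs V l) = rs (U \<inter> V) l"
  by (simp add: rs_def conj_commute)

lemma rs_id: "set l \<subseteq> V \<Longrightarrow> rs V l = l"
  unfolding rs_def by (rule filter_True) auto

lemma rs_eq_iff: "rs V l = l \<longleftrightarrow> set l \<subseteq> V"
  using rs_id[of l V] rs_simps(5)[of V l] by (metis inf.absorb_iff1)

lemma rs_cong: "(\<And>x. x \<in> set l \<Longrightarrow> x \<in> U \<longleftrightarrow> x \<in> V) \<Longrightarrow> rs U l = rs V l"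
  unfolding rs_def by (rule filter_cong) auto

lemma length_rs_less: "\<not> set l \<subseteq> V \<Longrightarrow> length (rs V l) < length l"
proof -
  assume "\<not> set l \<subseteq> V"
  then obtain x where "x \<in> set l" "x \<notin> V" by blast
  then show ?thesis unfolding rs_def by (rule length_filter_less)
qed

lemma rs_wl: "vr \<in> V \<Longrightarrow> vs \<in> V \<Longrightarrow> rs V (wl L vr M vs R) = wl (rs V L) vr (rs V M) vs (rs V R)"
  by (simp add: wl_eq)

lemma rs_tau:
  assumes "distinct [a, vr, vs]" "{a, vr, vs} \<subseteq> V"
  shows "rs V (map (tau a vr vs) l) = map (tau a vr vs) (rs V l)"
proof -
  have "tau a vr vs x \<in> V \<longleftrightarrow> x \<in> V" for x using assms by (auto simp: tau_def)
  then show ?thesis by (simp add: rs_def filter_map comp_def)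
qed

lemma rs_tau_disjoint:
  assumes "{a, vr, vs} \<inter> V = {}"
  shows "rs V (map (tau a vr vs) l) = rs V l"
  using assms by (induction l) (auto simp: tau_def)

lemma inv43_split: "inv43 x ys \<Longrightarrow> \<exists>C d D c E. ys = C @ d # D @ c # E \<and> x < c \<and> c < d"
proof (induction ys)
  case (Cons z zs)
  have b: "bel x z zs \<Longrightarrow> \<exists>D c E. zs = D @ c # E \<and> x < c \<and> c < z"
  proof (induction zs)
    case (Cons y ys)
    show ?case
    proof (cases "y < z \<and> x < y")
      case True
      then show ?thesis by (intro exI[of _ "[]"] exI[of _ y] exI[of _ ys]) simp
    next
      case False
      then obtain D c E where "ys = D @ c # E" "x < c" "c < z" using Cons by (auto split: if_splits)
      then show ?thesis by (intro exI[of _ "y # D"] exI[of _ c] exI[of _ E]) simp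
    qed
  qed simp
  show ?case
  proof (cases "inv43 x zs")
    case True
    then obtain C d D c E where "zs = C @ d # D @ c # E" "x < c" "c < d" using Cons by blast
    then show ?thesis by (intro exI[of _ "z # C"] exI[of _ d] exI[of _ D] exI[of _ c] exI[of _ E]) simp
  next
    case False
    then obtain D c E where "zs = D @ c # E" "x < c" "c < z" using Cons.prems b by (auto split: if_splits)
    then show ?thesis by (intro exI[of _ "[]"] exI[of _ z] exI[of _ D] exI[of _ c] exI[of _ E]) simp
  qed
qed simp

lemma nv_split: "nv l \<Longrightarrow> \<exists>A b B a C d D c E. l = A @ b # B @ a # C @ d # D @ c # E \<and> a < b \<and> b < c \<and> c < d"
proof (induction l)
  case (Cons x l)
  have f: "f21 x ys \<Longrightarrow> \<exists>B a Y. ys = B @ a # Y \<and> a < x \<and> inv43 x Y" for ys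
  proof (induction ys)
    case (Cons y ys)
    show ?case
    proof (cases "y < x")
      case True
      then show ?thesis using Cons.prems by (intro exI[of _ "[]"] exI[of _ y] exI[of _ ys]) simp
    next
      case False
      then obtain B a Y where "ys = B @ a # Y" "a < x" "inv43 x Y" using Cons by auto
      then show ?thesis by (intro exI[of _ "y # B"] exI[of _ a] exI[of _ Y]) simp
    qed
  qed simp
  show ?case
  proof (cases "nv l")
    case True
    then obtain A b B a C d D c E where "l = A @ b # B @ a # C @ d # D @ c # E" "a < b \<and> b < c \<and> c < d" using Cons by blast
    then have "x # l = (x # A) @ b # B @ a # C @ d # D @ c # E" by simp
    then show ?thesis using \<open>a < b \<and> b < c \<and> c < d\<close> by blast
  next
    case False
    then obtain B a Y where Y: "l = B @ a # Y" "a < x" "inv43 x Y" using Cons.prems f by (auto split: if_splits)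
    then obtain C d D c E where "Y = C @ d # D @ c # E" "x < c" "c < d" using inv43_split by blast
    then have "x # l = [] @ x # B @ a # C @ d # D @ c # E" using Y by simp
    then show ?thesis using Y(2) \<open>x < c\<close> \<open>c < d\<close> by blast
  qed
qed simp

lemma inv43_Cons: "inv43 x l \<Longrightarrow> inv43 x (z # l)"
  by auto

lemma inv43_app: "inv43 x l \<Longrightarrow> inv43 x (A @ l)"
  by (induction A) auto

lemma f21_Cons: "f21 x l \<Longrightarrow> inv43 x l"
  by (induction l) (auto split: if_splits)

lemma nv_app: "nv l \<Longrightarrow> nv (A @ l)"
  by (induction A) auto

lemma nv_I:
  assumes "a < b" "b < c" "c < d"
  shows "nv (A @ b # B @ a # C @ d # D @ c # E)"
proof -
  have "bel b d (D @ c # E)" using assms by (induction D) auto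
  then have "inv43 b (d # D @ c # E)" using assms by auto
  then have i: "inv43 b (C @ d # D @ c # E)" by (rule inv43_app)
  have "f21 b (B @ a # C @ d # D @ c # E)"
  proof (induction B)
    case Nil
    then show ?case using i assms by simp
  next
    case (Cons y B)
    have "inv43 b (B @ a # C @ d # D @ c # E)" using i by (simp add: inv43_app inv43_Cons)
    then show ?case using Cons by simp
  qed
  then have "nv (b # B @ a # C @ d # D @ c # E)" by simp
  then show ?thesis by (rule nv_app)
qed

lemma nv_rs: "nv (rs V l) \<Longrightarrow> nv l"
proof -
  have b: "bel x z (rs V ys) \<Longrightarrow> bel x z ys" for x z ys by (induction ys) (auto split: if_splits)
  have i: "inv43 x (rs V ys) \<Longrightarrow> inv43 x ys" for x ys
    by (induction ys) (auto split: if_splits dest: b)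
  have f: "f21 x (rs V ys) \<Longrightarrow> f21 x ys" for x ys
  proof (induction ys)
    case (Cons y ys)
    then show ?case using i[of x ys] f21_Cons[of x "rs V ys"] by (auto split: if_splits)
  qed simp
  show "nv (rs V l) \<Longrightarrow> nv l" by (induction l) (auto split: if_splits dest: f)
qed

lemma nv_occ:
  assumes "distinct x" "nv x"
  shows "\<exists>V\<subseteq>set x. fl (rs V x) = [2, 1, 4, 3]"
proof -
  obtain A b B a C d D c E where x: "x = A @ b # B @ a # C @ d # D @ c # E" and o: "a < b" "b < c" "c < d"
    using nv_split[OF assms(2)] by blast
  let ?V = "{a, b, c, d}"
  have n: "rs ?V X = []" if "set X \<inter> ?V = {}" for X using that unfolding rs_def by (auto simp: filter_empty_conv)
  have "rs ?V x = [b, a, d, c]" using assms(1) unfolding x by (simp add: n)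
  moreover have "fl [b, a, d, c] = [2, 1, 4, 3]"
  proof (rule fl_eqI)
    show "[2, 1, 4, 3] \<in> Sym (length [b, a, d, c])" by (auto simp: Sym_iff)
    show "same_relative_order [2, 1, 4, 3 :: nat] [b, a, d, c]"
      using o by (auto simp: same_relative_order_def less_Suc_eq numeral_eq_Suc)
  qed (use o in auto)
  ultimately show ?thesis using x by (intro exI[of _ ?V]) auto
qed

lemma nv_fl: "distinct x \<Longrightarrow> nv (fl x) = nv x"
proof -
  assume d: "distinct x"
  have "om (\<lambda>y. Suc (rk (set x) y)) (set x)" using om_rk[of "set x"] by (simp add: om_def)
  then show ?thesis using fl_rk[OF d] nv_om by simp
qed

lemma occ_nv: "distinct x \<Longrightarrow> fl (rs V x) = [2, 1, 4, 3] \<Longrightarrow> nv x"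
  using nv_fl[of "rs V x"] nv_rs[of V x] distinct_rs[of x V] by simp

text \<open>An obstructed letter is replaced by an obstructing one, which is larger, still below vs
  and nearer to the corner; this ends at a child point.\<close>

lemma Iv_dominate:
  assumes "L = X @ b # Y" "b < vs"
  shows "\<exists>a\<in>Iv vs L. b \<le> a \<and> a \<in> set (X @ [b])"
  using assms
proof (induction X arbitrary: L Y b rule: length_induct)
  case (1 X)
  show ?case
  proof (cases "\<forall>x\<in>set X. \<not> (b < x \<and> x < vs)")
    case True
    then have "b \<in> Iv vs L" using 1(2,3) unfolding Iv_def by blast
    then show ?thesis by auto
  next
    case False
    then obtain x where x: "x \<in> set X" "b < x" "x < vs" by blast
    then obtain X1 X2 where X: "X = X1 @ x # X2" by (auto simp: in_set_conv_decomp)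
    have "L = X1 @ x # (X2 @ b # Y)" using 1(2) X by simp
    then obtain a where "a \<in> Iv vs L" "x \<le> a" "a \<in> set (X1 @ [x])" using 1(1)[rule_format, of X1 L x "X2 @ b # Y"] X x(3) by auto
    then show ?thesis using X x(2) by (intro bexI[of _ a]) auto
  qed
qed

lemma Iv_split:
  assumes "distinct L" "L = X @ a # Y" "a \<in> Iv vs L"
  shows "a < vs \<and> (\<forall>x\<in>set X. \<not> (a < x \<and> x < vs))"
proof -
  obtain L2 L1 where L: "L = L2 @ a # L1" "a < vs" "\<forall>x\<in>set L2. \<not> (a < x \<and> x < vs)" using assms(3) by (auto simp: Iv_def)
  have "L2 = X" using L(1) assms(1,2) by (metis append_eq_append_conv_if append_Cons_eq_iff distinct_append not_distinct_conv_prefix append_Cons_eq_iff disjoint_iff distinct.simps(2) in_set_conv_decomp)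
  then show ?thesis using L by blast
qed

lemma Iv_rs: "a \<in> Iv vs L \<Longrightarrow> a \<in> V \<Longrightarrow> a \<in> Iv vs (rs V L)"
proof -
  assume a: "a \<in> Iv vs L" "a \<in> V"
  then obtain L2 L1 where L: "L = L2 @ a # L1" "a < vs" "\<forall>x\<in>set L2. \<not> (a < x \<and> x < vs)" by (auto simp: Iv_def)
  have "rs V L = rs V L2 @ a # rs V L1" "\<forall>x\<in>set (rs V L2). \<not> (a < x \<and> x < vs)" using L a(2) by auto
  then show ?thesis unfolding Iv_def using L(2) by blast
qed

text \<open>By \<open>Iv_dominate\<close> every letter below vs has a child point at least as large
  weakly nearer to the corner, and here this can only be a.\<close>

lemma Iv_singleton:
  assumes "distinct L" "Iv vs L = {a}" "L = L2 @ a # L1"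
  shows "\<forall>x\<in>set L2. \<not> x < vs" "\<forall>x\<in>set L1. \<not> (a < x \<and> x < vs)"
proof -
  show "\<forall>x\<in>set L2. \<not> x < vs"
  proof (intro ballI notI)
    fix x assume x: "x \<in> set L2" "x < vs"
    then obtain X Y where L2: "L2 = X @ x # Y" by (auto simp: in_set_conv_decomp)
    then have "L = X @ x # (Y @ a # L1)" using assms(3) by simp
    from Iv_dominate[OF this x(2)] have "a \<in> set (X @ [x])" using assms(2) by auto
    then show False using assms(1,3) L2 by auto
  qed
  show "\<forall>x\<in>set L1. \<not> (a < x \<and> x < vs)"
  proof (intro ballI notI)
    fix x assume x: "x \<in> set L1" "a < x \<and> x < vs"
    then obtain X Y where L1: "L1 = X @ x # Y" by (auto simp: in_set_conv_decomp)
    then have "L = (L2 @ a # X) @ x # Y" using assms(3) by simp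
    from Iv_dominate[OF this, of vs] x(2) assms(2) show False by auto
  qed
qed

text \<open>Read from left to right, child points decrease; two of them followed by vr and vs form a
  2143.\<close>

lemma Iv_two_nv:
  assumes D: "distinct (wl L vr M vs R)" "vs < vr" and ab: "a \<in> Iv vs L" "b \<in> Iv vs L" "a \<noteq> b"
  shows "nv (wl L vr M vs R)"
proof -
  have DL: "distinct L" using D by (simp add: wl_eq)
  have *: ?thesis if "L = X @ b # Y" "a \<in> set Y" "a \<in> Iv vs L" "b \<in> Iv vs L" for a b X Y
  proof -
    obtain Y1 Y2 where Y: "Y = Y1 @ a # Y2" using \<open>a \<in> set Y\<close> by (auto simp: in_set_conv_decomp)
    have L: "L = (X @ b # Y1) @ a # Y2" using that(1) Y by simp
    have "a < vs" "\<not> (a < b \<and> b < vs)" using Iv_split[OF DL L that(3)] by auto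
    moreover have "b < vs" using that(4) by (auto simp: Iv_def)
    moreover have "a \<noteq> b" using DL L by auto
    ultimately have "b < a" by linarith
    moreover have "wl L vr M vs R = rev Y2 @ a # rev Y1 @ b # rev X @ vr # M @ vs # R" by (simp add: wl_eq L)
    ultimately show ?thesis using nv_I[of b a vs vr] \<open>a < vs\<close> D(2) by simp
  qed
  obtain X Y where L: "L = X @ b # Y" using ab Iv_sub[of vs L] by (metis in_mono in_set_conv_decomp)
  have "a \<in> set X \<or> a \<in> set Y" using ab Iv_sub[of vs L] L by auto
  then show ?thesis
  proof
    assume "a \<in> set X"
    then obtain X1 X2 where "X = X1 @ a # X2" by (auto simp: in_set_conv_decomp)
    then have "L = X1 @ a # (X2 @ b # Y)" using L by simp
    from *[OF this _ ab(2,1)] show ?thesis by simp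
  qed (rule *[OF L _ ab(1,2)])
qed

lemma vc_rs:
  assumes "vc L vr M vs R" "vr \<in> V" "vs \<in> V"
  shows "vc (rs V L) vr (rs V M) vs (rs V R)"
  using assms distinct_rs[of "wl L vr M vs R" V] inr_filter[of vs vr R "\<lambda>x. x \<in> V"]
  unfolding vc_def rs_wl[OF assms(2,3)] by (auto simp: allt_iff rs_def)

lemma vc_vs: "vc L vr M vs R \<Longrightarrow> vs < vr" by (simp add: vc_def)

lemma vc_trio:
  assumes "vc L vr M vs R" "a \<in> Iv vs L"
  shows "distinct [a, vr, vs]" "{a, vr, vs} \<subseteq> set (wl L vr M vs R)" "a < vs"
proof -
  have "a \<in> set L" using assms(2) Iv_sub by blast
  then show "distinct [a, vr, vs]" "{a, vr, vs} \<subseteq> set (wl L vr M vs R)" using assms(1) by (auto simp: vc_def wl_eq)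
  show "a < vs" using assms(2) by (auto simp: Iv_def)
qed

lemma split_unique: "distinct (A @ x # B) \<Longrightarrow> A @ x # B = C @ x # D \<Longrightarrow> A = C \<and> B = D"
proof -
  assume d: "distinct (A @ x # B)" and e: "A @ x # B = C @ x # D"
  then have "distinct (C @ x # D)" by simp
  then have "x \<notin> set A" "x \<notin> set B" using d by auto
  then show ?thesis using e by (simp add: append_Cons_eq_iff)
qed

lemma wl_map: "wl (map f L) (f vr) (map f M) (f vs) (map f R) = map f (wl L vr M vs R)"
  by (simp add: wl_eq rev_map)

lemma set_wl: "set (wl L vr M vs R) = set L \<union> set M \<union> set R \<union> {vr, vs}"
  by (auto simp: wl_eq)

lemma rs_disjoint: "set X \<inter> T = {} \<Longrightarrow> rs (V \<union> T) X = rs V X"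
  by (rule rs_cong) auto

lemma rs_single: "rs V (x # X) = (if x \<in> V then [x] else []) @ rs V X"
  by simp

lemma seed_rank:
  assumes "distinct x" "V \<subseteq> set x" "fl (rs V x) = map Suc q"
  shows "q = map (rk V) (rs V x)" "length q = card V"
proof -
  have s: "set (rs V x) = V" using assms(2) by auto
  have "map Suc q = map Suc (map (rk V) (rs V x))"
    using fl_rk[OF distinct_rs[OF assms(1)], of V] s assms(3) by simp
  then show "q = map (rk V) (rs V x)" by (metis list.inj_map_strong nat.inject)
  then show "length q = card V" using distinct_card[OF distinct_rs[OF assms(1)], of V] s by simp
qed

text \<open>In the child word the moved letters appear in the order vs, a, vr. Adding those of them
  that are missing in V gives a configuration obtained from q by choosing or inserting the three
  roles, which is what \<open>gn\<close> runs through.\<close>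

lemma window:
  assumes vc: "vc (L2 @ a # L1) vr M vs R" and V: "V \<subseteq> set (wl (L2 @ a # L1) vr M vs R)"
    and f2: "f2 one a vs (rs V L1) (rs V L2) (rs V M)"
    and occ: "fl (rs V (map (tau a vr vs) (wl (L2 @ a # L1) vr M vs R))) = map Suc q"
    and gen: "if V \<inter> {a, vr, vs} = {} then \<not> one \<and> gn False False False F False (length q) q else gen F one (length q) q"
  shows "fin_at F (V \<union> {a, vr, vs}) (rs V L1) a (rs V L2) vr (rs V M) vs (rs V R)"
proof -
  let ?l = "wl (L2 @ a # L1) vr M vs R"
  have D: "distinct ?l" using vc by (simp add: vc_def)
  have av: "a < vs" using f2 by (simp add: f2_def split: if_splits)
  have vsr: "vs < vr" using vc by (simp add: vc_def)
  interpret C: config "rs V L1" "rs V L2" "rs V M" "rs V R" a vr vs one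
  proof
    show "distinct (rs V L1 @ rs V L2 @ rs V M @ rs V R @ [a, vr, vs])"
      using D by (auto simp: wl_eq distinct_rs)
    show "inr vs vr (rs V R)" using vc inr_filter unfolding vc_def rs_def by blast
  qed (use f2 vsr in auto)
  have W: "C.W = V \<union> {a, vr, vs}" using V unfolding C.W_def by (auto simp: set_wl)
  have tm: "map (tau a vr vs) ?l = rev L1 @ vs # rev L2 @ a # M @ vr # R" by (rule tau_map[OF D])
  have dx: "distinct (map (tau a vr vs) ?l)" using D unfolding tm by (auto simp: wl_eq)
  have sx: "set (map (tau a vr vs) ?l) = set ?l" unfolding tm by (auto simp: set_wl)
  have q: "q = map (rk V) (rs V (map (tau a vr vs) ?l))" "length q = card V"
    using seed_rank[OF dx _ occ] V unfolding sx by auto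
  have q': "q = map (rk V) (rev (rs V L1) @ (if vs \<in> V then [vs] else []) @ rev (rs V L2) @ (if a \<in> V then [a] else []) @ rs V M @
      (if vr \<in> V then [vr] else []) @ rs V R)"
    unfolding q(1) tm by (simp only: rs_simps(3,4) rs_single)
  have VW: "V = C.W - (if vs \<in> V then {} else {vs}) - (if a \<in> V then {} else {a}) - (if vr \<in> V then {} else {vr})"
    unfolding W by auto
  show ?thesis
  proof (cases "V \<inter> {a, vr, vs} = {}")
    case True
    then have n: "vs \<notin> V" "a \<notin> V" "vr \<notin> V" and one: "one = False" and "gn False False False F one (length q) q" using gen by auto
    then have "gn (vs \<in> V) (a \<in> V) (vr \<in> V) F one (length q) q" by simp
    from C.gn_sound[OF this[folded True, unfolded arg_cong[OF q', of "\<lambda>x. gn (vs \<in> V) (a \<in> V) (vr \<in> V) F one (length q) x"]] VW] q(2)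
    show ?thesis unfolding W by simp
  next
    case False
    then have "gen F one (length q) q" using gen by simp
    from C.gen_sound[OF this[unfolded arg_cong[OF q', of "\<lambda>x. gen F one (length q) x"]] VW] q(2) False
    show ?thesis unfolding W by auto
  qed
qed

lemma fl_2143: "[2, 1, 4, 3] = map Suc [c1, c0, c3, c2]" "length [c1, c0, c3, c2] = c4"
  by (simp_all add: c_defs)

text \<open>Without a 2143 there is only one child point by \<open>Iv_two_nv\<close>, and by the
  check \<open>run_VC\<close> a 2143 in its child would come from one in the word. So the value does
  not change along the recursion, which ends at words without 132.\<close>

theorem g_vexillary: "distinct l \<Longrightarrow> \<not> nv l \<Longrightarrow> g l = 1"
proof -
  assume "distinct l" "\<not> nv l"
  obtain N where "set l \<subseteq> {..<N}" using finite_nat_set_iff_bounded[of "set l"] by auto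
  then show ?thesis using \<open>distinct l\<close> \<open>\<not> nv l\<close>
  proof (induction l rule: wf_induct_rule[OF wf_lt[of N]])
    case (1 l)
    show ?case
    proof (cases "\<exists>A i B k C j E. l = A @ i # B @ k # C @ j # E \<and> i < j \<and> j < k")
      case True
      obtain L vr M vs R where l: "l = wl L vr M vs R" "vc L vr M vs R" "\<exists>x\<in>set L. x < vs"
        using corner132[OF 1(3) True] by blast
      have D: "distinct (wl L vr M vs R)" using 1(3) l(1) by simp
      then have DL: "distinct L" by (simp add: wl_eq)
      have vsr: "vs < vr" using l(2) by (simp add: vc_def)
      obtain a where a: "a \<in> Iv vs L" using l(3) Iv_nonempty by blast
      have I: "Iv vs L = {a}" using a Iv_two_nv[OF D vsr, of a] 1(4) l(1) by auto
      obtain L2 L1 where L: "L = L2 @ a # L1" using a by (auto simp: Iv_def)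
      note sg = Iv_singleton[OF DL I L] and tr = vc_trio[OF l(2) a]
      let ?x = "map (tau a vr vs) l"
      have dx: "distinct ?x" "set ?x = set l" using 1(3) tau_inj[OF tr(1)] tau_image[OF tr(1,2)] l(1) by (auto simp: distinct_map)
      have "\<not> nv ?x"
      proof
        assume "nv ?x"
        then obtain V where V: "V \<subseteq> set ?x" "fl (rs V ?x) = [2, 1, 4, 3]" using nv_occ[OF dx(1)] by blast
        show False
        proof (cases "V \<inter> {a, vr, vs} = {}")
          case True
          then have "fl (rs V l) = [2, 1, 4, 3]" using V(2) rs_tau_disjoint[of a vr vs V l] by (metis inf_commute)
          then show False using occ_nv[OF 1(3)] 1(4) by blast
        next
          case False
          have "f2 True a vs (rs V L1) (rs V L2) (rs V M)"
          proof -
            have "a \<notin> set L1" using DL L by simp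
            then show ?thesis using sg tr(3) l(2) unfolding f2_def vc_def by (auto simp: nb_iff allt_iff le_less)
          qed
          moreover have "gen FVC True (length [c1, c0, c3, c2]) [c1, c0, c3, c2]"
            using gens_sound[OF run_VC, of "[c1, c0, c3, c2]"] unfolding fl_2143(2) by simp
          ultimately have "fin_at FVC (V \<union> {a, vr, vs}) (rs V L1) a (rs V L2) vr (rs V M) vs (rs V R)"
            using window[of L2 a L1 vr M vs R V True "[c1, c0, c3, c2]" FVC] l(1,2) V False dx(2)
            unfolding L fl_2143(1) by (metis (no_types))
          then have n: "nv (map (rk (V \<union> {a, vr, vs})) (wl (rs V L2 @ a # rs V L1) vr (rs V M) vs (rs V R)))"
            (is "nv (map (rk ?W) ?l)") by (simp add: FVC_def wl_map[symmetric])
          have "rs ?W X = rs V X" if "set X \<inter> {a, vr, vs} = {}" for X by (rule rs_disjoint[OF that])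
          then have e: "?l = rs ?W l" using D unfolding l(1) L by (auto simp: wl_eq)
          have "om (rk ?W) (set ?l)"
            by (rule om_subset[OF om_rk]) (use V(1) finite_subset in \<open>auto simp: e\<close>)
          then have "nv (rs ?W l)" using n nv_om e by metis
          then show False using nv_rs 1(4) by blast
        qed
      qed
      then have "g ?x = 1" using 1(1)[of ?x] lt_tau[OF D _ a vsr, of N] 1(2) dx l(1) by simp
      then show ?thesis using vc_transition[OF l(2,3)] I l(1) by simp
    qed (use g_132_avoiding[OF 1(3)] in simp)
  qed
qed

section \<open>The corner of the lexicographically last 2143\<close>

fun hasinv :: "nat \<Rightarrow> nat list \<Rightarrow> bool" where
  "hasinv t [] = False"
| "hasinv t (y # L) = ((y < t \<and> t \<in> set L) \<or> hasinv t L)"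

lemma hasinv_app: "hasinv t L \<Longrightarrow> hasinv t (A @ L)" by (induction A) auto
lemma hasinv_mem: "hasinv t L \<Longrightarrow> t \<in> set L \<and> (\<exists>y\<in>set L. y < t)" by (induction L) auto
lemma hasinv_rs: "hasinv t (rs V L) \<Longrightarrow> hasinv t L" by (induction L) (auto split: if_splits)
lemma hasinv_split: "hasinv t L \<Longrightarrow> \<exists>X y Y Z. L = X @ y # Y @ t # Z \<and> y < t"
proof (induction L)
  case (Cons y L)
  show ?case
  proof (cases "y < t \<and> t \<in> set L")
    case True
    then obtain Y Z where "L = Y @ t # Z" by (auto simp: in_set_conv_decomp)
    then have "y # L = [] @ y # Y @ t # Z" by simp
    then show ?thesis using True by blast
  next
    case False
    then obtain X z Y Z where "L = X @ z # Y @ t # Z" "z < t" using Cons by auto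
    then have "y # L = (y # X) @ z # Y @ t # Z" by simp
    then show ?thesis using \<open>z < t\<close> by blast
  qed
qed simp

lemma mna_props: "mna x b Z \<le> b \<and> (mna x b Z = b \<or> mna x b Z \<in> set Z \<and> x \<le> mna x b Z) \<and>
    (\<forall>z\<in>set Z. x \<le> z \<longrightarrow> mna x b Z \<le> z)"
proof (induction Z arbitrary: b)
  case (Cons y Z)
  show ?case using Cons[of b] Cons[of y] by (cases "y < x"; cases "y < b") (auto intro: order_trans)
qed simp

lemma hm_props: "distinct L \<Longrightarrow> hm b L \<le> b \<and> (hm b L = b \<or> hasinv (hm b L) L) \<and> (\<forall>t. hasinv t L \<longrightarrow> hm b L \<le> t)"
proof (induction L arbitrary: b)
  case (Cons x L)
  let ?m = "mna x b L"
  note m = mna_props[of x b L] and IH = Cons.IH[of ?m]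
  have d: "distinct L" "x \<notin> set L" using Cons.prems by auto
  have le: "hm ?m L \<le> ?m" using IH d by blast
  have "hm b (x # L) = b \<or> hasinv (hm b (x # L)) (x # L)"
  proof (cases "hm ?m L = ?m")
    case True
    then show ?thesis using m d(2) by (auto simp: le_less)
  qed (use IH d in auto)
  moreover have "hm b (x # L) \<le> t" if "hasinv t (x # L)" for t
    using that IH d le m by (auto intro: order_trans)
  ultimately show ?case using le m by (auto intro: order_trans)
qed simp

text \<open>For every t below vs that can be the letter 2 of a 2143, a descent of M above t, or a
  letter of R between t and vr, would give a lexicographically later 43.\<close>

definition cf :: "nat list \<Rightarrow> nat \<Rightarrow> nat list \<Rightarrow> nat \<Rightarrow> nat list \<Rightarrow> bool" where
  "cf L vr M vs R \<longleftrightarrow> vc L vr M vs R \<and> (\<forall>t<vs. hasinv t L \<longrightarrow> inr t t M \<and> nb t vr R)"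

definition hi2 :: "nat list \<Rightarrow> nat \<Rightarrow> bool" where
  "hi2 L vs \<longleftrightarrow> (\<exists>t<vs. hasinv t L)"

lemma cf_okh: "cf L vr M vs R \<Longrightarrow> hi2 L vs \<Longrightarrow> okh L vr M vs R"
proof -
  assume c: "cf L vr M vs R" "hi2 L vs"
  then have "distinct L" by (auto simp: cf_def vc_def wl_eq)
  note h = hm_props[OF this, of vs]
  obtain t where "t < vs" "hasinv t L" using c(2) by (auto simp: hi2_def)
  then have hv: "hm vs L < vs" using h by (auto intro: le_less_trans)
  then have "hasinv (hm vs L) L" using h by auto
  then show ?thesis using c(1) hv by (simp add: okh_def okh1_def cf_def)
qed

lemma cf_rs:
  assumes "cf L vr M vs R" "vr \<in> V" "vs \<in> V"
  shows "cf (rs V L) vr (rs V M) vs (rs V R)"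
  unfolding cf_def
proof (intro conjI allI impI)
  fix t assume t: "t < vs" "hasinv t (rs V L)"
  then have *: "inr t t M" "nb t vr R" using assms(1) hasinv_rs unfolding cf_def by blast+
  show "inr t t (rs V M)" using *(1) inr_filter unfolding rs_def by blast
  show "nb t vr (rs V R)" using *(2) by (simp add: nb_iff)
qed (use assms vc_rs in \<open>auto simp: cf_def\<close>)

lemma corner2143:
  assumes D: "distinct l" and "nv l"
  obtains L vr M vs R where "l = wl L vr M vs R" "cf L vr M vs R" "hi2 L vs"
proof -
  define Q :: "nat list \<Rightarrow> nat \<Rightarrow> bool" where "Q P y \<longleftrightarrow> hi2 (rev P) y" for P y
  have mono: "Q (P @ P') z" if q: "Q P y" and yz: "y \<le> z" for P P' y z
    using q yz hasinv_app unfolding Q_def hi2_def by (metis less_le_trans rev_append)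
  have ex: "\<exists>P x M y R. l = P @ x # M @ y # R \<and> y < x \<and> Q P y"
  proof -
    obtain A b B a C d F c E where l: "l = A @ b # B @ a # C @ d # F @ c # E" "a < b" "b < c" "c < d"
      using nv_split[OF assms(2)] by blast
    have "hasinv b (rev C @ (a # rev B @ b # rev A))" by (rule hasinv_app) (use l in simp)
    then have "hasinv b (rev (A @ b # B @ a # C))" by simp
    then have "Q (A @ b # B @ a # C) c" using l(3) unfolding Q_def hi2_def by blast
    moreover have "l = (A @ b # B @ a # C) @ d # F @ c # E" using l(1) by simp
    ultimately show ?thesis using l(4) by blast
  qed
  obtain P vr M vs R where l: "l = P @ vr # M @ vs # R" "vs < vr" "Q P vs" "vc (rev P) vr M vs R"
    and m1: "\<And>A x B y C. M @ vs # R = A @ x # B @ y # C \<Longrightarrow> y < x \<Longrightarrow> \<not> Q (P @ vr # A) y"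
    and m2: "\<And>y. y \<in> set R \<Longrightarrow> y < vr \<Longrightarrow> \<not> Q P y"
    by (rule max_vc[OF D ex mono]) blast+
  have "cf (rev P) vr M vs R" unfolding cf_def
  proof (intro conjI allI impI)
    fix t assume t: "t < vs" "hasinv t (rev P)"
    then have tP: "t \<in> set P" using hasinv_mem by fastforce
    have Qy: "Q P y" if "t < y" for y using t(2) that unfolding Q_def hi2_def by blast
    show "inr t t M"
    proof (rule inr_split)
      fix A x B y C assume M: "M = A @ x # B @ y # C" "t \<le> x" "t \<le> y"
      have "t \<noteq> y" using tP D M(1) unfolding l(1) by auto
      then have "Q (P @ vr # A) y" using mono[OF Qy[of y], of y] M(3) by simp
      then show "x \<le> y" using m1[of A x B y "C @ vs # R"] M(1) by (simp add: not_less[symmetric]) blast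
    qed
    show "nb t vr R" unfolding nb_iff
    proof (intro ballI notI)
      fix y assume y: "y \<in> set R" "t \<le> y \<and> y < vr"
      have "t \<noteq> y" using tP D y(1) unfolding l(1) by auto
      then show False using m2[OF y(1)] Qy[of y] y(2) by simp
    qed
  qed (rule l(4))
  moreover have "l = wl (rev P) vr M vs R" using l(1) by (simp add: wl_eq)
  ultimately show ?thesis using that l(3) unfolding Q_def by blast
qed

lemma cf_ex: "hi2 L vs \<Longrightarrow> \<exists>x\<in>set L. x < vs"
  using hasinv_mem unfolding hi2_def by blast

text \<open>Two child points give two positive summands. With a single child point a, the letters t
  and y of the 21 in front of the corner stand to the left of a and below it, so t, y, vs, a is a
  2143 in the child and induction applies.\<close>

theorem g_nonvexillary: "distinct l \<Longrightarrow> nv l \<Longrightarrow> 2 \<le> g l"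
proof -
  assume "distinct l" "nv l"
  obtain N where "set l \<subseteq> {..<N}" using finite_nat_set_iff_bounded[of "set l"] by auto
  then show ?thesis using \<open>distinct l\<close> \<open>nv l\<close>
  proof (induction l rule: wf_induct_rule[OF wf_lt[of N]])
    case (1 l)
    obtain L vr M vs R where l: "l = wl L vr M vs R" "cf L vr M vs R" "hi2 L vs" using corner2143[OF 1(3,4)] by blast
    have vc: "vc L vr M vs R" using l(2) by (simp add: cf_def)
    have D: "distinct (wl L vr M vs R)" using 1(3) l(1) by simp
    then have DL: "distinct L" by (simp add: wl_eq)
    have gl: "g l = (\<Sum>a\<in>Iv vs L. g (map (tau a vr vs) l))" using vc_transition[OF vc cf_ex[OF l(3)]] l(1) by simp
    obtain a where a: "a \<in> Iv vs L" using cf_ex[OF l(3)] Iv_nonempty by blast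
    have dx: "distinct (map (tau b vr vs) l)" "set (map (tau b vr vs) l) = set l" if "b \<in> Iv vs L" for b
      using 1(3) vc_trio[OF vc that] tau_inj tau_image l(1) by (auto simp: distinct_map)
    show ?case
    proof (cases "Iv vs L = {a}")
      case False
      then obtain b where b: "b \<in> Iv vs L" "b \<noteq> a" using a by blast
      have "1 \<le> g (map (tau a vr vs) l)" "1 \<le> g (map (tau b vr vs) l)" using b g_pos dx a by blast+
      then have "2 \<le> (\<Sum>c\<in>{a, b}. g (map (tau c vr vs) l))" using b by simp
      also have "\<dots> \<le> g l" unfolding gl by (rule sum_mono2) (use a b finite_Iv in auto)
      finally show ?thesis .
    next
      case I: True
      obtain L2 L1 where L: "L = L2 @ a # L1" using a by (auto simp: Iv_def)
      note sg = Iv_singleton[OF DL I L] and tr = vc_trio[OF vc a]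
      obtain t X y Y Z where t: "t < vs" "L = X @ y # Y @ t # Z" "y < t" using l(3) hasinv_split unfolding hi2_def by blast
      have "t \<in> set L1"
      proof -
        have "t \<noteq> a"
        proof
          assume "t = a"
          then have "(X @ y # Y) @ a # Z = L2 @ a # L1" using t(2) L by simp
          from split_unique[OF _ this] have "X @ y # Y = L2" using \<open>t = a\<close> t(2) DL by simp
          then show False using sg(1) t by auto
        qed
        moreover have "t \<in> set L" using t(2) by simp
        ultimately show ?thesis using sg(1) t(1) unfolding L by auto
      qed
      moreover have "y \<in> set L1" if "y \<noteq> a"
        using t sg(1) that unfolding L by (metis Un_iff append_is_Nil_conv in_set_conv_decomp less_trans list.set_intros(1) set_ConsD set_append)
      moreover have "y \<noteq> a" using sg(2) t calculation(1) by blast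
      moreover have "t < a"
      proof -
        have "a \<notin> set L1" using DL L by simp
        then have "t \<noteq> a" using \<open>t \<in> set L1\<close> by blast
        moreover have "\<not> (a < t \<and> t < vs)" using sg(2) \<open>t \<in> set L1\<close> by blast
        ultimately show ?thesis using t(1) by linarith
      qed
      ultimately have ty: "t \<in> set L1" "y \<in> set L1" "t < a" by blast+
      have "\<exists>X Y Z. L1 = X @ y # Y @ t # Z"
      proof -
        obtain P S where P: "L1 = P @ y # S" using ty(2) by (auto simp: in_set_conv_decomp)
        have e: "X @ y # (Y @ t # Z) = (L2 @ a # P) @ y # S" using t(2) L P by simp
        have "Y @ t # Z = S"
          using split_unique[OF _ e] DL t(2) by simp
        then show ?thesis using P by blast
      qed
      then obtain X Y Z where L1: "L1 = X @ y # Y @ t # Z" by blast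
      have "map (tau a vr vs) l = rev L1 @ vs # rev L2 @ a # M @ vr # R" using tau_map D unfolding l(1) L by blast
      then have "map (tau a vr vs) l = rev Z @ t # rev Y @ y # rev X @ vs # rev L2 @ a # (M @ vr # R)" by (simp add: L1)
      then have "nv (map (tau a vr vs) l)" using nv_I[OF t(3) ty(3) tr(3)] by metis
      then have "2 \<le> g (map (tau a vr vs) l)" using 1(1)[of "map (tau a vr vs) l"] lt_tau[OF D _ a vc_vs[OF vc], of N] dx[OF a] 1(2) l(1) by simp
      then show ?thesis using gl I by simp
    qed
  qed
qed

section \<open>Truncated monotonicity and completeness of the lists\<close>

definition MM :: "nat \<Rightarrow> nat list set" where
  "MM d = (if d = 3 then map Suc ` set pats3 else map Suc ` set pats4)"

definition PA :: "nat list \<Rightarrow> bool" where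
  "PA l \<longleftrightarrow> (\<forall>V. min 4 (g (rs V l)) \<le> g l)"

text \<open>Both thresholds are carried along, because a minimal word for 4 may owe its value to a
  child that only reaches 3.\<close>

definition PB :: "nat list \<Rightarrow> bool" where
  "PB l \<longleftrightarrow> (\<forall>d\<in>{3, 4}. d \<le> g l \<longrightarrow> (\<forall>V. rs V l \<noteq> l \<longrightarrow> g (rs V l) < d) \<longrightarrow> fl l \<in> MM d)"

text \<open>Restrict repeatedly as long as the value stays at least d; the shortest word reached is
  minimal and hence listed.\<close>

lemma PB_occ:
  assumes "distinct l" "\<And>V. PB (rs V l)" "d \<in> {3, 4}" "d \<le> g l"
  shows "\<exists>V\<subseteq>set l. fl (rs V l) \<in> MM d"
  using assms
proof (induction l rule: length_induct)
  case (1 l)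
  show ?case
  proof (cases "\<forall>V. rs V l \<noteq> l \<longrightarrow> g (rs V l) < d")
    case True
    have "PB l" using 1(3)[of "set l"] rs_id[of l "set l"] by simp
    then have "fl l \<in> MM d" using True 1(4,5) by (auto simp: PB_def)
    then show ?thesis using rs_id[of l "set l"] by auto
  next
    case False
    then obtain V where V: "rs V l \<noteq> l" "d \<le> g (rs V l)" by (auto simp: not_less)
    have "length (rs V l) < length l" using V(1) rs_eq_iff length_rs_less by blast
    moreover have "\<And>U. PB (rs U (rs V l))" using 1(3) by (simp add: rs_rs)
    ultimately obtain U where "U \<subseteq> set (rs V l)" "fl (rs U (rs V l)) \<in> MM d"
      using 1(1) distinct_rs[OF 1(2)] 1(4) V(2) by metis
    then show ?thesis by (intro exI[of _ "U \<inter> V"]) (auto simp: rs_rs)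
  qed
qed

lemma ges_mem: "ges e ks \<Longrightarrow> k \<in> set ks \<Longrightarrow> ge e k"
  by (induction ks) (auto split: if_splits)

lemma fl_seed: "distinct l \<Longrightarrow> fl l = map Suc q \<Longrightarrow> distinct q \<and> g q = g l"
proof -
  assume d: "distinct l" and f: "fl l = map Suc q"
  have q: "q = map (rk (set l)) l" using seed_rank[OF d subset_refl, of q] f rs_id[of l "set l"] by simp
  have o: "om (rk (set l)) (set l)" by (rule om_rk) simp
  show ?thesis using q d o om_inj g_map by (auto simp: distinct_map)
qed

lemma MM_g: "distinct l \<Longrightarrow> d \<in> {3, 4} \<Longrightarrow> fl l \<in> MM d \<Longrightarrow> d \<le> g l"
proof -
  assume d: "distinct l" "d \<in> {3, 4}" "fl l \<in> MM d"
  then obtain q where q: "fl l = map Suc q" "if d = 3 then q \<in> set pats3 else q \<in> set pats4"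
    by (auto simp: MM_def split: if_splits)
  have "ge (if d = 3 then E3 else E4) q" using q(2) ges_mem[OF run_ge3] ges_mem[OF run_ge4] by (auto split: if_splits)
  from ge_sound[OF conjunct1[OF fl_seed[OF d(1) q(1)]] this] show ?thesis
    using fl_seed[OF d(1) q(1)] d(2) by (auto simp: E3_def E4_def split: if_splits)
qed

lemma min_sum: "finite S \<Longrightarrow> (\<And>x. x \<in> S \<Longrightarrow> min (4::nat) (f x) \<le> h x) \<Longrightarrow> min 4 (\<Sum>x\<in>S. f x) \<le> (\<Sum>x\<in>S. h x)"
proof (induction S rule: finite_induct)
  case (insert x S)
  have "min 4 (f x) \<le> h x" "min 4 (sum f S) \<le> sum h S" using insert by auto
  then have "min 4 (f x + sum f S) \<le> h x + sum h S" by linarith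
  then show ?case using insert by simp
qed simp

section \<open>Restricting a word at its last corner\<close>

locale corner =
  fixes L M R :: "nat list" and vr vs :: nat and l :: "nat list"
  assumes l: "l = wl L vr M vs R" and cf: "cf L vr M vs R" and hi2: "hi2 L vs"
begin

abbreviation "I \<equiv> Iv vs L"
abbreviation "x a \<equiv> map (tau a vr vs) l"

lemma vc: "vc L vr M vs R" using cf by (simp add: cf_def)
lemma D: "distinct l" using vc by (simp add: vc_def l)
lemma DL: "distinct L" using D by (simp add: l wl_eq)
lemma vsr: "vs < vr" using vc by (simp add: vc_def)
lemma setl: "set l = set L \<union> set M \<union> set R \<union> {vr, vs}" by (simp add: l set_wl)
lemma gl: "g l = (\<Sum>a\<in>I. g (x a))" using vc_transition[OF vc cf_ex[OF hi2]] l by simp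
lemma I_ne: "I \<noteq> {}" using cf_ex[OF hi2] Iv_nonempty by blast
lemma I_sub: "I \<subseteq> set l" using Iv_sub setl by blast
lemma trio: "a \<in> I \<Longrightarrow> distinct [a, vr, vs]" "a \<in> I \<Longrightarrow> {a, vr, vs} \<subseteq> set l" "a \<in> I \<Longrightarrow> a < vs"
  using vc_trio[OF vc] l by auto
lemma dx: "a \<in> I \<Longrightarrow> distinct (x a)" "a \<in> I \<Longrightarrow> set (x a) = set l"
  using D tau_inj tau_image trio by (auto simp: distinct_map)
lemma gx: "a \<in> I \<Longrightarrow> 1 \<le> g (x a)" using g_pos dx by blast
lemma ltx: "a \<in> I \<Longrightarrow> set l \<subseteq> {..<N} \<Longrightarrow> (x a, l) \<in> lt N" using lt_tau[of L vr M vs R N a] D vsr by (simp add: l)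
lemma gx_le: "a \<in> I \<Longrightarrow> g (x a) \<le> g l" unfolding gl by (rule member_le_sum) (auto simp: finite_Iv)

lemma card_I: "card I \<le> g l"
proof -
  have "card I = (\<Sum>a\<in>I. 1)" by simp
  also have "\<dots> \<le> g l" unfolding gl by (rule sum_mono) (use gx in auto)
  finally show ?thesis .
qed


lemma restrict:
  assumes "vr \<in> U" "vs \<in> U"
  shows "rs U l = wl (rs U L) vr (rs U M) vs (rs U R)" "vc (rs U L) vr (rs U M) vs (rs U R)"
  using rs_wl[OF assms] vc_rs[OF vc assms] by (simp_all add: l)

lemma restrict_g:
  assumes "vr \<in> U" "vs \<in> U" "\<exists>y\<in>set L. y \<in> U \<and> y < vs"
  shows "g (rs U l) = (\<Sum>a\<in>Iv vs (rs U L). g (map (tau a vr vs) (rs U l)))"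
  using vc_transition[OF restrict(2)[OF assms(1,2)]] assms(3) unfolding restrict(1)[OF assms(1,2)] by auto

text \<open>An obstructed letter is dominated by a child point, and this one survives the
  restriction, so no new child point appears.\<close>

lemma Iv_restrict:
  assumes "I \<subseteq> U"
  shows "Iv vs (rs U L) = I"
proof
  show "I \<subseteq> Iv vs (rs U L)" using Iv_rs assms by blast
  show "Iv vs (rs U L) \<subseteq> I"
  proof
    fix z assume z: "z \<in> Iv vs (rs U L)"
    then have zL: "z \<in> set L" "z \<in> U" "z < vs" using Iv_sub[of vs "rs U L"] by (auto simp: Iv_def)
    obtain X Y where L: "L = X @ z # Y" using zL(1) by (auto simp: in_set_conv_decomp)
    obtain a where a: "a \<in> I" "z \<le> a" "a \<in> set (X @ [z])" using Iv_dominate[OF L zL(3)] by blast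
    have "rs U L = rs U X @ z # rs U Y" using L zL by simp
    from Iv_split[OF distinct_rs[OF DL] this z] have "\<forall>y\<in>set (rs U X). \<not> (z < y \<and> y < vs)" by blast
    moreover have "a \<in> U" "a < vs" using a(1) assms trio(3) by auto
    ultimately have "a = z" using a(2,3) by (cases "a = z") auto
    then show "z \<in> I" using a by simp
  qed
qed

text \<open>A letter that becomes a child point when j is deleted was obstructed by j and by nothing
  else.\<close>

lemma new_point:
  assumes U: "U = - {j}" and z: "z \<in> Iv vs (rs U L)" "z \<notin> I" and L: "L = X @ j # Y"
  shows "z \<in> set Y" "z < j"
proof -
  have zL: "z \<in> set L" "z \<noteq> j" "z < vs" using z(1) Iv_sub[of vs "rs U L"] U by (auto simp: Iv_def)
  obtain P S where P: "L = P @ z # S" using zL(1) by (auto simp: in_set_conv_decomp)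
  obtain y where y: "y \<in> set P" "z < y" "y < vs" using z(2) P zL(3) unfolding Iv_def by blast
  have "rs U L = rs U P @ z # rs U S" using P zL U by simp
  from Iv_split[OF distinct_rs[OF DL] this z(1)] have "\<forall>y\<in>set (rs U P). \<not> (z < y \<and> y < vs)" by blast
  then have "y = j" using y U by auto
  then show "z < j" using y by simp
  obtain P1 P2 where "P = P1 @ j # P2" using y(1) \<open>y = j\<close> by (auto simp: in_set_conv_decomp)
  then have e: "X @ j # Y = P1 @ j # (P2 @ z # S)" using P L by simp
  then show "z \<in> set Y" using split_unique[OF _ e] DL L by auto
qed

text \<open>Two new child points would stand to the left of j, decreasing and below j; in the child
  at j they are followed by vs and j and form a 2143 with them.\<close>

lemma new_unique:
  assumes U: "U = - {j}" and j: "j \<in> I" "\<not> nv (x j)"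
    and z: "z1 \<in> Iv vs (rs U L)" "z1 \<notin> I" "z2 \<in> Iv vs (rs U L)" "z2 \<notin> I"
  shows "z1 = z2"
proof (rule ccontr)
  assume ne: "z1 \<noteq> z2"
  obtain X Y where L: "L = X @ j # Y" using j(1) by (auto simp: Iv_def)
  have lr: "l = wl (X @ j # Y) vr M vs R" using l L by simp
  have xj: "x j = rev Y @ vs # rev X @ j # M @ vr # R" using tau_map D unfolding lr by blast
  have *: False if "Y = P @ b # Q @ a # S" "{a, b} \<subseteq> Iv vs (rs U L) - I" for a b P Q S
  proof -
    have jn: "a \<noteq> j" "b \<noteq> j" using that DL L by auto
    have "rs U L = (rs U X @ rs U P @ b # rs U Q) @ a # rs U S" using L that(1) U jn by simp
    from Iv_split[OF distinct_rs[OF DL] this, of vs] that(2) have "\<not> (a < b \<and> b < vs)" by auto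
    moreover have "b < vs" using that(2) by (auto simp: Iv_def)
    moreover have "a \<noteq> b" using that(1) DL L by auto
    ultimately have "b < a" by linarith
    moreover have "a < j" using new_point(2)[OF U _ _ L] that(2) by blast
    moreover have "x j = rev S @ a # rev Q @ b # rev P @ vs # rev X @ j # (M @ vr # R)" using xj that(1) by simp
    ultimately have "nv (x j)" using nv_I[of b a j vs] trio(3)[OF j(1)] by metis
    then show False using j(2) by blast
  qed
  have zY: "z1 \<in> set Y" "z2 \<in> set Y" using new_point(1)[OF U _ _ L] z by blast+
  obtain P S where Y: "Y = P @ z1 # S" using zY(1) by (auto simp: in_set_conv_decomp)
  have "z2 \<in> set P \<or> z2 \<in> set S" using zY(2) ne Y by auto
  then show False
  proof
    assume "z2 \<in> set P"
    then obtain P1 P2 where "P = P1 @ z2 # P2" by (auto simp: in_set_conv_decomp)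
    then show False using *[of P1 z2 P2 z1 S] Y z by simp
  next
    assume "z2 \<in> set S"
    then obtain S1 S2 where "S = S1 @ z2 # S2" by (auto simp: in_set_conv_decomp)
    then show False using *[of P z1 S1 z2 S2] Y z by simp
  qed
qed

text \<open>A 2143 in the child at z of the word without j transfers to the child at j: unchanged if
  it uses none of the moved letters z, vr, vs, and by the check \<open>run_R1\<close>
  otherwise.\<close>

lemma new_vexillary:
  assumes U: "U = - {j}" and j: "j \<in> I" "\<not> nv (x j)" and z: "z \<in> Iv vs (rs U L)" "z \<notin> I"
  shows "\<not> nv (map (tau z vr vs) (rs U l))"
proof
  assume n: "nv (map (tau z vr vs) (rs U l))"
  obtain X Y where L: "L = X @ j # Y" using j(1) by (auto simp: Iv_def)
  have jX: "\<forall>y\<in>set X. \<not> (j < y \<and> y < vs)" using Iv_split[OF DL L j(1)] by blast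
  have tj: "distinct [j, vr, vs]" using trio(1)[OF j(1)] .
  have rU: "vr \<in> U" "vs \<in> U" using tj U by auto
  note res = restrict[OF rU]
  have tz: "distinct [z, vr, vs]" "{z, vr, vs} \<subseteq> set (rs U l)" "z < vs"
    using vc_trio[OF res(2) z(1)] by (simp_all add: res(1))
  note np = new_point[OF U z L]
  have dr: "distinct (rs U l)" by (rule distinct_rs[OF D])
  have dxz: "distinct (map (tau z vr vs) (rs U l))" "set (map (tau z vr vs) (rs U l)) = set (rs U l)"
    using tau_inj[OF tz(1)] tau_image[OF tz(1,2)] dr by (auto simp: distinct_map simp del: rs_simps)
  obtain V where V: "V \<subseteq> set (rs U l)" "fl (rs V (map (tau z vr vs) (rs U l))) = [2, 1, 4, 3]"
    using nv_occ[OF dxz(1) n] dxz(2) by blast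
  have VU: "V \<subseteq> U" "j \<notin> V" using V(1) U by auto
  show False
  proof (cases "V \<inter> {z, vr, vs} = {}")
    case True
    have "rs V (map (tau z vr vs) (rs U l)) = rs V (rs U l)" by (rule rs_tau_disjoint) (use True in auto)
    also have "\<dots> = rs V l" using VU(1) by (simp add: rs_rs Int_absorb2)
    also have "\<dots> = rs V (x j)" by (rule rs_tau_disjoint[symmetric]) (use True VU in auto)
    finally have "fl (rs V (x j)) = [2, 1, 4, 3]" using V(2) by simp
    from occ_nv[OF dx(1)[OF j(1)] this] show False using j(2) by blast
  next
    case False
    obtain P S where P: "rs U L = P @ z # S" "\<forall>y\<in>set P. \<not> (z < y \<and> y < vs)" using z(1) by (auto simp: Iv_def)
    have "z \<notin> set P" using P(1) distinct_rs[OF DL, of U] by auto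
    then have f2: "f2 False z vs (rs V S) (rs V P) (rs V (rs U M))"
      using P(2) tz(3) vc unfolding f2_def vc_def by (auto simp: nb_iff allt_iff le_less)
    have "gen FR1 False (length [c1, c0, c3, c2]) [c1, c0, c3, c2]"
      using gens_sound[OF run_R1, of "[c1, c0, c3, c2]"] unfolding fl_2143(2) by simp
    then have gen: "if V \<inter> {z, vr, vs} = {} then \<not> False \<and> gn False False False FR1 False (length [c1, c0, c3, c2]) [c1, c0, c3, c2]
        else gen FR1 False (length [c1, c0, c3, c2]) [c1, c0, c3, c2]" using False by (simp only: if_False)
    have "fin_at FR1 (V \<union> {z, vr, vs}) (rs V S) z (rs V P) vr (rs V (rs U M)) vs (rs V (rs U R))"
      by (rule window[OF res(2)[unfolded P(1)] V(1)[unfolded res(1) P(1)] f2 V(2)[unfolded res(1) P(1) fl_2143(1)] gen])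
    then have i: "ij HR1 (rk (V \<union> {z, vr, vs}) z) (map (rk (V \<union> {z, vr, vs})) (rs V P @ z # rs V S)) (rk (V \<union> {z, vr, vs}) vr)
       (map (rk (V \<union> {z, vr, vs})) (rs V (rs U M))) (rk (V \<union> {z, vr, vs}) vs) (map (rk (V \<union> {z, vr, vs})) (rs V (rs U R)))
       (vl (rk (V \<union> {z, vr, vs}) vs))"
      by (simp add: FR1_def)
    define W where "W = V \<union> {z, vr, vs}"
    have WU: "W \<subseteq> U" "j \<notin> W" "finite W" "z \<in> W" "vr \<in> W" "vs \<in> W" "W \<subseteq> set l"
      using VU rU tz(2) V(1) U finite_subset[OF V(1)] unfolding W_def by auto
    have e: "rs V P @ z # rs V S = rs W X @ rs W Y"
    proof -
      have "rs W (rs U L) = rs W L" using WU(1) by (simp add: rs_rs Int_absorb2)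
      moreover have "rs W L = rs W X @ rs W Y" using L WU(2) by simp
      moreover have "rs W (P @ z # S) = rs V P @ z # rs V S"
      proof -
        have "distinct (wl (P @ z # S) vr (rs U M) vs (rs U R))" using dr res(1) P(1) by simp
        then have "set P \<inter> {z, vr, vs} = {}" "set S \<inter> {z, vr, vs} = {}" by (auto simp: wl_eq)
        then have "rs W P = rs V P \<and> rs W S = rs V S"
          unfolding W_def using rs_disjoint[of P "{z, vr, vs}" V] rs_disjoint[of S "{z, vr, vs}" V] by blast
        then show ?thesis using WU(4) by simp
      qed
      ultimately show ?thesis using P(1) by simp
    qed
    have rsM: "rs V (rs U T) = rs W T" if "set T \<subseteq> set M \<or> set T \<subseteq> set R" for T
    proof -
      have "set T \<inter> {z, vr, vs} = {}"
        using that D np(1) L unfolding l by (auto simp: wl_eq)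
      then have "rs W T = rs V T" unfolding W_def by (rule rs_disjoint)
      then show ?thesis using VU(1) by (simp add: rs_rs Int_absorb2)
    qed
    have "fin_at (HR1 (ups (rk W z < rk W j) (rk W z))) (insert j W) (rs W Y) j (rs W X) vr (rs W M) vs (rs W R)"
    proof (rule ij_rk)
      show "ij HR1 (rk W z) (map (rk W) (rs W X @ rs W Y)) (rk W vr) (map (rk W) (rs W M)) (rk W vs) (map (rk W) (rs W R)) (vl (rk W vs))"
        using i unfolding W_def[symmetric] e rsM[of M, simplified] rsM[of R, simplified] .
      have "j \<notin> set X" using DL L by auto
      then show "nb j vs (rs W X)" using jX by (auto simp: nb_iff le_less)
    qed (use WU trio(3)[OF j(1)] vsr in auto)
    moreover have "ups (rk W z < rk W j) (rk W z) = rk (insert j W) z" using rk_insert[OF WU(3,2,4)] by simp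
    moreover have "rk (insert j W) z < rk (insert j W) j" using np(2) WU by (simp add: rk_less)
    moreover have "\<not> nb (rk (insert j W) z) (Suc (rk (insert j W) z)) (map (rk (insert j W)) (rs W Y))"
      using np(1) WU(4) by (auto simp: nb_iff)
    ultimately have "nv (xl (map (rk (insert j W)) (rs W Y)) (rk (insert j W) j) (map (rk (insert j W)) (rs W X))
        (rk (insert j W) vr) (map (rk (insert j W)) (rs W M)) (rk (insert j W) vs) (map (rk (insert j W)) (rs W R)))"
      by (simp add: HR1_def)
    moreover have "xl (map f A) (f a) (map f B) (f b) (map f C) (f c) (map f E) = map f (xl A a B b C c E)" for f A a B b C c E
      by (simp add: xl_def rap_rev rev_map)
    ultimately have nx: "nv (map (rk (insert j W)) (xl (rs W Y) j (rs W X) vr (rs W M) vs (rs W R)))" by simp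
    have "x j = rev Y @ vs # rev X @ j # M @ vr # R" using tau_map D unfolding l L by blast
    moreover have "rs (insert j W) T = rs W T" if "j \<notin> set T" for T by (rule rs_cong) (use that in auto)
    ultimately have xe: "xl (rs W Y) j (rs W X) vr (rs W M) vs (rs W R) = rs (insert j W) (x j)"
      using D WU(5,6) unfolding l L by (simp add: xl_def rap_rev wl_eq)
    have "om (rk (insert j W)) (set (rs (insert j W) (x j)))"
      by (rule om_subset[OF om_rk]) (use WU(3) in auto)
    then have "nv (rs (insert j W) (x j))" using nx nv_om xe by metis
    then show False using nv_rs j(2) by blast
  qed
qed

end

lemma lq_iff: "lq m n \<longleftrightarrow> m \<le> n"
  by (induction m n rule: lq.induct) auto

lemma exl_iff: "exl v X \<longleftrightarrow> (\<exists>x\<in>set X. x < v)"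
  by (induction X) auto

definition ed :: "nat \<Rightarrow> nat" where "ed d = (if d = 3 then E3 else E4)"

lemma ed: "d \<in> {3, 4} \<Longrightarrow> Suc (ed d) = d"
  by (auto simp: ed_def E3_def E4_def)

lemma allAs_run:
  assumes "d \<in> {3, 4}" "fl k \<in> MM d"
  obtains q GJ GB GC where "fl k = map Suc q" "allA GJ GB GC (length q) q"
    "\<And>L vr M vs R. GC L vr M vs R \<Longrightarrow> chA (ed d) L vr M vs R"
    "\<And>L vr M vs R. GB L vr M vs R \<Longrightarrow> GC L vr M vs R \<and> GJ L vr M vs R"
    "\<And>L vr M vs R. GJ L vr M vs R \<Longrightarrow> \<exists>HA. ij HA c0 L vr M vs R (vl vs) \<and>
      (\<forall>t J1 v J2 vr M vs R. HA t J1 v J2 vr M vs R \<longrightarrow> hA (ed d) J1 v J2 vr M vs R)"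
proof (cases "d = 3")
  case True
  then obtain q where q: "fl k = map Suc q" "q \<in> set pats3" using assms(2) by (auto simp: MM_def)
  then have "allA GJ3 GB3 GC3 (length q) q" using run_A3 by (auto simp: list_all_iff)
  from that[OF q(1) this] show ?thesis using True
    by (force simp: GC3_def GB3_def GJ3_def HA3_def ed_def split: if_splits)
next
  case False
  then obtain q where q: "fl k = map Suc q" "q \<in> set pats4" using assms by (auto simp: MM_def)
  then have "allA GJ4 GB4 GC4 (length q) q" using run_A4 by (auto simp: list_all_iff)
  from that[OF q(1) this] show ?thesis using False
    by (force simp: GC4_def GB4_def GJ4_def HA4_def ed_def split: if_splits)
qed

context corner
begin

lemma nvl: "nv l"
proof -
  obtain t where t: "t < vs" "hasinv t L" using hi2 by (auto simp: hi2_def)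
  then obtain X y Y Z where "L = X @ y # Y @ t # Z" "y < t" using hasinv_split by blast
  then have "l = rev Z @ t # rev Y @ y # rev X @ vr # M @ vs # R" by (simp add: l wl_eq)
  then show ?thesis using nv_I[OF \<open>y < t\<close> t(1) vsr] by metis
qed

lemma okh_rank: "okh (map (rk (set l)) L) (rk (set l) vr) (map (rk (set l)) M) (rk (set l) vs) (map (rk (set l)) R)"
  using okh_om[OF om_rk[of "set l"], of L vr M vs R] cf_okh[OF cf hi2] setl by auto

lemma ci_rank:
  assumes "distinct (wl L' vr M' vs R')" "set L' \<subseteq> W" "vs \<in> W" "finite W"
  shows "ci c0 (map (rk W) L') (rk W vs) = card (Iv vs L')"
  using ci_om[OF om_rk[OF assms(4)] assms(3,2), of c0 c0] ci_card[OF assms(1)] by (simp add: c0_def)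

lemma ge_rank: "ge e (wl (map (rk (set l)) L) (rk (set l) vr) (map (rk (set l)) M) (rk (set l) vs) (map (rk (set l)) R)) \<Longrightarrow> Suc e \<le> g l"
proof -
  assume "ge e (wl (map (rk (set l)) L) (rk (set l) vr) (map (rk (set l)) M) (rk (set l) vs) (map (rk (set l)) R))"
  then have "ge e (map (rk (set l)) l)" by (simp add: wl_map l[symmetric])
  moreover have "om (rk (set l)) (set l)" by (rule om_rk) simp
  ultimately show ?thesis using ge_sound[of "map (rk (set l)) l" e] g_map[OF D] om_inj D by (simp add: distinct_map)
qed

text \<open>If l violated monotonicity, a proper restriction K would be a listed pattern of value d
  = g l + 1. Outside K there can only be vr, vs and at most one child point j, and never all three,
  so l arises from the pattern by inserting at most two letters. For these insertions the checks
  \<open>run_A3\<close> and \<open>run_A4\<close> certify the value d, a contradiction.\<close>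

lemma PA_step:
  assumes IH: "\<And>k. (k, l) \<in> lt N \<Longrightarrow> distinct k \<Longrightarrow> set k \<subseteq> {..<N} \<Longrightarrow> PA k \<and> PB k" and S: "set l \<subseteq> {..<N}"
  shows "PA l"
proof (rule ccontr)
  assume "\<not> PA l"
  then obtain V where V: "g l < min 4 (g (rs V l))" by (auto simp: PA_def not_le)
  define d where "d = Suc (g l)"
  \<comment> \<open>Since l contains a 2143 its value is at least 2, and the violation keeps it
    below 4.\<close>
  have d: "d \<in> {3, 4}" "d \<le> 4" "g l < d" using g_nonvexillary[OF D nvl] V by (auto simp: d_def)
  have short: "PA (rs U l) \<and> PB (rs U l)" if "\<not> set l \<subseteq> U" for U
    by (rule IH[OF lt_shorter[OF length_rs_less[OF that]] distinct_rs[OF D]]) (use S in auto)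
  have PAx: "min 4 (g (rs U (x a))) \<le> g (x a)" if "a \<in> I" for a U
    using IH[OF ltx[OF that S]] dx[OF that] S unfolding PA_def by auto
  have nV: "\<not> set l \<subseteq> V" using V rs_id by fastforce
  have "PB (rs U (rs V l))" for U unfolding rs_rs by (rule conjunct2[OF short]) (use nV in auto)
  from PB_occ[OF distinct_rs[OF D] this d(1)] V obtain K0 where K0: "K0 \<subseteq> set (rs V l)" "fl (rs K0 (rs V l)) \<in> MM d"
    by (auto simp: d_def)
  define K where "K = K0 \<inter> V"
  have K: "K \<subseteq> set l" "fl (rs K l) \<in> MM d" "\<not> set l \<subseteq> K" using K0 nV by (auto simp: K_def rs_rs)
  have gK: "d \<le> g (rs K l)" using MM_g[OF distinct_rs[OF D] d(1) K(2)] .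
  have big: "d \<le> g (rs U l)" if "K \<subseteq> U" "\<not> set l \<subseteq> U" for U
  proof -
    have "min 4 (g (rs K (rs U l))) \<le> g (rs U l)" using short[OF that(2)] unfolding PA_def by blast
    moreover have "rs K (rs U l) = rs K l" using that(1) by (simp add: rs_rs Int_absorb2)
    ultimately show ?thesis using gK d(2) by simp
  qed
  have sub_sum: "min 4 (\<Sum>a\<in>J. g (map (tau a vr vs) (rs U l))) \<le> (\<Sum>a\<in>J. g (x a))"
    if "J \<subseteq> I" "J \<subseteq> U" "vr \<in> U" "vs \<in> U" for J U
  proof (rule min_sum)
    fix a assume a: "a \<in> J"
    have aI: "a \<in> I" "a \<in> U" using a that(1,2) by blast+
    have "map (tau a vr vs) (rs U l) = rs U (x a)" using rs_tau[OF trio(1)[OF aI(1)], of U l] aI that(3,4) by auto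
    then show "min 4 (g (map (tau a vr vs) (rs U l))) \<le> g (x a)" using PAx[of a U] a that by auto
  qed (use that finite_Iv finite_subset in blast)
  obtain a0 where a0: "a0 \<in> I" using I_ne by blast
  \<comment> \<open>Deleting a letter other than vr, vs and the child points leaves the child points
    as they are; monotonicity for the children would then bound the value of the restriction, which
    is at least d, by g l.\<close>
  have out: "t \<in> insert vr (insert vs I)" if "t \<in> set l" "t \<notin> K" for t
  proof (rule ccontr)
    assume t: "t \<notin> insert vr (insert vs I)"
    let ?U = "- {t}"
    have "\<exists>y\<in>set L. y \<in> ?U \<and> y < vs"
    proof (rule bexI[of _ a0])
      have "a0 \<noteq> t" using a0 t by auto
      then show "a0 \<in> ?U \<and> a0 < vs" using trio(3)[OF a0] by simp
      show "a0 \<in> set L" using a0 Iv_sub by blast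
    qed
    then have "g (rs ?U l) = (\<Sum>a\<in>I. g (map (tau a vr vs) (rs ?U l)))"
      using restrict_g[of ?U] Iv_restrict[of ?U] t by auto
    moreover have "min 4 (\<Sum>a\<in>I. g (map (tau a vr vs) (rs ?U l))) \<le> g l" using sub_sum[of I ?U] t gl by auto
    moreover have "d \<le> g (rs ?U l)" by (rule big) (use that in auto)
    ultimately show False using d(2,3) by simp
  qed
  \<comment> \<open>A pattern that avoids j, vr and vs reappears unchanged in the child at j, whose
    value is bounded by g l.\<close>
  have free: "j \<in> K" if "j \<in> I" "vr \<notin> K" "vs \<notin> K" for j
  proof (rule ccontr)
    assume "j \<notin> K"
    then have "rs K (x j) = rs K l" by (intro rs_tau_disjoint) (use that in auto)
    then show False using PAx[OF that(1), of K] gx_le[OF that(1)] gK d(2,3) by simp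
  qed
  \<comment> \<open>Without a new child point the restricted sum would be bounded by the values of
    the other children. If the child at j had no 2143, the new child point would be unique with
    value 1, which is no more than the child at j contributes to g l.\<close>
  have del: "(\<exists>z. z \<in> Iv vs (rs (- {j}) L) \<and> z \<notin> I) \<and> (I \<noteq> {j} \<longrightarrow> nv (x j))" if j: "j \<in> I" "j \<notin> K" for j
  proof -
    let ?U = "- {j}"
    let ?I' = "Iv vs (rs ?U L)"
    have U: "vr \<in> ?U" "vs \<in> ?U" using trio(1)[OF j(1)] by auto
    have jn: "j \<notin> ?I'"
    proof
      assume "j \<in> ?I'"
      then have "j \<in> set (rs ?U L)" using Iv_sub by blast
      then show False by simp
    qed
    have sub: "I - {j} \<subseteq> ?I'"
    proof
      fix b assume "b \<in> I - {j}"
      then show "b \<in> ?I'" by (intro Iv_rs) auto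
    qed
    have dl: "d \<le> g (rs ?U l)" by (rule big) (use j I_sub in auto)
    have ne: "\<exists>y\<in>set L. y \<in> ?U \<and> y < vs"
    proof -
      obtain t where t: "t < vs" "hasinv t L" using hi2 by (auto simp: hi2_def)
      then obtain y where "t \<in> set L" "y \<in> set L" "y < t" using hasinv_mem by blast
      then show ?thesis using t(1) by (cases "t = j") auto
    qed
    have sum: "g (rs ?U l) = (\<Sum>a\<in>?I'. g (map (tau a vr vs) (rs ?U l)))" by (rule restrict_g[OF U ne])
    have less: "min 4 (\<Sum>a\<in>I - {j}. g (map (tau a vr vs) (rs ?U l))) \<le> (\<Sum>a\<in>I - {j}. g (x a))"
      by (rule sub_sum) (use U in auto)
    have glj: "g l = g (x j) + (\<Sum>a\<in>I - {j}. g (x a))" unfolding gl by (rule sum.remove[OF finite_Iv j(1)])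
    have new: "\<exists>z. z \<in> ?I' \<and> z \<notin> I"
    proof (rule ccontr)
      assume "\<nexists>z. z \<in> ?I' \<and> z \<notin> I"
      then have "?I' = I - {j}" using sub jn by auto
      then show False using sum less glj dl d(2,3) by simp
    qed
    moreover have "nv (x j)"
    proof (rule ccontr)
      assume v: "\<not> nv (x j)"
      obtain z where z: "z \<in> ?I'" "z \<notin> I" using new by blast
      have "?I' = insert z (I - {j})" using sub jn z new_unique[OF refl j(1) v] by blast
      then have "g (rs ?U l) = g (map (tau z vr vs) (rs ?U l)) + (\<Sum>a\<in>I - {j}. g (map (tau a vr vs) (rs ?U l)))"
        unfolding sum using z finite_Iv by simp
      moreover have "g (map (tau z vr vs) (rs ?U l)) = 1"
      proof (rule g_vexillary)
        have "distinct [z, vr, vs]" using vc_trio[OF restrict(2)[OF U] z(1)] by blast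
        then show "distinct (map (tau z vr vs) (rs ?U l))" using tau_inj distinct_rs[OF D] by (simp add: distinct_map)
      qed (rule new_vexillary[OF refl j(1) v z])
      ultimately show False using less glj gx[OF j(1)] dl d(2,3) by linarith
    qed
    ultimately show ?thesis by blast
  qed
  \<comment> \<open>Two missing child points would have children with a 2143, each of value at least
    2, and g l would be at least 4.\<close>
  have one: "j1 = j2" if "j1 \<in> I - K" "j2 \<in> I - K" for j1 j2
  proof (rule ccontr)
    assume ne: "j1 \<noteq> j2"
    have j: "j1 \<in> I" "j1 \<notin> K" "j2 \<in> I" "j2 \<notin> K" using that by auto
    have "I \<noteq> {j1}" "I \<noteq> {j2}" using j ne by auto
    then have "nv (x j1)" "nv (x j2)" using del[OF j(1,2)] del[OF j(3,4)] by simp_all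
    then have "2 \<le> g (x j1)" "2 \<le> g (x j2)" using g_nonvexillary dx j(1,3) by blast+
    moreover have "(\<Sum>a\<in>{j1, j2}. g (x a)) \<le> g l" unfolding gl by (rule sum_mono2) (use that finite_Iv in auto)
    ultimately show False using ne d(2,3) d_def by simp
  qed
  have finl: "finite (set l)" by simp
  obtain q GJ GB GC where q: "fl (rs K l) = map Suc q" "allA GJ GB GC (length q) q"
    and GC: "\<And>L vr M vs R. GC L vr M vs R \<Longrightarrow> chA (ed d) L vr M vs R"
    and GB: "\<And>L vr M vs R. GB L vr M vs R \<Longrightarrow> GC L vr M vs R \<and> GJ L vr M vs R"
    and GJ: "\<And>L vr M vs R. GJ L vr M vs R \<Longrightarrow> \<exists>HA. ij HA c0 L vr M vs R (vl vs) \<and>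
      (\<forall>t J1 v J2 vr M vs R. HA t J1 v J2 vr M vs R \<longrightarrow> hA (ed d) J1 v J2 vr M vs R)"
    by (rule allAs_run[OF d(1) K(2)]) (rule that, assumption+)
  note qK = seed_rank[OF D K(1) q(1)]
  have noge: "\<not> ge (ed d) (wl (map (rk (set l)) L) (rk (set l) vr) (map (rk (set l)) M) (rk (set l) vs) (map (rk (set l)) R))"
    using ge_rank[of "ed d"] ed[OF d(1)] d(3) by auto
  have vcc: "vs < vr" "inr vs vr R" "allt vs M" "distinct (L @ M @ R @ [vr, vs])"
    using vc by (auto simp: vc_def distinct_wl)
  show False
  proof (cases "I - K = {}")
    case True
    have sub: "t \<in> K" if "t \<in> set l" "t \<noteq> vr" "t \<noteq> vs" for t using out[OF that(1)] True that by blast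
    have Keq: "K = set l - (if vs \<in> K then {} else {vs}) - (if vr \<in> K then {} else {vr})" using sub K(1) by auto
    have nb: "\<not> (vs \<in> K \<and> vr \<in> K)" using sub K(3) by blast
    have sL: "set L \<subseteq> K" "set M \<subseteq> K" "set R \<subseteq> K" using sub vcc(4) setl by auto
    have "rs K l = rev L @ (if vr \<in> K then [vr] else []) @ M @ (if vs \<in> K then [vs] else []) @ R"
      unfolding l wl_eq by (simp add: rs_id[OF sL(1)] rs_id[OF sL(2)] rs_id[OF sL(3)])
    then have q': "q = map (rk K) (rev L @ (if vr \<in> K then [vr] else []) @ M @ (if vs \<in> K then [vs] else []) @ R)"
      using qK(1) by simp
    obtain G where G: "gA (vs \<in> K) (vr \<in> K) G (length q) q" "G = GB \<or> G = GC"
      using q(2) nb unfolding allA_def by (cases "vs \<in> K"; cases "vr \<in> K") (auto split: if_splits)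
    have "G (map (rk (set l)) L) (rk (set l) vr) (map (rk (set l)) M) (rk (set l) vs) (map (rk (set l)) R)"
      by (rule gA_rk[where V=K and N="length q", OF _ vcc(4,1,2,3) setl Keq]) (use G(1) q' qK(2) in auto)
    then have "chA (ed d) (map (rk (set l)) L) (rk (set l) vr) (map (rk (set l)) M) (rk (set l) vs) (map (rk (set l)) R)"
      using G(2) GB GC by blast
    moreover have "ci c0 (map (rk (set l)) L) (rk (set l) vs) = card I"
      by (rule ci_rank) (use D l setl in auto)
    moreover have "card I \<le> ed d" using card_I ed[OF d(1)] d_def by simp
    ultimately show False using okh_rank noge unfolding chA_def by (simp add: lq_iff)
  next
    case False
    then obtain j where j: "j \<in> I" "j \<notin> K" "I - K = {j}" using one by blast
    obtain X Y where L: "L = X @ j # Y" using j(1) by (auto simp: Iv_def)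
    let ?W = "set l - {j}"
    have jv: "j \<noteq> vr" "j \<noteq> vs" "j < vs" using trio(1,3)[OF j(1)] by auto
    have br: "vs \<in> K \<or> vr \<in> K" using free[OF j(1)] j(2) by blast
    have sub: "t \<in> K" if "t \<in> set l" "t \<noteq> vr" "t \<noteq> vs" "t \<noteq> j" for t using out[OF that(1)] j(3) that by blast
    have Keq: "K = ?W - (if vs \<in> K then {} else {vs}) - (if vr \<in> K then {} else {vr})" using sub K(1) j(2) by auto
    have jX: "j \<notin> set (X @ Y @ M @ R)" "distinct ((X @ Y) @ M @ R @ [vr, vs])" using vcc(4) L by auto
    have sL: "set X \<subseteq> K" "set Y \<subseteq> K" "set M \<subseteq> K" "set R \<subseteq> K" using sub vcc(4) setl L by auto
    have "rs K l = rev (X @ Y) @ (if vr \<in> K then [vr] else []) @ M @ (if vs \<in> K then [vs] else []) @ R"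
      unfolding l wl_eq L using j(2) by (simp add: rs_id[OF sL(1)] rs_id[OF sL(2)] rs_id[OF sL(3)] rs_id[OF sL(4)])
    then have q': "q = map (rk K) (rev (X @ Y) @ (if vr \<in> K then [vr] else []) @ M @ (if vs \<in> K then [vs] else []) @ R)"
      using qK(1) by simp
    obtain G where G: "gA (vs \<in> K) (vr \<in> K) G (length q) q" "G = GB \<or> G = GJ"
      using q(2) br unfolding allA_def by (cases "vs \<in> K"; cases "vr \<in> K") (auto split: if_splits)
    have setW: "?W = set (X @ Y) \<union> set M \<union> set R \<union> {vr, vs}" using setl L jX(1) jv by auto
    have "G (map (rk ?W) (X @ Y)) (rk ?W vr) (map (rk ?W) M) (rk ?W vs) (map (rk ?W) R)"
      by (rule gA_rk[where V=K and N="length q", OF _ jX(2) vcc(1,2,3) setW Keq]) (use G(1) q' qK(2) in auto)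
    then have "GJ (map (rk ?W) (X @ Y)) (rk ?W vr) (map (rk ?W) M) (rk ?W vs) (map (rk ?W) R)"
      using G(2) GB by blast
    from GJ[OF this] obtain HA where HA: "ij HA c0 (map (rk ?W) (X @ Y)) (rk ?W vr) (map (rk ?W) M) (rk ?W vs) (map (rk ?W) R) (vl (rk ?W vs))"
      "\<And>t J1 v J2 vr M vs R. HA t J1 v J2 vr M vs R \<Longrightarrow> hA (ed d) J1 v J2 vr M vs R" by blast
    have nbX: "nb j vs X" using Iv_split[OF DL L j(1)] jX(1) by (auto simp: nb_iff le_less)
    have ins: "insert j ?W = set l" using j(1) I_sub by auto
    have "fin_at (HA (ups (c0 < rk ?W j) c0)) (insert j ?W) Y j X vr M vs R"
      by (rule ij_rk[OF HA(1)]) (use setW jv vcc(1) nbX in auto)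
    then have h: "fin_at (hA (ed d)) (set l) Y j X vr M vs R" unfolding ins by (rule HA(2))
    define \<rho> where "\<rho> = rk (set l)"
    have om: "\<rho> a < \<rho> b \<longleftrightarrow> a < b" if "a \<in> set l" for a b using rk_less[OF finl that] by (simp add: \<rho>_def)
    obtain z where z: "z \<in> Iv vs (rs (- {j}) L)" "z \<notin> I" using del[OF j(1,2)] by blast
    have zY: "z \<in> set Y" "z < j" using new_point[OF refl z L] by blast+
    have rL: "rs (- {j}) L = X @ Y"
    proof -
      have "rs (- {j}) X = X" "rs (- {j}) Y = Y" by (rule rs_id, use jX(1) in auto)+
      then show ?thesis by (simp add: L)
    qed
    have c1: "exl (\<rho> j) (map \<rho> Y)" using zY om[of z j] setl L by (auto simp: exl_iff)
    have mL: "map \<rho> X @ \<rho> j # map \<rho> Y = map \<rho> L" by (simp add: L)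
    have c2: "ci c0 (map \<rho> L) (\<rho> vs) = card I"
      unfolding \<rho>_def by (rule ci_rank) (use D l setl in auto)
    have c3: "ci c0 (map \<rho> X @ map \<rho> Y) (\<rho> vs) = card (Iv vs (X @ Y))"
      unfolding \<rho>_def map_append[symmetric] by (rule ci_rank[of "X @ Y" M R]) (use jX(2) setl L in \<open>auto simp: distinct_wl\<close>)
    have c4: "card I \<le> card (Iv vs (X @ Y))"
    proof -
      have "insert z (I - {j}) \<subseteq> Iv vs (X @ Y)" using z(1) Iv_rs[of _ vs L "- {j}"] unfolding rL by auto
      moreover have "card (insert z (I - {j})) = Suc (card (I - {j}))"
        by (rule card_insert_disjoint) (use z(2) finite_Iv in auto)
      then have "card (insert z (I - {j})) = card I" using card_Suc_Diff1[OF finite_Iv j(1)] by (rule trans)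
      ultimately show ?thesis using card_mono[OF finite_Iv[of vs "X @ Y"], of "insert z (I - {j})"] by linarith
    qed
    have c5: "nv (x j)" if "\<not> card I \<le> 1"
    proof -
      have "I \<noteq> {j}" using that by auto
      then show ?thesis using del[OF j(1,2)] by blast
    qed
    have c6: "Suc (card I) \<le> ed d"
    proof (cases "card I \<le> 1")
      case True
      then show ?thesis using ed[OF d(1)] d(1) by auto
    next
      case False
      then have "2 \<le> g (x j)" using c5 g_nonvexillary dx[OF j(1)] by blast
      moreover have "card (I - {j}) \<le> (\<Sum>a\<in>I - {j}. g (x a))" using sum_mono[of "I - {j}" "\<lambda>_. 1" "\<lambda>a. g (x a)"] gx by simp
      moreover have "g l = g (x j) + (\<Sum>a\<in>I - {j}. g (x a))" unfolding gl by (rule sum.remove[OF finite_Iv j(1)])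
      moreover have "Suc (card (I - {j})) = card I" using card_Suc_Diff1[OF finite_Iv j(1)] .
      ultimately show ?thesis using ed[OF d(1)] d_def by linarith
    qed
    have c7: "nv (xl (map \<rho> Y) (\<rho> j) (map \<rho> X) (\<rho> vr) (map \<rho> M) (\<rho> vs) (map \<rho> R))" if "\<not> card I \<le> 1"
    proof -
      have "x j = rev Y @ vs # rev X @ j # M @ vr # R" using tau_map D unfolding l L by blast
      then have "xl (map \<rho> Y) (\<rho> j) (map \<rho> X) (\<rho> vr) (map \<rho> M) (\<rho> vs) (map \<rho> R) = map \<rho> (x j)"
        by (simp add: xl_def rap_rev rev_map)
      moreover have "om \<rho> (set (x j))" using om_rk[OF finl] dx(2)[OF j(1)] by (simp add: \<rho>_def)
      ultimately show ?thesis using c5[OF that] nv_om by metis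
    qed
    show False
      using h[folded \<rho>_def] noge[folded \<rho>_def] okh_rank[folded \<rho>_def] c1 c2 c3 c4 c6 c7
      unfolding hA_def mL by (simp add: lq_iff split: if_splits)
  qed
qed

end

section \<open>Transfer of the checks to windows of a given word\<close>

lemma eqv_iff: "eqv a b \<longleftrightarrow> a = b"
  by (induction a b rule: eqv.induct) auto

lemma eqn_iff: "eqn m n \<longleftrightarrow> m = n"
  by (induction m n rule: eqn.induct) auto

lemma memb_iff: "memb l P \<longleftrightarrow> l \<in> set P"
  by (induction P) (auto simp: eqv_iff)

lemma memb5_iff: "memb5 L vr M vs R P \<longleftrightarrow> (L, vr, M, vs, R) \<in> set P"
  by (induction L vr M vs R P rule: memb5.induct) (auto simp: eqv_iff)

lemma nvs_iff: "nvs ks \<longleftrightarrow> (\<forall>k\<in>set ks. nv k)"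
  by (induction ks) auto

lemma anydel_split: "anydel e A l \<Longrightarrow> \<exists>X y Y. l = X @ y # Y \<and> ge e (rev A @ X @ Y)"
proof (induction l arbitrary: A)
  case (Cons y l)
  show ?case
  proof (cases "ge e (rap A l)")
    case True
    then have "y # l = [] @ y # l" "ge e (rev A @ [] @ l)" by (simp_all add: rap_rev)
    then show ?thesis by blast
  next
    case False
    then have "anydel e (y # A) l" using Cons.prems by simp
    from Cons.IH[OF this] obtain X z Y where "l = X @ z # Y" "ge e (rev (y # A) @ X @ Y)" by blast
    then have "y # l = (y # X) @ z # Y" "ge e (rev A @ (y # X) @ Y)" by simp_all
    then show ?thesis by blast
  qed
qed simp

lemma kd_all:
  assumes "distinct (wl L vr M vs R)"
  shows "(\<forall>k\<in>set (kd c0 L [] vs (M @ vr # R)). P k) \<longleftrightarrow> (\<forall>a\<in>Iv vs L. P (map (tau a vr vs) (wl L vr M vs R)))"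
proof -
  have 1: "(\<Sum>k\<leftarrow>ks. if P k then 0 else 1 :: nat) = 0 \<longleftrightarrow> (\<forall>k\<in>set ks. P k)" for ks by (induction ks) auto
  have 2: "(\<Sum>a\<in>Iv vs L. if P (map (tau a vr vs) (wl L vr M vs R)) then 0 else 1 :: nat) = 0 \<longleftrightarrow>
      (\<forall>a\<in>Iv vs L. P (map (tau a vr vs) (wl L vr M vs R)))" using finite_Iv[of vs L] by (simp add: sum_eq_0_iff)
  show ?thesis using kd_sum_Iv[OF assms, of "\<lambda>k. if P k then 0 else 1 :: nat"] 1 2 by metis
qed

lemma hi2_two:
  assumes "distinct L" "a \<in> Iv vs L" "b \<in> Iv vs L" "a \<noteq> b"
  shows "hi2 L vs"
proof -
  have *: ?thesis if L: "L = X @ a # Y" and bY: "b \<in> set Y" and bI: "b \<in> Iv vs L" and aI: "a \<in> Iv vs L" for a b X Y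
  proof -
    from bY obtain P S where Y: "Y = P @ b # S" by (auto simp: in_set_conv_decomp)
    have e: "L = (X @ a # P) @ b # S" using L Y by simp
    have "b < vs" "\<not> (b < a \<and> a < vs)" using Iv_split[OF assms(1) e bI] by auto
    moreover have "a < vs" using aI by (auto simp: Iv_def)
    moreover have "a \<noteq> b" using assms(1) e by auto
    ultimately have "a < b" by linarith
    then have "hasinv b (a # Y)" using Y by simp
    then have "hasinv b L" using hasinv_app[of b "a # Y" X] L by simp
    then show ?thesis using \<open>b < vs\<close> by (auto simp: hi2_def)
  qed
  obtain X Y where L: "L = X @ a # Y" using assms(2) by (auto simp: Iv_def)
  have "b \<in> set X \<or> b \<in> set Y" using assms(3,4) Iv_sub[of vs L] L by auto
  then show ?thesis
  proof
    assume "b \<in> set X"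
    then obtain P S where "X = P @ b # S" by (auto simp: in_set_conv_decomp)
    then have "L = P @ b # (S @ a # Y)" using L by simp
    from *[OF this _ assms(2,3)] show ?thesis by simp
  qed (rule *[OF L _ assms(3,2)])
qed

lemma a2v_sound: "a2v F L vr M vs R ws \<Longrightarrow> v \<in> set ws \<Longrightarrow>
    a2l F [] v (up v L) (ups (vr < v) vr) (up v M) (ups (vs < v) vs) (up v R) \<and>
    a2m F [] v (up v L) (ups (vr < v) vr) (up v M) (ups (vs < v) vs) (up v R) \<and>
    a2r F [] v (up v L) (ups (vr < v) vr) (up v M) (ups (vs < v) vs) (up v R)"
  by (induction ws) (auto split: if_splits)

lemma a2l_sound: "a2l F A v (X @ Y) vr M vs R \<Longrightarrow> F (rev A @ X @ v # Y) vr M vs R"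
proof (induction X arbitrary: A)
  case Nil
  then show ?case by (cases Y) (auto simp: rap_rev split: if_splits)
next
  case (Cons y X)
  then have "a2l F (y # A) v (X @ Y) vr M vs R" by (simp split: if_splits)
  from Cons.IH[OF this] show ?case by simp
qed

lemma a2m_sound: "a2m F A v L vr (X @ Y) vs R \<Longrightarrow> F L vr (rev A @ X @ v # Y) vs R"
proof (induction X arbitrary: A)
  case Nil
  then show ?case by (cases Y) (auto simp: rap_rev split: if_splits)
next
  case (Cons y X)
  then have "a2m F (y # A) v L vr (X @ Y) vs R" by (simp split: if_splits)
  from Cons.IH[OF this] show ?case by simp
qed

lemma a2r_sound: "a2r F A v L vr M vs (X @ Y) \<Longrightarrow> F L vr M vs (rev A @ X @ v # Y)"
proof (induction X arbitrary: A)
  case Nil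
  then show ?case by (cases Y) (auto simp: rap_rev split: if_splits)
next
  case (Cons y X)
  then have "a2r F (y # A) v L vr M vs (X @ Y)" by (simp split: if_splits)
  from Cons.IH[OF this] show ?case by simp
qed

lemma rs_insert_split:
  assumes "distinct (X @ e # Y)" "e \<notin> W"
  shows "rs (insert e W) (X @ e # Y) = rs W X @ e # rs W Y" "rs W (X @ e # Y) = rs W X @ rs W Y"
proof -
  have "rs (insert e W) X = rs W X" "rs (insert e W) Y = rs W Y" using assms(1) by (auto intro!: rs_cong)
  then show "rs (insert e W) (X @ e # Y) = rs W X @ e # rs W Y" by simp
  show "rs W (X @ e # Y) = rs W X @ rs W Y" using assms(2) by simp
qed

abbreviation at5 :: "(nat list \<Rightarrow> nat \<Rightarrow> nat list \<Rightarrow> nat \<Rightarrow> nat list \<Rightarrow> 'a) \<Rightarrow> nat set \<Rightarrow>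
    nat list \<Rightarrow> nat \<Rightarrow> nat list \<Rightarrow> nat \<Rightarrow> nat list \<Rightarrow> 'a" where
  "at5 F W L vr M vs R \<equiv> F (map (rk W) (rs W L)) (rk W vr) (map (rk W) (rs W M)) (rk W vs) (map (rk W) (rs W R))"

context corner
begin

lemma okh_at:
  assumes W: "finite W" "vr \<in> W" "vs \<in> W" and h: "hi2 (rs W L) vs"
  shows "at5 okh W L vr M vs R"
  using okh_om[OF om_rk[OF W(1)], of "rs W L" vr "rs W M" vs "rs W R"] cf_okh[OF cf_rs[OF cf W(2,3)] h] W by simp

lemma ci_at:
  assumes W: "finite W" "vr \<in> W" "vs \<in> W"
  shows "ci c0 (map (rk W) (rs W L)) (rk W vs) = card (Iv vs (rs W L))"
  by (rule ci_rank[of _ "rs W M" "rs W R"]) (use restrict[OF W(2,3)] W in \<open>auto simp: vc_def\<close>)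

lemma wl_at: "vr \<in> W \<Longrightarrow> vs \<in> W \<Longrightarrow> at5 wl W L vr M vs R = map (rk W) (rs W l)"
  by (simp add: wl_map restrict(1))

lemma ge_map: "finite W \<Longrightarrow> distinct k \<Longrightarrow> set k \<subseteq> W \<Longrightarrow> ge e (map (rk W) k) \<Longrightarrow> Suc e \<le> g k"
proof -
  assume W: "finite W" "distinct k" "set k \<subseteq> W" "ge e (map (rk W) k)"
  have o: "om (rk W) (set k)" using om_rk[OF W(1)] W(3) by (rule om_subset)
  then show ?thesis using ge_sound[of "map (rk W) k" e] W om_inj g_map by (simp add: distinct_map)
qed

lemma nvs_at:
  assumes W: "finite W" "vr \<in> W" "vs \<in> W"
  shows "nvs (kd c0 (map (rk W) (rs W L)) [] (rk W vs) (map (rk W) (rs W M) @ rk W vr # map (rk W) (rs W R))) \<longleftrightarrow>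
    (\<forall>a\<in>Iv vs (rs W L). nv (map (tau a vr vs) (rs W l)))"
proof -
  note res = restrict[OF W(2,3)]
  let ?ks = "kd c0 (rs W L) [] vs (rs W M @ vr # rs W R)"
  have "kd c0 (map (rk W) (rs W L)) (map (rk W) []) (rk W vs) (map (rk W) (rs W M @ vr # rs W R)) = map (map (rk W)) ?ks"
    by (rule kd_om[OF om_rk[OF W(1)]]) (use W in \<open>auto simp: c0_def\<close>)
  moreover have "nv (map (rk W) k) = nv k" if "k \<in> set ?ks" for k
  proof -
    have "set k \<subseteq> W" using kd_elem[OF that] W by (metis mset_eq_setD set_append set_simps(2) rs_simps(5) Un_subset_iff insert_subset Int_lower2 empty_subsetI set_empty)
    then show ?thesis using nv_om om_subset[OF om_rk[OF W(1)]] by blast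
  qed
  ultimately have "nvs (kd c0 (map (rk W) (rs W L)) [] (rk W vs) (map (rk W) (rs W M) @ rk W vr # map (rk W) (rs W R))) \<longleftrightarrow> (\<forall>k\<in>set ?ks. nv k)"
    by (simp add: nvs_iff)
  also have "\<dots> \<longleftrightarrow> (\<forall>a\<in>Iv vs (rs W L). nv (map (tau a vr vs) (rs W l)))"
    using kd_all[of "rs W L" vr "rs W M" vs "rs W R" nv] res by (simp add: vc_def)
  finally show ?thesis .
qed

lemma rs_x: "a \<in> I \<Longrightarrow> a \<in> W \<Longrightarrow> vr \<in> W \<Longrightarrow> vs \<in> W \<Longrightarrow> rs W (x a) = map (tau a vr vs) (rs W l)"
  by (rule rs_tau[OF trio(1)]) auto

lemma ij_at:
  assumes W: "W \<subseteq> set l" "vr \<in> W" "vs \<in> W" and b: "b \<in> I" "b \<notin> W"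
    and ij: "ij H t (map (rk W) (rs W L)) (rk W vr) (map (rk W) (rs W M)) (rk W vs) (map (rk W) (rs W R)) (vl (rk W vs))"
  obtains J1 J2 where "rs (insert b W) L = J2 @ b # J1"
    "fin_at (H (ups (t < rk W b) t)) (insert b W) J1 b J2 vr (rs (insert b W) M) vs (rs (insert b W) R)"
proof -
  have fin: "finite W" using W(1) finite_subset by blast
  obtain X Y where L: "L = X @ b # Y" using b(1) by (auto simp: Iv_def)
  have d: "distinct (X @ b # Y)" using DL L by simp
  note sp = rs_insert_split[OF d b(2)]
  have bMR: "b \<notin> set M" "b \<notin> set R" using D unfolding l wl_eq L by auto
  have MR: "rs (insert b W) M = rs W M" "rs (insert b W) R = rs W R" using bMR by (auto intro!: rs_cong)
  have nbX: "nb b vs (rs W X)" using Iv_split[OF DL L b(1)] d by (auto simp: nb_iff le_less)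
  have "fin_at (H (ups (t < rk W b) t)) (insert b W) (rs W Y) b (rs W X) vr (rs W M) vs (rs W R)"
    by (rule ij_rk) (use ij fin W b trio(3)[OF b(1)] vsr nbX in \<open>auto simp: L\<close>)
  then show ?thesis using that[of "rs W X" "rs W Y"] sp(1) MR by (simp add: L)
qed

text \<open>If a stood to the left of b and below it, b would obstruct a; both being child points,
  this is impossible. This is the guard under which the inserted second child point is
  tested.\<close>

lemma acond:
  assumes W: "W \<subseteq> set l" "a \<in> I" "a \<in> W" "b \<in> I" "b \<in> W" "a \<noteq> b" and L: "rs W L = J2 @ b # J1"
  shows "if rk W a < rk W b then nb (rk W a) (Suc (rk W a)) (map (rk W) J1) else True"
proof -
  have fin: "finite W" using W(1) finite_subset by blast
  have "a \<notin> set J1" if "a < b"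
  proof
    assume "a \<in> set J1"
    then obtain P S where "J1 = P @ a # S" by (auto simp: in_set_conv_decomp)
    then have "rs W L = (J2 @ b # P) @ a # S" using L by simp
    from Iv_split[OF distinct_rs[OF DL] this Iv_rs[OF W(2,3)]] show False using that trio(3)[OF W(4)] by auto
  qed
  moreover have "set J1 \<subseteq> W" using L rs_simps(5)[of W L] by auto
  moreover have "inj_on (rk W) W" using om_inj[OF om_rk[OF fin]] .
  ultimately show ?thesis using rk_less[OF fin W(3)] W(3) by (auto simp: nb_iff le_less_Suc_eq dest: inj_onD)
qed

lemma any_at:
  assumes W: "W \<subseteq> set l" "vr \<in> W" "vs \<in> W" and e: "e \<in> set l" "e \<notin> W" and N: "card W \<le> N"
    and a: "a2v F (map (rk W) (rs W L)) (rk W vr) (map (rk W) (rs W M)) (rk W vs) (map (rk W) (rs W R)) (vl N)"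
  shows "at5 F (insert e W) L vr M vs R"
proof -
  have fin: "finite W" using W(1) finite_subset by blast
  let ?W = "insert e W"
  have v: "rk W e \<in> set (vl N)" using rk_le[OF fin, of e] N by (simp add: set_vl)
  have up: "up (rk W e) (map (rk W) (rs W T)) = map (rk ?W) (rs W T)" for T by (rule up_map[OF fin e(2)]) auto
  have us: "ups (rk W vr < rk W e) (rk W vr) = rk ?W vr" "ups (rk W vs < rk W e) (rk W vs) = rk ?W vs"
    using rk_insert[OF fin e(2)] W by simp_all
  note s = a2v_sound[OF a v, unfolded up us, folded rk_insert_same[of e W]]
  have same: "rs ?W T = rs W T" if "e \<notin> set T" for T by (rule rs_cong) (use that in auto)
  have sp: "\<exists>X Y. map (rk ?W) (rs W T) = map (rk ?W) X @ map (rk ?W) Y \<and> rs ?W T = X @ e # Y"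
    if eT: "e \<in> set T" and dT: "distinct T" for T
  proof -
    from eT obtain X Y where "T = X @ e # Y" by (auto simp: in_set_conv_decomp)
    then show ?thesis using rs_insert_split[of X e Y W] dT e(2) by (intro exI[of _ "rs W X"] exI[of _ "rs W Y"]) simp
  qed
  have dd: "distinct L" "distinct M" "distinct R" "set L \<inter> set M = {}" "set L \<inter> set R = {}" "set M \<inter> set R = {}"
    using D unfolding l wl_eq by auto
  have "e \<in> set L \<or> e \<in> set M \<or> e \<in> set R" using e W setl by auto
  then show ?thesis
  proof (elim disjE)
    assume e': "e \<in> set L"
    obtain X Y where XY: "map (rk ?W) (rs W L) = map (rk ?W) X @ map (rk ?W) Y" "rs ?W L = X @ e # Y" using sp[OF e' dd(1)] by blast
    have n: "e \<notin> set M" "e \<notin> set R" using dd e' by auto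
    show ?thesis using a2l_sound[OF s[THEN conjunct1, unfolded XY(1)]] same[OF n(1)] same[OF n(2)] XY(2) by simp
  next
    assume e': "e \<in> set M"
    obtain X Y where XY: "map (rk ?W) (rs W M) = map (rk ?W) X @ map (rk ?W) Y" "rs ?W M = X @ e # Y" using sp[OF e' dd(2)] by blast
    have n: "e \<notin> set L" "e \<notin> set R" using dd e' by auto
    show ?thesis using a2m_sound[OF s[THEN conjunct2, THEN conjunct1, unfolded XY(1)]] same[OF n(1)] same[OF n(2)] XY(2) by simp
  next
    assume e': "e \<in> set R"
    obtain X Y where XY: "map (rk ?W) (rs W R) = map (rk ?W) X @ map (rk ?W) Y" "rs ?W R = X @ e # Y" using sp[OF e' dd(3)] by blast
    have n: "e \<notin> set L" "e \<notin> set M" using dd e' by auto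
    show ?thesis using a2r_sound[OF s[THEN conjunct2, THEN conjunct2, unfolded XY(1)]] same[OF n(1)] same[OF n(2)] XY(2) by simp
  qed
qed

lemma window_at:
  assumes a: "a \<in> I" and one: "one \<Longrightarrow> I = {a}" and V: "V \<subseteq> set l" and occ: "fl (rs V (x a)) = map Suc q"
    and gen: "if V \<inter> {a, vr, vs} = {} then \<not> one \<and> gn False False False F False (length q) q else gen F one (length q) q"
    and W: "W = V \<union> {a, vr, vs}"
  obtains J1 J2 where "rs W L = J2 @ a # J1" "fin_at F W J1 a J2 vr (rs W M) vs (rs W R)"
proof -
  obtain L2 L1 where L: "L = L2 @ a # L1" using a by (auto simp: Iv_def)
  have dl: "distinct (wl (L2 @ a # L1) vr M vs R)" using D unfolding l L .
  have a1: "\<forall>y\<in>set L2. \<not> (a < y \<and> y < vs)" using Iv_split[OF DL L a] by blast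
  have sg: "\<forall>y\<in>set L2. \<not> y < vs" "\<forall>y\<in>set L1. \<not> (a < y \<and> y < vs)" if one using Iv_singleton[OF DL one[OF that] L] by auto
  have aL: "a \<notin> set L1" "a \<notin> set L2" using DL L by auto
  have "f2 one a vs (rs V L1) (rs V L2) (rs V M)"
    using a1 sg trio(3)[OF a] vc aL unfolding f2_def vc_def by (auto simp: nb_iff allt_iff le_less)
  from window[OF vc[unfolded L] V[unfolded l L] this occ[unfolded l L] gen]
  have f: "fin_at F W (rs V L1) a (rs V L2) vr (rs V M) vs (rs V R)" unfolding W .
  have e: "rs W T = rs V T" if "set T \<inter> {a, vr, vs} = {}" for T unfolding W by (rule rs_disjoint[OF that])
  have n: "set L1 \<inter> {a, vr, vs} = {}" "set L2 \<inter> {a, vr, vs} = {}" "set M \<inter> {a, vr, vs} = {}" "set R \<inter> {a, vr, vs} = {}"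
    using dl by (auto simp: wl_eq)
  have "a \<in> W" using W by simp
  then have "rs W L = rs V L2 @ a # rs V L1" using e[OF n(1)] e[OF n(2)] by (simp add: L)
  then show ?thesis using that f e[OF n(3)] e[OF n(4)] by simp
qed

end

section \<open>Minimal words\<close>

declare subset_insertI2 [simp]

lemma sorted_wrt_splits: "(\<And>X p Y. L = X @ p # Y \<Longrightarrow> \<forall>q\<in>set Y. p < q) \<Longrightarrow> sorted_wrt (<) L"
proof (induction L)
  case (Cons z L)
  have "sorted_wrt (<) L"
  proof (rule Cons.IH)
    fix X p Y assume "L = X @ p # Y"
    then have "z # L = (z # X) @ p # Y" by simp
    then show "\<forall>q\<in>set Y. p < q" by (rule Cons.prems)
  qed
  then show ?case using Cons.prems[of "[]" z L] by simp
qed simp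

lemma fl_sorted:
  fixes ps :: "nat list"
  assumes "sorted_wrt (<) ps" "u \<in> Sym (length ps)"
  shows "fl (map (\<lambda>i. ps ! (i - 1)) u) = u"
proof -
  have u: "distinct u" "set u = {1..length ps}" using assms(2) by (auto simp: Sym_iff)
  have m: "ps ! (i - 1) < ps ! (j - 1)" if "i < j" "1 \<le> i" "j \<le> length ps" for i j
    using sorted_wrt_nth_less[OF assms(1), of "i - 1" "j - 1"] that by simp
  have "om (\<lambda>i. ps ! (i - 1)) (set u)" unfolding om_def
  proof (intro ballI)
    fix i j assume "i \<in> set u" "j \<in> set u"
    then have b: "1 \<le> i" "i \<le> length ps" "1 \<le> j" "j \<le> length ps" using u by auto
    show "ps ! (i - 1) < ps ! (j - 1) \<longleftrightarrow> i < j"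
      using m[of i j] m[of j i] b by (cases i j rule: linorder_cases) auto
  qed
  then have "fl (map (\<lambda>i. ps ! (i - 1)) u) = fl u" by (rule fl_map[OF u(1)])
  also have "fl u = u"
  proof (rule fl_eqI[OF u(1)])
    have "length u = length ps" using distinct_card[OF u(1)] u(2) by simp
    then show "u \<in> Sym (length u)" using assms(2) by simp
  qed (simp add: same_relative_order_def)
  finally show ?thesis .
qed

context corner
begin

lemma window_ex:
  assumes "a \<in> I" "one \<longrightarrow> I = {a}" "V \<subseteq> set l" "fl (rs V (x a)) = map Suc q"
    "if V \<inter> {a, vr, vs} = {} then \<not> one \<and> gn False False False F False (length q) q else gen F one (length q) q"
    "W = V \<union> {a, vr, vs}"
  shows "\<exists>J1 J2. rs W L = J2 @ a # J1 \<and> fin_at F W J1 a J2 vr (rs W M) vs (rs W R)"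
proof (rule window_at[OF assms(1) _ assms(3-6)])
  show "I = {a}" if one using that assms(2) by simp
qed blast

lemma rs_all: "rs (set l) L = L" "rs (set l) M = M" "rs (set l) R = R" "rs (set l) l = l"
  using setl by (auto intro!: rs_id)

lemma mem_l: "vr \<in> set l" "vs \<in> set l" using setl by auto

lemma okh_all: "at5 okh (set l) L vr M vs R"
  by (rule okh_at) (use mem_l hi2 in \<open>simp_all add: rs_all\<close>)

lemma fin_join: "rs W L = J2 @ a # J1 \<Longrightarrow> map (rk W) J2 @ rk W a # map (rk W) J1 = map (rk W) (rs W L)"
  by simp

text \<open>As long as letters are missing, minimality keeps the value of the window below 4, so its
  two children cannot both contain a 2143 and \<open>a2\<close> must extend it. Once the window is
  the whole word both children contain one, and the branch with \<open>concl\<close>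
  applies.\<close>

lemma a2_sound:
  assumes I: "I = {a, b}" "a \<noteq> b" and n: "nv (x a)" "nv (x b)"
    and min: "\<And>U. 4 \<le> g (rs U l) \<Longrightarrow> set l \<subseteq> U"
  shows "{a, b, vr, vs} \<subseteq> W \<Longrightarrow> W \<subseteq> set l \<Longrightarrow> card (set l - W) \<le> k \<Longrightarrow> card W = N \<Longrightarrow> at5 (a2 k N) W L vr M vs R \<Longrightarrow>
    at5 (concl E4 pats4) (set l) L vr M vs R"
proof (induction k arbitrary: W N)
  have base: "at5 a2f W L vr M vs R" and nvsW: "W = set l \<Longrightarrow> nvs (kd c0 (map (rk W) (rs W L)) [] (rk W vs) (map (rk W) (rs W M) @ rk W vr # map (rk W) (rs W R)))"
    and big: "nvs (kd c0 (map (rk W) (rs W L)) [] (rk W vs) (map (rk W) (rs W M) @ rk W vr # map (rk W) (rs W R))) \<Longrightarrow> 4 \<le> g (rs W l)"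
    if W: "{a, b, vr, vs} \<subseteq> W" "W \<subseteq> set l" for W
  proof -
    have fin: "finite W" using W(2) finite_subset by blast
    have v: "vr \<in> W" "vs \<in> W" using W(1) by auto
    have IvW: "Iv vs (rs W L) = I" by (rule Iv_restrict) (use I W in auto)
    have hi: "hi2 (rs W L) vs" by (rule hi2_two[where a = a and b = b]) (use distinct_rs[OF DL] IvW I in auto)
    have vcW: "vc (rs W L) vr (rs W M) vs (rs W R)" using restrict(2)[OF v] .
    have "allt (rk W vs) (map (rk W) (rs W M))" using allt_om[OF om_rk[OF fin] v(2), of "rs W M"] vcW by (auto simp: vc_def)
    moreover have "inr (rk W vs) (rk W vr) (map (rk W) (rs W R))"
      using inr_om[OF om_rk[OF fin] v(2,1), of "rs W R"] vcW by (auto simp: vc_def)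
    moreover have "ci c0 (map (rk W) (rs W L)) (rk W vs) = E3"
      using ci_at[OF fin v] IvW I by (simp add: E3_def)
    ultimately show "at5 a2f W L vr M vs R" using okh_at[OF fin v hi] by (simp add: a2f_def eqn_iff)
    have nv: "nvs (kd c0 (map (rk W) (rs W L)) [] (rk W vs) (map (rk W) (rs W M) @ rk W vr # map (rk W) (rs W R))) \<longleftrightarrow>
      nv (rs W (x a)) \<and> nv (rs W (x b))"
      using nvs_at[OF fin v] rs_x[of a W] rs_x[of b W] IvW I W(1) v by auto
    show "nvs (kd c0 (map (rk W) (rs W L)) [] (rk W vs) (map (rk W) (rs W M) @ rk W vr # map (rk W) (rs W R)))" if "W = set l"
      unfolding nv using n rs_id[of "x a" W] rs_id[of "x b" W] dx(2) I that by auto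
    show "4 \<le> g (rs W l)" if "nvs (kd c0 (map (rk W) (rs W L)) [] (rk W vs) (map (rk W) (rs W M) @ rk W vr # map (rk W) (rs W R)))"
    proof -
      have ab: "a \<in> I" "b \<in> I" using I by auto
      have "2 \<le> g (rs W (x a))" "2 \<le> g (rs W (x b))"
        using that[unfolded nv] g_nonvexillary distinct_rs dx(1)[OF ab(1)] dx(1)[OF ab(2)] by blast+
      moreover have "\<exists>y\<in>set L. y \<in> W \<and> y < vs" using ab(1) Iv_sub[of vs L] trio(3)[OF ab(1)] W(1) by blast
      then have "g (rs W l) = (\<Sum>c\<in>I. g (map (tau c vr vs) (rs W l)))" using restrict_g[OF v] IvW by simp
      then have "g (rs W l) = g (rs W (x a)) + g (rs W (x b))" using I rs_x[of a W] rs_x[of b W] ab W(1) v by simp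
      ultimately show ?thesis by simp
    qed
  qed
  {
    case 0
    have "W = set l" using 0(2,3) by auto
    then show ?case using 0(5) base[OF 0(1,2)] nvsW[OF 0(1,2)] by simp
  next
    case (Suc k)
    show ?case
    proof (cases "W = set l")
      case True
      then show ?thesis using Suc.prems(5) base[OF Suc.prems(1,2)] nvsW[OF Suc.prems(1,2)] by simp
    next
      case False
      then have less: "\<not> 4 \<le> g (rs W l)" using min[of W] Suc.prems(2) by auto
      have fin: "finite W" using Suc.prems(2) finite_subset by blast
      have v: "vr \<in> W" "vs \<in> W" using Suc.prems(1) by auto
      have "\<not> ge E4 (map (rk W) (rs W l))"
        using ge_map[OF fin distinct_rs[OF D], of W E4] less by (auto simp: E4_def)
      then have "\<not> ge E4 (at5 wl W L vr M vs R)" using wl_at[OF v] by simp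
      then have a: "a2v (a2 k (Suc N)) (map (rk W) (rs W L)) (rk W vr) (map (rk W) (rs W M)) (rk W vs) (map (rk W) (rs W R)) (vl N)"
        using Suc.prems(5) base[OF Suc.prems(1,2)] big[OF Suc.prems(1,2)] less by (auto split: if_splits)
      obtain e where e: "e \<in> set l" "e \<notin> W" using False Suc.prems(2) by auto
      show ?thesis
      proof (rule Suc.IH[of "insert e W" "Suc N"])
        show "at5 (a2 k (Suc N)) (insert e W) L vr M vs R"
          by (rule any_at[OF Suc.prems(2) v e _ a]) (use Suc.prems(4) in simp)
        have "card (set l - W) = Suc (card (set l - W - {e}))" using e by (intro card.remove) auto
        moreover have "set l - insert e W = set l - W - {e}" by auto
        ultimately show "card (set l - insert e W) \<le> k" using Suc.prems(3) by simp
        show "card (insert e W) = Suc N" using fin e Suc.prems(4) by simp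
      qed (use Suc.prems e in auto)
    qed
  }
qed

text \<open>A minimal word equals every window whose value reaches d. For each number of child
  points such a window is assembled from the corner, child points, and occurrences of smaller
  patterns in the children that supply the missing value; the check for its order type then puts it
  into the list.\<close>

lemma PB_step:
  assumes IH: "\<And>k. (k, l) \<in> lt N \<Longrightarrow> distinct k \<Longrightarrow> set k \<subseteq> {..<N} \<Longrightarrow> PA k \<and> PB k" and S: "set l \<subseteq> {..<N}"
  shows "PB l"
  unfolding PB_def
proof (intro ballI impI)
  fix d assume d: "d \<in> {3, 4::nat}" and dl: "d \<le> g l" and min: "\<forall>V. rs V l \<noteq> l \<longrightarrow> g (rs V l) < d"
  have minU: "set l \<subseteq> U" if "d \<le> g (rs U l)" for U using min that rs_eq_iff[of U l] by (meson not_less)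
  have IHW: "PA (rs W (x a)) \<and> PB (rs W (x a))" if a: "a \<in> I" for a W
  proof (cases "set (x a) \<subseteq> W")
    case True
    have "PA (x a) \<and> PB (x a)" by (rule IH[OF ltx[OF a S] dx(1)[OF a]]) (use dx(2)[OF a] S in simp)
    then show ?thesis using rs_id[OF True] by simp
  next
    case False
    have "(rs W (x a), l) \<in> lt N" using length_rs_less[OF False] by (intro lt_shorter) simp
    moreover have "set (rs W (x a)) \<subseteq> {..<N}" using dx(2)[OF a] S by auto
    ultimately show ?thesis using IH distinct_rs[OF dx(1)[OF a]] by blast
  qed
  have up: "min 4 (g (rs V (x a))) \<le> g (rs W (x a))" if a: "a \<in> I" and VW: "V \<subseteq> W" for a V W
  proof -
    have "rs V (rs W (x a)) = rs V (x a)" using VW by (simp only: rs_rs Int_absorb2)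
    moreover have "min 4 (g (rs V (rs W (x a)))) \<le> g (rs W (x a))" using IHW[OF a, of W] unfolding PA_def by blast
    ultimately show ?thesis by simp
  qed
  \<comment> \<open>A lower bound for the value of a window: the child points in J contribute the
    restricted values of their children, all further child points of the window contribute at least
    1.\<close>
  have low: "(\<Sum>b\<in>J. g (rs W (x b))) + card (Iv vs (rs W L) - J) \<le> g (rs W l)"
    if J: "J \<subseteq> I" "J \<subseteq> W" "J \<noteq> {}" and W: "vr \<in> W" "vs \<in> W" for J W
  proof -
    let ?f = "\<lambda>a. g (map (tau a vr vs) (rs W l))"
    obtain b where b: "b \<in> J" using J(3) by blast
    have "b \<in> set L" "b \<in> W" "b < vs" using b J Iv_sub trio(3) by blast+
    then have "\<exists>y\<in>set L. y \<in> W \<and> y < vs" by blast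
    from restrict_g[OF W this] have e: "g (rs W l) = (\<Sum>a\<in>Iv vs (rs W L). ?f a)" .
    have sub: "J \<subseteq> Iv vs (rs W L)" using J Iv_rs by blast
    have 1: "(\<Sum>b\<in>J. g (rs W (x b))) = (\<Sum>b\<in>J. ?f b)"
    proof (rule sum.cong)
      fix c assume "c \<in> J"
      then have "c \<in> I" "c \<in> W" using J by blast+
      then show "g (rs W (x c)) = ?f c" using rs_x[of c W] W by simp
    qed simp
    have "1 \<le> ?f a" if "a \<in> Iv vs (rs W L)" for a
    proof (rule g_pos)
      have "distinct [a, vr, vs]" using vc_trio[OF restrict(2)[OF W] that] by blast
      then show "distinct (map (tau a vr vs) (rs W l))" using tau_inj distinct_rs[OF D] by (simp add: distinct_map)
    qed
    then have 2: "card (Iv vs (rs W L) - J) \<le> (\<Sum>a\<in>Iv vs (rs W L) - J. ?f a)"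
      using sum_mono[of "Iv vs (rs W L) - J" "\<lambda>_. 1" ?f] by simp
    have "(\<Sum>a\<in>Iv vs (rs W L). ?f a) = (\<Sum>a\<in>Iv vs (rs W L) - J. ?f a) + (\<Sum>a\<in>J. ?f a)"
      by (rule sum.subset_diff[OF sub finite_Iv])
    then show ?thesis using e 1 2 by linarith
  qed
  have disj: "rs V (x a) = rs V l" if "V \<inter> {a, vr, vs} = {}" for V a by (rule rs_tau_disjoint) (use that in auto)
  have gx1: "1 \<le> g (rs W (x a))" if "a \<in> I" for a W using g_pos distinct_rs dx(1)[OF that] by blast
  define P where "P = (if d = 3 then pats3 else pats4)"
  have MMP: "MM d = map Suc ` set P" by (simp add: MM_def P_def)
  \<comment> \<open>Minimality refutes every alternative of \<open>concl\<close> that deletes a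
    letter, so only membership in the list remains.\<close>
  have conclD: "fl l \<in> MM d" if c: "at5 (concl (ed d) P) (set l) L vr M vs R"
  proof -
    let ?r = "rk (set l)"
    have nog: "\<not> ge (ed d) (map ?r k)" if k: "k = rs (- {y}) l" "y \<in> set l" for k y
    proof
      assume "ge (ed d) (map ?r k)"
      then have "Suc (ed d) \<le> g k" by (intro ge_map[of "set l"]) (use k distinct_rs[OF D] in auto)
      then have "set l \<subseteq> - {y}" using ed[OF d] k(1) minU by metis
      then show False using k(2) by blast
    qed
    have wlr: "wl (map ?r L) (?r vr) (map ?r M) (?r vs) (map ?r R) = map ?r l" unfolding wl_map l[symmetric] ..
    have nn: "y \<notin> set T \<Longrightarrow> rs (- {y}) T = T" for y T by (rule rs_id) auto
    have ds: "distinct (rev L @ vr # M @ vs # R)" using D unfolding l wl_eq .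
    have r1: "rev L @ M @ vs # R = rs (- {vr}) l" unfolding l wl_eq using ds by (simp add: nn)
    have r2: "rev L @ vr # M @ R = rs (- {vs}) l" unfolding l wl_eq using ds by (simp add: nn)
    have n1: "\<not> ge (ed d) (rap (map ?r L) (map ?r M @ ?r vs # map ?r R))"
      using nog[OF r1 mem_l(1)] by (simp add: rap_rev rev_map)
    have n2: "\<not> ge (ed d) (rap (map ?r L) (?r vr # map ?r M @ map ?r R))"
      using nog[OF r2 mem_l(2)] by (simp add: rap_rev rev_map)
    have "\<not> anydel (ed d) [] (map ?r l)"
    proof
      assume "anydel (ed d) [] (map ?r l)"
      then obtain X y Y where s: "map ?r l = X @ y # Y" "ge (ed d) (X @ Y)" using anydel_split by fastforce
      obtain X0 Z0 where 1: "l = X0 @ Z0" "map ?r X0 = X" "map ?r Z0 = y # Y" using s(1) by (auto simp: map_eq_append_conv)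
      obtain y0 Y0 where 2: "Z0 = y0 # Y0" "map ?r Y0 = Y" using 1(3) by (auto simp: map_eq_Cons_conv)
      have e: "X0 @ Y0 = rs (- {y0}) l" using D 1(1) 2(1) by (simp add: nn)
      have "y0 \<in> set l" using 1(1) 2(1) by simp
      from nog[OF e this] show False using s(2) 1(2) 2(2) by simp
    qed
    then have "map ?r l \<in> set P" using c n1 n2 unfolding rs_all concl_def wlr by (auto simp: memb_iff split: if_splits)
    moreover have "fl l = map Suc (map ?r l)" using fl_rk[OF D] by simp
    ultimately show ?thesis unfolding MMP by blast
  qed
  show "fl l \<in> MM d"
  proof (cases "d \<le> card I")
    \<comment> \<open>The corner and d child points already give the value d and hence are the whole
      word. Child points decrease from left to right, so its order type is 3 2 1 5 4 or 4 3 2 1 6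
      5.\<close>
    case True
    obtain J where J: "J \<subseteq> I" "card J = d" using obtain_subset_with_card_n[OF True] by blast
    have Jne: "J \<noteq> {}" using J(2) d by auto
    let ?W = "J \<union> {vr, vs}"
    have "d \<le> (\<Sum>b\<in>J. g (rs ?W (x b)))"
      using sum_mono[of J "\<lambda>_. 1" "\<lambda>b. g (rs ?W (x b))"] gx1 J by auto
    also have "\<dots> \<le> g (rs ?W l)"
    proof -
      have "J \<subseteq> ?W" "vr \<in> ?W" "vs \<in> ?W" by auto
      from low[OF J(1) this(1) Jne this(2,3)] show ?thesis by (rule add_leD1)
    qed
    finally have lW: "set l \<subseteq> ?W" by (rule minU)
    have JL: "J \<subseteq> set L" using J(1) Iv_sub by blast
    have dl': "distinct (rev L @ vr # M @ vs # R)" using D unfolding l wl_eq .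
    have LJ: "set L = J" using JL lW setl dl' by auto
    have iM: "set M \<inter> (J \<union> {vr, vs}) = {}" and iR: "set R \<inter> (J \<union> {vr, vs}) = {}" using dl' JL by auto
    have sM: "set M \<subseteq> J \<union> {vr, vs}" and sR: "set R \<subseteq> J \<union> {vr, vs}" using lW setl by auto
    have "set M = {}" "set R = {}"
      by (rule trans[OF sym[OF Int_absorb2[OF sM]] iM], rule trans[OF sym[OF Int_absorb2[OF sR]] iR])
    then have MR: "M = []" "R = []" by auto
    have "sorted_wrt (<) L"
    proof (rule sorted_wrt_splits)
      fix X p Y assume L: "L = X @ p # Y"
      show "\<forall>q\<in>set Y. p < q"
      proof
        fix q assume q: "q \<in> set Y"
        then obtain Y1 Y2 where "Y = Y1 @ q # Y2" by (auto simp: in_set_conv_decomp)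
        then have L': "L = (X @ p # Y1) @ q # Y2" using L by simp
        have I': "q \<in> I" "p \<in> I" using LJ J(1) L L' by auto
        have "\<not> (q < p \<and> p < vs)" using Iv_split[OF DL L' I'(1)] by simp
        moreover have "p \<noteq> q" using DL L' by auto
        ultimately show "p < q" using trio(3)[OF I'(2)] by linarith
      qed
    qed
    moreover have "length L = d" using distinct_card[OF DL] LJ J(2) by simp
    moreover have lt: "y < vs" if "y \<in> set L" for y using that LJ J(1) trio(3) by blast
    have lL: "l = rev L @ [vr, vs]" using MR by (simp add: l wl_eq)
    ultimately show ?thesis
    proof (cases "d = 3")
      case True
      then obtain p q s where L: "L = [p, q, s]" using \<open>length L = d\<close> by (auto simp: length_Suc_conv numeral_eq_Suc)
      then have o: "p < q" "q < s" "s < vs" using \<open>sorted_wrt (<) L\<close> lt by auto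
      have "sorted_wrt (<) [p, q, s, vs, vr]" using o vsr by auto
      then have "fl (map (\<lambda>i. [p, q, s, vs, vr] ! (i - 1)) [3, 2, 1, 5, 4]) = [3, 2, 1, 5, 4]" by (rule fl_sorted) (auto simp: Sym_iff)
      moreover have "map (\<lambda>i. [p, q, s, vs, vr] ! (i - 1)) [3, 2, 1, 5, 4] = l" by (simp add: lL L numeral_eq_Suc)
      ultimately have "fl l = [3, 2, 1, 5, 4]" by simp
      also have "\<dots> = map Suc [c2, c1, c0, c4, c3]" by (simp add: c_defs)
      also have "\<dots> \<in> MM d" unfolding MMP P_def using True by (intro imageI) (simp add: pats_run)
      finally show ?thesis .
    next
      case False
      then have "length L = 4" using \<open>length L = d\<close> d by simp
      then obtain p q s t where L: "L = [p, q, s, t]" by (auto simp: length_Suc_conv numeral_eq_Suc)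
      then have o: "p < q" "q < s" "s < t" "t < vs" using \<open>sorted_wrt (<) L\<close> lt by auto
      have "sorted_wrt (<) [p, q, s, t, vs, vr]" using o vsr by auto
      then have "fl (map (\<lambda>i. [p, q, s, t, vs, vr] ! (i - 1)) [4, 3, 2, 1, 6, 5]) = [4, 3, 2, 1, 6, 5]" by (rule fl_sorted) (auto simp: Sym_iff)
      moreover have "map (\<lambda>i. [p, q, s, t, vs, vr] ! (i - 1)) [4, 3, 2, 1, 6, 5] = l" by (simp add: lL L numeral_eq_Suc)
      ultimately have "fl l = [4, 3, 2, 1, 6, 5]" by simp
      also have "\<dots> = map Suc [c3, c2, c1, c0, c5, c4]" by (simp add: c_defs)
      also have "\<dots> \<in> MM d" unfolding MMP P_def using False by (intro imageI) (simp add: pats_run)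
      finally show ?thesis .
    qed
  next
    case few: False
    have cI: "1 \<le> card I" using I_ne finite_Iv by (simp add: Suc_le_eq card_gt_0_iff)
    have occ: "\<exists>V\<subseteq>set l. fl (rs V (x a)) \<in> MM e" if "a \<in> I" "e \<in> {3, 4}" "e \<le> g (x a)" for a e
      using PB_occ[OF dx(1)[OF that(1)] _ that(2,3)] IHW[OF that(1)] dx(2)[OF that(1)] by auto
    show ?thesis
    proof (cases "card I = 1")
      \<comment> \<open>The only child has the same value as l and so contains a listed pattern for
        d; this pattern and the three moved letters make up the word.\<close>
      case True
      then obtain a where I: "I = {a}" using card_1_singletonE by blast
      have a: "a \<in> I" using I by simp
      have "d \<le> g (x a)" using dl gl I by simp
      then obtain V where V: "V \<subseteq> set l" "fl (rs V (x a)) \<in> MM d" using occ[OF a d] by blast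
      then obtain q where q: "fl (rs V (x a)) = map Suc q" "q \<in> set P" unfolding MMP by blast
      have gV: "d \<le> g (rs V (x a))" using MM_g[OF distinct_rs[OF dx(1)[OF a]] d V(2)] .
      have ov: "V \<inter> {a, vr, vs} \<noteq> {}"
      proof
        assume e: "V \<inter> {a, vr, vs} = {}"
        then have "set l \<subseteq> V" using gV disj minU by simp
        then show False using e mem_l(1) by auto
      qed
      define W where "W = V \<union> {a, vr, vs}"
      have "d \<le> g (rs W l)" using low[of "{a}" W] up[OF a, of V W] gV d a by (auto simp: W_def)
      then have W: "W = set l" using minU trio(2)[OF a] V(1) unfolding W_def by blast
      define F where "F = (if d = 3 then F3k1 else F4k1)"
      have "gen F True (length q) q" using run_3k1 run_4k1 q(2) unfolding F_def P_def by (auto simp: list_all_iff split: if_splits)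
      then obtain J1 J2 where J: "rs W L = J2 @ a # J1" "fin_at F W J1 a J2 vr (rs W M) vs (rs W R)"
        using window_ex[OF a _ V(1) q(1) _ W_def, of True F] I ov by auto
      have "at5 okh W L vr M vs R" using okh_all W by simp
      then have "at5 (concl (ed d) P) W L vr M vs R"
        using J(2) unfolding F_def P_def F3k1_def F4k1_def ed_def by (auto simp: fin_join[OF J(1)] split: if_splits)
      then show ?thesis using conclD W by simp
    next
      case False
      then have c2: "2 \<le> card I" "card I < d" using cI few by auto
      \<comment> \<open>The common part of all cases in which a child with a 2143 is combined with a
        second child point b: if b is not in the window yet, it is inserted through
        \<open>ij_at\<close>.\<close>
      have w32: "at5 fin32 (insert b W) L vr M vs R \<and> (b \<notin> W \<or> True)"
        if a: "a \<in> I" and V: "V \<subseteq> set l" "fl (rs V (x a)) = [2, 1, 4, 3]" and W: "W = V \<union> {a, vr, vs}"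
          and b: "b \<in> I" "b \<noteq> a" and cf: "card (Iv vs (rs (insert b W) L)) = 2"
          and nb: "b \<notin> W \<Longrightarrow> card (Iv vs (rs W L)) \<le> 2 \<and> g (rs W l) < 4" for a V W b
      proof -
        have Ws: "W \<subseteq> set l" "finite W" "a \<in> W" "vr \<in> W" "vs \<in> W" using V(1) trio(2)[OF a] finite_subset[OF V(1)] by (auto simp: W)
        have "if V \<inter> {a, vr, vs} = {} then \<not> False \<and> gn False False False F32 False (length [c1, c0, c3, c2]) [c1, c0, c3, c2]
            else gen F32 False (length [c1, c0, c3, c2]) [c1, c0, c3, c2]"
          using gens_sound[OF run_F32, of "[c1, c0, c3, c2]"] gens0_sound[OF run_F32_0, of "[c1, c0, c3, c2]"]
          unfolding fl_2143(2) by simp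
        from window_ex[OF a _ V(1) V(2)[unfolded fl_2143(1)] this W]
        obtain J1 J2 where J: "rs W L = J2 @ a # J1" "fin_at F32 W J1 a J2 vr (rs W M) vs (rs W R)" by auto
        have F: "F32c (card (Iv vs (rs W L))) (map (rk W) J1) (rk W a) (map (rk W) J2) (rk W vr) (map (rk W) (rs W M)) (rk W vs) (map (rk W) (rs W R))"
          using J(2) ci_at[OF Ws(2,4,5)] unfolding F32_def fin_join[OF J(1)] by simp
        have aIv: "a \<in> Iv vs (rs W L)" by (rule Iv_rs[OF a Ws(3)])
        show ?thesis
        proof (cases "b \<in> W")
          case True
          then have "insert b W = W" by auto
          then show ?thesis using F cf fin_join[OF J(1)] by (simp add: numeral_eq_Suc split: if_splits)
        next
          case bW: False
          have "card (Iv vs (rs W L)) \<noteq> 0" using aIv finite_Iv by (metis card_0_eq empty_iff)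
          then have k: "card (Iv vs (rs W L)) = Suc 0 \<or> card (Iv vs (rs W L)) = Suc (Suc 0)" using nb[OF bW] by linarith
          have nge: "\<not> ge E4 (at5 wl W L vr M vs R)"
            using ge_map[OF Ws(2) distinct_rs[OF D], of W E4] nb[OF bW] wl_at[OF Ws(4,5)] by (auto simp: E4_def)
          have ij: "ij H32 (rk W a) (map (rk W) (rs W L)) (rk W vr) (map (rk W) (rs W M)) (rk W vs) (map (rk W) (rs W R)) (vl (rk W vs))"
            using k F nge unfolding F32b_def by (auto simp: fin_join[OF J(1)] F32b_def split: if_splits)
          obtain K1 K2 where K: "rs (insert b W) L = K2 @ b # K1"
            "fin_at (H32 (ups (rk W a < rk W b) (rk W a))) (insert b W) K1 b K2 vr (rs (insert b W) M) vs (rs (insert b W) R)"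
            by (rule ij_at[OF Ws(1,4,5) b(1) bW ij])
          have t: "ups (rk W a < rk W b) (rk W a) = rk (insert b W) a" using rk_insert[OF Ws(2) bW Ws(3)] by simp
          have Ws': "insert b W \<subseteq> set l" using Ws(1) b(1) I_sub by auto
          have ac: "if rk (insert b W) a < rk (insert b W) b then nb (rk (insert b W) a) (Suc (rk (insert b W) a)) (map (rk (insert b W)) K1) else True"
            by (rule acond[OF Ws' a _ b(1) _ _ K(1)]) (use Ws b in auto)
          have "ci c0 (map (rk (insert b W)) (rs (insert b W) L)) (rk (insert b W) vs) = E3"
            using ci_at[of "insert b W"] Ws cf by (simp add: E3_def)
          then show ?thesis using K(2) ac unfolding t H32_def fin_join[OF K(1)] by (simp add: eqn_iff)
        qed
      qed
      have nv2: "2 \<le> g (rs V (x a))" if "a \<in> I" "fl (rs V (x a)) = [2, 1, 4, 3]" for a V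
      proof -
        have dd: "distinct (rs V (x a))" using distinct_rs dx(1)[OF that(1)] by blast
        have "nv [2, 1, 4, 3 :: nat]" by simp
        then have "nv (rs V (x a))" using nv_fl[OF dd] that(2) by simp
        then show ?thesis by (rule g_nonvexillary[OF dd])
      qed
      have lowa: "2 + card (Iv vs (rs W L) - {a}) \<le> g (rs W l)" "2 \<le> g (rs W (x a))"
        if "a \<in> I" "fl (rs V (x a)) = [2, 1, 4, 3]" "V \<subseteq> W" "{a, vr, vs} \<subseteq> W" for a V W
        using low[of "{a}" W] up[OF that(1,3)] nv2[OF that(1,2)] that by auto
      have okW: "at5 okh W L vr M vs R" if "{a, b, vr, vs} \<subseteq> W" "W \<subseteq> set l" "a \<in> I" "b \<in> I" "a \<noteq> b" for a b W
        by (rule okh_at[OF finite_subset[OF that(2)]], simp, use that in simp, use that in simp,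
            rule hi2_two[OF distinct_rs[OF DL] Iv_rs[OF that(3)] Iv_rs[OF that(4)] that(5)]) (use that in auto)
      have nva: "\<exists>a\<in>I. nv (x a)"
      proof (rule ccontr)
        assume "\<not> (\<exists>a\<in>I. nv (x a))"
        then have "g l = card I" using gl g_vexillary dx(1) by simp
        then show False using dl c2 by simp
      qed
      have diffc: "card (Iv vs (rs W L) - {a}) = card (Iv vs (rs W L)) - 1" if "a \<in> I" "a \<in> W" for a W
        using Iv_rs[OF that] by simp
      show ?thesis
      proof (cases "d = 3")
        \<comment> \<open>Two children reach 3 only if one of them has value at least 2, that is,
          contains a 2143; the window adds the other child point.\<close>
        case d3: True
        then have cI2: "card I = 2" using c2 by simp
        obtain a where a: "a \<in> I" "nv (x a)" using nva by blast
        have "card (I - {a}) = 1" using cI2 a(1) by simp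
        then obtain b where "I - {a} = {b}" using card_1_singletonE by blast
        then have I: "I = {a, b}" "b \<noteq> a" using a(1) by auto
        obtain V where V: "V \<subseteq> set l" "fl (rs V (x a)) = [2, 1, 4, 3]" using nv_occ[OF dx(1)[OF a(1)] a(2)] dx(2)[OF a(1)] by auto
        define W where "W = V \<union> {a, vr, vs}"
        have IW: "Iv vs (rs (insert b W) L) = I" by (rule Iv_restrict) (use I in \<open>auto simp: W_def\<close>)
        have "card (I - {a}) = 1" using cI2 a(1) by simp
        then have "d \<le> g (rs (insert b W) l)" using lowa(1)[OF a(1) V(2), of "insert b W"] IW d3 by (auto simp: W_def)
        then have Wl: "insert b W = set l" using minU V(1) trio(2)[OF a(1)] I_sub I unfolding W_def by blast
        have nb: "card (Iv vs (rs W L)) \<le> 2 \<and> g (rs W l) < 4" if "b \<notin> W"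
        proof -
          have "\<not> set l \<subseteq> W" using that Wl by blast
          then have "g (rs W l) < 3" using minU[of W] d3 by linarith
          then show ?thesis using lowa(1)[OF a(1) V(2), of W] diffc[OF a(1), of W] by (auto simp: W_def)
        qed
        have "at5 fin32 (insert b W) L vr M vs R" using w32[OF a(1) V W_def _ I(2) _ nb] I IW cI2 by simp
        then have "at5 (concl (ed d) P) (set l) L vr M vs R" using okh_all d3
          unfolding Wl fin32_def ed_def P_def by (auto split: if_splits)
        then show ?thesis by (rule conclD)
      next
        case False
        then have d4: "d = 4" using d by simp
        have P4: "P = pats4" "ed d = E4" using d4 by (simp_all add: P_def ed_def)
        have lt4: "g (rs U l) < 4" if "\<not> set l \<subseteq> U" for U using minU[of U] that d4 by linarith
        show ?thesis
        proof (cases "card I = 3")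
          \<comment> \<open>Three child points reach 4 as 2 + 1 + 1, so one child with a 2143
            suffices; the other child points are added to its window where they are missing.\<close>
          case cI3: True
          obtain a where a: "a \<in> I" "nv (x a)" using nva by blast
          obtain V where V: "V \<subseteq> set l" "fl (rs V (x a)) = [2, 1, 4, 3]" using nv_occ[OF dx(1)[OF a(1)] a(2)] dx(2)[OF a(1)] by auto
          define W where "W = V \<union> {a, vr, vs}"
          have Ws: "W \<subseteq> set l" "finite W" "a \<in> W" "vr \<in> W" "vs \<in> W" using V(1) trio(2)[OF a(1)] finite_subset[OF V(1)] by (auto simp: W_def)
          have full: "U = set l" if "W \<subseteq> U" "I \<subseteq> U" "U \<subseteq> set l" for U
          proof -
            have "Iv vs (rs U L) = I" using Iv_restrict[OF that(2)] .
            then have "4 \<le> g (rs U l)" using lowa(1)[OF a(1) V(2), of U] that(1) cI3 a(1) by (auto simp: W_def)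
            then show ?thesis using minU[of U] d4 that(3) by blast
          qed
          have fin43: "at5 fin43 (set l) L vr M vs R \<Longrightarrow> fl l \<in> MM d"
          proof -
            assume "at5 fin43 (set l) L vr M vs R"
            moreover have "ci c0 (map (rk (set l)) (rs (set l) L)) (rk (set l) vs) = E4"
              using ci_at[of "set l"] mem_l cI3 by (simp add: rs_all E4_def)
            ultimately show ?thesis using okh_all conclD unfolding fin43_def P4 by (simp add: eqn_iff split: if_splits)
          qed
          show ?thesis
          proof (cases "I \<subseteq> W")
            case True
            then have Wl: "W = set l" using full Ws(1) by blast
            have "if V \<inter> {a, vr, vs} = {} then \<not> False \<and> gn False False False F32 False (length [c1, c0, c3, c2]) [c1, c0, c3, c2]
                else gen F32 False (length [c1, c0, c3, c2]) [c1, c0, c3, c2]"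
              using gens_sound[OF run_F32, of "[c1, c0, c3, c2]"] gens0_sound[OF run_F32_0, of "[c1, c0, c3, c2]"]
              unfolding fl_2143(2) by simp
            from window_ex[OF a(1) _ V(1) V(2)[unfolded fl_2143(1)] this W_def]
            obtain J1 J2 where J: "rs W L = J2 @ a # J1" "fin_at F32 W J1 a J2 vr (rs W M) vs (rs W R)" by auto
            have "Iv vs (rs W L) = I" using Iv_restrict[OF True] .
            then have "at5 fin43 W L vr M vs R"
              using J(2) ci_at[OF Ws(2,4,5)] cI3 unfolding F32_def fin_join[OF J(1)] by (simp add: numeral_eq_Suc fin_join[OF J(1)])
            then show ?thesis using fin43 Wl by simp
          next
            case False
            then obtain c where c: "c \<in> I" "c \<notin> W" by blast
            have "a \<noteq> c" using c Ws(3) by auto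
            then have "card (I - {a, c}) = 1" using cI3 a(1) c by (simp add: card_Diff_subset)
            then obtain b where "I - {a, c} = {b}" using card_1_singletonE by blast
            then have b: "b \<in> I" "b \<noteq> a" "b \<noteq> c" "I = {a, b, c}" using a(1) c(1) by auto
            define U where "U = insert b W"
            have U: "U \<subseteq> set l" "finite U" "c \<notin> U" using Ws b c I_sub unfolding U_def by auto
            have nl: "\<not> set l \<subseteq> U" "\<not> set l \<subseteq> W" using U(3) c I_sub unfolding U_def by auto
            have le: "2 + card (Iv vs (rs U L) - {a}) \<le> 3" using lowa(1)[OF a(1) V(2), of U] lt4[OF nl(1)] unfolding U_def W_def by auto
            have "{a, b} \<subseteq> Iv vs (rs U L)" using Iv_rs a(1) b(1) Ws(3) unfolding U_def by auto
            then have "card {a, b} \<le> card (Iv vs (rs U L))" by (rule card_mono[OF finite_Iv])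
            then have c2U: "card (Iv vs (rs U L)) = 2" using le diffc[OF a(1), of U] b(2) Ws(3) by (simp add: U_def)
            have nbW: "card (Iv vs (rs W L)) \<le> 2 \<and> g (rs W l) < 4"
              using lowa(1)[OF a(1) V(2), of W] lt4[OF nl(2)] diffc[OF a(1) Ws(3)] unfolding W_def by auto
            have f: "at5 fin32 U L vr M vs R" using w32[OF a(1) V W_def b(1,2) c2U[unfolded U_def]] nbW unfolding U_def by blast
            have ok: "at5 okh U L vr M vs R" by (rule okW[of a b]) (use U a b Ws in \<open>auto simp: U_def\<close>)
            have v: "vr \<in> U" "vs \<in> U" using Ws unfolding U_def by auto
            have "\<not> ge E4 (at5 wl U L vr M vs R)"
              using ge_map[OF U(2) distinct_rs[OF D], of U E4] lt4[OF nl(1)] wl_at[OF v] by (auto simp: E4_def)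
            then have "ij H43 c0 (map (rk U) (rs U L)) (rk U vr) (map (rk U) (rs U M)) (rk U vs) (map (rk U) (rs U R)) (vl (rk U vs))"
              using f ok unfolding fin32_def by (auto split: if_splits)
            then obtain K1 K2 where K: "rs (insert c U) L = K2 @ c # K1"
              "fin_at (H43 (ups (c0 < rk U c) c0)) (insert c U) K1 c K2 vr (rs (insert c U) M) vs (rs (insert c U) R)"
              by (rule ij_at[OF U(1) v c(1) U(3)])
            have "insert c U = set l" by (rule full) (use U c b I_sub Ws(3) in \<open>auto simp: U_def\<close>)
            then have "at5 fin43 (set l) L vr M vs R" using K(2) unfolding H43_def fin_join[OF K(1)] by simp
            then show ?thesis by (rule fin43)
          qed
        next
          case False
          then have cI2: "card I = 2" using c2 d4 by simp
          show ?thesis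
          proof (cases "\<forall>a\<in>I. nv (x a)")
            \<comment> \<open>The value 4 arises as 2 + 2, from one 2143 in each child. Either one
              of the two windows settles the claim, or both are exceptional and together make up the
              word.\<close>
            case both: True
            obtain a b where I: "I = {a, b}" "a \<noteq> b" using cI2 by (auto simp: card_2_iff)
            have ab: "a \<in> I" "b \<in> I" "nv (x a)" "nv (x b)" using I both by auto
            have min4: "set l \<subseteq> U" if "4 \<le> g (rs U l)" for U using minU that d4 by blast
            have type: "fl l \<in> MM d \<or> (let W = insert b' (V \<union> {a', vr, vs}) in W \<subseteq> set l \<and>
                (map (rk W) (rs W L), rk W vr, map (rk W) (rs W M), rk W vs, map (rk W) (rs W R)) \<in> set types22)"
              if I': "I = {a', b'}" "b' \<noteq> a'" and V: "V \<subseteq> set l" "fl (rs V (x a')) = [2, 1, 4, 3]" for a' b' V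
            proof -
              have a': "a' \<in> I" "b' \<in> I" using I' by auto
              define W where "W = V \<union> {a', vr, vs}"
              define U where "U = insert b' W"
              have Ws: "W \<subseteq> set l" "U \<subseteq> set l" "finite U" "vr \<in> U" "vs \<in> U" "{a', b', vr, vs} \<subseteq> U"
                using V(1) trio(2)[OF a'(1)] I_sub a' finite_subset[OF V(1)] by (auto simp: W_def U_def)
              have IU: "Iv vs (rs U L) = I" by (rule Iv_restrict) (use I' Ws in auto)
              have nb: "card (Iv vs (rs W L)) \<le> 2 \<and> g (rs W l) < 4" if "b' \<notin> W"
              proof -
                have "g (rs W l) < 4" by (rule lt4) (use that a' I_sub in auto)
                then show ?thesis using lowa(1)[OF a'(1) V(2), of W] diffc[OF a'(1), of W] by (auto simp: W_def)
              qed
              have f: "at5 fin32 U L vr M vs R" using w32[OF a'(1) V W_def a'(2) I'(2) _ nb] IU cI2 unfolding U_def by simp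
              have ok: "at5 okh U L vr M vs R" by (rule okW[of a' b']) (use Ws a' I' in auto)
              show ?thesis
              proof (cases "ge E4 (at5 wl U L vr M vs R)")
                case True
                then have "4 \<le> g (rs U l)"
                  using ge_map[OF Ws(3) distinct_rs[OF D], of U E4] wl_at[OF Ws(4,5)] by (auto simp: E4_def)
                then have Ul: "U = set l" using min4 Ws(2) by blast
                have "nvs (kd c0 (map (rk U) (rs U L)) [] (rk U vs) (map (rk U) (rs U M) @ rk U vr # map (rk U) (rs U R)))"
                  unfolding nvs_at[OF Ws(3,4,5)] IU using both Ul by (simp add: rs_all)
                then have "at5 (concl E4 pats4) U L vr M vs R" using f ok True unfolding fin32_def by (auto split: if_splits)
                then show ?thesis using conclD Ul P4 by simp
              next
                case False
                then have "memb5 (map (rk U) (rs U L)) (rk U vr) (map (rk U) (rs U M)) (rk U vs) (map (rk U) (rs U R)) types22"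
                  using f ok unfolding fin32_def by (auto split: if_splits)
                then show ?thesis using Ws(2) unfolding memb5_iff U_def W_def Let_def by blast
              qed
            qed
            obtain V1 where V1: "V1 \<subseteq> set l" "fl (rs V1 (x a)) = [2, 1, 4, 3]" using nv_occ[OF dx(1)[OF ab(1)] ab(3)] dx(2)[OF ab(1)] by auto
            obtain V2 where V2: "V2 \<subseteq> set l" "fl (rs V2 (x b)) = [2, 1, 4, 3]" using nv_occ[OF dx(1)[OF ab(2)] ab(4)] dx(2)[OF ab(2)] by auto
            define W1 where "W1 = insert b (V1 \<union> {a, vr, vs})"
            define W2 where "W2 = insert a (V2 \<union> {b, vr, vs})"
            have sub: "{a, b, vr, vs} \<subseteq> W1" "{a, b, vr, vs} \<subseteq> W2" by (auto simp: W1_def W2_def)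
            have len: "card W = length (rs W L) + length (rs W M) + length (rs W R) + 2" if "{a, b, vr, vs} \<subseteq> W" "W \<subseteq> set l" for W
            proof -
              have "length (rs W l) = card W" using distinct_card[OF distinct_rs[OF D], of W] that(2) by (simp add: Int_absorb1)
              moreover have "rs W l = wl (rs W L) vr (rs W M) vs (rs W R)" by (rule restrict(1)) (use that in auto)
              ultimately show ?thesis by (simp add: wl_eq)
            qed
            have fin22: "fl l \<in> MM d" if W: "{a, b, vr, vs} \<subseteq> W" "W \<subseteq> set l" "{a, b, vr, vs} \<subseteq> W'" "W' \<subseteq> set l" "set l = W \<union> W'"
              and t: "(map (rk W) (rs W L), rk W vr, map (rk W) (rs W M), rk W vs, map (rk W) (rs W R)) \<in> set types22"
              and t': "(map (rk W') (rs W' L), rk W' vr, map (rk W') (rs W' M), rk W' vs, map (rk W') (rs W' R)) \<in> set types22"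
              and le: "card W' \<le> card W" for W W'
            proof -
              have c7: "card W \<le> 7" "card W' \<le> 7" using len[OF W(1,2)] len[OF W(3,4)] t t' types22_length by (auto simp: list_all_iff)
              \<comment> \<open>The two windows share a, b, vr and vs, so the one that is not larger
                adds at most card W - 4 letters: three for a window of seven letters, two for
                smaller ones.\<close>
              define n where "n = (if card W = 7 then 3 else 2 :: nat)"
              have a2: "at5 (a2 n (card W)) W L vr M vs R" using run_22 t len[OF W(1,2)] by (force simp: list_all_iff n_def)
              have "distinct [a, b, vr, vs]" using trio(1)[OF ab(1)] trio(1)[OF ab(2)] I(2) by auto
              then have "card {a, b, vr, vs} = 4" using distinct_card[of "[a, b, vr, vs]"] by simp
              then have "card (W' - {a, b, vr, vs}) = card W' - 4" using W(3) by (subst card_Diff_subset) auto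
              moreover have "card (set l - W) \<le> card (W' - {a, b, vr, vs})"
              proof (rule card_mono)
                show "finite (W' - {a, b, vr, vs})" using finite_subset[OF W(4)] by simp
                show "set l - W \<subseteq> W' - {a, b, vr, vs}" using W(1,5) by blast
              qed
              ultimately have "card (set l - W) \<le> n" using le c7 by (auto simp: n_def)
              from a2_sound[OF I ab(3,4) min4 W(1,2) this refl a2] show ?thesis using conclD P4 by simp
            qed
            show ?thesis
            proof (rule ccontr)
              assume no: "fl l \<notin> MM d"
              have t1: "W1 \<subseteq> set l" "(map (rk W1) (rs W1 L), rk W1 vr, map (rk W1) (rs W1 M), rk W1 vs, map (rk W1) (rs W1 R)) \<in> set types22"
                using type[OF I(1) I(2)[symmetric] V1] no unfolding W1_def Let_def by blast+
              have I2: "I = {b, a}" using I(1) by auto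
              have t2: "W2 \<subseteq> set l" "(map (rk W2) (rs W2 L), rk W2 vr, map (rk W2) (rs W2 M), rk W2 vs, map (rk W2) (rs W2 R)) \<in> set types22"
                using type[OF I2 I(2) V2] no unfolding W2_def Let_def by blast+
              let ?U = "W1 \<union> W2"
              have "2 \<le> g (rs ?U (x a))" by (rule lowa(2)[OF ab(1) V1(2)]) (auto simp: W1_def)
              moreover have "2 \<le> g (rs ?U (x b))" by (rule lowa(2)[OF ab(2) V2(2)]) (auto simp: W2_def)
              moreover have "(\<Sum>c\<in>{a, b}. g (rs ?U (x c))) \<le> g (rs ?U l)" using low[of "{a, b}" ?U] I sub by auto
              ultimately have "4 \<le> g (rs ?U l)" using I(2) by simp
              then have U: "set l = ?U" using min4 t1(1) t2(1) by blast
              have "card W2 \<le> card W1 \<or> card W1 \<le> card W2" by linarith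
              then show False
              proof
                assume "card W2 \<le> card W1"
                then show False using fin22[OF sub(1) t1(1) sub(2) t2(1) U t1(2) t2(2)] no by blast
              next
                assume "card W1 \<le> card W2"
                moreover have "set l = W2 \<union> W1" using U by auto
                ultimately show False using fin22[OF sub(2) t2(1) sub(1) t1(1) _ t2(2) t1(2)] no by blast
              qed
            qed
          next
            case False
            \<comment> \<open>Now the value 4 arises as 3 + 1: the child without a 2143 counts 1, so
              the other child contains a listed pattern for the threshold 3.\<close>
            then obtain b where b: "b \<in> I" "\<not> nv (x b)" by blast
            obtain a where a: "a \<in> I" "nv (x a)" using nva by blast
            have ne: "a \<noteq> b" using a b by auto
            have I: "I = {a, b}"
            proof (rule card_seteq[symmetric])
              show "card I \<le> card {a, b}" using cI2 ne by simp
            qed (use a b finite_Iv in auto)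
            have "g (x b) = 1" using g_vexillary dx(1) b by blast
            moreover have "g l = g (x a) + g (x b)" using gl I ne by simp
            ultimately have g3: "3 \<le> g (x a)" using dl d4 by simp
            then obtain V where V: "V \<subseteq> set l" "fl (rs V (x a)) \<in> MM 3" using occ[OF a(1), of 3] by auto
            then obtain q where q: "fl (rs V (x a)) = map Suc q" "q \<in> set pats3" by (auto simp: MM_def)
            have gV: "3 \<le> g (rs V (x a))" using MM_g[OF distinct_rs[OF dx(1)[OF a(1)]] _ V(2)] by simp
            define W where "W = V \<union> {a, vr, vs}"
            have Ws: "W \<subseteq> set l" "finite W" "a \<in> W" "vr \<in> W" "vs \<in> W" using V(1) trio(2)[OF a(1)] finite_subset[OF V(1)] by (auto simp: W_def)
            have gW: "3 \<le> g (rs U (x a))" if "V \<subseteq> U" for U using up[OF a(1) that] gV by simp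
            have bl: "b \<in> set l" using b I_sub by blast
            have Wf: "insert b W = set l"
            proof -
              have "(\<Sum>c\<in>{a, b}. g (rs (insert b W) (x c))) \<le> g (rs (insert b W) l)"
                using low[of "{a, b}" "insert b W"] I Ws by auto
              then have "4 \<le> g (rs (insert b W) l)" using gW[of "insert b W"] gx1[OF b(1), of "insert b W"] ne by (auto simp: W_def)
              then show ?thesis using minU[of "insert b W"] d4 Ws(1) bl by blast
            qed
            have nn: "\<not> nvs (kd c0 (map (rk (set l)) (rs (set l) L)) [] (rk (set l) vs) (map (rk (set l)) (rs (set l) M) @ rk (set l) vr # map (rk (set l)) (rs (set l) R)))"
              using nvs_at[of "set l"] mem_l b by (auto simp: rs_all)
            have fin42: "at5 fin42 (set l) L vr M vs R \<Longrightarrow> fl l \<in> MM d"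
              using nn okh_all conclD unfolding fin42_def P4 by (auto split: if_splits)
            have cil: "ci c0 (map (rk (set l)) (rs (set l) L)) (rk (set l) vs) = E3"
              using ci_at[of "set l"] mem_l cI2 by (simp add: rs_all E3_def)
            have q4: "4 \<le> g (rs V (x a))" if "q \<in> set pats4"
              using MM_g[OF distinct_rs[OF dx(1)[OF a(1)]], of 4 V] q(1) that by (auto simp: MM_def)
            have run: "q \<in> set pats4 \<and> gen F4k2 False (length q) q \<or>
                gen F4k2x False (length q) q \<and> gn False False False F4k2 False (length q) q"
              using run_4k2 q(2) by (auto simp: list_all_iff)
            have done1: "fl l \<in> MM d" if "W = set l" and gen: "if V \<inter> {a, vr, vs} = {} then \<not> False \<and> gn False False False F4k2 False (length q) q
                else gen F4k2 False (length q) q"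
            proof -
              from window_ex[OF a(1) _ V(1) q(1) gen W_def]
              obtain J1 J2 where J: "rs W L = J2 @ a # J1" "fin_at F4k2 W J1 a J2 vr (rs W M) vs (rs W R)" by auto
              then have "at5 fin42 (set l) L vr M vs R" using cil that(1) unfolding F4k2_def fin_join[OF J(1)] by (simp add: eqn_iff)
              then show ?thesis by (rule fin42)
            qed
            show ?thesis
            proof (cases "V \<inter> {a, vr, vs} = {}")
              case True
              \<comment> \<open>The pattern avoids the letters moved in the child at a. If it
                avoided b as well, it would survive in the child at b and bring a 2143 with
                it.\<close>
              have bV: "b \<in> V"
              proof (rule ccontr)
                assume "b \<notin> V"
                then have "rs V (x b) = rs V (x a)" using disj[of V b] disj[of V a] True by simp
                then have "nv (rs V (x b))" using g_vexillary[OF distinct_rs[OF dx(1)[OF b(1)]], of V] gV by fastforce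
                then show False using nv_rs b(2) by blast
              qed
              then have Wl: "W = set l" using Wf by (auto simp: W_def)
              have "q \<notin> set pats4"
              proof
                assume "q \<in> set pats4"
                then have "4 \<le> g (rs V l)" using q4 disj[OF True] by simp
                then have "set l \<subseteq> V" using minU d4 by blast
                then show False using True mem_l by auto
              qed
              then show ?thesis using done1[OF Wl] run True by simp
            next
              case ov: False
              show ?thesis
              proof (cases "q \<in> set pats4 \<and> gen F4k2 False (length q) q")
                case True
                have "4 \<le> g (rs W l)" using low[of "{a}" W] up[OF a(1), of V W] q4 True Ws a by (auto simp: W_def)
                then have "W = set l" using minU[of W] d4 Ws(1) by blast
                have "if V \<inter> {a, vr, vs} = {} then \<not> False \<and> gn False False False F4k2 False (length q) q
                  else gen F4k2 False (length q) q" using ov True by (simp only: if_False)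
                from done1[OF \<open>W = set l\<close> this] show ?thesis .
              next
                case False
                then have g: "gen F4k2x False (length q) q" using run by blast
                then have gg: "if V \<inter> {a, vr, vs} = {} then \<not> False \<and> gn False False False F4k2x False (length q) q
                  else gen F4k2x False (length q) q" using g ov by (simp only: if_False)
                from window_ex[OF a(1) _ V(1) q(1) gg W_def]
                obtain J1 J2 where J: "rs W L = J2 @ a # J1" "fin_at F4k2x W J1 a J2 vr (rs W M) vs (rs W R)" by auto
                show ?thesis
                proof (cases "b \<in> W")
                  case True
                  then have Wl: "W = set l" using Wf by auto
                  have "at5 fin42 (set l) L vr M vs R"
                    using J(2) cil Wl unfolding F4k2x_def F4k2_def fin_join[OF J(1)] by (simp add: eqn_iff lq_iff E3_def)
                  then show ?thesis by (rule fin42)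
                next
                  case bW: False
                  have "g (rs W l) < 4" by (rule lt4) (use bW bl in auto)
                  moreover have "g (rs W (x a)) + card (Iv vs (rs W L) - {a}) \<le> g (rs W l)"
                    using low[of "{a}" W] a Ws by auto
                  ultimately have "card (Iv vs (rs W L)) \<le> 1" using gW[of W] diffc[OF a(1) Ws(3)] by (auto simp: W_def)
                  then have "ij H4k2 (rk W a) (map (rk W) (rs W L)) (rk W vr) (map (rk W) (rs W M)) (rk W vs) (map (rk W) (rs W R)) (vl (rk W vs))"
                    using J(2) ci_at[OF Ws(2,4,5)] unfolding F4k2x_def fin_join[OF J(1)] by (simp add: lq_iff)
                  then obtain K1 K2 where K: "rs (insert b W) L = K2 @ b # K1"
                    "fin_at (H4k2 (ups (rk W a < rk W b) (rk W a))) (insert b W) K1 b K2 vr (rs (insert b W) M) vs (rs (insert b W) R)"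
                    by (rule ij_at[OF Ws(1,4,5) b(1) bW])
                  have t: "ups (rk W a < rk W b) (rk W a) = rk (insert b W) a" using rk_insert[OF Ws(2) bW Ws(3)] by simp
                  have ac: "if rk (insert b W) a < rk (insert b W) b then nb (rk (insert b W) a) (Suc (rk (insert b W) a)) (map (rk (insert b W)) K1) else True"
                    by (rule acond[OF _ a(1) _ b(1) _ ne K(1)]) (use Ws Wf in auto)
                  have "at5 fin42 (insert b W) L vr M vs R" using K(2) ac unfolding t H4k2_def fin_join[OF K(1)] by simp
                  then show ?thesis using fin42 Wf by simp
                qed
              qed
            qed
          qed
        qed
      qed
    qed
  qed
qed

end

section \<open>The simultaneous induction and its consequence for words\<close>

theorem PA_PB: "distinct l \<Longrightarrow> PA l \<and> PB l"
proof -
  assume "distinct l"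
  obtain N where "set l \<subseteq> {..<N}" using finite_nat_set_iff_bounded[of "set l"] by auto
  then show ?thesis using \<open>distinct l\<close>
  proof (induction l rule: wf_induct_rule[OF wf_lt[of N]])
    case (1 l)
    have IH: "PA k \<and> PB k" if "(k, l) \<in> lt N" "distinct k" "set k \<subseteq> {..<N}" for k using 1(1) that by blast
    show ?case
    proof (cases "nv l")
      case True
      obtain L vr M vs R where c: "l = wl L vr M vs R" "cf L vr M vs R" "hi2 L vs" by (rule corner2143[OF 1(3) True])
      interpret corner L M R vr vs l by (unfold_locales) (rule c)+
      show ?thesis using PA_step[OF IH 1(2)] PB_step[OF IH 1(2)] by blast
    next
      case False
      then have "g (rs V l) = 1" for V using g_vexillary[OF distinct_rs[OF 1(3)]] nv_rs by blast
      moreover have "g l = 1" using g_vexillary[OF 1(3) False] .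
      ultimately show ?thesis by (auto simp: PA_def PB_def)
    qed
  qed
qed

theorem g_ge_4: "distinct l \<Longrightarrow> 4 \<le> g l \<longleftrightarrow> (\<exists>V\<subseteq>set l. fl (rs V l) \<in> MM 4)"
proof
  assume d: "distinct l" and "4 \<le> g l"
  moreover have "PB (rs V l)" for V using PA_PB distinct_rs[OF d] by blast
  ultimately show "\<exists>V\<subseteq>set l. fl (rs V l) \<in> MM 4" using PB_occ[of l 4] by blast
next
  assume d: "distinct l" and "\<exists>V\<subseteq>set l. fl (rs V l) \<in> MM 4"
  then obtain V where "fl (rs V l) \<in> MM 4" by blast
  then have "4 \<le> g (rs V l)" using MM_g[OF distinct_rs[OF d], of 4 V] by simp
  moreover have "min 4 (g (rs V l)) \<le> g l" using PA_PB[OF d] by (auto simp: PA_def)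
  ultimately show "4 \<le> g l" by simp
qed

section \<open>Return to permutations of the positive integers\<close>

lemma line_word:
  assumes "w permutes {1..n}"
  shows "distinct (map w [1..<Suc n])" "EG w = g (map w [1..<Suc n])"
proof -
  let ?l = "map w [1..<Suc n]"
  have inj: "inj w" using assms by (rule permutes_inj)
  show d: "distinct ?l" using inj by (simp add: distinct_map inj_on_subset[OF inj])
  have "set ?l = {1..n}" using permutes_image[OF assms] by (simp only: set_map set_upt atLeastLessThanSuc_atLeastAtMost)
  then have "?l \<in> Sym (length ?l)" using d by (simp add: Sym_iff)
  then have "fl ?l = ?l" by (rule fl_eqI[OF d]) (simp add: same_relative_order_def)
  moreover have "pw ?l = w"
  proof
    fix i
    show "pw ?l i = w i"
    proof (cases "1 \<le> i \<and> i \<le> n")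
      case True
      then have "[1..<Suc n] ! (i - 1) = i" by (subst nth_upt) auto
      moreover have "i - 1 < length [1..<Suc n]" using True by (simp only: length_upt) linarith
      ultimately have "?l ! (i - 1) = w i" using nth_map[of "i - 1" "[1..<Suc n]" w] by (simp only:)
      then show ?thesis using True by (simp add: pw_def del: upt_Suc One_nat_def nth_map)
    next
      case False
      then show ?thesis using assms by (auto simp: pw_def permutes_def)
    qed
  qed
  ultimately show "EG w = g ?l" by (simp add: g_def)
qed

lemma EG_ge_4:
  assumes w: "w permutes {1..n}"
  shows "4 \<le> EG w \<longleftrightarrow> (\<exists>v\<in>MM 4. contains_pattern w v)"
proof
  have inj: "inj w" using w by (rule permutes_inj)
  have rs_map: "rs V (map w xs) = map w (filter (\<lambda>i. w i \<in> V) xs)" for V xs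
    by (simp add: rs_def filter_map comp_def)
  {
    assume "4 \<le> EG w"
    then obtain V where V: "fl (rs V (map w [1..<Suc n])) \<in> MM 4" using g_ge_4 line_word[OF w] by auto
    let ?is = "filter (\<lambda>i. w i \<in> V) [1..<Suc n]"
    have "sorted_wrt (<) ?is" by (intro sorted_wrt_filter) (simp only: sorted_wrt_upt)
    moreover have "\<forall>i\<in>set ?is. 1 \<le> i" by auto
    ultimately have "contains_pattern w (fl (map w ?is))" unfolding contains_pattern_def by blast
    then show "\<exists>v\<in>MM 4. contains_pattern w v" using V unfolding rs_map by blast
  next
    assume "\<exists>v\<in>MM 4. contains_pattern w v"
    then obtain "is" where i: "sorted_wrt (<) is" "\<forall>i\<in>set is. 1 \<le> i" "fl (map w is) \<in> MM 4"
      unfolding contains_pattern_def by blast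
    \<comment> \<open>An occurrence may use fixed points beyond n, so the one-line word is prolonged
      until it covers all positions used.\<close>
    define m where "m = Max (insert n (set is))"
    have nm: "n \<le> m" unfolding m_def by (rule Max_ge) auto
    have im: "i \<le> m" if "i \<in> set is" for i unfolding m_def by (rule Max_ge) (use that in auto)
    have wm: "w permutes {1..m}" by (rule permutes_subset[OF w]) (use nm in auto)
    have sub: "set is \<subseteq> set [1..<Suc m]"
    proof
      fix i assume "i \<in> set is"
      then have "1 \<le> i" "i \<le> m" using i(2) im by blast+
      then show "i \<in> set [1..<Suc m]" by (simp only: set_upt) simp
    qed
    have "filter (\<lambda>i. i \<in> set is) [1..<Suc m] = is"
    proof (rule strict_sorted_equal)
      show "sorted_wrt (<) (filter (\<lambda>i. i \<in> set is) [1..<Suc m])" by (intro sorted_wrt_filter) (simp only: sorted_wrt_upt)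
      show "set (filter (\<lambda>i. i \<in> set is) [1..<Suc m]) = set is" by (simp only: set_filter) (use sub in blast)
    qed (rule i(1))
    moreover have "w i \<in> w ` set is \<longleftrightarrow> i \<in> set is" for i using inj by (rule inj_image_mem_iff)
    ultimately have "rs (w ` set is) (map w [1..<Suc m]) = map w is" unfolding rs_map by simp
    moreover have "w ` set is \<subseteq> set (map w [1..<Suc m])" unfolding set_map by (rule image_mono[OF sub])
    ultimately have "4 \<le> g (map w [1..<Suc m])" using g_ge_4[OF line_word(1)[OF wm]] i(3) by metis
    then show "4 \<le> EG w" using line_word(2)[OF wm] by simp
  }
qed

lemma Sym_SucI:
  assumes "distinct q" "\<forall>x\<in>set q. x < length q"
  shows "map Suc q \<in> Sym (length q)"
proof -
  have "Suc ` set q \<subseteq> {1..length q}" using assms(2) by (auto simp: Suc_le_eq)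
  moreover have "card (Suc ` set q) = card {1..length q}" using distinct_card[OF assms(1)] by (simp add: card_image)
  ultimately have "Suc ` set q = {1..length q}" by (intro card_subset_eq) auto
  then show ?thesis using assms(1) by (simp add: Sym_iff distinct_map)
qed

lemma pats4_Sym: "list_all (\<lambda>q. distinct q \<and> list_all (\<lambda>x. x < length q) q \<and> length q \<in> {6, 7, 8}) pats4"
  by (simp add: pats_run c_defs)

lemma pats4_distinct: "distinct pats4" "length pats4 = 91"
  by (simp_all add: pats_run c_defs)

theorem theorem5p13:
  shows "\<exists>P :: nat list set. P \<subseteq> Sym 6 \<union> Sym 7 \<union> Sym 8 \<and> card P = 91 \<and>
    (\<forall>w \<in> S_infinity. vexillary 3 w \<longleftrightarrow> (\<forall>v \<in> P. avoids w v))"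
proof (intro exI[of _ "MM 4"] conjI ballI)
  have M: "MM 4 = map Suc ` set pats4" by (simp add: MM_def)
  show "MM 4 \<subseteq> Sym 6 \<union> Sym 7 \<union> Sym 8"
  proof
    fix v assume "v \<in> MM 4"
    then obtain q where q: "v = map Suc q" "q \<in> set pats4" unfolding M by blast
    then have "distinct q" "\<forall>x\<in>set q. x < length q" and len: "length q \<in> {6, 7, 8}"
      using pats4_Sym unfolding list_all_iff by blast+
    then have "v \<in> Sym (length q)" unfolding q(1) by (intro Sym_SucI)
    then show "v \<in> Sym 6 \<union> Sym 7 \<union> Sym 8" using len by auto
  qed
  have "inj_on (map Suc) (set pats4)" by (rule inj_on_subset[of _ UNIV]) simp_all
  then have "card (MM 4) = card (set pats4)" unfolding M by (rule card_image)
  then show "card (MM 4) = 91" using distinct_card[OF pats4_distinct(1)] pats4_distinct(2) by simp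
  fix w assume "w \<in> S_infinity"
  then obtain n where "w permutes {1..n}" by (auto simp: S_infinity_def)
  from EG_ge_4[OF this] show "vexillary 3 w \<longleftrightarrow> (\<forall>v \<in> MM 4. avoids w v)"
    by (auto simp: vexillary_def avoids_def not_le)
qed

end
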